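(* Let $\varphi\in C^2(\mathbb R^d)$ with $\sup_{x\in\mathbb R^d}|\partial_k\partial_l\varphi(x)|<\infty$ for $1\le k,l\le d$, and let $u:\mathscr P_2\to\mathbb R$, $u(\mu):=\mu(\varphi)$. Then the generator $L_{G,\lambda}$ of $(\mathscr E^{G,\lambda},\mathscr D(\mathscr E^{G,\lambda}))$ is given on $u$ by $$L_{G,\lambda}u(\mu)=\mu\big(\mathscr L^\mu_{G,\lambda}\varphi\big)\qquad\text{for }\Lambda\text{-a.e. }\mu\in\mathscr P_2,$$ where $$\mathscr L^\mu_{G,\lambda}\varphi(x)=\sum_{k=1}^d\Big[\Big(\sum_{l=1}^d\rho^\mu_{k,l}(x)\,\partial_k\partial_l\varphi(x)\Big)-x_k\partial_k\varphi(x)\Big],\qquad \mu\text{-a.e. }x\in\mathbb R^d.$$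
   Context: Setting. Fix $d\in\mathbb N$; $\langle x,y\rangle_{\mathrm{euc}}=x^{T}y$, $|x|_{\mathrm{euc}}=\sqrt{x^Tx}$ on $\mathbb R^d$. $\mathscr P_2$ is the space of Borel probability measures on $\mathbb R^d$ with finite second moment, with the $2$-Wasserstein metric and its Borel $\sigma$-algebra. For $\mu\in\mathscr P_2$ let $T_\mu:=L^2(\mathbb R^d,\mu;\mathbb R^d)$ with $\langle f,g\rangle_{T_\mu}=\int\langle f,g\rangle_{\mathrm{euc}}\,d\mu$, and $\mu(\varphi):=\int\varphi\,d\mu$. Fix $\lambda\in\mathscr P_2$ absolutely continuous w.r.t. Lebesgue measure, and let $\Psi_\lambda:T_\lambda\to\mathscr P_2$, $\Psi_\lambda(f)=\lambda\circ f^{-1}$ (push-forward). Let $(A,\mathscr D(A))$ be a self-adjoint, strictly positive operator on $T_\lambda$ whose inverse $A^{-1}:T_\lambda\to T_\lambda$ is trace class, and let $G$ be the centered Gaussian measure on $T_\lambda$ with covariance operator $A^{-1}$, i.e. $\int_{T_\lambda}\langle f_1,g\rangle_{T_\lambda}\langle f_2,g\rangle_{T_\lambda}G(dg)=\langle f_1,A^{-1}f_2\rangle_{T_\lambda}$. Put $\Lambda:=G\circ\Psi_\lambda^{-1}$, a Borel probability measure on $\mathscr P_2$. Class $C_b^1(\mathscr P_2)$. A continuous $u:\mathscr P_2\to\mathbb R$ is intrinsically differentiable if for every $\mu\in\mathscr P_2$ the map $T_\mu\ni f\mapsto D_fu(\mu):=\lim_{\varepsilon\to0}\varepsilon^{-1}\big(u(\mu\circ(\mathrm{id}+\varepsilon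 f)^{-1})-u(\mu)\big)$ is a well-defined bounded linear functional; then $Du(\mu)\in T_\mu$ is defined by $D_fu(\mu)=\langle Du(\mu),f\rangle_{T_\mu}$. $u\in C^1(\mathscr P_2)$ if moreover $|u(\mu\circ(\mathrm{id}+f_n)^{-1})-u(\mu)-D_{f_n}u(\mu)|/\|f_n\|_{T_\mu}\to0$ for all $\mu$ and all (nonzero) $f_n\to0$ in $T_\mu$, and there are $\mu$-versions $\widetilde{Du}(\mu)$ of $Du(\mu)$ such that $(\mu,x)\mapsto\widetilde{Du}(\mu)(x)$ is continuous on $\mathscr P_2\times\mathbb R^d$. $u\in C^1_b(\mathscr P_2)$ if additionally $\sup_{\mu,x}(|u(\mu)|+|\widetilde{Du}(\mu)(x)|_{\mathrm{euc}})<\infty$. Dirichlet form. $(\mathscr E^{G,\lambda},\mathscr D(\mathscr E^{G,\lambda}))$ is the Dirichlet form on $L^2(\mathscr P_2,\Lambda)$ obtained as the closure of the (closable) form $$\mathscr E^{G,\lambda}(u,v)=\int_{T_\lambda}\big\langle Du(\lambda\circ f^{-1})\circ f,\,A^{-1}\big(Dv(\lambda\circ f^{-1})\circ f\big)\big\rangle_{T_\lambda}G(df),\quad u,v\in C_b^1(\mathscr P_2).$$ Its generator $(L_{G,\lambda},\mathscr D(L_{G,\lambda}))$ is the non-positive self-adjoint operator on $L^2(\mathscr P_2,\Lambda)$ with $\mathscr E^{G,\lambda}(u,v)=-\int (L_{G,\lambda}u)\,v\,d\Lambda$ for $u\in\mathscr D(L_{G,\lambda})$, $v\in\mathscr D(\mathscr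 E^{G,\lambda})$. Coefficients $\rho^\mu_{k,l}$. Let $(g_n)_n$ be an orthonormal eigenbasis of $A^{-1}$ in $T_\lambda$, $A^{-1}g_n=\alpha_ng_n$, $\alpha_n>0$; let $\pi_k(x)=x_k$; set $q_{k,l}:=\sum_n\alpha_n(\pi_k\circ g_n)(\pi_l\circ g_n)\in L^1(\mathbb R^d,\lambda)$ for $1\le k,l\le d$. Let $\vec\Psi_\lambda:T_\lambda\times\mathbb R^d\to\mathscr P_2\times\mathbb R^d$, $\vec\Psi_\lambda(f,x)=(\Psi_\lambda(f),f(x))$ (defined $G\times\lambda$-a.e. via a jointly measurable version of $(f,x)\mapsto f(x)$). Then $(\mu,x)\mapsto\rho^\mu_{k,l}(x)$ is a measurable function on $\mathscr P_2\times\mathbb R^d$ determined by $$\int_{\mathscr P_2}\int_{\mathbb R^d}h(\mu,x)\rho^\mu_{k,l}(x)\,\mu(dx)\,\Lambda(d\mu)=\int_{T_\lambda}\int_{\mathbb R^d}h\big(\vec\Psi_\lambda(f,x)\big)q_{k,l}(x)\,\lambda(dx)\,G(df)$$ for all bounded measurable $h:\mathscr P_2\times\mathbb R^d\to\mathbb R$; equivalently, it is the Radon–Nikodym derivative of the finite signed measure $(G\times q_{k,l}\lambda)\circ\vec\Psi_\lambda^{-1}$ w.r.t. $(G\times\lambda)\circ\vec\Psi_\lambda^{-1}$. *)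

theory Defs
  imports "HOL-Probability.Probability"
begin

section \<open>Topologies and Borel sigma-algebras of (pseudo-)metrics\<close>

text \<open>
  The usual topology of a (pseudo-)metric \<open>d\<close> on a carrier set \<open>X\<close>.  It is introduced directly, rather
  than through the locale \<open>Metric_space\<close>, because it is also used for the \<open>L\<^sup>2\<close>-seminorm, where
  distinct functions may have distance zero.
\<close>

definition dist_topology :: "'a set \<Rightarrow> ('a \<Rightarrow> 'a \<Rightarrow> real) \<Rightarrow> 'a topology" where
  "dist_topology X d =
     topology (\<lambda>U. U \<subseteq> X \<and> (\<forall>x\<in>U. \<exists>e>0. \<forall>y\<in>X. d x y < e \<longrightarrow> y \<in> U))"

lemma openin_dist_topology:
  "openin (dist_topology X d) U \<longleftrightarrow>
     U \<subseteq> X \<and> (\<forall>x\<in>U. \<exists>e>0. \<forall>y\<in>X. d x y < e \<longrightarrow> y \<in> U)"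
proof -
  let ?P = "\<lambda>U. U \<subseteq> X \<and> (\<forall>x\<in>U. \<exists>e>0. \<forall>y\<in>X. d x y < e \<longrightarrow> y \<in> U)"
  have "istopology ?P"
    unfolding istopology_def
  proof (intro conjI allI impI)
    fix S T assume S: "?P S" and T: "?P T"
    show "S \<inter> T \<subseteq> X" using S by blast
    show "\<forall>x\<in>S \<inter> T. \<exists>e>0. \<forall>y\<in>X. d x y < e \<longrightarrow> y \<in> S \<inter> T"
    proof
      fix x assume "x \<in> S \<inter> T"
      then obtain a b where "a > 0" "b > 0"
        "\<forall>y\<in>X. d x y < a \<longrightarrow> y \<in> S" "\<forall>y\<in>X. d x y < b \<longrightarrow> y \<in> T"
        using S T by blast
      then show "\<exists>e>0. \<forall>y\<in>X. d x y < e \<longrightarrow> y \<in> S \<inter> T"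
        by (intro exI[of _ "min a b"]) auto
    qed
  next
    fix K assume K: "\<forall>S\<in>K. ?P S"
    show "\<Union>K \<subseteq> X" using K by blast
    show "\<forall>x\<in>\<Union>K. \<exists>e>0. \<forall>y\<in>X. d x y < e \<longrightarrow> y \<in> \<Union>K"
      using K by (meson UnionE UnionI)
  qed
  then show ?thesis
    unfolding dist_topology_def by (simp add: topology_inverse')
qed

lemma topspace_dist_topology [simp]: "topspace (dist_topology X d) = X"
proof (rule subset_antisym)
  show "topspace (dist_topology X d) \<subseteq> X"
    using openin_topspace[of "dist_topology X d"] unfolding openin_dist_topology by blast
  have "openin (dist_topology X d) X"
    unfolding openin_dist_topology by (auto intro: exI[of _ 1])
  then show "X \<subseteq> topspace (dist_topology X d)" by (rule openin_subset)
qed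

definition borel_of_top :: "'a topology \<Rightarrow> 'a measure" where
  "borel_of_top T = sigma (topspace T) {U. openin T U}"

section \<open>\<open>L\<^sup>2\<close>-spaces\<close>

text \<open>
  Elements of \<open>L\<^sup>2(M)\<close> are represented by square-integrable functions; two of them denote the same
  element iff they agree \<open>M\<close>-almost everywhere.  Open sets for the \<open>L\<^sup>2\<close>-seminorm are invariant under
  almost everywhere modification, so \<open>L2_borel M\<close> is the pull-back of the Borel sigma-algebra of the
  quotient Hilbert space, and measures on the two correspond bijectively.
\<close>

definition L2_space :: "'a measure \<Rightarrow> ('a \<Rightarrow> 'b::euclidean_space) set" where
  "L2_space M = {f \<in> borel_measurable M. integrable M (\<lambda>x. (norm (f x))\<^sup>2)}"

definition L2_inner :: "'a measure \<Rightarrow> ('a \<Rightarrow> 'b::euclidean_space) \<Rightarrow> ('a \<Rightarrow> 'b) \<Rightarrow> real" where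
  "L2_inner M f g = (\<integral>x. f x \<bullet> g x \<partial>M)"

definition L2_norm :: "'a measure \<Rightarrow> ('a \<Rightarrow> 'b::euclidean_space) \<Rightarrow> real" where
  "L2_norm M f = sqrt (L2_inner M f f)"

definition L2_borel :: "'a measure \<Rightarrow> ('a \<Rightarrow> 'b::euclidean_space) measure" where
  "L2_borel M = borel_of_top (dist_topology (L2_space M) (\<lambda>f g. L2_norm M (\<lambda>x. f x - g x)))"

section \<open>Operators on \<open>L\<^sup>2\<close>-spaces\<close>

text \<open>An (unbounded) operator is a pair of a map \<open>T\<close> on functions and a domain \<open>D\<close>.\<close>

definition linear_operator ::
  "'a measure \<Rightarrow> (('a \<Rightarrow> 'b::euclidean_space) \<Rightarrow> ('a \<Rightarrow> 'b)) \<Rightarrow> ('a \<Rightarrow> 'b) set \<Rightarrow> bool" where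
  "linear_operator M T D \<longleftrightarrow>
     D \<subseteq> L2_space M \<and> T ` D \<subseteq> L2_space M \<and> (\<lambda>x. 0) \<in> D \<and>
     (\<forall>f\<in>D. \<forall>g\<in>D. \<forall>a b.
        (\<lambda>x. a *\<^sub>R f x + b *\<^sub>R g x) \<in> D \<and>
        (AE x in M. T (\<lambda>x. a *\<^sub>R f x + b *\<^sub>R g x) x = a *\<^sub>R T f x + b *\<^sub>R T g x)) \<and>
     (\<forall>f\<in>D. \<forall>g\<in>L2_space M. (AE x in M. f x = g x) \<longrightarrow>
        g \<in> D \<and> (AE x in M. T f x = T g x))"

definition densely_defined :: "'a measure \<Rightarrow> ('a \<Rightarrow> 'b::euclidean_space) set \<Rightarrow> bool" where
  "densely_defined M D \<longleftrightarrow>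
     (\<forall>f\<in>L2_space M. \<forall>e>0. \<exists>g\<in>D. L2_norm M (\<lambda>x. f x - g x) < e)"

text \<open>The last conjunct says that the graph of the adjoint of \<open>T\<close> equals the graph of \<open>T\<close>.\<close>

definition self_adjoint_operator ::
  "'a measure \<Rightarrow> (('a \<Rightarrow> 'b::euclidean_space) \<Rightarrow> ('a \<Rightarrow> 'b)) \<Rightarrow> ('a \<Rightarrow> 'b) set \<Rightarrow> bool" where
  "self_adjoint_operator M T D \<longleftrightarrow>
     linear_operator M T D \<and> densely_defined M D \<and>
     (\<forall>g\<in>L2_space M. \<forall>h\<in>L2_space M.
        (\<forall>f\<in>D. L2_inner M (T f) g = L2_inner M f h) \<longleftrightarrow>
        g \<in> D \<and> (AE x in M. h x = T g x))"

definition strictly_positive_operator ::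
  "'a measure \<Rightarrow> (('a \<Rightarrow> 'b::euclidean_space) \<Rightarrow> ('a \<Rightarrow> 'b)) \<Rightarrow> ('a \<Rightarrow> 'b) set \<Rightarrow> bool" where
  "strictly_positive_operator M T D \<longleftrightarrow>
     (\<forall>f\<in>D. \<not> (AE x in M. f x = 0) \<longrightarrow> L2_inner M f (T f) > 0)"

definition bijective_operator ::
  "'a measure \<Rightarrow> (('a \<Rightarrow> 'b::euclidean_space) \<Rightarrow> ('a \<Rightarrow> 'b)) \<Rightarrow> ('a \<Rightarrow> 'b) set \<Rightarrow> bool" where
  "bijective_operator M T D \<longleftrightarrow>
     (\<forall>f\<in>D. \<forall>g\<in>D. (AE x in M. T f x = T g x) \<longrightarrow> (AE x in M. f x = g x)) \<and>
     (\<forall>h\<in>L2_space M. \<exists>f\<in>D. AE x in M. T f x = h x)"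

definition inverse_operator ::
  "'a measure \<Rightarrow> (('a \<Rightarrow> 'b::euclidean_space) \<Rightarrow> ('a \<Rightarrow> 'b)) \<Rightarrow> ('a \<Rightarrow> 'b) set \<Rightarrow>
     ('a \<Rightarrow> 'b) \<Rightarrow> ('a \<Rightarrow> 'b)" where
  "inverse_operator M T D h = (SOME f. f \<in> D \<and> (AE x in M. T f x = h x))"

text \<open>
  Trace class (nuclear) operators on a Hilbert space:
  \<open>S f = (\<Sum>n. \<langle>f, a\<^sub>n\<rangle> b\<^sub>n)\<close> with \<open>(\<Sum>n. \<parallel>a\<^sub>n\<parallel> \<parallel>b\<^sub>n\<parallel>) < \<infinity>\<close>.
\<close>

definition trace_class_operator ::
  "'a measure \<Rightarrow> (('a \<Rightarrow> 'b::euclidean_space) \<Rightarrow> ('a \<Rightarrow> 'b)) \<Rightarrow> bool" where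
  "trace_class_operator M S \<longleftrightarrow>
     S ` L2_space M \<subseteq> L2_space M \<and>
     (\<exists>a b :: nat \<Rightarrow> 'a \<Rightarrow> 'b. range a \<subseteq> L2_space M \<and> range b \<subseteq> L2_space M \<and>
        summable (\<lambda>n. L2_norm M (a n) * L2_norm M (b n)) \<and>
        (\<forall>f\<in>L2_space M.
           (\<lambda>N. L2_norm M (\<lambda>x. S f x - (\<Sum>n<N. L2_inner M f (a n) *\<^sub>R b n x))) \<longlonglongrightarrow> 0))"

definition orthonormal_basis :: "'a measure \<Rightarrow> (nat \<Rightarrow> 'a \<Rightarrow> 'b::euclidean_space) \<Rightarrow> bool" where
  "orthonormal_basis M g \<longleftrightarrow>
     range g \<subseteq> L2_space M \<and>
     (\<forall>m n. L2_inner M (g m) (g n) = (if m = n then 1 else 0)) \<and>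
     (\<forall>f\<in>L2_space M. (\<forall>n. L2_inner M f (g n) = 0) \<longrightarrow> (AE x in M. f x = 0))"

section \<open>Centered Gaussian measures on \<open>L\<^sup>2\<close>-spaces\<close>

text \<open>
  Every continuous linear functional has a centered normal law (the Dirac measure at zero being the
  degenerate case) and the covariance operator is \<open>S\<close>.
\<close>

definition centered_gaussian ::
  "'a measure \<Rightarrow> (('a \<Rightarrow> 'b::euclidean_space) \<Rightarrow> ('a \<Rightarrow> 'b)) \<Rightarrow> ('a \<Rightarrow> 'b) measure \<Rightarrow> bool" where
  "centered_gaussian M S G \<longleftrightarrow>
     prob_space G \<and> sets G = sets (L2_borel M) \<and>
     (\<forall>f\<in>L2_space M. \<exists>\<sigma>\<ge>0.
        distr G borel (\<lambda>g. L2_inner M f g) =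
          (if \<sigma> = 0 then return borel 0 else density lborel (\<lambda>t. ennreal (normal_density 0 \<sigma> t)))) \<and>
     (\<forall>f\<^sub>1\<in>L2_space M. \<forall>f\<^sub>2\<in>L2_space M.
        (\<integral>g. L2_inner M f\<^sub>1 g * L2_inner M f\<^sub>2 g \<partial>G) = L2_inner M f\<^sub>1 (S f\<^sub>2))"

section \<open>The Wasserstein space\<close>

definition P2 :: "(real ^ 'd) measure set" where
  "P2 = {\<mu>. sets \<mu> = sets borel \<and> prob_space \<mu> \<and> integrable \<mu> (\<lambda>x. (norm x)\<^sup>2)}"

definition couplings ::
  "(real ^ 'd) measure \<Rightarrow> (real ^ 'd) measure \<Rightarrow> ((real ^ 'd) \<times> (real ^ 'd)) measure set" where
  "couplings \<mu> \<nu> = {\<gamma>. sets \<gamma> = sets (borel \<Otimes>\<^sub>M borel) \<and> prob_space \<gamma> \<and>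
     distr \<gamma> borel fst = \<mu> \<and> distr \<gamma> borel snd = \<nu>}"

definition W2 :: "(real ^ 'd) measure \<Rightarrow> (real ^ 'd) measure \<Rightarrow> real" where
  "W2 \<mu> \<nu> = sqrt (INF \<gamma>\<in>couplings \<mu> \<nu>. \<integral>z. (norm (fst z - snd z))\<^sup>2 \<partial>\<gamma>)"

definition P2_topology :: "(real ^ 'd) measure topology" where
  "P2_topology = dist_topology P2 W2"

definition P2_borel :: "(real ^ 'd) measure measure" where
  "P2_borel = borel_of_top P2_topology"

text \<open>The map \<open>\<Psi>\<^sub>\<lambda>\<close>; it is 1-Lipschitz from \<open>L\<^sup>2(\<lambda>)\<close> to \<open>P2\<close>.\<close>

definition push :: "(real ^ 'd) measure \<Rightarrow> (real ^ 'd \<Rightarrow> real ^ 'd) \<Rightarrow> (real ^ 'd) measure" where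
  "push \<mu> f = distr \<mu> borel f"

section \<open>Intrinsic derivatives and the class \<open>C\<^sub>b\<^sup>1\<close>\<close>

definition difference_quotient ::
  "((real ^ 'd) measure \<Rightarrow> real) \<Rightarrow> (real ^ 'd) measure \<Rightarrow> (real ^ 'd \<Rightarrow> real ^ 'd) \<Rightarrow> real \<Rightarrow> real" where
  "difference_quotient u \<mu> f \<epsilon> = (u (push \<mu> (\<lambda>x. x + \<epsilon> *\<^sub>R f x)) - u \<mu>) / \<epsilon>"

definition dir_deriv ::
  "((real ^ 'd) measure \<Rightarrow> real) \<Rightarrow> (real ^ 'd) measure \<Rightarrow> (real ^ 'd \<Rightarrow> real ^ 'd) \<Rightarrow> real" where
  "dir_deriv u \<mu> f = Lim (at 0) (difference_quotient u \<mu> f)"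

definition intrinsically_differentiable :: "((real ^ 'd) measure \<Rightarrow> real) \<Rightarrow> bool" where
  "intrinsically_differentiable u \<longleftrightarrow>
     continuous_map P2_topology euclideanreal u \<and>
     (\<forall>\<mu>\<in>P2.
        (\<forall>f\<in>L2_space \<mu>. \<exists>l. (difference_quotient u \<mu> f \<longlongrightarrow> l) (at 0)) \<and>
        (\<forall>f\<in>L2_space \<mu>. \<forall>g\<in>L2_space \<mu>. \<forall>a b.
           dir_deriv u \<mu> (\<lambda>x. a *\<^sub>R f x + b *\<^sub>R g x) = a * dir_deriv u \<mu> f + b * dir_deriv u \<mu> g) \<and>
        (\<exists>C. \<forall>f\<in>L2_space \<mu>. \<bar>dir_deriv u \<mu> f\<bar> \<le> C * L2_norm \<mu> f))"

text \<open>\<open>gradient u \<mu>\<close> is a representative of \<open>Du(\<mu>)\<close>, which is unique up to \<open>\<mu>\<close>-null sets.\<close>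

definition gradient ::
  "((real ^ 'd) measure \<Rightarrow> real) \<Rightarrow> (real ^ 'd) measure \<Rightarrow> (real ^ 'd \<Rightarrow> real ^ 'd)" where
  "gradient u \<mu> = (SOME w. w \<in> L2_space \<mu> \<and> (\<forall>f\<in>L2_space \<mu>. dir_deriv u \<mu> f = L2_inner \<mu> w f))"

definition frechet_condition :: "((real ^ 'd) measure \<Rightarrow> real) \<Rightarrow> bool" where
  "frechet_condition u \<longleftrightarrow>
     (\<forall>\<mu>\<in>P2. \<forall>f :: nat \<Rightarrow> real ^ 'd \<Rightarrow> real ^ 'd.
        (\<forall>n. f n \<in> L2_space \<mu> \<and> L2_norm \<mu> (f n) \<noteq> 0) \<longrightarrow>
        (\<lambda>n. L2_norm \<mu> (f n)) \<longlonglongrightarrow> 0 \<longrightarrow>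
        (\<lambda>n. \<bar>u (push \<mu> (\<lambda>x. x + f n x)) - u \<mu> - dir_deriv u \<mu> (f n)\<bar> / L2_norm \<mu> (f n)) \<longlonglongrightarrow> 0)"

definition continuous_gradient_version ::
  "((real ^ 'd) measure \<Rightarrow> real) \<Rightarrow> ((real ^ 'd) measure \<Rightarrow> real ^ 'd \<Rightarrow> real ^ 'd) \<Rightarrow> bool" where
  "continuous_gradient_version u w \<longleftrightarrow>
     (\<forall>\<mu>\<in>P2. AE x in \<mu>. w \<mu> x = gradient u \<mu> x) \<and>
     continuous_map (prod_topology P2_topology euclidean) euclidean (\<lambda>(\<mu>, x). w \<mu> x)"

definition C1b_P2 :: "((real ^ 'd) measure \<Rightarrow> real) set" where
  "C1b_P2 = {u. intrinsically_differentiable u \<and> frechet_condition u \<and>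
     (\<exists>w. continuous_gradient_version u w \<and>
        (\<exists>C. \<forall>\<mu>\<in>P2. \<forall>x. \<bar>u \<mu>\<bar> + norm (w \<mu> x) \<le> C))}"

section \<open>Closures of forms and generators\<close>

text \<open>\<open>U\<close> is an \<open>E\<close>-Cauchy sequence in \<open>C\<close> that converges to \<open>u\<close> in \<open>L\<^sup>2(M)\<close>.\<close>

definition form_approx ::
  "'a measure \<Rightarrow> (('a \<Rightarrow> real) \<Rightarrow> ('a \<Rightarrow> real) \<Rightarrow> real) \<Rightarrow> ('a \<Rightarrow> real) set \<Rightarrow>
     (nat \<Rightarrow> 'a \<Rightarrow> real) \<Rightarrow> ('a \<Rightarrow> real) \<Rightarrow> bool" where
  "form_approx M E C U u \<longleftrightarrow>
     range U \<subseteq> C \<and> u \<in> L2_space M \<and>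
     (\<forall>e>0. \<exists>N. \<forall>m\<ge>N. \<forall>n\<ge>N. E (\<lambda>x. U m x - U n x) (\<lambda>x. U m x - U n x) < e) \<and>
     (\<lambda>n. L2_norm M (\<lambda>x. U n x - u x)) \<longlonglongrightarrow> 0"

definition closure_domain ::
  "'a measure \<Rightarrow> (('a \<Rightarrow> real) \<Rightarrow> ('a \<Rightarrow> real) \<Rightarrow> real) \<Rightarrow> ('a \<Rightarrow> real) set \<Rightarrow> ('a \<Rightarrow> real) set" where
  "closure_domain M E C = {u. \<exists>U. form_approx M E C U u}"

text \<open>
  For a closable form the common limit below exists and is unique for all \<open>u\<close>, \<open>v\<close> in the domain.
\<close>

definition closure_form ::
  "'a measure \<Rightarrow> (('a \<Rightarrow> real) \<Rightarrow> ('a \<Rightarrow> real) \<Rightarrow> real) \<Rightarrow> ('a \<Rightarrow> real) set \<Rightarrow>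
     ('a \<Rightarrow> real) \<Rightarrow> ('a \<Rightarrow> real) \<Rightarrow> real" where
  "closure_form M E C u v =
     (THE r. \<forall>U V. form_approx M E C U u \<longrightarrow> form_approx M E C V v \<longrightarrow> (\<lambda>n. E (U n) (V n)) \<longlonglongrightarrow> r)"

text \<open>
  \<open>(L, DL)\<close> is the non-positive self-adjoint operator associated with the closed form \<open>(E, DE)\<close>;
  as an operator on \<open>L\<^sup>2(M)\<close> it is uniquely determined by these conditions.
\<close>

definition form_generator ::
  "'a measure \<Rightarrow> (('a \<Rightarrow> real) \<Rightarrow> ('a \<Rightarrow> real) \<Rightarrow> real) \<Rightarrow> ('a \<Rightarrow> real) set \<Rightarrow>
     (('a \<Rightarrow> real) \<Rightarrow> ('a \<Rightarrow> real)) \<Rightarrow> ('a \<Rightarrow> real) set \<Rightarrow> bool" where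
  "form_generator M E DE L DL \<longleftrightarrow>
     self_adjoint_operator M L DL \<and>
     (\<forall>u\<in>DL. L2_inner M (L u) u \<le> 0) \<and>
     DL \<subseteq> DE \<and>
     (\<forall>u\<in>DL. \<forall>v\<in>DE. E u v = - (\<integral>x. L u x * v x \<partial>M))"

section \<open>The Gaussian-based Dirichlet form on the Wasserstein space\<close>

definition Lambda_measure ::
  "(real ^ 'd) measure \<Rightarrow> (real ^ 'd \<Rightarrow> real ^ 'd) measure \<Rightarrow> (real ^ 'd) measure measure" where
  "Lambda_measure lam G = distr G P2_borel (push lam)"

text \<open>In the following, \<open>S\<close> stands for the covariance operator \<open>A\<^sup>-\<^sup>1\<close>.\<close>

definition pre_form ::
  "(real ^ 'd) measure \<Rightarrow> ((real ^ 'd \<Rightarrow> real ^ 'd) \<Rightarrow> (real ^ 'd \<Rightarrow> real ^ 'd)) \<Rightarrow>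
     (real ^ 'd \<Rightarrow> real ^ 'd) measure \<Rightarrow>
     ((real ^ 'd) measure \<Rightarrow> real) \<Rightarrow> ((real ^ 'd) measure \<Rightarrow> real) \<Rightarrow> real" where
  "pre_form lam S G u v =
     (\<integral>f. L2_inner lam (gradient u (push lam f) \<circ> f) (S (gradient v (push lam f) \<circ> f)) \<partial>G)"

definition dirichlet_form ::
  "(real ^ 'd) measure \<Rightarrow> ((real ^ 'd \<Rightarrow> real ^ 'd) \<Rightarrow> (real ^ 'd \<Rightarrow> real ^ 'd)) \<Rightarrow>
     (real ^ 'd \<Rightarrow> real ^ 'd) measure \<Rightarrow>
     ((real ^ 'd) measure \<Rightarrow> real) \<Rightarrow> ((real ^ 'd) measure \<Rightarrow> real) \<Rightarrow> real" where
  "dirichlet_form lam S G = closure_form (Lambda_measure lam G) (pre_form lam S G) C1b_P2"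

definition dirichlet_domain ::
  "(real ^ 'd) measure \<Rightarrow> ((real ^ 'd \<Rightarrow> real ^ 'd) \<Rightarrow> (real ^ 'd \<Rightarrow> real ^ 'd)) \<Rightarrow>
     (real ^ 'd \<Rightarrow> real ^ 'd) measure \<Rightarrow> ((real ^ 'd) measure \<Rightarrow> real) set" where
  "dirichlet_domain lam S G = closure_domain (Lambda_measure lam G) (pre_form lam S G) C1b_P2"

section \<open>The coefficients \<open>\<rho>\<close>\<close>

text \<open>
  Since the eigenvalues \<open>\<alpha>\<close> are summable and \<open>g\<close> is orthonormal, the series converges absolutely
  \<open>\<lambda>\<close>-a.e. and in \<open>L\<^sup>1(\<lambda>)\<close>; the pointwise sum is a version of the \<open>L\<^sup>1\<close>-limit.
\<close>

definition q_coeff ::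
  "(nat \<Rightarrow> real) \<Rightarrow> (nat \<Rightarrow> real ^ 'd \<Rightarrow> real ^ 'd) \<Rightarrow> 'd \<Rightarrow> 'd \<Rightarrow> real ^ 'd \<Rightarrow> real" where
  "q_coeff \<alpha> g k l x = (\<Sum>n. \<alpha> n * (g n x $ k) * (g n x $ l))"

text \<open>
  A jointly measurable version of the evaluation \<open>(f, x) \<mapsto> f x\<close>.  Evaluation of representatives is not
  itself measurable for the product sigma-algebra.
\<close>

definition evaluation_version ::
  "(real ^ 'd) measure \<Rightarrow> (real ^ 'd \<Rightarrow> real ^ 'd) measure \<Rightarrow>
     ((real ^ 'd \<Rightarrow> real ^ 'd) \<Rightarrow> real ^ 'd \<Rightarrow> real ^ 'd) \<Rightarrow> bool" where
  "evaluation_version lam G evl \<longleftrightarrow>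
     (\<lambda>(f, x). evl f x) \<in> borel_measurable (G \<Otimes>\<^sub>M lam) \<and>
     (AE f in G. AE x in lam. evl f x = f x)"

definition vec_push ::
  "(real ^ 'd) measure \<Rightarrow> ((real ^ 'd \<Rightarrow> real ^ 'd) \<Rightarrow> real ^ 'd \<Rightarrow> real ^ 'd) \<Rightarrow>
     (real ^ 'd \<Rightarrow> real ^ 'd) \<times> (real ^ 'd) \<Rightarrow> (real ^ 'd) measure \<times> (real ^ 'd)" where
  "vec_push lam evl = (\<lambda>(f, x). (push lam f, evl f x))"

text \<open>
  Characterisation of \<open>\<rho>\<close>.  The integrability condition (a Radon-Nikodym derivative of a finite
  signed measure is integrable) makes the integrals on the left-hand side meaningful.
\<close>

definition rho_coefficients ::
  "(real ^ 'd) measure \<Rightarrow> (real ^ 'd \<Rightarrow> real ^ 'd) measure \<Rightarrow>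
     ((real ^ 'd \<Rightarrow> real ^ 'd) \<Rightarrow> real ^ 'd \<Rightarrow> real ^ 'd) \<Rightarrow>
     ('d \<Rightarrow> 'd \<Rightarrow> real ^ 'd \<Rightarrow> real) \<Rightarrow>
     ((real ^ 'd) measure \<Rightarrow> 'd \<Rightarrow> 'd \<Rightarrow> real ^ 'd \<Rightarrow> real) \<Rightarrow> bool" where
  "rho_coefficients lam G evl q \<rho> \<longleftrightarrow>
     (\<forall>k l.
        (\<lambda>(\<mu>, x). \<rho> \<mu> k l x) \<in> borel_measurable (P2_borel \<Otimes>\<^sub>M borel) \<and>
        integrable (distr (G \<Otimes>\<^sub>M lam) (P2_borel \<Otimes>\<^sub>M borel) (vec_push lam evl)) (\<lambda>(\<mu>, x). \<rho> \<mu> k l x) \<and>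
        (\<forall>h \<in> borel_measurable (P2_borel \<Otimes>\<^sub>M borel).
           (\<exists>C. \<forall>z. \<bar>h z\<bar> \<le> C) \<longrightarrow>
           (\<integral>\<mu>. (\<integral>x. h (\<mu>, x) * \<rho> \<mu> k l x \<partial>\<mu>) \<partial>Lambda_measure lam G) =
           (\<integral>f. (\<integral>x. h (vec_push lam evl (f, x)) * q k l x \<partial>lam) \<partial>G)))"

section \<open>Partial derivatives and the limit operator\<close>

definition partial_deriv :: "'d \<Rightarrow> (real ^ 'd \<Rightarrow> real) \<Rightarrow> real ^ 'd \<Rightarrow> real" where
  "partial_deriv k \<phi> x = deriv (\<lambda>t. \<phi> (x + t *\<^sub>R axis k 1)) 0"

definition C1_fun :: "(real ^ 'd \<Rightarrow> real) \<Rightarrow> bool" where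
  "C1_fun \<phi> \<longleftrightarrow>
     continuous_on UNIV \<phi> \<and>
     (\<forall>k. (\<forall>x. (\<lambda>t. \<phi> (x + t *\<^sub>R axis k 1)) field_differentiable (at 0)) \<and>
        continuous_on UNIV (partial_deriv k \<phi>))"

definition C2_fun :: "(real ^ 'd \<Rightarrow> real) \<Rightarrow> bool" where
  "C2_fun \<phi> \<longleftrightarrow> C1_fun \<phi> \<and> (\<forall>k. C1_fun (partial_deriv k \<phi>))"

definition diffusion_operator ::
  "('d \<Rightarrow> 'd \<Rightarrow> real ^ 'd \<Rightarrow> real) \<Rightarrow> (real ^ 'd \<Rightarrow> real) \<Rightarrow> real ^ 'd \<Rightarrow> real" where
  "diffusion_operator r \<phi> x =
     (\<Sum>k\<in>UNIV. (\<Sum>l\<in>UNIV. r k l x * partial_deriv k (partial_deriv l \<phi>) x) - x $ k * partial_deriv k \<phi> x)"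

end

theory Submission
  imports Defs "HOL-Real_Asymp.Real_Asymp"
begin

text \<open>
  By the chain rule, \<open>f \<mapsto> U (push lam f)\<close> has the \<open>L\<^sup>2(lam)\<close>-gradient \<open>DU (push lam f) \<circ> f\<close>. Gaussian
  integration by parts in the eigendirections \<open>g\<^sub>n\<close> of \<open>A\<^sup>-\<^sup>1\<close> therefore turns
  \<open>\<integral> \<langle>DU (push lam f) \<circ> f, A\<^sup>-\<^sup>1 (\<nabla>\<phi> \<circ> f)\<rangle> dG\<close> into \<open>\<integral> U (push lam f) (\<langle>\<nabla>\<phi> \<circ> f, f\<rangle> - Q f) dG\<close>, where
  \<open>Q f = (\<Sum>k l. \<integral> q\<^sub>k\<^sub>l (\<partial>\<^sub>k \<partial>\<^sub>l \<phi> \<circ> f) dlam)\<close> is the trace of the derivative of \<open>A\<^sup>-\<^sup>1 (\<nabla>\<phi> \<circ> f)\<close>. Testing against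
  functions of \<open>push lam f\<close> replaces \<open>Q\<close> by the \<open>\<rho>\<close>-weighted second order term, which inherits the
  bound of \<open>Q\<close> and is thus square integrable. Since \<open>\<phi>\<close> is unbounded, \<open>u\<close> itself is only a limit of
  elements of \<open>C\<^sub>b\<^sup>1\<close>: compose \<open>\<phi>\<close> with bounded contractions that converge to the identity.
\<close>

section \<open>The Hilbert space \<open>L\<^sup>2\<close>\<close>

text \<open>Two obstacles shape the proof. \<open>Du\<close> only pairs with directions that are
  functions of the position, whereas a shift of \<open>f\<close> along \<open>g\<^sub>n\<close> may
  separate points that \<open>f\<close> maps to the same place. The chain rule is therefore proved
  for simple functions, where such coincidences occur at finitely many times, and extended in
  integrated form, which is stable under \<open>L\<^sup>2\<close> limits because the gradient has a
  bounded continuous version. The second obstacle is that the value of the closed form is defined as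
  a limit common to all approximating sequences, so closability has to be established. Reading the
  form as the inner product of coordinate sequences in \<open>L\<^sup>2(NG)\<close> reduces it to a
  weak convergence statement in each direction, where integration by parts is applied to difference
  quotients in place of derivatives. For the generator the form is evaluated at pairs
  \<open>(f, u)\<close> with \<open>f\<close> in the domain; self-adjointness turns this into
  \<open>u \<in> DL\<close>. The functional \<open>u\<close> and the drift grow at most
  quadratically in the norm of \<open>f\<close>, which is why a fourth moment of \<open>G\<close> is
  computed.\<close>

lemma L2_measurable: "f \<in> L2_space M \<Longrightarrow> f \<in> borel_measurable M"
  by (simp add: L2_space_def)

lemma L2_integrable_sq: "f \<in> L2_space M \<Longrightarrow> integrable M (\<lambda>x. (norm (f x))\<^sup>2)"
  by (simp add: L2_space_def)

lemma L2_bound: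
  assumes "f \<in> borel_measurable M" "g \<in> L2_space M" "AE x in M. norm (f x) \<le> norm (g x)"
  shows "f \<in> L2_space M"
proof -
  have "integrable M (\<lambda>x. (norm (f x))\<^sup>2)"
    using L2_integrable_sq[OF assms(2)]
    by (rule Bochner_Integration.integrable_bound) (use assms in \<open>auto intro!: power_mono\<close>)
  then show ?thesis using assms(1) by (simp add: L2_space_def)
qed

lemma L2_integrable_inner:
  fixes f g :: "'a \<Rightarrow> 'b::euclidean_space"
  assumes "f \<in> L2_space M" "g \<in> L2_space M"
  shows "integrable M (\<lambda>x. f x \<bullet> g x)"
proof (rule Bochner_Integration.integrable_bound)
  show "integrable M (\<lambda>x. (norm (f x))\<^sup>2 + (norm (g x))\<^sup>2)"
    using assms by (intro Bochner_Integration.integrable_add L2_integrable_sq)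
  show "(\<lambda>x. f x \<bullet> g x) \<in> borel_measurable M"
    using assms by (intro borel_measurable_inner L2_measurable)
  show "AE x in M. norm (f x \<bullet> g x) \<le> norm ((norm (f x))\<^sup>2 + (norm (g x))\<^sup>2)"
  proof (intro AE_I2)
    fix x
    have "\<bar>f x \<bullet> g x\<bar> \<le> norm (f x) * norm (g x)" by (rule Cauchy_Schwarz_ineq2)
    moreover have "2 * (norm (f x) * norm (g x)) \<le> (norm (f x))\<^sup>2 + (norm (g x))\<^sup>2"
      using sum_squares_bound[of "norm (f x)" "norm (g x)"] by simp
    moreover have "0 \<le> norm (f x) * norm (g x)" by simp
    ultimately show "norm (f x \<bullet> g x) \<le> norm ((norm (f x))\<^sup>2 + (norm (g x))\<^sup>2)" by simp
  qed
qed

lemma L2_zero [simp]: "(\<lambda>x. 0) \<in> L2_space M"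
  by (simp add: L2_space_def)

lemma L2_scaleR: "f \<in> L2_space M \<Longrightarrow> (\<lambda>x. a *\<^sub>R f x) \<in> L2_space M"
  by (auto simp: L2_space_def power_mult_distrib)

lemma L2_add:
  assumes f: "f \<in> L2_space M" and g: "g \<in> L2_space M"
  shows "(\<lambda>x. f x + g x) \<in> L2_space M"
proof -
  have "integrable M (\<lambda>x. (norm (f x))\<^sup>2 + 2 * (f x \<bullet> g x) + (norm (g x))\<^sup>2)"
    using assms by (intro Bochner_Integration.integrable_add L2_integrable_sq
        integrable_mult_right L2_integrable_inner)
  then have "integrable M (\<lambda>x. (norm (f x + g x))\<^sup>2)"
    by (simp add: power2_norm_eq_inner inner_add_left inner_add_right inner_commute algebra_simps)
  then show ?thesis using L2_measurable[OF f] L2_measurable[OF g] by (simp add: L2_space_def)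
qed

lemma L2_diff: "f \<in> L2_space M \<Longrightarrow> g \<in> L2_space M \<Longrightarrow> (\<lambda>x. f x - g x) \<in> L2_space M"
  using L2_add[of f M "\<lambda>x. (-1) *\<^sub>R g x"] L2_scaleR[of g M "-1"] by simp

lemma L2_add_scaleR:
  "f \<in> L2_space M \<Longrightarrow> g \<in> L2_space M \<Longrightarrow> (\<lambda>x. f x + t *\<^sub>R g x) \<in> L2_space M"
  by (intro L2_add L2_scaleR)

lemma L2_sum:
  "(\<And>i. i \<in> I \<Longrightarrow> f i \<in> L2_space M) \<Longrightarrow> (\<lambda>x. \<Sum>i\<in>I. f i x) \<in> L2_space M"
  by (induction I rule: infinite_finite_induct) (auto intro: L2_add)

lemma L2_const: "finite_measure M \<Longrightarrow> (\<lambda>x. c) \<in> L2_space M"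
  by (simp add: L2_space_def finite_measure.integrable_const)

lemma L2_inner_commute: "L2_inner M f g = L2_inner M g f"
  by (simp add: L2_inner_def inner_commute)

section \<open>Algebra of the inner product and the norm\<close>

lemma L2_inner_add_left:
  "f \<in> L2_space M \<Longrightarrow> g \<in> L2_space M \<Longrightarrow> h \<in> L2_space M \<Longrightarrow>
    L2_inner M (\<lambda>x. f x + g x) h = L2_inner M f h + L2_inner M g h"
  by (simp add: L2_inner_def inner_add_left L2_integrable_inner)

lemma L2_inner_diff_left:
  "f \<in> L2_space M \<Longrightarrow> g \<in> L2_space M \<Longrightarrow> h \<in> L2_space M \<Longrightarrow>
    L2_inner M (\<lambda>x. f x - g x) h = L2_inner M f h - L2_inner M g h"
  by (simp add: L2_inner_def inner_diff_left L2_integrable_inner)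

lemma L2_inner_scaleR_left: "L2_inner M (\<lambda>x. a *\<^sub>R f x) h = a * L2_inner M f h"
  by (simp add: L2_inner_def)

lemma L2_inner_add_right:
  "f \<in> L2_space M \<Longrightarrow> g \<in> L2_space M \<Longrightarrow> h \<in> L2_space M \<Longrightarrow>
    L2_inner M h (\<lambda>x. f x + g x) = L2_inner M h f + L2_inner M h g"
  by (simp add: L2_inner_add_left L2_inner_commute[of M h])

lemma L2_inner_diff_right:
  "f \<in> L2_space M \<Longrightarrow> g \<in> L2_space M \<Longrightarrow> h \<in> L2_space M \<Longrightarrow>
    L2_inner M h (\<lambda>x. f x - g x) = L2_inner M h f - L2_inner M h g"
  by (simp add: L2_inner_diff_left L2_inner_commute[of M h])

lemma L2_inner_scaleR_right: "L2_inner M h (\<lambda>x. a *\<^sub>R f x) = a * L2_inner M h f"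
  by (simp add: L2_inner_def)

lemma L2_inner_zero [simp]: "L2_inner M (\<lambda>x. 0) f = 0" "L2_inner M f (\<lambda>x. 0) = 0"
  by (simp_all add: L2_inner_def)

lemma L2_inner_sum_left:
  "(\<And>i. i \<in> I \<Longrightarrow> f i \<in> L2_space M) \<Longrightarrow> h \<in> L2_space M \<Longrightarrow>
    L2_inner M (\<lambda>x. \<Sum>i\<in>I. f i x) h = (\<Sum>i\<in>I. L2_inner M (f i) h)"
  by (simp add: L2_inner_def inner_sum_left L2_integrable_inner)

lemma L2_inner_cong_AE:
  assumes "AE x in M. f x = f' x" "AE x in M. g x = g' x"
    "f \<in> borel_measurable M" "f' \<in> borel_measurable M"
    "g \<in> borel_measurable M" "g' \<in> borel_measurable M"
  shows "L2_inner M f g = L2_inner M f' g'"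
  unfolding L2_inner_def
  by (rule integral_cong_AE) (use assms in auto)

lemma L2_norm_sq: "(L2_norm M f)\<^sup>2 = L2_inner M f f"
proof -
  have "0 \<le> L2_inner M f f" unfolding L2_inner_def by (intro Bochner_Integration.integral_nonneg) simp
  then show ?thesis by (simp add: L2_norm_def)
qed

lemma L2_norm_sq_integral: "(L2_norm M f)\<^sup>2 = (\<integral>x. (norm (f x))\<^sup>2 \<partial>M)"
  by (simp add: L2_norm_sq L2_inner_def power2_norm_eq_inner)

lemma L2_norm_nonneg [simp]: "0 \<le> L2_norm M f"
  unfolding L2_norm_def L2_inner_def by (intro real_sqrt_ge_zero Bochner_Integration.integral_nonneg) simp

lemma L2_norm_cong_AE:
  assumes "AE x in M. f x = f' x" "f \<in> borel_measurable M" "f' \<in> borel_measurable M"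
  shows "L2_norm M f = L2_norm M f'"
  unfolding L2_norm_def using L2_inner_cong_AE[OF assms(1) assms(1)] assms by simp

lemma L2_norm_scaleR: "L2_norm M (\<lambda>x. a *\<^sub>R f x) = \<bar>a\<bar> * L2_norm M f"
proof -
  have "L2_inner M (\<lambda>x. a *\<^sub>R f x) (\<lambda>x. a *\<^sub>R f x) = a\<^sup>2 * L2_inner M f f"
    by (simp add: L2_inner_scaleR_left L2_inner_scaleR_right power2_eq_square)
  then show ?thesis by (simp add: L2_norm_def real_sqrt_mult)
qed

lemma L2_norm_minus_commute: "L2_norm M (\<lambda>x. f x - g x) = L2_norm M (\<lambda>x. g x - f x)"
  using L2_norm_scaleR[of M "-1" "\<lambda>x. f x - g x"] by simp

lemma L2_norm_zero [simp]: "L2_norm M (\<lambda>x. 0) = 0"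
  by (simp add: L2_norm_def)

lemma L2_norm_eq_0_iff:
  assumes "f \<in> L2_space M"
  shows "L2_norm M f = 0 \<longleftrightarrow> (AE x in M. f x = 0)"
proof -
  have "L2_norm M f = 0 \<longleftrightarrow> (\<integral>x. (norm (f x))\<^sup>2 \<partial>M) = 0"
    using L2_norm_sq_integral[of M f] by (metis power2_eq_iff_nonneg L2_norm_nonneg power_zero_numeral zero_eq_power2)
  also have "\<dots> \<longleftrightarrow> (AE x in M. (norm (f x))\<^sup>2 = 0)"
    using assms by (intro integral_nonneg_eq_0_iff_AE L2_integrable_sq) auto
  finally show ?thesis by simp
qed

lemma L2_norm_add_sq:
  assumes "f \<in> L2_space M" "g \<in> L2_space M"
  shows "(L2_norm M (\<lambda>x. f x + g x))\<^sup>2 = (L2_norm M f)\<^sup>2 + 2 * L2_inner M f g + (L2_norm M g)\<^sup>2"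
  using assms by (simp add: L2_norm_sq L2_inner_add_left L2_inner_add_right L2_add L2_inner_commute[of M g f])

lemma L2_norm_diff_sq:
  assumes "f \<in> L2_space M" "g \<in> L2_space M"
  shows "(L2_norm M (\<lambda>x. f x - g x))\<^sup>2 = (L2_norm M f)\<^sup>2 - 2 * L2_inner M f g + (L2_norm M g)\<^sup>2"
  using assms by (simp add: L2_norm_sq L2_inner_diff_left L2_inner_diff_right L2_diff L2_inner_commute[of M g f])

lemma L2_Cauchy_Schwarz:
  assumes f: "f \<in> L2_space M" and g: "g \<in> L2_space M"
  shows "\<bar>L2_inner M f g\<bar> \<le> L2_norm M f * L2_norm M g"
proof (cases "L2_norm M g = 0")
  case True
  then have "AE x in M. g x = 0" using L2_norm_eq_0_iff[OF g] by simp
  then have "L2_inner M f g = L2_inner M f (\<lambda>x. 0)"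
    using f g by (intro L2_inner_cong_AE) (auto intro: L2_measurable)
  with True show ?thesis by simp
next
  case False
  then have pos: "L2_norm M g > 0" using L2_norm_nonneg[of M g] by linarith
  \<comment> \<open>The value of \<open>t\<close> that brings \<open>f - t g\<close> closest to
    zero; nonnegativity of that distance is the inequality.\<close>
  define t where "t = L2_inner M f g / (L2_norm M g)\<^sup>2"
  have "0 \<le> (L2_norm M (\<lambda>x. f x - t *\<^sub>R g x))\<^sup>2" by simp
  also have "\<dots> = (L2_norm M f)\<^sup>2 - 2 * t * L2_inner M f g + t\<^sup>2 * (L2_norm M g)\<^sup>2"
    by (subst L2_norm_diff_sq) (use f g in \<open>auto simp: L2_scaleR L2_inner_scaleR_right L2_norm_scaleR power_mult_distrib\<close>)
  also have "\<dots> = (L2_norm M f)\<^sup>2 - (L2_inner M f g)\<^sup>2 / (L2_norm M g)\<^sup>2"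
    using pos by (simp add: t_def field_simps power2_eq_square)
  finally have "(L2_inner M f g)\<^sup>2 \<le> (L2_norm M f * L2_norm M g)\<^sup>2"
    using pos by (simp add: field_simps power_mult_distrib)
  then show ?thesis
    by (metis L2_norm_nonneg abs_le_square_iff abs_of_nonneg mult_nonneg_nonneg)
qed

lemma L2_norm_triangle:
  assumes f: "f \<in> L2_space M" and g: "g \<in> L2_space M"
  shows "L2_norm M (\<lambda>x. f x + g x) \<le> L2_norm M f + L2_norm M g"
proof (rule power2_le_imp_le)
  have "L2_inner M f g \<le> L2_norm M f * L2_norm M g" using L2_Cauchy_Schwarz[OF f g] by simp
  then show "(L2_norm M (\<lambda>x. f x + g x))\<^sup>2 \<le> (L2_norm M f + L2_norm M g)\<^sup>2"
    by (simp add: L2_norm_add_sq[OF f g] power2_sum)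
qed simp

lemma L2_norm_diff_triangle:
  assumes "f \<in> L2_space M" "g \<in> L2_space M" "h \<in> L2_space M"
  shows "L2_norm M (\<lambda>x. f x - h x) \<le> L2_norm M (\<lambda>x. f x - g x) + L2_norm M (\<lambda>x. g x - h x)"
  using L2_norm_triangle[of "\<lambda>x. f x - g x" M "\<lambda>x. g x - h x"] assms by (simp add: L2_diff)

lemma L2_norm_le_diff:
  assumes "f \<in> L2_space M" "g \<in> L2_space M"
  shows "L2_norm M f \<le> L2_norm M (\<lambda>x. f x - g x) + L2_norm M g"
  using L2_norm_triangle[of "\<lambda>x. f x - g x" M g] assms by (simp add: L2_diff)

lemma L2_norm_mono:
  assumes "f \<in> L2_space M" "g \<in> L2_space M" "AE x in M. norm (f x) \<le> norm (g x)"
  shows "L2_norm M f \<le> L2_norm M g"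
proof (rule power2_le_imp_le)
  show "(L2_norm M f)\<^sup>2 \<le> (L2_norm M g)\<^sup>2" unfolding L2_norm_sq_integral
    by (rule integral_mono_AE) (use assms in \<open>auto simp: L2_integrable_sq\<close>)
qed simp

text \<open>Cauchy-Schwarz against the constant 1, a unit vector in a probability space.\<close>

lemma (in prob_space) L1_le_L2_norm:
  fixes f :: "'a \<Rightarrow> 'b::euclidean_space"
  assumes f: "f \<in> L2_space M"
  shows "integrable M (\<lambda>x. norm (f x))" "(\<integral>x. norm (f x) \<partial>M) \<le> L2_norm M f"
proof -
  have n: "(\<lambda>x. norm (f x)) \<in> L2_space M" using L2_measurable[OF f] f by (simp add: L2_space_def)
  have c: "(\<lambda>x. 1::real) \<in> L2_space M" by (simp add: L2_space_def)
  show "integrable M (\<lambda>x. norm (f x))" using L2_integrable_inner[OF n c] by simp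
  have "L2_norm M (\<lambda>x. norm (f x)) = L2_norm M f"
    by (simp add: L2_norm_def L2_inner_def power2_norm_eq_inner[symmetric] power2_eq_square[symmetric])
  then show "(\<integral>x. norm (f x) \<partial>M) \<le> L2_norm M f"
    using L2_Cauchy_Schwarz[OF n c] by (simp add: L2_inner_def L2_norm_def[of M "\<lambda>x. 1"] prob_space)
qed

lemma (in finite_measure) L2_I_bounded:
  assumes "f \<in> borel_measurable M" "\<And>x. x \<in> space M \<Longrightarrow> norm (f x) \<le> C"
  shows "f \<in> L2_space M"
  by (rule L2_bound[OF assms(1) L2_const[of M C]]) (use assms in \<open>auto intro!: AE_I2 order_trans[OF assms(2)]  finite_measure_axioms\<close>)

section \<open>Convergence in \<open>L2\<close>, completeness and the Riesz representation\<close>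

lemma tendsto_inner_L2:
  assumes "\<And>n. f n \<in> L2_space M" "f' \<in> L2_space M" "g \<in> L2_space M"
    and lim: "(\<lambda>n. L2_norm M (\<lambda>x. f n x - f' x)) \<longlonglongrightarrow> 0"
  shows "(\<lambda>n. L2_inner M (f n) g) \<longlonglongrightarrow> L2_inner M f' g"
proof -
  have "(\<lambda>n. L2_inner M (f n) g - L2_inner M f' g) \<longlonglongrightarrow> 0"
  proof (rule Lim_null_comparison)
    show "\<forall>\<^sub>F n in sequentially. norm (L2_inner M (f n) g - L2_inner M f' g) \<le>
        L2_norm M (\<lambda>x. f n x - f' x) * L2_norm M g"
      using L2_Cauchy_Schwarz[OF L2_diff assms(3)] assms by (simp add: L2_inner_diff_left)
    show "(\<lambda>n. L2_norm M (\<lambda>x. f n x - f' x) * L2_norm M g) \<longlonglongrightarrow> 0"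
      using tendsto_mult_left_zero[OF lim] by simp
  qed
  then show ?thesis by (simp add: LIM_zero_iff)
qed

lemma tendsto_norm_L2:
  assumes "\<And>n. f n \<in> L2_space M" "f' \<in> L2_space M"
    and lim: "(\<lambda>n. L2_norm M (\<lambda>x. f n x - f' x)) \<longlonglongrightarrow> 0"
  shows "(\<lambda>n. L2_norm M (f n)) \<longlonglongrightarrow> L2_norm M f'"
proof -
  have "(\<lambda>n. L2_norm M (f n) - L2_norm M f') \<longlonglongrightarrow> 0"
  proof (rule Lim_null_comparison[OF _ lim], intro always_eventually allI)
    fix n
    show "norm (L2_norm M (f n) - L2_norm M f') \<le> L2_norm M (\<lambda>x. f n x - f' x)"
      using L2_norm_le_diff[of "f n" M f'] L2_norm_le_diff[of f' M "f n"] assms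
      by (auto simp: L2_norm_minus_commute[of M f'] abs_le_iff)
  qed
  then show ?thesis by (simp add: LIM_zero_iff)
qed

text \<open>\<open>L2\<close> convergence gives almost everywhere convergence only along a
  subsequence. This criterion carries the conclusion of a dominated convergence argument back to the
  full sequence.\<close>

lemma tendsto_subsubseq:
  fixes X :: "nat \<Rightarrow> 'a::metric_space"
  assumes "\<And>r::nat \<Rightarrow> nat. strict_mono r \<Longrightarrow> \<exists>s::nat \<Rightarrow> nat. strict_mono s \<and> (\<lambda>n. X (r (s n))) \<longlonglongrightarrow> L"
  shows "X \<longlonglongrightarrow> L"
proof (rule ccontr)
  assume "\<not> X \<longlonglongrightarrow> L"
  then obtain e where e: "e > 0" "\<And>N. \<exists>n\<ge>N. dist (X n) L \<ge> e"
    unfolding lim_sequentially by (meson not_less)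
  then have inf: "infinite {n. dist (X n) L \<ge> e}"
    by (metis infinite_nat_iff_unbounded_le mem_Collect_eq)
  obtain r :: "nat \<Rightarrow> nat" where r: "strict_mono r" "\<And>n. dist (X (r n)) L \<ge> e"
    using infinite_enumerate[OF inf] by auto
  obtain s :: "nat \<Rightarrow> nat" where "(\<lambda>n. X (r (s n))) \<longlonglongrightarrow> L" using assms[OF r(1)] by blast
  then obtain n where "dist (X (r (s n))) L < e" using e(1) unfolding lim_sequentially by blast
  with r(2)[of "s n"] show False by simp
qed

lemma L2_AE_subseq:
  fixes f :: "nat \<Rightarrow> 'a \<Rightarrow> 'b::euclidean_space"
  assumes "\<And>n. f n \<in> L2_space M" "f' \<in> L2_space M"
    and lim: "(\<lambda>n. L2_norm M (\<lambda>x. f n x - f' x)) \<longlonglongrightarrow> 0"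
  obtains r :: "nat \<Rightarrow> nat" where "strict_mono r" "AE x in M. (\<lambda>n. f (r n) x) \<longlonglongrightarrow> f' x"
proof -
  have d: "(\<lambda>x. f n x - f' x) \<in> L2_space M" for n using assms by (intro L2_diff) auto
  have "(\<lambda>n. (L2_norm M (\<lambda>x. f n x - f' x))\<^sup>2) \<longlonglongrightarrow> 0"
    using tendsto_power[OF lim, of 2] by simp
  then have l: "(\<lambda>n. \<integral>x. norm ((norm (f n x - f' x))\<^sup>2) \<partial>M) \<longlonglongrightarrow> 0"
    by (simp add: L2_norm_sq_integral)
  obtain r :: "nat \<Rightarrow> nat" where r: "strict_mono r" "AE x in M. (\<lambda>n. (norm (f (r n) x - f' x))\<^sup>2) \<longlonglongrightarrow> 0"
    using tendsto_L1_AE_subseq[OF L2_integrable_sq[OF d] l] by blast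
  have "AE x in M. (\<lambda>n. f (r n) x) \<longlonglongrightarrow> f' x"
    using r(2)
  proof eventually_elim
    case (elim x)
    then have "(\<lambda>n. sqrt ((norm (f (r n) x - f' x))\<^sup>2)) \<longlonglongrightarrow> sqrt 0" by (rule tendsto_real_sqrt)
    then show ?case by (simp add: tendsto_norm_zero_iff LIM_zero_iff)
  qed
  with r(1) show ?thesis using that by blast
qed

text \<open>Riesz--Fischer; a fast subsequence converges almost everywhere because \<open>L\<^sup>2 \<subseteq> L\<^sup>1\<close>.\<close>

lemma (in prob_space) L2_complete:
  fixes f :: "nat \<Rightarrow> 'a \<Rightarrow> 'b::euclidean_space"
  assumes f: "\<And>n. f n \<in> L2_space M"
    and cauchy: "\<And>e. e > 0 \<Longrightarrow> \<exists>N. \<forall>m\<ge>N. \<forall>n\<ge>N. L2_norm M (\<lambda>x. f m x - f n x) < e"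
  obtains f' where "f' \<in> L2_space M" "(\<lambda>n. L2_norm M (\<lambda>x. f n x - f' x)) \<longlonglongrightarrow> 0"
proof -
  have [measurable]: "f n \<in> borel_measurable M" for n using f by (rule L2_measurable)
  have "\<exists>N. \<forall>m\<ge>N. \<forall>n\<ge>N. L2_norm M (\<lambda>x. f m x - f n x) < (1/2)^k" for k :: nat
    by (rule cauchy) simp
  then obtain N where N: "\<And>k m n. m \<ge> N k \<Longrightarrow> n \<ge> N k \<Longrightarrow> L2_norm M (\<lambda>x. f m x - f n x) < (1/2)^k"
    by metis
  \<comment> \<open>Summing the thresholds makes \<open>r\<close> nondecreasing and keeps
    \<open>r k \<ge> N k\<close>.\<close>
  define r where "r k = (\<Sum>i\<le>k. N i)" for k
  have rN: "r k \<ge> N k" for k unfolding r_def by (rule member_le_sum) auto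
  have rmono: "r k \<le> r (Suc k)" for k unfolding r_def by simp
  have rl: "L2_norm M (\<lambda>x. f (r (Suc k)) x - f (r k) x) < (1/2)^k" for k
    by (rule N) (use rN[of k] rmono[of k] in auto)
  define D where "D k x = norm (f (r (Suc k)) x - f (r k) x)" for k x
  have D[measurable]: "D k \<in> borel_measurable M" for k unfolding D_def by measurable
  have d: "(\<lambda>x. f (r (Suc k)) x - f (r k) x) \<in> L2_space M" for k by (intro L2_diff f)
  have "(\<integral>\<^sup>+x. (\<Sum>k. ennreal (D k x)) \<partial>M) = (\<Sum>k. \<integral>\<^sup>+x. ennreal (D k x) \<partial>M)"
    by (intro nn_integral_suminf) simp
  also have "\<dots> \<le> (\<Sum>k. ennreal ((1/2)^k))"
  proof (intro suminf_le allI)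
    fix k
    have "(\<integral>\<^sup>+x. ennreal (D k x) \<partial>M) = ennreal (\<integral>x. D k x \<partial>M)"
      unfolding D_def by (intro nn_integral_eq_integral L1_le_L2_norm d) simp
    also have "\<dots> \<le> ennreal ((1/2)^k)"
      using L1_le_L2_norm(2)[OF d[of k]] rl[of k] unfolding D_def by (intro ennreal_leI) simp
    finally show "(\<integral>\<^sup>+x. ennreal (D k x) \<partial>M) \<le> ennreal ((1/2)^k)" .
  qed auto
  also have "\<dots> = ennreal (\<Sum>k. (1/2)^k)" by (intro suminf_ennreal2) (auto intro: summable_geometric)
  finally have "(\<integral>\<^sup>+x. (\<Sum>k. ennreal (D k x)) \<partial>M) < \<infinity>" using le_less_trans ennreal_less_top by (metis infinity_ennreal_def)
  then have "AE x in M. (\<Sum>k. ennreal (D k x)) \<noteq> \<infinity>"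
    by (intro nn_integral_PInf_AE) auto
  then have conv: "AE x in M. convergent (\<lambda>k. f (r k) x)"
  proof eventually_elim
    case (elim x)
    then have "summable (\<lambda>k. D k x)"
      by (intro summable_suminf_not_top) (auto simp: D_def)
    then have "summable (\<lambda>k. f (r (Suc k)) x - f (r k) x)"
      unfolding D_def by (rule summable_norm_cancel)
    then have "convergent (\<lambda>n. \<Sum>k<n. f (r (Suc k)) x - f (r k) x)"
      by (simp add: summable_iff_convergent)
    then have "convergent (\<lambda>n. f (r n) x - f (r 0) x)" 
      by (subst (asm) sum_lessThan_telescope[of "\<lambda>k. f (r k) x"])
    then obtain l where "(\<lambda>n. f (r n) x - f (r 0) x) \<longlonglongrightarrow> l" by (auto simp: convergent_def)
    then have "(\<lambda>n. (f (r n) x - f (r 0) x) + f (r 0) x) \<longlonglongrightarrow> l + f (r 0) x" by (intro tendsto_intros)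
    then show ?case by (auto simp: convergent_def)
  qed
  \<comment> \<open>Where the subsequence diverges, \<open>lim\<close> is an unspecified value; by
    \<open>conv\<close> this concerns a null set only.\<close>
  define f' where "f' x = lim (\<lambda>k. f (r k) x)" for x
  have f'm[measurable]: "f' \<in> borel_measurable M" unfolding f'_def by measurable
  have AElim: "AE x in M. (\<lambda>k. f (r k) x) \<longlonglongrightarrow> f' x"
    using conv by eventually_elim (simp add: f'_def convergent_LIMSEQ_iff)
  \<comment> \<open>Fatou's lemma: the Cauchy bound for \<open>n\<close> against \<open>r k\<close>
    survives as \<open>k\<close> tends to infinity.\<close>
  have bnd: "(\<integral>\<^sup>+x. ennreal ((norm (f n x - f' x))\<^sup>2) \<partial>M) \<le> ennreal (((1/2)^j)\<^sup>2)" if n: "n \<ge> N j" for n j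
  proof -
    have "(\<integral>\<^sup>+x. ennreal ((norm (f n x - f' x))\<^sup>2) \<partial>M)
        = (\<integral>\<^sup>+x. liminf (\<lambda>k. ennreal ((norm (f n x - f (r k) x))\<^sup>2)) \<partial>M)"
    proof (rule nn_integral_cong_AE, use AElim in eventually_elim)
      fix x assume "(\<lambda>k. f (r k) x) \<longlonglongrightarrow> f' x"
      then have "(\<lambda>k. ennreal ((norm (f n x - f (r k) x))\<^sup>2)) \<longlonglongrightarrow> ennreal ((norm (f n x - f' x))\<^sup>2)"
        by (intro tendsto_intros) 
      then show "ennreal ((norm (f n x - f' x))\<^sup>2) = liminf (\<lambda>k. ennreal ((norm (f n x - f (r k) x))\<^sup>2))"
        by (rule sym[OF lim_imp_Liminf[OF sequentially_bot]])
    qed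
    also have "\<dots> \<le> liminf (\<lambda>k. \<integral>\<^sup>+x. ennreal ((norm (f n x - f (r k) x))\<^sup>2) \<partial>M)"
      by (rule nn_integral_liminf) simp
    also have "\<dots> \<le> ennreal (((1/2)^j)\<^sup>2)"
    proof (rule Liminf_le, simp)
      have "(\<integral>\<^sup>+x. ennreal ((norm (f n x - f (r k) x))\<^sup>2) \<partial>M) \<le> ennreal (((1/2)^j)\<^sup>2)" if k: "k \<ge> j" for k
      proof -
        have "N j \<le> r j" by (rule rN)
        also have "r j \<le> r k" by (rule lift_Suc_mono_le[of r, OF rmono k])
        finally have "L2_norm M (\<lambda>x. f n x - f (r k) x) < (1/2)^j" using n by (intro N) auto
        then have "(L2_norm M (\<lambda>x. f n x - f (r k) x))\<^sup>2 \<le> ((1/2)^j)\<^sup>2" by (intro power_mono) auto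
        moreover have "(\<integral>\<^sup>+x. ennreal ((norm (f n x - f (r k) x))\<^sup>2) \<partial>M)
            = ennreal ((L2_norm M (\<lambda>x. f n x - f (r k) x))\<^sup>2)"
          unfolding L2_norm_sq_integral by (intro nn_integral_eq_integral L2_integrable_sq L2_diff f) simp
        ultimately show ?thesis by (simp add: ennreal_leI)
      qed
      then show "\<forall>\<^sub>F k in sequentially. (\<integral>\<^sup>+x. ennreal ((norm (f n x - f (r k) x))\<^sup>2) \<partial>M) \<le> ennreal (((1/2)^j)\<^sup>2)"
        unfolding eventually_sequentially by blast
    qed
    finally show ?thesis .
  qed
  have df: "(\<lambda>x. f n x - f' x) \<in> L2_space M" if "n \<ge> N j" for n j
  proof -
    have "integrable M (\<lambda>x. (norm (f n x - f' x))\<^sup>2)"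
      by (rule integrableI_bounded) (use bnd[OF that] in \<open>auto intro: le_less_trans\<close>)
    then show ?thesis by (simp add: L2_space_def)
  qed
  have f': "f' \<in> L2_space M"
    using L2_diff[OF f[of "N 0"] df[of 0 "N 0"]] by simp
  have "(\<lambda>n. L2_norm M (\<lambda>x. f n x - f' x)) \<longlonglongrightarrow> 0"
  proof (rule LIMSEQ_I)
    fix e :: real assume "e > 0"
    then obtain j where j: "(1/2)^j < e" using real_arch_pow_inv[of e "1/2"] by auto
    have "norm (L2_norm M (\<lambda>x. f n x - f' x) - 0) < e" if n: "n \<ge> N j" for n
    proof -
      have "ennreal ((L2_norm M (\<lambda>x. f n x - f' x))\<^sup>2) \<le> ennreal (((1/2)^j)\<^sup>2)"
        using bnd[OF n] L2_integrable_sq[OF df[OF n]] unfolding L2_norm_sq_integral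
        by (subst (asm) nn_integral_eq_integral) auto
      then have "(L2_norm M (\<lambda>x. f n x - f' x))\<^sup>2 \<le> ((1/2)^j)\<^sup>2" by simp
      then have "L2_norm M (\<lambda>x. f n x - f' x) \<le> (1/2)^j" by (rule power2_le_imp_le) simp
      with j show ?thesis by simp
    qed
    then show "\<exists>no. \<forall>n\<ge>no. norm (L2_norm M (\<lambda>x. f n x - f' x) - 0) < e" by blast
  qed
  with f' show ?thesis using that by blast
qed

text \<open>The representing vector is a minimiser of the energy
  \<open>J f = |f|\<^sup>2 - 2 l f\<close>, which is bounded below by completing the square. The
  parallelogram identity makes a minimising sequence Cauchy, and the first variation of
  \<open>J\<close> vanishes at the limit.\<close>

lemma (in prob_space) L2_Riesz:
  fixes l :: "('a \<Rightarrow> 'b::euclidean_space) \<Rightarrow> real"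
  assumes lin: "\<And>f g a b. f \<in> L2_space M \<Longrightarrow> g \<in> L2_space M \<Longrightarrow>
      l (\<lambda>x. a *\<^sub>R f x + b *\<^sub>R g x) = a * l f + b * l g"
    and bd: "\<And>f. f \<in> L2_space M \<Longrightarrow> \<bar>l f\<bar> \<le> C * L2_norm M f"
  obtains w where "w \<in> L2_space M" "\<And>f. f \<in> L2_space M \<Longrightarrow> l f = L2_inner M w f"
proof -
  define J where "J f = (L2_norm M f)\<^sup>2 - 2 * l f" for f
  have Jlow: "J f \<ge> - C\<^sup>2" if "f \<in> L2_space M" for f
  proof -
    have "l f \<le> C * L2_norm M f" using bd[OF that] by simp
    then have "J f \<ge> (L2_norm M f)\<^sup>2 - 2 * (C * L2_norm M f)" unfolding J_def by simp
    moreover have "(L2_norm M f)\<^sup>2 - 2 * (C * L2_norm M f) = (L2_norm M f - C)\<^sup>2 - C\<^sup>2"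
      by (simp add: power2_eq_square algebra_simps)
    ultimately show ?thesis using zero_le_power2[of "L2_norm M f - C"] by linarith
  qed
  have bb: "bdd_below (J ` L2_space M)" using Jlow by (intro bdd_belowI[of _ "- C\<^sup>2"]) auto
  have ne: "J ` L2_space M \<noteq> {}" using L2_zero by blast
  define m where "m = (INF f\<in>L2_space M. J f)"
  have mle: "m \<le> J f" if "f \<in> L2_space M" for f unfolding m_def by (rule cINF_lower[OF bb that])
  have "\<exists>f\<in>L2_space M. J f < m + 1 / (real n + 1)" for n :: nat
    using cInf_lessD[OF ne, of "m + 1 / (real n + 1)"] unfolding m_def by auto
  then obtain F where F: "\<And>n. F n \<in> L2_space M" "\<And>n. J (F n) < m + 1 / (real n + 1)"
    by metis
  have par: "(L2_norm M (\<lambda>x. F i x - F j x))\<^sup>2 \<le> 2 / (real i + 1) + 2 / (real j + 1)" for i j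
  proof -
    define h where "h = (\<lambda>x. (1/2) *\<^sub>R F i x + (1/2) *\<^sub>R F j x)"
    have h: "h \<in> L2_space M" unfolding h_def by (intro L2_add L2_scaleR F)
    have lh: "l h = l (F i) / 2 + l (F j) / 2" unfolding h_def by (simp add: lin F)
    have nh: "(L2_norm M h)\<^sup>2 = ((L2_norm M (F i))\<^sup>2 + 2 * L2_inner M (F i) (F j) + (L2_norm M (F j))\<^sup>2) / 4"
      unfolding h_def by (subst L2_norm_add_sq)
        (use F in \<open>auto simp: L2_scaleR L2_inner_scaleR_right L2_inner_scaleR_left L2_norm_scaleR power_divide\<close>)
    have "(L2_norm M (\<lambda>x. F i x - F j x))\<^sup>2 = 2 * J (F i) + 2 * J (F j) - 4 * J h"
      unfolding J_def lh nh by (subst L2_norm_diff_sq) (use F in \<open>auto simp: field_simps\<close>)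
    also have "\<dots> \<le> 2 * (m + 1 / (real i + 1)) + 2 * (m + 1 / (real j + 1)) - 4 * m"
    proof -
      have "2 * a + 2 * b - 4 * c \<le> 2 * (m + p) + 2 * (m + q) - 4 * m"
        if "a < m + p" "b < m + q" "m \<le> c" for a b c p q :: real
        using that by argo
      from this[OF F(2)[of i] F(2)[of j] mle[OF h]] show ?thesis .
    qed
    finally show ?thesis by simp
  qed
  have "\<exists>N. \<forall>i\<ge>N. \<forall>j\<ge>N. L2_norm M (\<lambda>x. F i x - F j x) < e" if e: "e > 0" for e
  proof -
    obtain N :: nat where N: "real N > 4 / e\<^sup>2" using reals_Archimedean2 by blast
    have "L2_norm M (\<lambda>x. F i x - F j x) < e" if "i \<ge> N" "j \<ge> N" for i j
    proof (rule power2_less_imp_less)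
      have "2 / (real i + 1) \<le> 2 / (real N + 1)" "2 / (real j + 1) \<le> 2 / (real N + 1)"
        using that by (auto intro!: divide_left_mono)
      then have "(L2_norm M (\<lambda>x. F i x - F j x))\<^sup>2 \<le> 4 / (real N + 1)" using par[of i j] by simp
      also have "\<dots> < e\<^sup>2"
      proof -
        have "4 < real N * e\<^sup>2" using N e by (simp add: field_simps)
        also have "\<dots> \<le> e\<^sup>2 * (real N + 1)" by (simp add: algebra_simps)
        finally show ?thesis by (simp add: pos_divide_less_eq add_nonneg_pos)
      qed
      finally show "(L2_norm M (\<lambda>x. F i x - F j x))\<^sup>2 < e\<^sup>2" .
    qed (use e in simp)
    then show ?thesis by blast
  qed
  then obtain w where w: "w \<in> L2_space M" "(\<lambda>n. L2_norm M (\<lambda>x. F n x - w x)) \<longlonglongrightarrow> 0"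
    using L2_complete[of F] F(1) by blast
  have ldiff: "l (\<lambda>x. f x - g x) = l f - l g" if "f \<in> L2_space M" "g \<in> L2_space M" for f g
    using lin[OF that, of 1 "-1"] by simp
  have "(\<lambda>n. l (F n) - l w) \<longlonglongrightarrow> 0"
  proof (rule Lim_null_comparison)
    show "\<forall>\<^sub>F n in sequentially. norm (l (F n) - l w) \<le> C * L2_norm M (\<lambda>x. F n x - w x)"
      using bd[OF L2_diff[OF F(1) w(1)]] by (simp add: ldiff F w)
    show "(\<lambda>n. C * L2_norm M (\<lambda>x. F n x - w x)) \<longlonglongrightarrow> 0" using tendsto_mult_right_zero[OF w(2)] by simp
  qed
  then have "(\<lambda>n. l (F n)) \<longlonglongrightarrow> l w" by (simp add: LIM_zero_iff)
  then have "(\<lambda>n. J (F n)) \<longlonglongrightarrow> J w"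
    unfolding J_def using tendsto_norm_L2[OF F(1) w] by (intro tendsto_intros)
  moreover have "(\<lambda>n. m + 1 / (real n + 1)) \<longlonglongrightarrow> m + 0"
    using LIMSEQ_inverse_real_of_nat by (intro tendsto_add tendsto_const) (simp add: inverse_eq_divide add.commute)
  ultimately have Jw: "J w \<le> m" using F(2) by (intro LIMSEQ_le[of _ _ _ m]) (auto intro: less_imp_le)
  have "l f = L2_inner M w f" if f: "f \<in> L2_space M" for f
  proof -
    have q: "0 \<le> 2 * t * (L2_inner M w f - l f) + t\<^sup>2 * (L2_norm M f)\<^sup>2" for t
    proof -
      have "J w \<le> J (\<lambda>x. 1 *\<^sub>R w x + t *\<^sub>R f x)" using Jw mle[OF L2_add[OF L2_scaleR[OF w(1)] L2_scaleR[OF f]]] by (rule order_trans)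
      also have "\<dots> = J w + 2 * t * (L2_inner M w f - l f) + t\<^sup>2 * (L2_norm M f)\<^sup>2"
        unfolding J_def
        by (subst L2_norm_add_sq, use w f in \<open>simp_all add: L2_scaleR\<close>)
          (use lin[OF w(1) f, of 1 t] in \<open>simp add: L2_inner_scaleR_right L2_norm_scaleR power_mult_distrib algebra_simps\<close>)
      finally show ?thesis by simp
    qed
    define c where "c = L2_inner M w f - l f"
    \<comment> \<open>The trial step is \<open>t = - c / K\<close>; the summand 1 keeps the divisor
      positive when \<open>f\<close> has norm zero.\<close>
    define K where "K = (L2_norm M f)\<^sup>2 + 1"
    have K: "K > 0" unfolding K_def by (simp add: add_nonneg_pos)
    have "0 \<le> 2 * (- c / K) * c + (- c / K)\<^sup>2 * (L2_norm M f)\<^sup>2" using q[of "- c / K"] by (simp add: c_def)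
    also have "\<dots> \<le> 2 * (- c / K) * c + (- c / K)\<^sup>2 * K" unfolding K_def by (simp add: mult_left_mono)
    also have "\<dots> = - c\<^sup>2 / K" using K by (simp add: field_simps power2_eq_square)
    finally have "c\<^sup>2 \<le> 0" using K by (simp add: field_simps)
    then show ?thesis by (simp add: c_def)
  qed
  with w(1) show ?thesis using that by blast
qed

section \<open>Orthonormal bases and Borel sets of \<open>L\<^sup>2\<close>\<close>

text \<open>If no ball around \<open>x\<close> fits into \<open>U\<close>, the radii
  \<open>1 / (n + 1)\<close> yield a sequence outside \<open>U\<close> that converges to
  \<open>x\<close>. Stated for any nonnegative \<open>d\<close>, the criterion serves the
  \<open>L2\<close> seminorm and \<open>W2\<close> alike.\<close>

lemma openin_dist_topologyI:
  assumes "U \<subseteq> X"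
    and seq: "\<And>x y. x \<in> U \<Longrightarrow> (\<And>n. y n \<in> X) \<Longrightarrow> (\<lambda>n. d x (y n)) \<longlonglongrightarrow> 0 \<Longrightarrow> (\<And>n. d x (y n) \<ge> 0)
      \<Longrightarrow> \<exists>n::nat. y n \<in> U"
    and nn: "\<And>x y. x \<in> X \<Longrightarrow> y \<in> X \<Longrightarrow> d x y \<ge> 0"
  shows "openin (dist_topology X d) U"
  unfolding openin_dist_topology
proof (intro conjI ballI assms(1))
  fix x assume x: "x \<in> U"
  show "\<exists>e>0. \<forall>y\<in>X. d x y < e \<longrightarrow> y \<in> U"
  proof (rule ccontr)
    assume "\<not> ?thesis"
    then have "\<exists>y\<in>X. d x y < 1 / (real n + 1) \<and> y \<notin> U" for n :: nat
      by (metis of_nat_0_le_iff add_nonneg_pos zero_less_divide_1_iff zero_less_one)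
    then obtain y where y: "\<And>n. y n \<in> X" "\<And>n. d x (y n) < 1 / (real n + 1)" "\<And>n. y n \<notin> U"
      by metis
    have nnn: "d x (y n) \<ge> 0" for n using nn[of x "y n"] x y(1) assms(1) by blast
    have "(\<lambda>n. 1 / (real n + 1)) \<longlonglongrightarrow> 0"
      using LIMSEQ_inverse_real_of_nat by (simp add: inverse_eq_divide add.commute)
    then have "(\<lambda>n. d x (y n)) \<longlonglongrightarrow> 0"
      by (rule Lim_null_comparison[rotated]) (use nnn y(2) in \<open>auto intro!: always_eventually less_imp_le\<close>)
    with seq[where y=y, OF x y(1) _ nnn] y(3) show False by blast
  qed
qed

section \<open>Borel sets of a topology and measurability criteria\<close>

lemma space_borel_of_top [simp]: "space (borel_of_top T) = topspace T"
  unfolding borel_of_top_def by (rule space_measure_of) (auto dest: openin_subset)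

lemma sets_borel_of_top: "sets (borel_of_top T) = sigma_sets (topspace T) {U. openin T U}"
  unfolding borel_of_top_def by (rule sets_measure_of) (auto dest: openin_subset)

lemma openin_sets_borel_of_top: "openin T U \<Longrightarrow> U \<in> sets (borel_of_top T)"
  unfolding sets_borel_of_top by (intro sigma_sets.Basic) simp

lemma measurable_borel_of_topI:
  assumes "\<And>z. z \<in> space N \<Longrightarrow> K z \<in> topspace T"
    and "\<And>U. openin T U \<Longrightarrow> K -` U \<inter> space N \<in> sets N"
  shows "K \<in> measurable N (borel_of_top T)"
  unfolding borel_of_top_def
  by (rule measurable_measure_of) (use assms in \<open>auto dest: openin_subset\<close>)

lemma space_L2_borel [simp]: "space (L2_borel M) = L2_space M"
  by (simp add: L2_borel_def)

text \<open>Preimages of open sets are open by the sequential criterion. Most functionals of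
  \<open>f\<close> below owe their measurability to this.\<close>

lemma measurable_L2_borel_seq:
  fixes \<Phi> :: "('a \<Rightarrow> 'b::euclidean_space) \<Rightarrow> 'c::topological_space"
  assumes "\<And>f F. f \<in> L2_space M \<Longrightarrow> (\<And>n. F n \<in> L2_space M) \<Longrightarrow>
      (\<lambda>n. L2_norm M (\<lambda>x. F n x - f x)) \<longlonglongrightarrow> 0 \<Longrightarrow> (\<lambda>n. \<Phi> (F n)) \<longlonglongrightarrow> \<Phi> f"
  shows "\<Phi> \<in> borel_measurable (L2_borel M)"
proof (rule borel_measurableI)
  fix S :: "'c set" assume S: "open S"
  have "openin (dist_topology (L2_space M) (\<lambda>f g. L2_norm M (\<lambda>x. f x - g x))) (\<Phi> -` S \<inter> L2_space M)"
  proof (rule openin_dist_topologyI)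
    fix f F assume f: "f \<in> \<Phi> -` S \<inter> L2_space M" and F: "\<And>n. F n \<in> L2_space M"
      and "(\<lambda>n. L2_norm M (\<lambda>x. f x - F n x)) \<longlonglongrightarrow> 0"
    then have "(\<lambda>n. L2_norm M (\<lambda>x. F n x - f x)) \<longlonglongrightarrow> 0"
      by (simp add: L2_norm_minus_commute[of M f])
    then have "(\<lambda>n. \<Phi> (F n)) \<longlonglongrightarrow> \<Phi> f" using assms f F by blast
    then have "\<forall>\<^sub>F n in sequentially. \<Phi> (F n) \<in> S" using S f by (intro topological_tendstoD) auto
    then show "\<exists>n. F n \<in> \<Phi> -` S \<inter> L2_space M"
      using F by (auto simp: eventually_sequentially)
  qed auto
  then show "\<Phi> -` S \<inter> space (L2_borel M) \<in> sets (L2_borel M)"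
    by (simp add: L2_borel_def openin_sets_borel_of_top)
qed

lemma measurable_L2_inner:
  assumes "h \<in> L2_space M"
  shows "(\<lambda>f. L2_inner M f h) \<in> borel_measurable (L2_borel M)"
    "(\<lambda>f. L2_inner M h f) \<in> borel_measurable (L2_borel M)"
  unfolding L2_inner_commute[of M h]
  by (rule measurable_L2_borel_seq; rule tendsto_inner_L2; use assms in simp)+

lemma measurable_L2_norm: "L2_norm M \<in> borel_measurable (L2_borel M)"
  by (rule measurable_L2_borel_seq) (rule tendsto_norm_L2)

lemma L2_norm_sum_le:
  assumes "\<And>i. i \<in> I \<Longrightarrow> f i \<in> L2_space M"
  shows "L2_norm M (\<lambda>x. \<Sum>i\<in>I. f i x) \<le> (\<Sum>i\<in>I. L2_norm M (f i))"
  using assms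
proof (induction I rule: infinite_finite_induct)
  case (insert i I)
  have "L2_norm M (\<lambda>x. f i x + (\<Sum>i\<in>I. f i x)) \<le> L2_norm M (f i) + L2_norm M (\<lambda>x. \<Sum>i\<in>I. f i x)"
    using insert by (intro L2_norm_triangle L2_sum) auto
  with insert show ?case by force
qed auto

locale L2_basis = prob_space M for M :: "'a measure" +
  fixes g :: "nat \<Rightarrow> 'a \<Rightarrow> 'b::euclidean_space"
  assumes onb: "orthonormal_basis M g"
begin

lemma g_L2 [simp]: "g n \<in> L2_space M"
  using onb unfolding orthonormal_basis_def by auto

lemma g_inner: "L2_inner M (g m) (g n) = (if m = n then 1 else 0)"
  using onb unfolding orthonormal_basis_def by blast

lemma g_norm [simp]: "L2_norm M (g n) = 1"
  by (simp add: L2_norm_def g_inner)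

lemma g_complete: "f \<in> L2_space M \<Longrightarrow> (\<And>n. L2_inner M f (g n) = 0) \<Longrightarrow> AE x in M. f x = 0"
  using onb unfolding orthonormal_basis_def by blast

abbreviation coord :: "nat \<Rightarrow> ('a \<Rightarrow> 'b) \<Rightarrow> real" where
  "coord n f \<equiv> L2_inner M f (g n)"

text \<open>The orthogonal projection onto the span of \<open>g 0, ..., g (N - 1)\<close>.\<close>

abbreviation P :: "nat \<Rightarrow> ('a \<Rightarrow> 'b) \<Rightarrow> 'a \<Rightarrow> 'b" where
  "P N f \<equiv> \<lambda>x. \<Sum>n<N. coord n f *\<^sub>R g n x"

lemma P_L2 [simp]: "P N f \<in> L2_space M"
  by (intro L2_sum L2_scaleR g_L2)

lemma P_inner: "h \<in> L2_space M \<Longrightarrow> L2_inner M (P N f) h = (\<Sum>n<N. coord n f * coord n h)"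
  by (subst L2_inner_sum_left) (auto simp: L2_scaleR L2_inner_scaleR_left L2_inner_commute[of M "g _"])

lemma coord_P: "coord m (P N f) = (if m < N then coord m f else 0)"
proof -
  have "coord m (P N f) = (\<Sum>n<N. if n = m then coord n f else 0)"
    by (subst P_inner[OF g_L2], rule sum.cong) (auto simp: g_inner)
  then show ?thesis by (simp add: sum.delta)
qed

lemma P_inner_P: "K \<le> (N::nat) \<Longrightarrow> L2_inner M (P N f) (P K f) = (\<Sum>n<K. (coord n f)\<^sup>2)"
proof -
  assume KN: "K \<le> N"
  have "L2_inner M (P N f) (P K f) = (\<Sum>n<N. if n < K then (coord n f)\<^sup>2 else 0)"
    by (subst P_inner) (auto simp: coord_P power2_eq_square intro!: sum.cong)
  also have "\<dots> = (\<Sum>n<K. (coord n f)\<^sup>2)"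
    by (rule sum.mono_neutral_cong_right) (use KN in auto)
  finally show ?thesis .
qed

lemma P_norm_sq: "(L2_norm M (P N f))\<^sup>2 = (\<Sum>n<N. (coord n f)\<^sup>2)"
  using P_inner_P[where K=N and N=N and f=f] by (simp add: L2_norm_sq)

lemma P_diff_norm_sq:
  assumes "f \<in> L2_space M"
  shows "(L2_norm M (\<lambda>x. f x - P N f x))\<^sup>2 = (L2_norm M f)\<^sup>2 - (\<Sum>n<N. (coord n f)\<^sup>2)"
  using assms P_norm_sq[where N=N and f=f] P_inner[OF assms, where N=N and f=f]
  by (subst L2_norm_diff_sq) (auto simp: L2_inner_commute[of M f "P N f"] power2_eq_square)

lemma Bessel: "f \<in> L2_space M \<Longrightarrow> (\<Sum>n<N. (coord n f)\<^sup>2) \<le> (L2_norm M f)\<^sup>2"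
  using P_diff_norm_sq[where f=f and N=N] zero_le_power2[of "L2_norm M (\<lambda>x. f x - P N f x)"] by linarith

lemma summable_coord_sq:
  assumes "f \<in> L2_space M" shows "summable (\<lambda>n. (coord n f)\<^sup>2)"
  by (rule summableI_nonneg_bounded[of _ "(L2_norm M f)\<^sup>2"]) (use Bessel[OF assms] in auto)

text \<open>Summability of the squared coordinates makes the projections a Cauchy sequence. Its
  limit has the same coordinates as \<open>f\<close>, and completeness of the basis identifies the
  two almost everywhere.\<close>

lemma P_tendsto:
  assumes f: "f \<in> L2_space M"
  shows "(\<lambda>N. L2_norm M (\<lambda>x. P N f x - f x)) \<longlonglongrightarrow> 0"
proof -
  define s where "s N = (\<Sum>n<N. (coord n f)\<^sup>2)" for N
  have "convergent s" using summable_coord_sq[OF f] unfolding s_def by (simp add: summable_iff_convergent)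
  then have cs: "Cauchy s" by (rule convergent_Cauchy)
  have pd: "(L2_norm M (\<lambda>x. P i f x - P j f x))\<^sup>2 = \<bar>s i - s j\<bar>" for i j
  proof -
    have 1: "(L2_norm M (\<lambda>x. P i f x - P j f x))\<^sup>2 = s i - s j" if "j \<le> i" for i j
      using that P_inner_P[OF that, where f=f] by (subst L2_norm_diff_sq) (auto simp: P_norm_sq s_def)
    have m: "s j \<le> s i" if "j \<le> i" for i j
      unfolding s_def using that by (intro sum_mono2) auto
    show ?thesis
    proof (cases "j \<le> i")
      case False
      then have "i \<le> j" by simp
      with 1[OF this] m[OF this] show ?thesis by (simp add: L2_norm_minus_commute[of M "P i f"])
    qed (simp add: 1 m)
  qed
  have "\<exists>N. \<forall>i\<ge>N. \<forall>j\<ge>N. L2_norm M (\<lambda>x. P i f x - P j f x) < e" if e: "e > 0" for e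
  proof -
    obtain N where "\<forall>i\<ge>N. \<forall>j\<ge>N. \<bar>s i - s j\<bar> < e\<^sup>2"
      using cs[unfolded Cauchy_def, rule_format, of "e\<^sup>2"] e by (auto simp: dist_real_def)
    then have "(L2_norm M (\<lambda>x. P i f x - P j f x))\<^sup>2 < e\<^sup>2" if "i \<ge> N" "j \<ge> N" for i j
      using that by (simp only: pd)
    then show ?thesis using power2_less_imp_less less_imp_le[OF e] by blast
  qed
  then obtain h where h: "h \<in> L2_space M" "(\<lambda>N. L2_norm M (\<lambda>x. P N f x - h x)) \<longlonglongrightarrow> 0"
    using L2_complete[of "\<lambda>N. P N f"] P_L2 by blast
  have "coord m (\<lambda>x. f x - h x) = 0" for m
  proof -
    have "(\<lambda>N. coord m (P N f)) \<longlonglongrightarrow> coord m h" by (rule tendsto_inner_L2) (use h in auto)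
    moreover have "(\<lambda>N. coord m (P N f)) \<longlonglongrightarrow> coord m f"
      by (rule tendsto_eventually) (auto simp: coord_P eventually_sequentially intro!: exI[of _ "Suc m"])
    ultimately have "coord m h = coord m f" by (rule LIMSEQ_unique)
    then show ?thesis using f h by (simp add: L2_inner_diff_left)
  qed
  then have ae: "AE x in M. f x - h x = 0" by (intro g_complete L2_diff f h) auto
  have "L2_norm M (\<lambda>x. P N f x - h x) = L2_norm M (\<lambda>x. P N f x - f x)" for N
  proof (rule L2_norm_cong_AE)
    show "AE x in M. P N f x - h x = P N f x - f x" using ae by eventually_elim simp
  qed (intro L2_measurable L2_diff P_L2 f h)+
  with h(2) show ?thesis by simp
qed

lemma Parseval_inner:
  assumes "f \<in> L2_space M" "h \<in> L2_space M"
  shows "(\<lambda>n. coord n f * coord n h) sums L2_inner M f h"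
  using tendsto_inner_L2[OF P_L2 assms P_tendsto[OF assms(1)]]
  by (simp add: sums_def P_inner assms)

lemma Parseval:
  assumes "f \<in> L2_space M"
  shows "(\<lambda>n. (coord n f)\<^sup>2) sums (L2_norm M f)\<^sup>2"
  using Parseval_inner[OF assms assms] by (simp add: power2_eq_square[symmetric] L2_norm_sq)

text \<open>Separability, witnessed by finite rational combinations of the basis; coding them as
  \<open>rat list\<close> puts them into a countable type.\<close>

lemma countable_dense:
  assumes f: "f \<in> L2_space M" and e: "e > 0"
  shows "\<exists>qs :: rat list. L2_norm M (\<lambda>x. f x - (\<Sum>i<length qs. of_rat (qs ! i) *\<^sub>R g i x)) < e"
proof -
  obtain N where N: "L2_norm M (\<lambda>x. P N f x - f x) < e/2"
    using LIMSEQ_D[OF P_tendsto[OF f], of "e/2"] e by auto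
  \<comment> \<open>The \<open>N\<close> coordinate errors add up to at most \<open>e / 2\<close>;
    the summand 1 covers \<open>N = 0\<close>.\<close>
  have "\<exists>q. \<bar>coord i f - of_rat q\<bar> < e / (2 * (real N + 1))" for i
  proof -
    have "coord i f - e / (2 * (real N + 1)) < coord i f" using e by simp
    then obtain q where "coord i f - e / (2 * (real N + 1)) < of_rat q" "of_rat q < coord i f"
      using of_rat_dense by blast
    then show ?thesis by (intro exI[of _ q]) (simp add: abs_if)
  qed
  then obtain q where q: "\<And>i. \<bar>coord i f - of_rat (q i)\<bar> < e / (2 * (real N + 1))" by metis
  define qs where "qs = map q [0..<N]"
  have "L2_norm M (\<lambda>x. P N f x - (\<Sum>i<N. of_rat (q i) *\<^sub>R g i x))
      = L2_norm M (\<lambda>x. \<Sum>i<N. (coord i f - of_rat (q i)) *\<^sub>R g i x)"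
    by (simp add: sum_subtractf scaleR_diff_left)
  also have "\<dots> \<le> (\<Sum>i<N. L2_norm M (\<lambda>x. (coord i f - of_rat (q i)) *\<^sub>R g i x))"
    by (intro L2_norm_sum_le L2_scaleR g_L2)
  also have "\<dots> \<le> (\<Sum>i<N. e / (2 * (real N + 1)))"
    using q by (intro sum_mono) (simp add: L2_norm_scaleR less_imp_le)
  also have "\<dots> \<le> e/2" using e by (simp add: field_simps)
  finally have "L2_norm M (\<lambda>x. P N f x - (\<Sum>i<N. of_rat (q i) *\<^sub>R g i x)) \<le> e/2" .
  moreover have "L2_norm M (\<lambda>x. f x - (\<Sum>i<N. of_rat (q i) *\<^sub>R g i x))
     \<le> L2_norm M (\<lambda>x. f x - P N f x) + L2_norm M (\<lambda>x. P N f x - (\<Sum>i<N. of_rat (q i) *\<^sub>R g i x))"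
    by (intro L2_norm_diff_triangle f P_L2 L2_sum L2_scaleR g_L2)
  ultimately have "L2_norm M (\<lambda>x. f x - (\<Sum>i<N. of_rat (q i) *\<^sub>R g i x)) < e"
    using N by (simp add: L2_norm_minus_commute[of M f])
  then show ?thesis by (intro exI[of _ qs]) (simp add: qs_def)
qed

text \<open>By separability every open set is a countable union of balls with centres
  \<open>dd qs\<close> and rational radii, and by Parseval's identity membership in such a ball is a
  measurable condition on the coordinates.\<close>

lemma measurable_into_L2_borel:
  assumes K: "\<And>z. z \<in> space N \<Longrightarrow> K z \<in> L2_space M"
    and meas: "\<And>i. (\<lambda>z. coord i (K z)) \<in> borel_measurable N"
  shows "K \<in> measurable N (L2_borel M)"
  unfolding L2_borel_def
proof (rule measurable_borel_of_topI)
  note meas[measurable]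
  define dd where "dd qs = (\<lambda>x. \<Sum>i<length qs. of_rat (qs ! i) *\<^sub>R g i x)" for qs :: "rat list"
  have dd: "dd qs \<in> L2_space M" for qs unfolding dd_def by (intro L2_sum L2_scaleR g_L2)
  define B where "B qs r = {f \<in> L2_space M. L2_norm M (\<lambda>x. f x - dd qs x) < r}" for qs and r :: real
  have Bm: "K -` B qs r \<inter> space N \<in> sets N" for qs r
  proof (cases "r \<le> 0")
    case True
    have "\<not> L2_norm M (\<lambda>x. f x - dd qs x) < r" for f
      using True L2_norm_nonneg[of M "\<lambda>x. f x - dd qs x"] by linarith
    then have "B qs r = {}" unfolding B_def by blast
    then show ?thesis by simp
  next
    case False
    have eq: "L2_norm M (\<lambda>x. K z x - dd qs x) < r \<longleftrightarrow> (\<Sum>i. (coord i (K z) - coord i (dd qs))\<^sup>2) < r\<^sup>2"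
      if "z \<in> space N" for z
    proof -
      have "(\<lambda>i. (coord i (K z) - coord i (dd qs))\<^sup>2) sums (L2_norm M (\<lambda>x. K z x - dd qs x))\<^sup>2"
        using Parseval[OF L2_diff[OF K[OF that] dd]] by (simp add: L2_inner_diff_left K[OF that] dd)
      then have "(\<Sum>i. (coord i (K z) - coord i (dd qs))\<^sup>2) = (L2_norm M (\<lambda>x. K z x - dd qs x))\<^sup>2"
        by (simp add: sums_iff)
      moreover have "a < r \<longleftrightarrow> a\<^sup>2 < r\<^sup>2" if "a \<ge> 0" for a
        using False that power_mono_iff[of r a 2] by (simp add: not_le[symmetric])
      ultimately show ?thesis by simp
    qed
    have "K -` B qs r \<inter> space N = {z \<in> space N. (\<Sum>i. (coord i (K z) - coord i (dd qs))\<^sup>2) < r\<^sup>2}"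
      unfolding B_def using eq K by auto
    also have "\<dots> \<in> sets N" by measurable
    finally show ?thesis .
  qed
  fix U assume U: "openin (dist_topology (L2_space M) (\<lambda>f h :: 'a \<Rightarrow> 'b. L2_norm M (\<lambda>x. f x - h x))) U"
  have "U = (\<Union>(qs, r)\<in>{(qs, r :: rat). B qs (of_rat r) \<subseteq> U}. B qs (of_rat r))"
  proof (intro equalityI subsetI)
    fix f assume f: "f \<in> U"
    then have fL: "f \<in> L2_space M" using U by (auto simp: openin_dist_topology)
    obtain e where e: "e > 0" "\<And>h. h \<in> L2_space M \<Longrightarrow> L2_norm M (\<lambda>x. f x - h x) < e \<Longrightarrow> h \<in> U"
      using U f unfolding openin_dist_topology by blast
    obtain r where r: "0 < (of_rat r :: real)" "of_rat r < e/2"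
      using of_rat_dense[of 0 "e/2"] e(1) by auto
    obtain qs where qs: "L2_norm M (\<lambda>x. f x - dd qs x) < of_rat r"
      using countable_dense[OF fL r(1)] unfolding dd_def by blast
    have "B qs (of_rat r) \<subseteq> U"
    proof
      fix h assume h: "h \<in> B qs (of_rat r)"
      then have hL: "h \<in> L2_space M" by (simp add: B_def)
      have "L2_norm M (\<lambda>x. f x - h x) \<le> L2_norm M (\<lambda>x. f x - dd qs x) + L2_norm M (\<lambda>x. dd qs x - h x)"
        by (intro L2_norm_diff_triangle fL hL dd)
      also have "\<dots> < of_rat r + of_rat r"
        using qs h by (intro add_strict_mono) (auto simp: B_def L2_norm_minus_commute[of M "dd qs"])
      finally show "h \<in> U" using e(2)[OF hL] r(2) by simp
    qed
    moreover have "f \<in> B qs (of_rat r)" using qs fL by (simp add: B_def)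
    ultimately show "f \<in> (\<Union>(qs, r)\<in>{(qs, r :: rat). B qs (of_rat r) \<subseteq> U}. B qs (of_rat r))" by blast
  qed auto
  then have "K -` U \<inter> space N = (\<Union>(qs, r)\<in>{(qs, r :: rat). B qs (of_rat r) \<subseteq> U}. K -` B qs (of_rat r) \<inter> space N)"
    by blast
  also have "\<dots> \<in> sets N"
    by (intro sets.countable_UN' ) (auto intro: Bm)
  finally show "K -` U \<inter> space N \<in> sets N" .
qed (use K in simp)

end

section \<open>Laws determined by cosines of linear functionals\<close>

text \<open>After normalisation this is uniqueness of characteristic functions: the phases
  \<open>0\<close> and \<open>- pi/2\<close> yield their real and imaginary parts. Frequency zero
  compares the total masses, and mass zero is treated apart because it cannot be normalised.\<close>

lemma finite_measure_eqI_cos: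
  fixes R1 R2 :: "real measure"
  assumes fin: "finite_measure R1" "finite_measure R2"
    and sets: "sets R1 = sets borel" "sets R2 = sets borel"
    and eq: "\<And>\<theta> t. (\<integral>x. cos (\<theta> + t * x) \<partial>R1) = (\<integral>x. cos (\<theta> + t * x) \<partial>R2)"
  shows "R1 = R2"
proof -
  interpret R1: finite_measure R1 by fact
  interpret R2: finite_measure R2 by fact
  note sets[measurable_cong]
  have space: "space R1 = UNIV" "space R2 = UNIV" using sets by (auto dest: sets_eq_imp_space_eq)
  have mass: "measure R1 (space R1) = measure R2 (space R2)"
    using eq[of 0 0] by simp
  show ?thesis
  proof (cases "measure R1 (space R1) = 0")
    case True
    have "emeasure R1 A = 0" "emeasure R2 A = 0" for A
      using emeasure_space[of R1 A] emeasure_space[of R2 A] True mass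
      by (auto simp: R1.emeasure_eq_measure R2.emeasure_eq_measure order_antisym)
    then show ?thesis by (intro measure_eqI) (auto simp: sets)
  next
    case False
    define c where "c = 1 / measure R1 (space R1)"
    have c: "c > 0" unfolding c_def using False by (simp add: zero_less_measure_iff)
    have mass1: "emeasure (density R (\<lambda>_. ennreal c)) (space R) = 1"
      if "finite_measure R" "measure R (space R) = measure R1 (space R1)" for R :: "real measure"
    proof -
      interpret R: finite_measure R by fact
      have "emeasure (density R (\<lambda>_. ennreal c)) (space R) = ennreal c * ennreal (measure R (space R))"
        by (simp add: emeasure_density_const R.emeasure_eq_measure)
      also have "\<dots> = ennreal (c * measure R (space R))" using c by (simp add: ennreal_mult')
      also have "\<dots> = 1" using that(2) False by (simp add: c_def)
      finally show ?thesis .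
    qed
    have rd: "real_distribution (density R (\<lambda>_. ennreal c))"
      if "finite_measure R" "sets R = sets borel" "measure R (space R) = measure R1 (space R1)" for R
      by (intro real_distribution.intro prob_spaceI real_distribution_axioms.intro)
        (use mass1[OF that(1,3)] that(2) in auto)
    have ch: "char (density R (\<lambda>_. ennreal c)) t
        = complex_of_real (c * (\<integral>x. cos (0 + t * x) \<partial>R)) + \<i> * complex_of_real (c * (\<integral>x. cos (- pi/2 + t * x) \<partial>R))"
      if R: "finite_measure R" "sets R = sets borel" "measure R (space R) = measure R1 (space R1)" for R t
    proof -
      interpret R: finite_measure R by fact
      note R(2)[measurable_cong]
      have i: "integrable R (\<lambda>x. cos (\<theta> + t * x))" for \<theta>
        by (rule R.integrable_const_bound[of _ 1]) auto
      have "char (density R (\<lambda>_. ennreal c)) t = (\<integral>x. c *\<^sub>R iexp (t * x) \<partial>R)"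
        unfolding char_def using c by (subst integral_density) auto
      also have "\<dots> = (\<integral>x. complex_of_real (c * cos (0 + t * x)) + \<i> * complex_of_real (c * cos (- pi/2 + t * x)) \<partial>R)"
      proof (rule Bochner_Integration.integral_cong[OF refl])
        fix x
        have "cos (- pi / 2 + t * x) = sin (t * x)" using cos_diff[of "t * x" "pi / 2"] by simp
        then show "c *\<^sub>R iexp (t * x) = complex_of_real (c * cos (0 + t * x)) + \<i> * complex_of_real (c * cos (- pi/2 + t * x))"
          by (simp add: complex_eq_iff Re_exp Im_exp)
      qed
      also have "\<dots> = (\<integral>x. complex_of_real (c * cos (0 + t * x)) \<partial>R) + (\<integral>x. \<i> * complex_of_real (c * cos (- pi/2 + t * x)) \<partial>R)"
        by (rule Bochner_Integration.integral_add)
          (intro integrable_mult_right integrable_of_real i)+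
      finally show ?thesis by simp
    qed
    have "density R1 (\<lambda>_. ennreal c) = density R2 (\<lambda>_. ennreal c)"
    proof (rule Levy_uniqueness)
      show "char (density R1 (\<lambda>_. ennreal c)) = char (density R2 (\<lambda>_. ennreal c))"
        unfolding ch[OF fin(1) sets(1) refl, abs_def] ch[OF fin(2) sets(2) mass[symmetric], abs_def] eq ..
    qed (rule rd; simp add: fin sets mass)+
    then have eqd: "emeasure (density R1 (\<lambda>_. ennreal c)) A = emeasure (density R2 (\<lambda>_. ennreal c)) A" for A by simp
    show ?thesis
    proof (rule measure_eqI)
      fix A assume A: "A \<in> sets R1"
      then have A2: "A \<in> sets R2" using sets by simp
      have "ennreal c * emeasure R1 A = ennreal c * emeasure R2 A"
        using eqd[of A] A A2 by (simp add: emeasure_density_const)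
      then have "ennreal (c * measure R1 A) = ennreal (c * measure R2 A)"
        using c by (simp add: R1.emeasure_eq_measure R2.emeasure_eq_measure ennreal_mult')
      then have "measure R1 A = measure R2 A" using c by simp
      then show "emeasure R1 A = emeasure R2 A" by (simp add: R1.emeasure_eq_measure R2.emeasure_eq_measure)
    qed (simp add: sets)
  qed
qed

text \<open>The phase \<open>\<theta>\<close> treats sine and cosine at once. In the induction step the positive weight
  \<open>2 \<plusminus> cos(\<dots>)\<close> in the first coordinates reduces the last coordinate to the
  one-dimensional case.\<close>

lemma joint_law_eqI_cos:
  fixes X :: "nat \<Rightarrow> 'a \<Rightarrow> real"
  assumes "finite_measure M" "finite_measure N" "sets M = sets N"
    and "\<And>i. X i \<in> borel_measurable M" "\<And>i. B i \<in> sets borel"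
    and "\<And>\<theta> s. (\<integral>x. cos (\<theta> + (\<Sum>i<n. s i * X i x)) \<partial>M) = (\<integral>x. cos (\<theta> + (\<Sum>i<n. s i * X i x)) \<partial>N)"
  shows "emeasure M {x\<in>space M. \<forall>i<n. X i x \<in> B i} = emeasure N {x\<in>space M. \<forall>i<n. X i x \<in> B i}"
  using assms
proof (induction n arbitrary: M N)
  case 0
  interpret M: finite_measure M by fact
  interpret N: finite_measure N by fact
  have "measure M (space M) = measure N (space N)" using 0(6)[of 0] by simp
  moreover have "space M = space N" using 0(3) by (rule sets_eq_imp_space_eq)
  ultimately show ?case by (simp add: M.emeasure_eq_measure N.emeasure_eq_measure)
next
  case (Suc n)
  interpret M: finite_measure M by fact
  interpret N: finite_measure N by fact
  note X[measurable] = Suc.prems(4)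
  note B[measurable] = Suc.prems(5)
  note sets_eq[measurable_cong, simp] = Suc.prems(3)
  have sp: "space N = space M" using sets_eq by (rule sets_eq_imp_space_eq[symmetric])
  have XN[measurable]: "X i \<in> borel_measurable N" for i
    using X measurable_cong_sets[OF sets_eq refl] by blast
  have cosi: "finite_measure K \<Longrightarrow> (\<And>i. X i \<in> borel_measurable K) \<Longrightarrow>
      integrable K (\<lambda>x. cos (\<theta> + (\<Sum>i<n. s i * X i x) + t * X n x))" for K \<theta> s t
    by (rule finite_measure.integrable_const_bound[of _ _ 1]) auto
  have E: "(\<integral>x. cos (\<theta> + (\<Sum>i<n. s i * X i x) + t * X n x) \<partial>M) = (\<integral>x. cos (\<theta> + (\<Sum>i<n. s i * X i x) + t * X n x) \<partial>N)"
    for \<theta> s t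
  proof -
    have "\<theta> + (\<Sum>i<Suc n. (if i = n then t else s i) * X i x) = \<theta> + (\<Sum>i<n. s i * X i x) + t * X n x" for x
      by simp
    with Suc.prems(6)[of \<theta> "\<lambda>i. if i = n then t else s i"] show ?thesis by (simp add: add.assoc)
  qed
  define Y where "Y \<theta> s x = cos (\<theta> + (\<Sum>i<n. s i * X i x))" for \<theta> s x
  have Y[measurable]: "Y \<theta> s \<in> borel_measurable M" "Y \<theta> s \<in> borel_measurable N" for \<theta> s
    unfolding Y_def by measurable
  have Yb: "\<bar>Y \<theta> s x\<bar> \<le> 1" for \<theta> s x unfolding Y_def by simp
  \<comment> \<open>The weight \<open>2 + Y\<close> lies between 1 and 3, so \<open>D K\<close>, the
    law of the last coordinate under the weighted measure, is a finite measure and the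
    one-dimensional result applies.\<close>
  have W: "(\<integral>x. indicator (B n) (X n x) * (2 + Y \<theta> s x) \<partial>M) = (\<integral>x. indicator (B n) (X n x) * (2 + Y \<theta> s x) \<partial>N)" for \<theta> s
  proof -
    define D where "D K = distr (density K (\<lambda>x. ennreal (2 + Y \<theta> s x))) borel (X n)" for K
    have pos: "0 \<le> 2 + Y \<theta> s x" for x using Yb[of \<theta> s x] by (simp add: abs_le_iff)
    have DI: "(\<integral>x. f x \<partial>D K) = (\<integral>x. (2 + Y \<theta> s x) * f (X n x) \<partial>K)"
      if "\<And>i. X i \<in> borel_measurable K" "f \<in> borel_measurable borel" for K and f :: "real \<Rightarrow> real"
    proof -
      note that[measurable]
      have [measurable]: "Y \<theta> s \<in> borel_measurable K" unfolding Y_def by measurable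
      show ?thesis unfolding D_def using pos by (simp add: integral_distr integral_density)
    qed
    have fD: "finite_measure (D K)" if "finite_measure K" "\<And>i. X i \<in> borel_measurable K" for K
    proof
      interpret K: finite_measure K by fact
      note that(2)[measurable]
      have [measurable]: "Y \<theta> s \<in> borel_measurable K" unfolding Y_def by measurable
      have "emeasure (D K) (space (D K)) = (\<integral>\<^sup>+x. ennreal (2 + Y \<theta> s x) \<partial>K)"
        unfolding D_def by (auto simp: emeasure_distr emeasure_density cong: nn_integral_cong)
      also have "\<dots> \<le> (\<integral>\<^sup>+x. ennreal 3 \<partial>K)"
        using Yb[of \<theta> s] by (intro nn_integral_mono ennreal_leI) (simp add: abs_le_iff)
      also have "\<dots> < \<infinity>" by (simp add: K.emeasure_eq_measure ennreal_mult_less_top)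
      finally show "emeasure (D K) (space (D K)) \<noteq> \<infinity>" by simp
    qed
    \<comment> \<open>A product of two cosines is half the sum of the cosines of the sum and the
      difference, so every term is an integral on which \<open>M\<close> and \<open>N\<close> agree
      by \<open>E\<close>.\<close>
    have expand: "(\<integral>x. cos (\<phi> + t * x) \<partial>D K) = 2 * (\<integral>x. cos (\<phi> + (\<Sum>i<n. 0 * X i x) + t * X n x) \<partial>K)
        + ((\<integral>x. cos ((\<theta> + \<phi>) + (\<Sum>i<n. s i * X i x) + t * X n x) \<partial>K)
        + (\<integral>x. cos ((\<theta> - \<phi>) + (\<Sum>i<n. s i * X i x) + (- t) * X n x) \<partial>K)) / 2"
      if K: "finite_measure K" "\<And>i. X i \<in> borel_measurable K" for \<phi> t K
    proof -
      have "(\<integral>x. cos (\<phi> + t * x) \<partial>D K) = (\<integral>x. (2 + Y \<theta> s x) * cos (\<phi> + t * X n x) \<partial>K)"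
        by (rule DI) (use K in auto)
      also have "\<dots> = (\<integral>x. 2 * cos (\<phi> + (\<Sum>i<n. 0 * X i x) + t * X n x)
          + (cos ((\<theta> + \<phi>) + (\<Sum>i<n. s i * X i x) + t * X n x) + cos ((\<theta> - \<phi>) + (\<Sum>i<n. s i * X i x) + (- t) * X n x)) / 2 \<partial>K)"
      proof (rule Bochner_Integration.integral_cong[OF refl])
        fix x
        have "cos a * cos b = (cos (a + b) + cos (a - b)) / 2" for a b :: real
          by (simp add: cos_add cos_diff)
        from this[of "\<theta> + (\<Sum>i<n. s i * X i x)" "\<phi> + t * X n x"]
        show "(2 + Y \<theta> s x) * cos (\<phi> + t * X n x) = 2 * cos (\<phi> + (\<Sum>i<n. 0 * X i x) + t * X n x)
          + (cos ((\<theta> + \<phi>) + (\<Sum>i<n. s i * X i x) + t * X n x) + cos ((\<theta> - \<phi>) + (\<Sum>i<n. s i * X i x) + (- t) * X n x)) / 2"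
          unfolding Y_def by (simp add: algebra_simps)
      qed
      also have "\<dots> = 2 * (\<integral>x. cos (\<phi> + (\<Sum>i<n. 0 * X i x) + t * X n x) \<partial>K)
        + ((\<integral>x. cos ((\<theta> + \<phi>) + (\<Sum>i<n. s i * X i x) + t * X n x) \<partial>K)
        + (\<integral>x. cos ((\<theta> - \<phi>) + (\<Sum>i<n. s i * X i x) + (- t) * X n x) \<partial>K)) / 2"
      proof -
        have "(\<integral>x. 2 * f x + (u x + v x) / 2 \<partial>K) = 2 * (\<integral>x. f x \<partial>K) + ((\<integral>x. u x \<partial>K) + (\<integral>x. v x \<partial>K)) / 2"
          if "integrable K f" "integrable K u" "integrable K v" for f u v :: "'a \<Rightarrow> real"
          using that by simp
        then show ?thesis by this (rule cosi[OF K])+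
      qed
      finally show ?thesis .
    qed
    have "D M = D N"
    proof (rule finite_measure_eqI_cos)
      show "(\<integral>x. cos (\<phi> + t * x) \<partial>D M) = (\<integral>x. cos (\<phi> + t * x) \<partial>D N)" for \<phi> t
        unfolding expand[OF Suc.prems(1) X] expand[OF Suc.prems(2) XN]
        by (simp only: E[of \<phi> "\<lambda>i. 0"] E[of _ s])
    qed (use fD[OF Suc.prems(1) X] fD[OF Suc.prems(2) XN] in \<open>auto simp: D_def\<close>)
    moreover have "(\<integral>x. indicator (B n) x \<partial>D K) = (\<integral>x. (2 + Y \<theta> s x) * indicator (B n) (X n x) \<partial>K)"
      if "\<And>i. X i \<in> borel_measurable K" for K
      by (rule DI) (use that in auto)
    ultimately have "(\<integral>x. (2 + Y \<theta> s x) * indicator (B n) (X n x) \<partial>M) = (\<integral>x. (2 + Y \<theta> s x) * indicator (B n) (X n x) \<partial>N)"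
      using X XN by metis
    then show ?thesis by (simp only: mult.commute)
  qed
  have iW: "finite_measure K \<Longrightarrow> (\<And>i. X i \<in> borel_measurable K) \<Longrightarrow>
      integrable K (\<lambda>x. indicator (B n) (X n x) * (2 + Y \<theta> s x))" for K \<theta> s
  proof (rule finite_measure.integrable_const_bound[of _ _ 3])
    assume K: "\<And>i. X i \<in> borel_measurable K"
    note K[measurable]
    show "(\<lambda>x. indicator (B n) (X n x) * (2 + Y \<theta> s x)) \<in> borel_measurable K" unfolding Y_def by measurable
    have "\<bar>2 + Y \<theta> s x\<bar> \<le> 3" for x using Yb[of \<theta> s x] by linarith
    then show "AE x in K. norm (indicator (B n) (X n x) * (2 + Y \<theta> s x)) \<le> 3"
      by (auto simp: indicator_def)
  qed
  \<comment> \<open>Shifting the phase by \<open>pi\<close> changes the sign of \<open>Y\<close>;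
    half the difference of the two weighted integrals removes the constant 2.\<close>
  have V: "(\<integral>x. indicator (B n) (X n x) * Y \<theta> s x \<partial>K)
      = ((\<integral>x. indicator (B n) (X n x) * (2 + Y \<theta> s x) \<partial>K) - (\<integral>x. indicator (B n) (X n x) * (2 + Y (\<theta> + pi) s x) \<partial>K)) / 2"
    if K: "finite_measure K" "\<And>i. X i \<in> borel_measurable K" for K \<theta> s
  proof -
    have "cos (\<theta> + pi + r) = - cos (\<theta> + r)" for r
      by (simp add: cos_add sin_add)
    then have "indicator (B n) (X n x) * Y \<theta> s x =
       (indicator (B n) (X n x) * (2 + Y \<theta> s x) - indicator (B n) (X n x) * (2 + Y (\<theta> + pi) s x)) / 2" for x
      unfolding Y_def by (simp add: field_simps)
    then have "(\<integral>x. indicator (B n) (X n x) * Y \<theta> s x \<partial>K) = (\<integral>x. (indicator (B n) (X n x) * (2 + Y \<theta> s x)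
        - indicator (B n) (X n x) * (2 + Y (\<theta> + pi) s x)) / 2 \<partial>K)" by (rule Bochner_Integration.integral_cong[OF refl])
    also have "\<dots> = ((\<integral>x. indicator (B n) (X n x) * (2 + Y \<theta> s x) \<partial>K)
        - (\<integral>x. indicator (B n) (X n x) * (2 + Y (\<theta> + pi) s x) \<partial>K)) / 2"
    proof -
      have "(\<integral>x. (u x - v x) / 2 \<partial>K) = ((\<integral>x. u x \<partial>K) - (\<integral>x. v x \<partial>K)) / 2"
        if "integrable K u" "integrable K v" for u v :: "'a \<Rightarrow> real"
        using that by simp
      then show ?thesis by this (rule iW[OF K])+
    qed
    finally show ?thesis .
  qed
  define M' where "M' = density M (\<lambda>x. indicator (B n) (X n x))"
  define N' where "N' = density N (\<lambda>x. indicator (B n) (X n x))"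
  have I: "(\<integral>x. f x \<partial>density K (\<lambda>x. indicator (B n) (X n x))) = (\<integral>x. indicator (B n) (X n x) * f x \<partial>K)"
    if [measurable]: "f \<in> borel_measurable K" "\<And>i. X i \<in> borel_measurable K" for K and f :: "'a \<Rightarrow> real"
    using integral_density[of f K "\<lambda>x. indicator (B n) (X n x)"] by (simp add: ennreal_indicator)
  have fin: "finite_measure (density K (\<lambda>x. indicator (B n) (X n x)))"
    if "finite_measure K" "\<And>i. X i \<in> borel_measurable K" for K
  proof
    interpret K: finite_measure K by fact
    note that(2)[measurable]
    have "emeasure (density K (\<lambda>x. indicator (B n) (X n x))) (space K)
        = (\<integral>\<^sup>+x. indicator (B n) (X n x) * indicator (space K) x \<partial>K)"
      by (rule emeasure_density) auto
    also have "\<dots> \<le> (\<integral>\<^sup>+x. 1 \<partial>K)"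
      by (rule nn_integral_mono) (auto simp: indicator_def)
    also have "\<dots> < \<infinity>" by (simp add: K.emeasure_eq_measure)
    finally show "emeasure (density K (\<lambda>x. indicator (B n) (X n x))) (space (density K (\<lambda>x. indicator (B n) (X n x)))) \<noteq> \<infinity>" by simp
  qed
  \<comment> \<open>The induction hypothesis is used for both measures restricted to the event
    \<open>X n x \<in> B n\<close>.\<close>
  have IH: "emeasure M' {x\<in>space M'. \<forall>i<n. X i x \<in> B i} = emeasure N' {x\<in>space M'. \<forall>i<n. X i x \<in> B i}"
  proof (rule Suc.IH)
    fix \<theta> s
    have "(\<integral>x. indicator (B n) (X n x) * Y \<theta> s x \<partial>M) = (\<integral>x. indicator (B n) (X n x) * Y \<theta> s x \<partial>N)"
      unfolding V[OF Suc.prems(1) X] V[OF Suc.prems(2) XN] W ..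
    then show "(\<integral>x. cos (\<theta> + (\<Sum>i<n. s i * X i x)) \<partial>M') = (\<integral>x. cos (\<theta> + (\<Sum>i<n. s i * X i x)) \<partial>N')"
      using I[OF Y(1) X, of \<theta> s] I[OF Y(2) XN, of \<theta> s] unfolding M'_def N'_def Y_def by simp
  qed (use fin[OF Suc.prems(1) X] fin[OF Suc.prems(2) XN] in \<open>auto simp: M'_def N'_def\<close>)
  have set: "emeasure (density K (\<lambda>x. indicator (B n) (X n x))) {x\<in>space M. \<forall>i<n. X i x \<in> B i} = emeasure K {x\<in>space M. \<forall>i<Suc n. X i x \<in> B i}"
    if K: "sets K = sets M" "\<And>i. X i \<in> borel_measurable K" for K
  proof -
    note K(2)[measurable] K(1)[measurable_cong]
    have "emeasure (density K (\<lambda>x. indicator (B n) (X n x))) {x\<in>space M. \<forall>i<n. X i x \<in> B i}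
        = (\<integral>\<^sup>+x. indicator (B n) (X n x) * indicator {x\<in>space M. \<forall>i<n. X i x \<in> B i} x \<partial>K)"
      by (rule emeasure_density) auto
    also have "\<dots> = (\<integral>\<^sup>+x. indicator {x\<in>space M. \<forall>i<Suc n. X i x \<in> B i} x \<partial>K)"
      by (intro nn_integral_cong) (auto simp: indicator_def less_Suc_eq)
    also have "\<dots> = emeasure K {x\<in>space M. \<forall>i<Suc n. X i x \<in> B i}"
      by (rule nn_integral_indicator) measurable
    finally show ?thesis .
  qed
  show ?case using IH set[OF refl X] set[OF sets_eq[symmetric] XN] by (simp add: M'_def N'_def)
qed

context L2_basis
begin

text \<open>Cylinder sets over the coordinates are stable under intersection, generate the Borel
  sets, and have equal mass by the finite-dimensional result.\<close>

lemma finite_measure_L2_eqI: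
  fixes G1 G2 :: "('a \<Rightarrow> 'b) measure"
  assumes fin: "finite_measure G1" "finite_measure G2"
    and sets1: "sets G1 = sets (L2_borel M)" "sets G2 = sets (L2_borel M)"
    and eq: "\<And>\<theta> h. h \<in> L2_space M \<Longrightarrow> (\<integral>f. cos (\<theta> + L2_inner M f h) \<partial>G1) = (\<integral>f. cos (\<theta> + L2_inner M f h) \<partial>G2)"
  shows "G1 = G2"
proof -
  interpret G1: finite_measure G1 by fact
  have sp: "space G1 = L2_space M" "space G2 = L2_space M"
    using sets1 by (auto dest: sets_eq_imp_space_eq)
  note sets1[measurable_cong]
  note measurable_L2_inner(1)[measurable]
  define C where "C n B = {f \<in> L2_space M. \<forall>i<n. coord i f \<in> B i}" for n :: nat and B :: "nat \<Rightarrow> real set"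
  define E where "E = {C n B |n B. \<forall>i. B i \<in> sets borel}"
  have Eeq: "emeasure G1 A = emeasure G2 A" if "A \<in> E" for A
  proof -
    obtain n B where A: "A = C n B" "\<And>i. B i \<in> sets borel" using \<open>A \<in> E\<close> by (auto simp: E_def)
    have "emeasure G1 {f\<in>space G1. \<forall>i<n. coord i f \<in> B i} = emeasure G2 {f\<in>space G1. \<forall>i<n. coord i f \<in> B i}"
    proof (rule joint_law_eqI_cos)
      fix \<theta> and s :: "nat \<Rightarrow> real"
      define h where "h = (\<lambda>x. \<Sum>i<n. s i *\<^sub>R g i x)"
      have h: "h \<in> L2_space M" unfolding h_def by (intro L2_sum L2_scaleR g_L2)
      have "L2_inner M f h = (\<Sum>i<n. s i * coord i f)" if "f \<in> L2_space M" for f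
        using that by (subst L2_inner_commute, unfold h_def, subst L2_inner_sum_left)
          (auto simp: L2_scaleR L2_inner_scaleR_left L2_inner_commute[of M _ f])
      then have "(\<integral>f. cos (\<theta> + (\<Sum>i<n. s i * coord i f)) \<partial>G1) = (\<integral>f. cos (\<theta> + L2_inner M f h) \<partial>G1)"
        "(\<integral>f. cos (\<theta> + (\<Sum>i<n. s i * coord i f)) \<partial>G2) = (\<integral>f. cos (\<theta> + L2_inner M f h) \<partial>G2)"
        by (auto intro!: Bochner_Integration.integral_cong simp: sp)
      then show "(\<integral>f. cos (\<theta> + (\<Sum>i<n. s i * coord i f)) \<partial>G1) = (\<integral>f. cos (\<theta> + (\<Sum>i<n. s i * coord i f)) \<partial>G2)"
        using eq[OF h] by simp
    qed (use fin sets1 A(2) in \<open>auto intro: measurable_L2_inner(1)\<close>)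
    then show ?thesis by (simp add: A C_def sp)
  qed
  have EI: "C n B \<in> E" if "\<And>i. B i \<in> sets borel" for n B
    unfolding E_def using that by blast
  have EP: "E \<subseteq> Pow (L2_space M)" by (auto simp: E_def C_def)
  have "C n B \<in> sets (L2_borel M)" if "\<And>i. B i \<in> sets borel" for n B
  proof -
    note that[measurable]
    have "{f \<in> space (L2_borel M). \<forall>i<n. coord i f \<in> B i} \<in> sets (L2_borel M)"
      by measurable
    then show ?thesis unfolding C_def space_L2_borel .
  qed
  then have "sigma_sets (L2_space M) E \<subseteq> sets (L2_borel M)"
    using sets.sigma_sets_subset[of E "L2_borel M"] by (auto simp: E_def)
  moreover have "sets (L2_borel M) \<subseteq> sigma_sets (L2_space M) E"
  proof -
    define N where "N = sigma (L2_space M) E"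
    have N: "space N = L2_space M" "sets N = sigma_sets (L2_space M) E"
      using EP by (auto simp: N_def)
    \<comment> \<open>Measurability of the identity says that every Borel set lies in the
      sigma-algebra of the cylinders; separability enters through
      \<open>measurable_into_L2_borel\<close>.\<close>
    have "(\<lambda>f. f) \<in> measurable N (L2_borel M)"
    proof (rule measurable_into_L2_borel)
      fix i
      show "coord i \<in> borel_measurable N"
      proof (rule measurableI)
        fix S :: "real set" assume S: "S \<in> sets borel"
        have "coord i -` S \<inter> space N = C (Suc i) (\<lambda>j. if j = i then S else UNIV)"
          by (auto simp: C_def N)
        also have "\<dots> \<in> E" by (rule EI) (use S in simp)
        finally show "coord i -` S \<inter> space N \<in> sets N" by (simp add: N sigma_sets.Basic)
      qed simp
    qed (simp add: N)
    then have "A \<in> sets N" if "A \<in> sets (L2_borel M)" for A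
      using measurable_sets[OF _ that, of "\<lambda>f. f" N] sets.sets_into_space[OF that] by (simp add: N Int_absorb2)
    then show ?thesis by (auto simp: N)
  qed
  ultimately have gen: "sets (L2_borel M) = sigma_sets (L2_space M) E" by (rule subset_antisym[rotated])
  have IS: "Int_stable E"
  proof (rule Int_stableI)
    fix a b assume "a \<in> E" "b \<in> E"
    then obtain n B m D where ab: "a = C n B" "b = C m D" "\<And>i. B i \<in> sets borel" "\<And>i. D i \<in> sets borel"
      by (auto simp: E_def)
    \<comment> \<open>The shorter cylinder is padded with \<open>UNIV\<close> to the common
      length.\<close>
    have "a \<inter> b = C (max n m) (\<lambda>i. (if i < n then B i else UNIV) \<inter> (if i < m then D i else UNIV))"
    proof -
      have "(\<forall>i<n. x i \<in> B i) \<and> (\<forall>i<m. x i \<in> D i) \<longleftrightarrow>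
          (\<forall>i<max n m. x i \<in> (if i < n then B i else UNIV) \<inter> (if i < m then D i else UNIV))" for x :: "nat \<Rightarrow> real"
      proof (intro iffI conjI allI impI)
        assume H: "\<forall>i<max n m. x i \<in> (if i < n then B i else UNIV) \<inter> (if i < m then D i else UNIV)"
        show "x i \<in> B i" if "i < n" for i using H[rule_format, of i] that by simp
        show "x i \<in> D i" if "i < m" for i using H[rule_format, of i] that by simp
      qed auto
      note Z = this
      have "f \<in> a \<inter> b \<longleftrightarrow> f \<in> C (max n m) (\<lambda>i. (if i < n then B i else UNIV) \<inter> (if i < m then D i else UNIV))" for f
        unfolding ab(1,2) C_def Int_iff[of f] mem_Collect_eq Z[of "\<lambda>i. coord i f", symmetric]
        by (rule iffI; elim conjE; intro conjI; assumption)
      then show ?thesis by (rule set_eqI)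
    qed
    also have "\<dots> \<in> E" by (rule EI) (use ab(3,4) in simp)
    finally show "a \<inter> b \<in> E" .
  qed
  have top: "L2_space M \<in> E"
  proof -
    have "L2_space M = C 0 (\<lambda>i. UNIV)" by (simp add: C_def)
    also have "\<dots> \<in> E" by (rule EI) simp
    finally show ?thesis .
  qed
  show ?thesis
    by (rule measure_eqI_generator_eq[OF IS EP Eeq, where A="\<lambda>i. L2_space M"])
      (use top sets1 gen G1.emeasure_finite in auto)
qed

end

section \<open>Gaussian integration by parts\<close>

text \<open>The normal density \<open>n\<close> satisfies
  \<open>n' = - t / \<sigma>\<^sup>2 * n\<close>, so the function \<open>f\<close> below is the
  derivative of \<open>\<psi> * n\<close>. Linear growth of \<open>\<psi>\<close> makes the boundary
  terms at both infinities vanish.\<close>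

lemma Stein_identity:
  fixes \<psi> \<psi>' :: "real \<Rightarrow> real"
  assumes \<sigma>: "\<sigma> > 0"
    and deriv: "\<And>t. (\<psi> has_real_derivative \<psi>' t) (at t)"
    and cont: "\<And>t. isCont \<psi>' t"
    and b1: "\<And>t. \<bar>\<psi> t\<bar> \<le> a + b * \<bar>t\<bar>" and b2: "\<And>t. \<bar>\<psi>' t\<bar> \<le> a + b * \<bar>t\<bar>"
  shows "(\<integral>t. normal_density 0 \<sigma> t * (\<psi> t * t) \<partial>lborel) = \<sigma>\<^sup>2 * (\<integral>t. normal_density 0 \<sigma> t * \<psi>' t \<partial>lborel)"
proof -
  let ?n = "normal_density 0 \<sigma>"
  have [measurable]: "\<psi>' \<in> borel_measurable borel"
    by (rule borel_measurable_continuous_onI) (simp add: cont continuous_at_imp_continuous_on)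
  have [measurable]: "\<psi> \<in> borel_measurable borel"
    by (rule borel_measurable_continuous_onI) (meson DERIV_isCont deriv continuous_at_imp_continuous_on)
  have mom: "integrable lborel (\<lambda>t. ?n t * \<bar>t\<bar> ^ k)" for k
    using integrable_normal_moment_abs[OF \<sigma>, of 0 k] by simp
  have i1: "integrable lborel (\<lambda>t. ?n t * \<psi>' t)"
  proof (rule Bochner_Integration.integrable_bound)
    show "integrable lborel (\<lambda>t. a * (?n t * \<bar>t\<bar> ^ 0) + b * (?n t * \<bar>t\<bar> ^ 1))"
      by (intro Bochner_Integration.integrable_add integrable_mult_right mom)
    have "norm (?n t * \<psi>' t) \<le> norm (a * (?n t * \<bar>t\<bar> ^ 0) + b * (?n t * \<bar>t\<bar> ^ 1))" for t
    proof -
      have "\<bar>?n t * \<psi>' t\<bar> \<le> ?n t * (a + b * \<bar>t\<bar>)" using b2[of t] by (simp add: abs_mult mult_left_mono)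
      then show ?thesis by (simp add: algebra_simps)
    qed
    then show "AE t in lborel. norm (?n t * \<psi>' t) \<le> norm (a * (?n t * \<bar>t\<bar> ^ 0) + b * (?n t * \<bar>t\<bar> ^ 1))" by simp
  qed simp
  have i2: "integrable lborel (\<lambda>t. ?n t * (\<psi> t * t))"
  proof (rule Bochner_Integration.integrable_bound)
    show "integrable lborel (\<lambda>t. a * (?n t * \<bar>t\<bar> ^ 1) + b * (?n t * \<bar>t\<bar> ^ 2))"
      by (intro Bochner_Integration.integrable_add integrable_mult_right mom)
    have "norm (?n t * (\<psi> t * t)) \<le> norm (a * (?n t * \<bar>t\<bar> ^ 1) + b * (?n t * \<bar>t\<bar> ^ 2))" for t
    proof -
      have "\<bar>?n t * (\<psi> t * t)\<bar> = ?n t * \<bar>t\<bar> * \<bar>\<psi> t\<bar>" by (simp add: abs_mult)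
      also have "\<dots> \<le> ?n t * \<bar>t\<bar> * (a + b * \<bar>t\<bar>)" using b1[of t] by (intro mult_left_mono) auto
      also have "\<dots> = a * (?n t * \<bar>t\<bar> ^ 1) + b * (?n t * \<bar>t\<bar> ^ 2)" by (simp add: algebra_simps power2_eq_square)
      finally show ?thesis by simp
    qed
    then show "AE t in lborel. norm (?n t * (\<psi> t * t)) \<le> norm (a * (?n t * \<bar>t\<bar> ^ 1) + b * (?n t * \<bar>t\<bar> ^ 2))" by simp
  qed simp
  have nd: "(?n has_real_derivative - t / \<sigma>\<^sup>2 * ?n t) (at t)" for t
    unfolding normal_density_def
    using \<sigma> by (auto intro!: derivative_eq_intros simp: field_simps power2_eq_square)
  have lim0: "((\<lambda>t. (a + b * \<bar>t\<bar>) * ?n t) \<longlongrightarrow> 0) F" if F: "F = at_top \<or> F = at_bot" for F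
  proof -
    define c where "c = 1 / (2 * \<sigma>\<^sup>2)"
    have c: "c > 0" using \<sigma> by (simp add: c_def)
    have "((\<lambda>t. (a + b * \<bar>t\<bar>) * exp (- c * t\<^sup>2)) \<longlongrightarrow> 0) at_top" using c by real_asymp
    moreover have "((\<lambda>t. (a + b * \<bar>t\<bar>) * exp (- c * t\<^sup>2)) \<longlongrightarrow> 0) at_bot" using c by real_asymp
    ultimately have "((\<lambda>t. (a + b * \<bar>t\<bar>) * exp (- c * t\<^sup>2)) \<longlongrightarrow> 0) F" using F by auto
    from tendsto_mult_left[OF this, of "1 / sqrt (2 * pi * \<sigma>\<^sup>2)"]
    show ?thesis unfolding normal_density_def c_def by (simp add: field_simps)
  qed
  have lim: "((\<lambda>t. \<psi> t * ?n t) \<longlongrightarrow> 0) F" if F: "F = at_top \<or> F = at_bot" for F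
  proof (rule Lim_null_comparison[OF _ lim0[OF F]])
    show "\<forall>\<^sub>F t in F. norm (\<psi> t * ?n t) \<le> (a + b * \<bar>t\<bar>) * ?n t"
      using b1 by (intro always_eventually allI) (simp add: abs_mult mult_right_mono)
  qed
  define f where "f t = ?n t * \<psi>' t - (1 / \<sigma>\<^sup>2) * (?n t * (\<psi> t * t))" for t
  have fi: "integrable lborel f" unfolding f_def by (intro Bochner_Integration.integrable_diff integrable_mult_right i1 i2)
  have "(LBINT t=-\<infinity>..\<infinity>. f t) = 0 - 0"
  proof (rule interval_integral_FTC_integrable[where F="\<lambda>t. \<psi> t * ?n t"])
    fix t
    show "((\<lambda>t. \<psi> t * ?n t) has_vector_derivative f t) (at t)"
      unfolding has_real_derivative_iff_has_vector_derivative[symmetric] f_def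
      by (rule DERIV_cong[OF DERIV_mult[OF deriv nd]]) (simp add: field_simps)
    show "isCont f t" unfolding f_def
      by (intro continuous_intros cont DERIV_isCont[OF nd] DERIV_isCont[OF deriv])
  qed (use fi lim in \<open>auto simp: ereal_tendsto_simps set_integrable_def\<close>)
  then have "(\<integral>t. f t \<partial>lborel) = 0"
    by (simp add: interval_lebesgue_integral_def set_lebesgue_integral_def)
  then have "(\<integral>t. ?n t * \<psi>' t \<partial>lborel) = (1 / \<sigma>\<^sup>2) * (\<integral>t. ?n t * (\<psi> t * t) \<partial>lborel)"
    unfolding f_def using i1 i2 by simp
  then show ?thesis using \<sigma> by simp
qed

text \<open>The characteristic function of the standard normal law, rescaled by
  \<open>\<sigma>\<close>; the sine part vanishes because that characteristic function is
  real.\<close>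

lemma integral_cos_normal:
  assumes \<sigma>: "\<sigma> > 0"
  shows "(\<integral>x. normal_density 0 \<sigma> x * cos (\<theta> + x) \<partial>lborel) = cos \<theta> * exp (- \<sigma>\<^sup>2 / 2)"
proof -
  interpret S: real_distribution std_normal_distribution
    by (rule real_dist_normal_dist)
  have ii: "integrable std_normal_distribution (\<lambda>x. iexp (\<sigma> * x))"
    by (rule S.integrable_iexp) auto
  have ch: "(CLINT x|std_normal_distribution. iexp (\<sigma> * x)) = complex_of_real (exp (- \<sigma>\<^sup>2 / 2))"
    using fun_cong[OF char_std_normal_distribution, of \<sigma>] by (simp add: char_def)
  have c: "(\<integral>x. cos (\<sigma> * x) \<partial>std_normal_distribution) = exp (- \<sigma>\<^sup>2 / 2)"
    using integral_Re[OF ii] ch by (simp add: Re_exp)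
  have s: "(\<integral>x. sin (\<sigma> * x) \<partial>std_normal_distribution) = 0"
    using integral_Im[OF ii] ch by (simp add: Im_exp)
  have ic: "integrable std_normal_distribution (\<lambda>x. cos (\<sigma> * x))" "integrable std_normal_distribution (\<lambda>x. sin (\<sigma> * x))"
    by (rule S.integrable_const_bound[of _ 1]; simp)+
  have "(\<integral>x. cos (\<theta> + \<sigma> * x) \<partial>std_normal_distribution) = cos \<theta> * exp (- \<sigma>\<^sup>2 / 2)"
    using ic c s by (simp add: cos_add)
  then have std: "(\<integral>x. std_normal_density x * cos (\<theta> + \<sigma> * x) \<partial>lborel) = cos \<theta> * exp (- \<sigma>\<^sup>2 / 2)"
    by (subst (asm) integral_density) auto
  have "(\<integral>x. normal_density 0 \<sigma> x * cos (\<theta> + x) \<partial>lborel)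
      = \<bar>\<sigma>\<bar> *\<^sub>R (\<integral>x. normal_density 0 \<sigma> (0 + \<sigma> * x) * cos (\<theta> + (0 + \<sigma> * x)) \<partial>lborel)"
    by (rule lborel_integral_real_affine) (use \<sigma> in simp)
  also have "\<dots> = \<bar>\<sigma>\<bar> *\<^sub>R (\<integral>x. std_normal_density x / \<sigma> * cos (\<theta> + (0 + \<sigma> * x)) \<partial>lborel)"
  proof -
    have "normal_density 0 \<sigma> (0 + \<sigma> * x) = std_normal_density x / \<sigma>" for x
      using \<sigma> by (simp add: normal_density_def power_mult_distrib real_sqrt_mult)
    then show ?thesis by simp
  qed
  also have "\<dots> = (\<integral>x. std_normal_density x * cos (\<theta> + \<sigma> * x) \<partial>lborel)"
    using \<sigma> by simp
  finally show ?thesis using std by simp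
qed

text \<open>\<open>S\<close> is described by its coordinates because it acts on representatives and
  is determined only up to null sets, which coordinates do not see. In the basis \<open>g\<close> it
  is diagonal with positive summable eigenvalues.\<close>

locale L2_gaussian = L2_basis M g for M :: "'a measure" and g :: "nat \<Rightarrow> 'a \<Rightarrow> 'b::euclidean_space" +
  fixes \<alpha> :: "nat \<Rightarrow> real" and S :: "('a \<Rightarrow> 'b) \<Rightarrow> 'a \<Rightarrow> 'b" and G :: "('a \<Rightarrow> 'b) measure"
  assumes \<alpha>_pos: "\<And>n. \<alpha> n > 0" and \<alpha>_summable: "summable \<alpha>"
    and S_L2: "\<And>f. f \<in> L2_space M \<Longrightarrow> S f \<in> L2_space M"
    and S_coord: "\<And>f n. f \<in> L2_space M \<Longrightarrow> coord n (S f) = \<alpha> n * coord n f"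
    and gauss: "centered_gaussian M S G"
begin

sublocale G: prob_space G
  using gauss by (simp add: centered_gaussian_def)

lemma sets_G: "sets G = sets (L2_borel M)"
  using gauss by (simp add: centered_gaussian_def)

lemma space_G [simp]: "space G = L2_space M"
  using sets_eq_imp_space_eq[OF sets_G] by simp

lemma measurable_G [measurable]:
  "L2_norm M \<in> borel_measurable G"
  "h \<in> L2_space M \<Longrightarrow> (\<lambda>f. L2_inner M f h) \<in> borel_measurable G"
  "h \<in> L2_space M \<Longrightarrow> (\<lambda>f. L2_inner M h f) \<in> borel_measurable G"
  using measurable_L2_norm measurable_L2_inner measurable_cong_sets[OF sets_G refl] by blast+

lemma S_inner:
  assumes "f \<in> L2_space M" "h \<in> L2_space M"
  shows "(\<lambda>n. \<alpha> n * coord n f * coord n h) sums L2_inner M f (S h)"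
  using Parseval_inner[OF assms(1) S_L2[OF assms(2)]] by (simp add: S_coord assms mult_ac)

text \<open>The covariance identity with both arguments equal to \<open>h\<close> computes the
  second moment of the law and thereby fixes \<open>\<sigma>\<^sup>2\<close>.\<close>

lemma law:
  assumes h: "h \<in> L2_space M"
  obtains \<sigma> where "\<sigma> \<ge> 0" "\<sigma>\<^sup>2 = L2_inner M h (S h)"
    "distr G borel (\<lambda>f. L2_inner M f h) =
       (if \<sigma> = 0 then return borel 0 else density lborel (\<lambda>t. ennreal (normal_density 0 \<sigma> t)))"
proof -
  obtain \<sigma> where \<sigma>: "\<sigma> \<ge> 0" and d: "distr G borel (\<lambda>f. L2_inner M f h) =
       (if \<sigma> = 0 then return borel 0 else density lborel (\<lambda>t. ennreal (normal_density 0 \<sigma> t)))"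
    using gauss h unfolding centered_gaussian_def L2_inner_commute[of M _ h] by blast
  have [measurable]: "(\<lambda>f. L2_inner M f h) \<in> borel_measurable G" using h by measurable
  have "(\<integral>f. L2_inner M h f * L2_inner M h f \<partial>G) = L2_inner M h (S h)"
    using gauss h unfolding centered_gaussian_def by blast
  then have "L2_inner M h (S h) = (\<integral>f. (L2_inner M f h)\<^sup>2 \<partial>G)"
    by (simp add: power2_eq_square L2_inner_commute[of M h])
  also have "\<dots> = (\<integral>t. t\<^sup>2 \<partial>distr G borel (\<lambda>f. L2_inner M f h))"
    by (simp add: integral_distr)
  also have "\<dots> = \<sigma>\<^sup>2"
  proof (cases "\<sigma> = 0")
    case True
    then show ?thesis using d by (simp add: integral_return)
  next
    case False
    then have pos: "\<sigma> > 0" using \<sigma> by simp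
    have "(\<integral>t. t\<^sup>2 \<partial>distr G borel (\<lambda>f. L2_inner M f h)) = (\<integral>t. normal_density 0 \<sigma> t * t\<^sup>2 \<partial>lborel)"
      using False d by (simp add: integral_density)
    also have "\<dots> = \<sigma>\<^sup>2" using integral_normal_moment_even[OF pos, of 0 1] by simp
    finally show ?thesis .
  qed
  finally show ?thesis using that \<sigma> d by simp
qed

lemma integral_cos:
  assumes h: "h \<in> L2_space M"
  shows "(\<integral>f. cos (\<theta> + L2_inner M f h) \<partial>G) = cos \<theta> * exp (- L2_inner M h (S h) / 2)"
proof -
  obtain \<sigma> where \<sigma>: "\<sigma> \<ge> 0" "\<sigma>\<^sup>2 = L2_inner M h (S h)" and d: "distr G borel (\<lambda>f. L2_inner M f h) =
       (if \<sigma> = 0 then return borel 0 else density lborel (\<lambda>t. ennreal (normal_density 0 \<sigma> t)))"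
    using law[OF h] by blast
  have [measurable]: "(\<lambda>f. L2_inner M f h) \<in> borel_measurable G" using h by measurable
  have "(\<integral>f. cos (\<theta> + L2_inner M f h) \<partial>G) = (\<integral>t. cos (\<theta> + t) \<partial>distr G borel (\<lambda>f. L2_inner M f h))"
    by (simp add: integral_distr)
  also have "\<dots> = cos \<theta> * exp (- \<sigma>\<^sup>2 / 2)"
  proof (cases "\<sigma> = 0")
    case True
    then show ?thesis using d by (simp add: integral_return)
  next
    case False
    then show ?thesis using \<sigma>(1) d by (simp add: integral_density integral_cos_normal)
  qed
  finally show ?thesis using \<sigma>(2) by simp
qed

lemma coord_law: "distr G borel (coord n) = density lborel (\<lambda>t. ennreal (normal_density 0 (sqrt (\<alpha> n)) t))"
proof -
  obtain \<sigma> where \<sigma>: "\<sigma> \<ge> 0" "\<sigma>\<^sup>2 = L2_inner M (g n) (S (g n))" and d: "distr G borel (coord n) =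
       (if \<sigma> = 0 then return borel 0 else density lborel (\<lambda>t. ennreal (normal_density 0 \<sigma> t)))"
    using law[OF g_L2[of n]] by blast
  have "\<sigma>\<^sup>2 = \<alpha> n" using \<sigma>(2) S_coord[OF g_L2[of n], of n]
    by (simp add: L2_inner_commute[of M "g n" "S (g n)"] g_inner)
  then have "\<sigma> = sqrt (\<alpha> n)" "\<sigma> \<noteq> 0" using \<sigma>(1) \<alpha>_pos[of n] by (auto simp: real_sqrt_unique)
  then show ?thesis using d by simp
qed

lemma integral_coord:
  fixes \<psi> :: "real \<Rightarrow> real"
  assumes [measurable]: "\<psi> \<in> borel_measurable borel"
  shows "(\<integral>f. \<psi> (coord n f) \<partial>G) = (\<integral>t. normal_density 0 (sqrt (\<alpha> n)) t * \<psi> t \<partial>lborel)"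
proof -
  have "(\<integral>f. \<psi> (coord n f) \<partial>G) = (\<integral>t. \<psi> t \<partial>distr G borel (coord n))"
    by (simp add: integral_distr)
  also have "\<dots> = (\<integral>t. normal_density 0 (sqrt (\<alpha> n)) t * \<psi> t \<partial>lborel)"
    unfolding coord_law by (subst integral_density) auto
  finally show ?thesis .
qed

lemma nn_integral_coord_power4: "(\<integral>\<^sup>+f. ennreal ((coord n f) ^ 4) \<partial>G) = ennreal (3 * (\<alpha> n)\<^sup>2)"
proof -
  let ?n = "normal_density 0 (sqrt (\<alpha> n))"
  have pos: "sqrt (\<alpha> n) > 0" using \<alpha>_pos by simp
  have "(\<integral>\<^sup>+f. ennreal ((coord n f) ^ 4) \<partial>G) = (\<integral>\<^sup>+t. ennreal (t ^ 4) \<partial>distr G borel (coord n))"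
    by (simp add: nn_integral_distr)
  also have "\<dots> = (\<integral>\<^sup>+t. ennreal (?n t * t ^ 4) \<partial>lborel)"
    unfolding coord_law by (subst nn_integral_density) (auto simp: ennreal_mult')
  also have "\<dots> = ennreal (\<integral>t. ?n t * t ^ 4 \<partial>lborel)"
    using integrable_normal_moment[OF pos, of 0 4] by (intro nn_integral_eq_integral) auto
  also have "(\<integral>t. ?n t * t ^ 4 \<partial>lborel) = 3 * (\<alpha> n)\<^sup>2"
    using integral_normal_moment_even[OF pos, of 0 2] \<alpha>_pos[of n]
    by (simp add: fact_numeral field_simps power2_eq_square power4_eq_xxxx)
  finally show ?thesis .
qed

text \<open>By the Cauchy--Schwarz inequality \<open>(\<Sum> x\<^sub>n\<^sup>2)\<^sup>2 \<le> (\<Sum> \<alpha>\<^sub>n) (\<Sum> x\<^sub>n\<^sup>4 / \<alpha>\<^sub>n)\<close>, so that no mixed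
  moments are needed.\<close>

lemma integrable_norm_power4: "integrable G (\<lambda>f. (L2_norm M f) ^ 4)"
proof (rule integrableI_bounded)
  define A where "A = suminf \<alpha>"
  have A0: "A \<ge> 0" unfolding A_def using \<alpha>_pos by (intro suminf_nonneg \<alpha>_summable) (auto intro: less_imp_le)
  have fin: "(\<Sum>n<N. (coord n f)\<^sup>2)\<^sup>2 \<le> A * (\<Sum>n<N. (coord n f) ^ 4 / \<alpha> n)" for N f
  proof -
    have "(\<Sum>n<N. (coord n f)\<^sup>2) = (\<Sum>n<N. sqrt (\<alpha> n) * ((coord n f)\<^sup>2 / sqrt (\<alpha> n)))"
      using \<alpha>_pos by (intro sum.cong) (auto simp: less_imp_neq[THEN not_sym])
    then have "(\<Sum>n<N. (coord n f)\<^sup>2)\<^sup>2 \<le> (\<Sum>n<N. (sqrt (\<alpha> n))\<^sup>2) * (\<Sum>n<N. ((coord n f)\<^sup>2 / sqrt (\<alpha> n))\<^sup>2)"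
      using Cauchy_Schwarz_ineq_sum[of "\<lambda>n. sqrt (\<alpha> n)" "\<lambda>n. (coord n f)\<^sup>2 / sqrt (\<alpha> n)" "{..<N}"] by simp
    also have "(\<Sum>n<N. ((coord n f)\<^sup>2 / sqrt (\<alpha> n))\<^sup>2) = (\<Sum>n<N. (coord n f) ^ 4 / \<alpha> n)"
      using \<alpha>_pos by (intro sum.cong) (auto simp: power_divide less_imp_le)
    also have "(\<Sum>n<N. (sqrt (\<alpha> n))\<^sup>2) = (\<Sum>n<N. \<alpha> n)"
      using \<alpha>_pos by (intro sum.cong) (auto simp: less_imp_le)
    also have "(\<Sum>n<N. \<alpha> n) * (\<Sum>n<N. (coord n f) ^ 4 / \<alpha> n) \<le> A * (\<Sum>n<N. (coord n f) ^ 4 / \<alpha> n)"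
      unfolding A_def using \<alpha>_pos
      by (intro mult_right_mono sum_le_suminf \<alpha>_summable sum_nonneg) (auto intro: less_imp_le divide_nonneg_pos)
    finally show ?thesis .
  qed
  have bnd: "ennreal ((L2_norm M f) ^ 4) \<le> ennreal A * (\<Sum>n. ennreal ((coord n f) ^ 4 / \<alpha> n))" if f: "f \<in> L2_space M" for f
  proof (rule LIMSEQ_le_const2)
    have "(\<lambda>N. (\<Sum>n<N. (coord n f)\<^sup>2)\<^sup>2) \<longlonglongrightarrow> ((L2_norm M f)\<^sup>2)\<^sup>2"
      using Parseval[OF f] unfolding sums_def by (intro tendsto_intros)
    then show "(\<lambda>N. ennreal ((\<Sum>n<N. (coord n f)\<^sup>2)\<^sup>2)) \<longlonglongrightarrow> ennreal ((L2_norm M f) ^ 4)"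
      by (simp add: power_mult[symmetric])
    have "ennreal ((\<Sum>n<N. (coord n f)\<^sup>2)\<^sup>2) \<le> ennreal A * (\<Sum>n. ennreal ((coord n f) ^ 4 / \<alpha> n))" for N
    proof -
      have "ennreal ((\<Sum>n<N. (coord n f)\<^sup>2)\<^sup>2) \<le> ennreal (A * (\<Sum>n<N. (coord n f) ^ 4 / \<alpha> n))"
        using fin by (rule ennreal_leI)
      also have "\<dots> = ennreal A * (\<Sum>n<N. ennreal ((coord n f) ^ 4 / \<alpha> n))"
        using A0 \<alpha>_pos by (subst ennreal_mult) (auto simp: less_imp_le sum_ennreal intro!: sum_nonneg)
      also have "\<dots> \<le> ennreal A * (\<Sum>n. ennreal ((coord n f) ^ 4 / \<alpha> n))"
        by (intro mult_left_mono sum_le_suminf) auto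
      finally show ?thesis .
    qed
    then show "\<exists>N. \<forall>n\<ge>N. ennreal ((\<Sum>n<n. (coord n f)\<^sup>2)\<^sup>2) \<le> ennreal A * (\<Sum>n. ennreal ((coord n f) ^ 4 / \<alpha> n))"
      by blast
  qed
  have "(\<integral>\<^sup>+f. ennreal (norm ((L2_norm M f) ^ 4)) \<partial>G)
      \<le> (\<integral>\<^sup>+f. ennreal A * (\<Sum>n. ennreal ((coord n f) ^ 4 / \<alpha> n)) \<partial>G)"
    using bnd by (intro nn_integral_mono) simp
  also have "\<dots> = ennreal A * (\<Sum>n. \<integral>\<^sup>+f. ennreal ((coord n f) ^ 4 / \<alpha> n) \<partial>G)"
    by (subst nn_integral_cmult) (auto simp: nn_integral_suminf)
  \<comment> \<open>Dividing the fourth moment \<open>3 * (\<alpha> n)\<^sup>2\<close> by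
    \<open>\<alpha> n\<close> leaves a summable sequence.\<close>
  also have "\<dots> = ennreal A * (\<Sum>n. ennreal (3 * \<alpha> n))"
  proof -
    have "(\<integral>\<^sup>+f. ennreal ((coord n f) ^ 4 / \<alpha> n) \<partial>G) = ennreal (3 * \<alpha> n)" for n
    proof -
      have "(\<integral>\<^sup>+f. ennreal ((coord n f) ^ 4 / \<alpha> n) \<partial>G) = (\<integral>\<^sup>+f. ennreal (1 / \<alpha> n) * ennreal ((coord n f) ^ 4) \<partial>G)"
        using \<alpha>_pos[of n] by (simp add: ennreal_mult'[symmetric])
      also have "\<dots> = ennreal (1 / \<alpha> n) * ennreal (3 * (\<alpha> n)\<^sup>2)"
        by (subst nn_integral_cmult) (auto simp: nn_integral_coord_power4)
      also have "\<dots> = ennreal (3 * \<alpha> n)"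
        using \<alpha>_pos[of n] by (simp add: ennreal_mult'[symmetric] power2_eq_square)
      finally show ?thesis .
    qed
    then show ?thesis by simp
  qed
  also have "\<dots> < \<infinity>"
  proof -
    have "(\<Sum>n. ennreal (3 * \<alpha> n)) = ennreal (\<Sum>n. 3 * \<alpha> n)"
      using \<alpha>_pos \<alpha>_summable by (intro suminf_ennreal2) (auto intro: less_imp_le summable_mult)
    then show ?thesis by (simp add: ennreal_mult_less_top)
  qed
  finally show "(\<integral>\<^sup>+f. ennreal (norm ((L2_norm M f) ^ 4)) \<partial>G) < \<infinity>" .
qed simp

text \<open>Comparison with the fourth moment. From here on, integrability over \<open>G\<close> is
  mostly reduced to a pointwise growth bound in this way.\<close>

lemma integrable_norm_bound:
  fixes \<Phi> :: "('a \<Rightarrow> 'b) \<Rightarrow> real"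
  assumes [measurable]: "\<Phi> \<in> borel_measurable G" and bd: "\<And>f. f \<in> L2_space M \<Longrightarrow> \<bar>\<Phi> f\<bar> \<le> C * (1 + (L2_norm M f) ^ 4)"
  shows "integrable G \<Phi>"
proof (rule Bochner_Integration.integrable_bound)
  show "integrable G (\<lambda>f. C * (1 + (L2_norm M f) ^ 4))"
    by (intro integrable_mult_right Bochner_Integration.integrable_add integrable_norm_power4) simp
  show "AE f in G. norm (\<Phi> f) \<le> norm (C * (1 + (L2_norm M f) ^ 4))"
    using bd by (intro AE_I2) (simp, meson abs_ge_self order_trans)
qed simp

text \<open>The map \<open>?R\<close> exchanges the coordinate of \<open>f\<close> along
  \<open>g n\<close> for that of an independent copy \<open>f'\<close> and leaves all other
  coordinates alone.\<close>

lemma measurable_resample: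
  "(\<lambda>(f, f'). \<lambda>x. f x + (coord n f' - coord n f) *\<^sub>R g n x) \<in> measurable (G \<Otimes>\<^sub>M G) (L2_borel M)"
    (is "?R \<in> _")
proof (rule measurable_into_L2_borel)
  fix i
  have "(\<lambda>z. coord i (?R z)) \<in> borel_measurable (G \<Otimes>\<^sub>M G) \<longleftrightarrow>
      (\<lambda>z. coord i (fst z) + (coord n (snd z) - coord n (fst z)) * L2_inner M (g n) (g i)) \<in> borel_measurable (G \<Otimes>\<^sub>M G)"
    by (rule measurable_cong) (auto simp: space_pair_measure L2_inner_add_left L2_scaleR L2_inner_scaleR_left)
  also have "\<dots>" by measurable
  finally show "(\<lambda>z. coord i (?R z)) \<in> borel_measurable (G \<Otimes>\<^sub>M G)" .
qed (auto simp: space_pair_measure intro!: L2_add L2_scaleR)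

text \<open>Conditionally on \<open>f\<close>, only the \<open>n\<close>-th coordinate of the resampled function is random, which
  reduces integration by parts to the one-dimensional Stein identity.\<close>

lemma resample_coord:
  "G = distr (G \<Otimes>\<^sub>M G) (L2_borel M) (\<lambda>(f, f'). \<lambda>x. f x + (coord n f' - coord n f) *\<^sub>R g n x)"
    (is "G = distr _ _ ?R")
proof (rule finite_measure_L2_eqI)
  interpret GG: pair_prob_space G G ..
  note R = measurable_resample[of n]
  interpret D: prob_space "distr (G \<Otimes>\<^sub>M G) (L2_borel M) ?R"
    by (rule GG.prob_space_distr[OF R])
  show "finite_measure G" "finite_measure (distr (G \<Otimes>\<^sub>M G) (L2_borel M) ?R)" by unfold_locales
  show "sets G = sets (L2_borel M)" by (rule sets_G)
  show "sets (distr (G \<Otimes>\<^sub>M G) (L2_borel M) ?R) = sets (L2_borel M)" by simp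
  fix \<theta> :: real and h :: "'a \<Rightarrow> 'b" assume h: "h \<in> L2_space M"
  \<comment> \<open>Split \<open>h = h' + k\<close> with \<open>h'\<close> orthogonal to
    \<open>g n\<close> and \<open>k\<close> along it. Pairing the resampled function with
    \<open>h\<close> gives the pairing of \<open>f\<close> with \<open>h'\<close> plus the pairing
    of the independent copy with \<open>k\<close>.\<close>
  define c where "c = coord n h"
  define h' where "h' = (\<lambda>x. h x - c *\<^sub>R g n x)"
  define k where "k = (\<lambda>x. c *\<^sub>R g n x)"
  have h': "h' \<in> L2_space M" unfolding h'_def by (intro L2_diff L2_scaleR h g_L2)
  have k: "k \<in> L2_space M" unfolding k_def by (intro L2_scaleR g_L2)
  note [measurable] = measurable_L2_inner(1)[OF h] measurable_G(2)[OF h'] measurable_G(2)[OF k] measurable_G(2)[OF h]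
  \<comment> \<open>No cross term occurs because \<open>S\<close> is diagonal in the basis; the
    variances of the two parts add up.\<close>
  have v: "L2_inner M h (S h) = L2_inner M h' (S h') + L2_inner M k (S k)"
  proof (rule sums_unique2[OF S_inner[OF h h]])
    have "\<alpha> m * coord m h * coord m h = \<alpha> m * coord m h' * coord m h' + \<alpha> m * coord m k * coord m k" for m
      unfolding h'_def k_def c_def
      by (simp add: L2_inner_diff_left h L2_scaleR L2_inner_scaleR_left g_inner)
    then show "(\<lambda>m. \<alpha> m * coord m h * coord m h) sums (L2_inner M h' (S h') + L2_inner M k (S k))"
      using sums_add[OF S_inner[OF h' h'] S_inner[OF k k]] by simp
  qed
  have "(\<integral>f. cos (\<theta> + L2_inner M f h) \<partial>distr (G \<Otimes>\<^sub>M G) (L2_borel M) ?R)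
      = (\<integral>z. cos (\<theta> + L2_inner M (?R z) h) \<partial>(G \<Otimes>\<^sub>M G))"
    by (rule integral_distr[OF R]) measurable
  also have "\<dots> = (\<integral>z. cos (\<theta> + L2_inner M (fst z) h' + L2_inner M (snd z) k) \<partial>(G \<Otimes>\<^sub>M G))"
  proof (rule Bochner_Integration.integral_cong[OF refl])
    fix z assume "z \<in> space (G \<Otimes>\<^sub>M G)"
    then have z: "fst z \<in> L2_space M" "snd z \<in> L2_space M" by (auto simp: space_pair_measure)
    have "L2_inner M (?R z) h = L2_inner M (fst z) h + (coord n (snd z) - coord n (fst z)) * c"
      unfolding split_beta using z h
      by (simp add: L2_inner_add_left L2_scaleR L2_inner_scaleR_left c_def L2_inner_commute[of M "g n"])
    moreover have "L2_inner M (fst z) h' = L2_inner M (fst z) h - c * coord n (fst z)"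
      unfolding h'_def using z h by (simp add: L2_inner_diff_right L2_scaleR L2_inner_scaleR_right)
    moreover have "L2_inner M (snd z) k = c * coord n (snd z)"
      unfolding k_def by (simp add: L2_inner_scaleR_right)
    ultimately have "L2_inner M (?R z) h = L2_inner M (fst z) h' + L2_inner M (snd z) k"
      by (simp add: algebra_simps)
    then show "cos (\<theta> + L2_inner M (?R z) h) = cos (\<theta> + L2_inner M (fst z) h' + L2_inner M (snd z) k)"
      by (simp add: add.assoc)
  qed
  also have "\<dots> = (\<integral>f. (\<integral>f'. cos (\<theta> + L2_inner M f h' + L2_inner M f' k) \<partial>G) \<partial>G)"
  proof (subst GG.integral_fst'[symmetric])
    show "integrable (G \<Otimes>\<^sub>M G) (\<lambda>z. cos (\<theta> + L2_inner M (fst z) h' + L2_inner M (snd z) k))"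
      by (rule GG.integrable_const_bound[of _ 1]) auto
  qed simp
  also have "\<dots> = (\<integral>f. cos (\<theta> + L2_inner M f h') * exp (- L2_inner M k (S k) / 2) \<partial>G)"
    by (simp add: integral_cos[OF k])
  also have "\<dots> = cos \<theta> * exp (- L2_inner M h' (S h') / 2) * exp (- L2_inner M k (S k) / 2)"
    by (simp add: integral_cos[OF h'])
  also have "\<dots> = cos \<theta> * exp (- L2_inner M h (S h) / 2)"
    by (simp add: v mult.assoc exp_add[symmetric] field_simps)
  also have "\<dots> = (\<integral>f. cos (\<theta> + L2_inner M f h) \<partial>G)" by (simp add: integral_cos[OF h])
  finally show "(\<integral>f. cos (\<theta> + L2_inner M f h) \<partial>G)
      = (\<integral>f. cos (\<theta> + L2_inner M f h) \<partial>distr (G \<Otimes>\<^sub>M G) (L2_borel M) ?R)" ..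
qed

text \<open>Stein's identity is applied on the lines \<open>y + t g n\<close> with \<open>y\<close>
  orthogonal to \<open>g n\<close>. Accordingly differentiability and continuity are asked for along
  direction \<open>g n\<close>, and linear growth in the norm restricts to linear growth in
  \<open>t\<close>.\<close>

lemma Gaussian_integration_by_parts:
  fixes \<Phi> D :: "('a \<Rightarrow> 'b) \<Rightarrow> real"
  assumes m[measurable]: "\<Phi> \<in> borel_measurable G" "D \<in> borel_measurable G"
    and deriv: "\<And>f t. f \<in> L2_space M \<Longrightarrow>
      ((\<lambda>t. \<Phi> (\<lambda>x. f x + t *\<^sub>R g n x)) has_real_derivative D (\<lambda>x. f x + t *\<^sub>R g n x)) (at t)"
    and cont: "\<And>f t. f \<in> L2_space M \<Longrightarrow> isCont (\<lambda>t. D (\<lambda>x. f x + t *\<^sub>R g n x)) t"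
    and b1: "\<And>f. f \<in> L2_space M \<Longrightarrow> \<bar>\<Phi> f\<bar> \<le> C * (1 + L2_norm M f)"
    and b2: "\<And>f. f \<in> L2_space M \<Longrightarrow> \<bar>D f\<bar> \<le> C * (1 + L2_norm M f)"
  shows "(\<integral>f. \<Phi> f * coord n f \<partial>G) = \<alpha> n * (\<integral>f. D f \<partial>G)"
proof -
  interpret GG: pair_prob_space G G ..
  have C: "C \<ge> 0" using b1[OF L2_zero] by simp
  have le: "1 + x \<le> 2 * (1 + x ^ 4)" "(1 + x) * x \<le> 2 * (1 + x ^ 4)" if "x \<ge> 0" for x :: real
  proof -
    have "x \<le> 1 + x ^ 4" "x\<^sup>2 \<le> 1 + x ^ 4"
    proof -
      have "0 \<le> (x\<^sup>2 - 1/2)\<^sup>2" by simp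
      then have q: "x\<^sup>2 \<le> x ^ 4 + 1/4" by (simp add: power2_eq_square power4_eq_xxxx algebra_simps)
      have "0 \<le> (x - 1/2)\<^sup>2" by simp
      then have "x \<le> x\<^sup>2 + 1/4" by (simp add: power2_eq_square algebra_simps)
      with q show "x \<le> 1 + x ^ 4" "x\<^sup>2 \<le> 1 + x ^ 4" by linarith+
    qed
    moreover have "0 \<le> x ^ 4" by simp
    ultimately show "1 + x \<le> 2 * (1 + x ^ 4)" "(1 + x) * x \<le> 2 * (1 + x ^ 4)"
      unfolding power2_eq_square distrib_right distrib_left mult_1_left by linarith+
  qed
  have iD: "integrable G D"
  proof (rule integrable_norm_bound[of _ "C * 2"])
    fix f :: "'a \<Rightarrow> 'b" assume "f \<in> L2_space M"
    then have "\<bar>D f\<bar> \<le> C * (1 + L2_norm M f)" by (rule b2)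
    also have "\<dots> \<le> C * (2 * (1 + L2_norm M f ^ 4))" by (intro mult_left_mono le C L2_norm_nonneg)
    finally show "\<bar>D f\<bar> \<le> C * 2 * (1 + L2_norm M f ^ 4)" by (simp only: mult.assoc)
  qed simp
  have i\<Phi>: "integrable G (\<lambda>f. \<Phi> f * coord n f)"
  proof (rule integrable_norm_bound[of _ "C * 2"])
    fix f :: "'a \<Rightarrow> 'b" assume f: "f \<in> L2_space M"
    have "\<bar>\<Phi> f * coord n f\<bar> \<le> (C * (1 + L2_norm M f)) * L2_norm M f"
      unfolding abs_mult using L2_Cauchy_Schwarz[OF f g_L2[of n]] b1[OF f] C by (intro mult_mono) auto
    also have "\<dots> = C * ((1 + L2_norm M f) * L2_norm M f)" by simp
    also have "\<dots> \<le> C * (2 * (1 + L2_norm M f ^ 4))" by (intro mult_left_mono le C L2_norm_nonneg)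
    finally show "\<bar>\<Phi> f * coord n f\<bar> \<le> C * 2 * (1 + L2_norm M f ^ 4)" by (simp only: mult.assoc)
  qed simp
  define R where "R = (\<lambda>(f, f'). \<lambda>x. f x + (coord n f' - coord n f) *\<^sub>R g n x)"
  have Gd: "G = distr (G \<Otimes>\<^sub>M G) (L2_borel M) R" unfolding R_def by (rule resample_coord)
  have R[measurable]: "R \<in> measurable (G \<Otimes>\<^sub>M G) G"
    unfolding R_def using measurable_resample[of n] measurable_cong_sets[OF refl sets_G] by blast
  have Gd': "distr (G \<Otimes>\<^sub>M G) G R = G"
    using Gd by (metis distr_cong sets_G)
  \<comment> \<open>Invariance of \<open>G\<close> under resampling followed by Fubini: the inner
    integral averages over the \<open>n\<close>-th coordinate alone.\<close>
  have tr: "(\<integral>f. F f \<partial>G) = (\<integral>f. (\<integral>f'. F (R (f, f')) \<partial>G) \<partial>G)"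
    if F: "integrable G F" for F :: "('a \<Rightarrow> 'b) \<Rightarrow> real"
  proof -
    have [measurable]: "F \<in> borel_measurable G" using F by simp
    have "integrable (G \<Otimes>\<^sub>M G) (\<lambda>z. F (R z))"
      by (rule integrable_distr[OF R]) (simp add: Gd' F)
    then have "(\<integral>z. F (R z) \<partial>(G \<Otimes>\<^sub>M G)) = (\<integral>f. (\<integral>f'. F (R (f, f')) \<partial>G) \<partial>G)"
      by (subst GG.integral_fst'[symmetric]) auto
    moreover have "(\<integral>f. F f \<partial>G) = (\<integral>z. F (R z) \<partial>(G \<Otimes>\<^sub>M G))"
      by (subst Gd'[symmetric], subst integral_distr) auto
    ultimately show ?thesis by simp
  qed
  have inner: "(\<integral>f'. \<Phi> (R (f, f')) * coord n (R (f, f')) \<partial>G) = \<alpha> n * (\<integral>f'. D (R (f, f')) \<partial>G)"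
    if f: "f \<in> L2_space M" for f
  proof -
    define y where "y = (\<lambda>x. f x - coord n f *\<^sub>R g n x)"
    have y: "y \<in> L2_space M" unfolding y_def by (intro L2_diff L2_scaleR f g_L2)
    have Ry: "R (f, f') = (\<lambda>x. y x + coord n f' *\<^sub>R g n x)" for f'
      by (simp add: R_def y_def algebra_simps)
    have cR: "coord n (R (f, f')) = coord n f'" for f'
      unfolding Ry using f y
      by (simp add: L2_inner_add_left L2_scaleR L2_inner_scaleR_left g_inner y_def L2_inner_diff_left)
    define \<psi> where "\<psi> t = \<Phi> (\<lambda>x. y x + t *\<^sub>R g n x)" for t
    define \<psi>' where "\<psi>' t = D (\<lambda>x. y x + t *\<^sub>R g n x)" for t
    have d: "(\<psi> has_real_derivative \<psi>' t) (at t)" for t unfolding \<psi>_def \<psi>'_def by (rule deriv[OF y])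
    have c: "isCont \<psi>' t" for t unfolding \<psi>'_def by (rule cont[OF y])
    have [measurable]: "\<psi>' \<in> borel_measurable borel"
      by (rule borel_measurable_continuous_onI) (simp add: c continuous_at_imp_continuous_on)
    have [measurable]: "\<psi> \<in> borel_measurable borel"
      by (rule borel_measurable_continuous_onI) (meson DERIV_isCont d continuous_at_imp_continuous_on)
    have n: "L2_norm M (\<lambda>x. y x + t *\<^sub>R g n x) \<le> L2_norm M y + \<bar>t\<bar>" for t
      using L2_norm_triangle[OF y L2_scaleR[OF g_L2, of t n]] by (simp add: L2_norm_scaleR)
    have bb: "C * (1 + L2_norm M (\<lambda>x. y x + t *\<^sub>R g n x)) \<le> C * (1 + L2_norm M y) + C * \<bar>t\<bar>" for t
      using mult_left_mono[OF n[of t] C] by (simp add: algebra_simps)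
    have L: "(\<lambda>x. y x + t *\<^sub>R g n x) \<in> L2_space M" for t by (intro L2_add_scaleR y g_L2)
    have bds: "\<bar>\<psi> t\<bar> \<le> C * (1 + L2_norm M y) + C * \<bar>t\<bar>" "\<bar>\<psi>' t\<bar> \<le> C * (1 + L2_norm M y) + C * \<bar>t\<bar>" for t
      unfolding \<psi>_def \<psi>'_def using b1[OF L, of t] b2[OF L, of t] bb[of t] by linarith+
    have "(\<integral>f'. \<Phi> (R (f, f')) * coord n (R (f, f')) \<partial>G) = (\<integral>f'. \<psi> (coord n f') * coord n f' \<partial>G)"
      unfolding cR by (simp add: Ry \<psi>_def)
    also have "\<dots> = (\<integral>t. normal_density 0 (sqrt (\<alpha> n)) t * (\<psi> t * t) \<partial>lborel)"
      by (rule integral_coord[of "\<lambda>t. \<psi> t * t"]) measurable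
    also have "\<dots> = (sqrt (\<alpha> n))\<^sup>2 * (\<integral>t. normal_density 0 (sqrt (\<alpha> n)) t * \<psi>' t \<partial>lborel)"
      by (rule Stein_identity[OF _ d c bds]) (simp add: \<alpha>_pos)
    also have "\<dots> = \<alpha> n * (\<integral>f'. \<psi>' (coord n f') \<partial>G)"
      using \<alpha>_pos[of n] by (simp add: integral_coord)
    finally show ?thesis by (simp add: Ry \<psi>'_def)
  qed
  have "(\<integral>f. \<Phi> f * coord n f \<partial>G) = (\<integral>f. (\<integral>f'. \<Phi> (R (f, f')) * coord n (R (f, f')) \<partial>G) \<partial>G)"
    by (rule tr[OF i\<Phi>])
  also have "\<dots> = (\<integral>f. \<alpha> n * (\<integral>f'. D (R (f, f')) \<partial>G) \<partial>G)"
    by (rule Bochner_Integration.integral_cong) (auto simp: inner)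
  also have "\<dots> = \<alpha> n * (\<integral>f. D f \<partial>G)" using tr[OF iD] by simp
  finally show ?thesis .
qed

end

section \<open>Wasserstein space and push-forwards\<close>

lemma P2_D:
  assumes "\<mu> \<in> P2"
  shows "sets \<mu> = sets borel" "prob_space \<mu>" "integrable \<mu> (\<lambda>x. (norm x)\<^sup>2)" "space \<mu> = UNIV"
  using assms sets_eq_imp_space_eq[of \<mu> borel] by (auto simp: P2_def)

lemma P2_id_L2: "\<mu> \<in> P2 \<Longrightarrow> (\<lambda>x. x) \<in> L2_space \<mu>"
  using measurable_cong_sets[of \<mu> borel borel borel] by (auto simp: P2_def L2_space_def)

context
  fixes lam :: "(real ^ 'd) measure" and f :: "real ^ 'd \<Rightarrow> real ^ 'd"
  assumes lam: "lam \<in> P2" and f: "f \<in> L2_space lam"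
begin

lemma push_P2: "push lam f \<in> P2"
proof -
  have [measurable]: "f \<in> borel_measurable lam" using f by (rule L2_measurable)
  interpret prob_space lam using P2_D(2)[OF lam] .
  show ?thesis using f
    by (auto simp: P2_def push_def prob_space_distr integrable_distr_eq L2_space_def)
qed

lemma integral_push:
  fixes \<phi> :: "real ^ 'd \<Rightarrow> 'b::{banach, second_countable_topology}"
  assumes "\<phi> \<in> borel_measurable borel"
  shows "(\<integral>x. \<phi> x \<partial>push lam f) = (\<integral>x. \<phi> (f x) \<partial>lam)"
  unfolding push_def by (rule integral_distr) (use L2_measurable[OF f] assms in auto)

lemma AE_push: "AE x in push lam f. Q x \<Longrightarrow> AE x in lam. Q (f x)"
  unfolding push_def using AE_distrD[OF L2_measurable[OF f]] by blast

lemma L2_push: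
  fixes v :: "real ^ 'd \<Rightarrow> 'b::euclidean_space"
  assumes v: "v \<in> L2_space (push lam f)"
  shows "v \<in> borel_measurable borel" "(\<lambda>x. v (f x)) \<in> L2_space lam"
proof -
  have [measurable]: "f \<in> borel_measurable lam" using f by (rule L2_measurable)
  show [measurable]: "v \<in> borel_measurable borel" using L2_measurable[OF v] by (simp add: push_def)
  show "(\<lambda>x. v (f x)) \<in> L2_space lam"
    using v by (simp add: L2_space_def push_def integrable_distr_eq)
qed

lemma L2_pushI:
  fixes v :: "real ^ 'd \<Rightarrow> 'b::euclidean_space"
  assumes [measurable]: "v \<in> borel_measurable borel" and v: "(\<lambda>x. v (f x)) \<in> L2_space lam"
  shows "v \<in> L2_space (push lam f)"
proof -
  have [measurable]: "f \<in> borel_measurable lam" using f by (rule L2_measurable)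
  show ?thesis using v by (simp add: L2_space_def push_def integrable_distr_eq)
qed

lemma L2_inner_push:
  fixes v w :: "real ^ 'd \<Rightarrow> 'b::euclidean_space"
  assumes "v \<in> borel_measurable borel" "w \<in> borel_measurable borel"
  shows "L2_inner (push lam f) v w = L2_inner lam (\<lambda>x. v (f x)) (\<lambda>x. w (f x))"
  unfolding L2_inner_def by (rule integral_push) (use assms in measurable)

end

section \<open>The Wasserstein distance, its topology and continuous functionals\<close>

lemma W2_nonneg: "0 \<le> W2 \<mu> \<nu>" if "couplings \<mu> \<nu> \<noteq> {}"
  unfolding W2_def using that by (intro real_sqrt_ge_zero cINF_greatest Bochner_Integration.integral_nonneg) auto

text \<open>Witnessed by the product measure; over an empty set of couplings the infimum in
  \<open>W2\<close> would be an unspecified value.\<close>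

lemma couplings_nonempty:
  assumes "\<mu> \<in> P2" "\<nu> \<in> P2"
  shows "couplings \<mu> \<nu> \<noteq> {}"
proof -
  interpret M: prob_space \<mu> using P2_D(2)[OF assms(1)] .
  interpret N: prob_space \<nu> using P2_D(2)[OF assms(2)] .
  interpret MN: pair_prob_space \<mu> \<nu> ..
  have snd: "distr (\<mu> \<Otimes>\<^sub>M \<nu>) \<nu> snd = \<nu>"
  proof (rule measure_eqI)
    fix A assume "A \<in> sets (distr (\<mu> \<Otimes>\<^sub>M \<nu>) \<nu> snd)"
    then have A: "A \<in> sets \<nu>" by simp
    have "snd -` A \<inter> space (\<mu> \<Otimes>\<^sub>M \<nu>) = space \<mu> \<times> A"
      using sets.sets_into_space[OF A] by (auto simp: space_pair_measure)
    then show "emeasure (distr (\<mu> \<Otimes>\<^sub>M \<nu>) \<nu> snd) A = emeasure \<nu> A"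
      using A by (simp add: emeasure_distr N.emeasure_pair_measure_Times M.emeasure_space_1)
  qed simp
  have s: "sets \<mu> = sets borel" "sets \<nu> = sets borel" using P2_D assms by auto
  have "distr (\<mu> \<Otimes>\<^sub>M \<nu>) borel fst = distr (\<mu> \<Otimes>\<^sub>M \<nu>) \<mu> fst" by (rule distr_cong) (auto simp: s)
  moreover have "distr (\<mu> \<Otimes>\<^sub>M \<nu>) borel snd = distr (\<mu> \<Otimes>\<^sub>M \<nu>) \<nu> snd" by (rule distr_cong) (auto simp: s)
  ultimately have "\<mu> \<Otimes>\<^sub>M \<nu> \<in> couplings \<mu> \<nu>"
    unfolding couplings_def
    by (auto simp: N.distr_pair_fst snd MN.prob_space_axioms intro!: sets_pair_measure_cong s)
  then show ?thesis by blast
qed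

lemma W2_bdd: "bdd_below ((\<lambda>\<gamma>. \<integral>z. (norm (fst z - snd z))\<^sup>2 \<partial>\<gamma>) ` couplings \<mu> \<nu>)"
  by (rule bdd_belowI2[of _ 0]) simp

text \<open>The joint law of \<open>f\<close> and \<open>h\<close> under \<open>lam\<close> is one
  of the couplings over which the infimum is taken, and its cost is the squared \<open>L2\<close>
  distance.\<close>

lemma W2_push_le:
  assumes lam: "lam \<in> P2" and f: "f \<in> L2_space lam" and h: "h \<in> L2_space lam"
  shows "W2 (push lam f) (push lam h) \<le> L2_norm lam (\<lambda>x. f x - h x)"
proof -
  have [measurable]: "f \<in> borel_measurable lam" "h \<in> borel_measurable lam"
    using L2_measurable f h by blast+
  interpret prob_space lam using P2_D(2)[OF lam] .
  define \<gamma> where "\<gamma> = distr lam (borel \<Otimes>\<^sub>M borel) (\<lambda>x. (f x, h x))"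
  have "\<gamma> \<in> couplings (push lam f) (push lam h)"
    unfolding couplings_def \<gamma>_def push_def
    by (auto simp: prob_space_distr distr_distr comp_def)
  then have "W2 (push lam f) (push lam h) \<le> sqrt (\<integral>z. (norm (fst z - snd z))\<^sup>2 \<partial>\<gamma>)"
    unfolding W2_def by (intro real_sqrt_le_mono cINF_lower W2_bdd)
  also have "(\<integral>z. (norm (fst z - snd z))\<^sup>2 \<partial>\<gamma>) = (\<integral>x. (norm (f x - h x))\<^sup>2 \<partial>lam)"
    unfolding \<gamma>_def by (subst integral_distr) auto
  finally show ?thesis by (simp add: L2_norm_sq_integral[symmetric])
qed

lemma limitin_dist_topologyI:
  assumes "x \<in> X" "\<And>n. y n \<in> X" "(\<lambda>n. d x (y n)) \<longlonglongrightarrow> 0"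
  shows "limitin (dist_topology X d) y x sequentially"
  unfolding limitin_def topspace_dist_topology
proof (intro conjI allI impI assms(1))
  fix U assume U: "openin (dist_topology X d) U \<and> x \<in> U"
  then obtain e where e: "e > 0" "\<And>y. y \<in> X \<Longrightarrow> d x y < e \<Longrightarrow> y \<in> U"
    unfolding openin_dist_topology by blast
  have "\<forall>\<^sub>F n in sequentially. d x (y n) < e" using order_tendstoD(2)[OF assms(3) e(1)] .
  then show "\<forall>\<^sub>F n in sequentially. y n \<in> U" by eventually_elim (use e assms(2) in blast)
qed

lemma limitin_push:
  assumes lam: "lam \<in> P2" and f: "f \<in> L2_space lam" and F: "\<And>n. F n \<in> L2_space lam"
    and lim: "(\<lambda>n. L2_norm lam (\<lambda>x. F n x - f x)) \<longlonglongrightarrow> 0"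
  shows "limitin P2_topology (\<lambda>n. push lam (F n)) (push lam f) sequentially"
  unfolding P2_topology_def
proof (rule limitin_dist_topologyI)
  show "(\<lambda>n. W2 (push lam f) (push lam (F n))) \<longlonglongrightarrow> 0"
  proof (rule Lim_null_comparison[OF _ lim], intro always_eventually allI)
    fix n
    show "norm (W2 (push lam f) (push lam (F n))) \<le> L2_norm lam (\<lambda>x. F n x - f x)"
      using W2_push_le[OF lam f F[of n]] W2_nonneg[OF couplings_nonempty[OF push_P2[OF lam f] push_P2[OF lam F[of n]]]]
      by (simp add: L2_norm_minus_commute[of lam f])
  qed
qed (use push_P2 lam f F in auto)

lemma space_P2_borel [simp]: "space P2_borel = P2"
  by (simp add: P2_borel_def P2_topology_def)

lemma topspace_P2 [simp]: "topspace P2_topology = P2"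
  by (simp add: P2_topology_def)

lemma measurable_push:
  fixes lam :: "(real ^ 'd) measure"
  assumes lam: "lam \<in> P2"
  shows "push lam \<in> measurable (L2_borel lam) P2_borel"
  unfolding P2_borel_def
proof (rule measurable_borel_of_topI)
  fix U :: "(real ^ 'd) measure set" assume U: "openin P2_topology U"
  have "openin (dist_topology (L2_space lam) (\<lambda>f g. L2_norm lam (\<lambda>x. f x - g x))) (push lam -` U \<inter> L2_space lam)"
  proof (rule openin_dist_topologyI)
    fix f :: "real ^ 'd \<Rightarrow> real ^ 'd" and F assume f: "f \<in> push lam -` U \<inter> L2_space lam" and F: "\<And>n. F n \<in> L2_space lam"
      and "(\<lambda>n. L2_norm lam (\<lambda>x. f x - F n x)) \<longlonglongrightarrow> 0"
    then have "(\<lambda>n. L2_norm lam (\<lambda>x. F n x - f x)) \<longlonglongrightarrow> 0"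
      by (simp add: L2_norm_minus_commute[of lam f])
    then have "limitin P2_topology (\<lambda>n. push lam (F n)) (push lam f) sequentially"
      using limitin_push[OF lam] f F by blast
    then have "\<forall>\<^sub>F n in sequentially. push lam (F n) \<in> U" using U f unfolding limitin_def by blast
    then show "\<exists>n. F n \<in> push lam -` U \<inter> L2_space lam"
      using F by (auto simp: eventually_sequentially)
  qed auto
  then show "push lam -` U \<inter> space (L2_borel lam) \<in> sets (L2_borel lam)"
    by (simp add: L2_borel_def openin_sets_borel_of_top)
qed (simp add: push_P2 lam)

lemma continuous_map_P2_measurable:
  fixes u :: "(real ^ 'd) measure \<Rightarrow> real"
  assumes "continuous_map P2_topology euclideanreal u"
  shows "u \<in> borel_measurable P2_borel"
proof (rule borel_measurableI)
  fix S :: "real set" assume "open S"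
  then have "openin P2_topology {x \<in> topspace P2_topology. u x \<in> S}"
    using openin_continuous_map_preimage[OF assms, of S] by simp
  moreover have "{x \<in> topspace P2_topology. u x \<in> S} = u -` S \<inter> space P2_borel" by auto
  ultimately show "u -` S \<inter> space P2_borel \<in> sets P2_borel"
    unfolding P2_borel_def using openin_sets_borel_of_top by metis
qed

text \<open>The strict inequality provides a coupling of cost below
  \<open>\<epsilon>\<^sup>2\<close>. Integrating the local Lipschitz bound against it and applying
  Cauchy-Schwarz separates the growth factor from the distance.\<close>

lemma integral_W2_estimate:
  fixes \<phi> :: "real ^ 'd \<Rightarrow> real"
  assumes \<mu>: "\<mu> \<in> P2" and \<nu>: "\<nu> \<in> P2" and W: "W2 \<mu> \<nu> < \<epsilon>"
    and [measurable]: "\<phi> \<in> borel_measurable borel" and K: "K \<ge> 0"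
    and \<phi>: "\<And>x y. \<bar>\<phi> x - \<phi> y\<bar> \<le> K * ((1 + norm x + norm y) * norm (x - y))"
    and int: "integrable \<mu> \<phi>" "integrable \<nu> \<phi>"
  shows "\<bar>(\<integral>x. \<phi> x \<partial>\<mu>) - (\<integral>x. \<phi> x \<partial>\<nu>)\<bar> \<le> K * ((1 + 2 * L2_norm \<mu> (\<lambda>x. x) + \<epsilon>) * \<epsilon>)"
proof -
  have e0: "\<epsilon> > 0" using W W2_nonneg[OF couplings_nonempty[OF \<mu> \<nu>]] by simp
  have ne: "(\<lambda>\<gamma>. \<integral>z. (norm (fst z - snd z))\<^sup>2 \<partial>\<gamma>) ` couplings \<mu> \<nu> \<noteq> {}"
    using couplings_nonempty[OF \<mu> \<nu>] by simp
  have "sqrt (INF \<gamma>\<in>couplings \<mu> \<nu>. \<integral>z. (norm (fst z - snd z))\<^sup>2 \<partial>\<gamma>) < sqrt (\<epsilon>\<^sup>2)"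
    using W e0 unfolding W2_def by simp
  then have "(INF \<gamma>\<in>couplings \<mu> \<nu>. \<integral>z. (norm (fst z - snd z))\<^sup>2 \<partial>\<gamma>) < \<epsilon>\<^sup>2" by (simp only: real_sqrt_less_iff)
  then obtain \<gamma> where \<gamma>: "\<gamma> \<in> couplings \<mu> \<nu>" "(\<integral>z. (norm (fst z - snd z))\<^sup>2 \<partial>\<gamma>) < \<epsilon>\<^sup>2"
    using cInf_lessD[OF ne] by blast
  have sg[measurable_cong]: "sets \<gamma> = sets (borel \<Otimes>\<^sub>M borel)" and "prob_space \<gamma>"
    and m: "distr \<gamma> borel fst = \<mu>" "distr \<gamma> borel snd = \<nu>"
    using \<gamma>(1) by (auto simp: couplings_def)
  interpret prob_space \<gamma> by fact
  have sm[measurable]: "fst \<in> borel_measurable \<gamma>" "snd \<in> borel_measurable \<gamma>" by measurable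
  have L: "fst \<in> L2_space \<gamma>" "snd \<in> L2_space \<gamma>"
    using P2_D(3)[OF \<mu>] P2_D(3)[OF \<nu>] unfolding m[symmetric] by (auto simp: L2_space_def integrable_distr_eq)
  have n1: "L2_norm \<gamma> fst = L2_norm \<mu> (\<lambda>x. x)"
    unfolding L2_norm_def L2_inner_def by (subst m(1)[symmetric], subst integral_distr) auto
  have d: "(\<lambda>z. fst z - snd z) \<in> L2_space \<gamma>" by (rule L2_diff[OF L])
  have nd: "L2_norm \<gamma> (\<lambda>z. fst z - snd z) \<le> \<epsilon>"
    by (rule power2_le_imp_le) (use \<gamma>(2) e0 in \<open>auto simp: L2_norm_sq_integral\<close>)
  \<comment> \<open>The second moment of \<open>\<nu>\<close> is controlled by that of
    \<open>\<mu>\<close>, so the final bound is uniform over \<open>\<nu>\<close> near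
    \<open>\<mu>\<close>.\<close>
  have n2: "L2_norm \<gamma> snd \<le> L2_norm \<mu> (\<lambda>x. x) + \<epsilon>"
    using L2_norm_le_diff[OF L(2) L(1)] nd by (simp add: n1 L2_norm_minus_commute[of \<gamma> snd])
  define s where "s z = 1 + norm (fst z) + norm (snd z)" for z :: "(real ^ 'd) \<times> (real ^ 'd)"
  have nL: "(\<lambda>z. norm (v z)) \<in> L2_space \<gamma>" "L2_norm \<gamma> (\<lambda>z. norm (v z)) = L2_norm \<gamma> v"
    if "v \<in> L2_space \<gamma>" for v :: "_ \<Rightarrow> real ^ 'd"
    using that by (auto simp: L2_space_def L2_norm_def L2_inner_def power2_norm_eq_inner[symmetric] power2_eq_square[symmetric])
  have c1: "(\<lambda>z. 1::real) \<in> L2_space \<gamma>" by (simp add: L2_space_def)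
  have s: "s \<in> L2_space \<gamma>" unfolding s_def by (intro L2_add c1 nL L)
  have ns: "L2_norm \<gamma> s \<le> 1 + L2_norm \<gamma> fst + L2_norm \<gamma> snd"
  proof -
    have "L2_norm \<gamma> (\<lambda>z. 1::real) = 1" by (simp add: L2_norm_def L2_inner_def prob_space)
    moreover have "L2_norm \<gamma> s \<le> L2_norm \<gamma> (\<lambda>z. 1 + norm (fst z)) + L2_norm \<gamma> (\<lambda>z. norm (snd z))"
      unfolding s_def by (intro L2_norm_triangle L2_add c1 nL L)
    moreover have "L2_norm \<gamma> (\<lambda>z. 1 + norm (fst z)) \<le> L2_norm \<gamma> (\<lambda>z. 1::real) + L2_norm \<gamma> (\<lambda>z. norm (fst z))"
      by (intro L2_norm_triangle c1 nL L)
    ultimately show ?thesis using nL(2)[OF L(1)] nL(2)[OF L(2)] by simp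
  qed
  have i1: "integrable \<gamma> (\<lambda>z. \<phi> (fst z))" "integrable \<gamma> (\<lambda>z. \<phi> (snd z))"
    using int unfolding m[symmetric] by (auto simp: integrable_distr_eq)
  have "(\<integral>x. \<phi> x \<partial>\<mu>) = (\<integral>z. \<phi> (fst z) \<partial>\<gamma>)" "(\<integral>x. \<phi> x \<partial>\<nu>) = (\<integral>z. \<phi> (snd z) \<partial>\<gamma>)"
    unfolding m[symmetric] by (auto simp: integral_distr)
  then have "\<bar>(\<integral>x. \<phi> x \<partial>\<mu>) - (\<integral>x. \<phi> x \<partial>\<nu>)\<bar> = \<bar>\<integral>z. \<phi> (fst z) - \<phi> (snd z) \<partial>\<gamma>\<bar>"
    using i1 by simp
  also have "\<dots> \<le> (\<integral>z. \<bar>\<phi> (fst z) - \<phi> (snd z)\<bar> \<partial>\<gamma>)" by (rule integral_abs_bound)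
  also have "\<dots> \<le> (\<integral>z. K * (s z \<bullet> norm (fst z - snd z)) \<partial>\<gamma>)"
    using \<phi> i1 L2_integrable_inner[OF s nL(1)[OF d]]
    by (intro integral_mono integrable_mult_right) (auto simp: s_def)
  also have "\<dots> = K * L2_inner \<gamma> s (\<lambda>z. norm (fst z - snd z))" by (simp add: L2_inner_def)
  also have "\<dots> \<le> K * (L2_norm \<gamma> s * L2_norm \<gamma> (\<lambda>z. fst z - snd z))"
    using L2_Cauchy_Schwarz[OF s nL(1)[OF d]] nL(2)[OF d] K by (intro mult_left_mono) auto
  also have "\<dots> \<le> K * ((1 + 2 * L2_norm \<mu> (\<lambda>x. x) + \<epsilon>) * \<epsilon>)"
    using nd ns n1 n2 K e0 by (intro mult_left_mono mult_mono) auto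
  finally show ?thesis .
qed

lemma continuous_map_P2_integral:
  fixes \<phi> :: "real ^ 'd \<Rightarrow> real"
  assumes [measurable]: "\<phi> \<in> borel_measurable borel" and K: "K \<ge> 0"
    and \<phi>: "\<And>x y. \<bar>\<phi> x - \<phi> y\<bar> \<le> K * ((1 + norm x + norm y) * norm (x - y))"
    and int: "\<And>\<mu>. \<mu> \<in> P2 \<Longrightarrow> integrable \<mu> \<phi>"
  shows "continuous_map P2_topology euclideanreal (\<lambda>\<mu>. \<integral>x. \<phi> x \<partial>\<mu>)"
  unfolding continuous_map
proof (intro conjI allI impI)
  fix U :: "real set" assume U: "openin euclideanreal U"
  show "openin P2_topology {\<mu> \<in> topspace P2_topology. (\<integral>x. \<phi> x \<partial>\<mu>) \<in> U}"
    unfolding P2_topology_def topspace_dist_topology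
  proof (rule openin_dist_topologyI)
    fix \<mu> :: "(real ^ 'd) measure" and \<nu> assume \<mu>: "\<mu> \<in> {\<mu> \<in> P2. (\<integral>x. \<phi> x \<partial>\<mu>) \<in> U}" and \<nu>: "\<And>n. \<nu> n \<in> P2"
      and lim: "(\<lambda>n. W2 \<mu> (\<nu> n)) \<longlonglongrightarrow> 0"
    have \<mu>P: "\<mu> \<in> P2" using \<mu> by simp
    \<comment> \<open>The added null sequence turns \<open>W2 \<mu> (\<nu> n)\<close> into the
      strict upper bound that the estimate asks for.\<close>
    define e where "e n = W2 \<mu> (\<nu> n) + 1 / (real n + 1)" for n
    have "(\<lambda>n. 1 / (real n + 1)) \<longlonglongrightarrow> 0"
      using LIMSEQ_inverse_real_of_nat by (simp add: inverse_eq_divide add.commute)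
    then have e: "e \<longlonglongrightarrow> 0" unfolding e_def using tendsto_add[OF lim] by simp
    have "(\<lambda>n. (\<integral>x. \<phi> x \<partial>\<mu>) - (\<integral>x. \<phi> x \<partial>\<nu> n)) \<longlonglongrightarrow> 0"
    proof (rule Lim_null_comparison)
      show "\<forall>\<^sub>F n in sequentially. norm ((\<integral>x. \<phi> x \<partial>\<mu>) - (\<integral>x. \<phi> x \<partial>\<nu> n)) \<le> K * ((1 + 2 * L2_norm \<mu> (\<lambda>x. x) + e n) * e n)"
        unfolding real_norm_def
        by (intro always_eventually allI integral_W2_estimate \<mu>P \<nu> K \<phi> int) (auto simp: e_def add_nonneg_pos)
      have "(\<lambda>n. K * ((1 + 2 * L2_norm \<mu> (\<lambda>x. x) + e n) * e n)) \<longlonglongrightarrow> K * ((1 + 2 * L2_norm \<mu> (\<lambda>x. x) + 0) * 0)"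
        by (intro tendsto_intros e)
      then show "(\<lambda>n. K * ((1 + 2 * L2_norm \<mu> (\<lambda>x. x) + e n) * e n)) \<longlonglongrightarrow> 0" by simp
    qed
    from tendsto_diff[OF tendsto_const this, of "\<integral>x. \<phi> x \<partial>\<mu>"]
    have "(\<lambda>n. \<integral>x. \<phi> x \<partial>\<nu> n) \<longlonglongrightarrow> (\<integral>x. \<phi> x \<partial>\<mu>)" by simp
    then have "\<forall>\<^sub>F n in sequentially. (\<integral>x. \<phi> x \<partial>\<nu> n) \<in> U"
      using U \<mu> by (intro topological_tendstoD) auto
    then show "\<exists>n. \<nu> n \<in> {\<mu> \<in> P2. (\<integral>x. \<phi> x \<partial>\<mu>) \<in> U}"
      using \<nu> by (auto simp: eventually_sequentially)
  qed (auto intro!: W2_nonneg simp: couplings_nonempty)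
qed simp

text \<open>The indicator of a closed set is the pointwise limit of the Lipschitz functions
  \<open>\<phi> k\<close>, whose integrals are continuous on \<open>P2\<close>.\<close>

lemma measurable_emeasure_closed_P2:
  assumes C: "closed C"
  shows "(\<lambda>\<mu>. emeasure \<mu> C) \<in> borel_measurable (P2_borel :: (real ^ 'd) measure measure)"
\<comment> \<open>The distance to the empty set is 0 by convention, which would make every
  \<open>\<phi> k\<close> constantly 1.\<close>
proof (cases "C = {}")
  case False
  define \<phi> where "\<phi> k x = max 0 (1 - real k * infdist x C)" for k and x :: "real ^ 'd"
  have c: "continuous_on UNIV (\<phi> k)" for k unfolding \<phi>_def by (intro continuous_intros)
  then have [measurable]: "\<phi> k \<in> borel_measurable borel" for k by (rule borel_measurable_continuous_onI)
  have b: "0 \<le> \<phi> k x" "\<phi> k x \<le> 1" for k x unfolding \<phi>_def using infdist_nonneg[of x C] by auto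
  have lip: "\<bar>\<phi> k x - \<phi> k y\<bar> \<le> real k * ((1 + norm x + norm y) * norm (x - y))" for k x y
  proof -
    have "\<bar>\<phi> k x - \<phi> k y\<bar> \<le> \<bar>real k * infdist x C - real k * infdist y C\<bar>"
      unfolding \<phi>_def by (auto simp: max_def abs_if)
    also have "\<dots> = real k * \<bar>infdist x C - infdist y C\<bar>" by (simp add: abs_mult flip: right_diff_distrib)
    also have "\<dots> \<le> real k * (1 * norm (x - y))"
      using infdist_triangle_abs[of x C y] by (intro mult_left_mono) (auto simp: dist_norm)
    also have "\<dots> \<le> real k * ((1 + norm x + norm y) * norm (x - y))"
      by (intro mult_left_mono mult_right_mono) auto
    finally show ?thesis .
  qed
  have int: "integrable \<mu> (\<phi> k)" if "\<mu> \<in> P2" for \<mu> k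
  proof -
    interpret prob_space \<mu> using P2_D(2)[OF that] .
    note P2_D(1)[OF that, measurable_cong]
    show ?thesis by (rule integrable_const_bound[of _ 1]) (use b[of k] in auto)
  qed
  have lim: "(\<lambda>k. \<integral>x. \<phi> k x \<partial>\<mu>) \<longlonglongrightarrow> measure \<mu> C" if \<mu>: "\<mu> \<in> P2" for \<mu>
  proof -
    interpret prob_space \<mu> using P2_D(2)[OF that] .
    note P2_D(1)[OF that, measurable_cong]
    have Cm: "C \<in> sets \<mu>" using C P2_D(1)[OF \<mu>] by simp
    have "(\<lambda>k. \<integral>x. \<phi> k x \<partial>\<mu>) \<longlonglongrightarrow> (\<integral>x. indicator C x \<partial>\<mu>)"
    proof (rule integral_dominated_convergence[where w="\<lambda>x. 1"])
      have "(\<lambda>k. \<phi> k x) \<longlonglongrightarrow> indicator C x" for x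
      proof (cases "x \<in> C")
        case True
        then show ?thesis by (simp add: \<phi>_def)
      next
        case False
        then have pos: "infdist x C > 0" using infdist_pos_not_in_closed[OF C \<open>C \<noteq> {}\<close>] by simp
        obtain N :: nat where N: "real N > 1 / infdist x C" using reals_Archimedean2 by blast
        have "\<phi> k x = 0" if "k \<ge> N" for k
        proof -
          have "1 / infdist x C \<le> real k" using N that by linarith
          then have "1 \<le> real k * infdist x C" using pos by (simp add: field_simps)
          then show ?thesis by (simp add: \<phi>_def)
        qed
        then have "(\<lambda>k. \<phi> k x) \<longlonglongrightarrow> 0" by (intro tendsto_eventually) (auto simp: eventually_sequentially)
        with False show ?thesis by simp
      qed
      then show "AE x in \<mu>. (\<lambda>k. \<phi> k x) \<longlonglongrightarrow> indicator C x" by simp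
    qed (use Cm b in auto)
    then show ?thesis using Cm sets.sets_into_space[OF Cm] by (simp add: Int_absorb2)
  qed
  have "(\<lambda>\<mu>. \<integral>x. \<phi> k x \<partial>\<mu>) \<in> borel_measurable P2_borel" for k
    by (intro continuous_map_P2_measurable continuous_map_P2_integral[OF _ _ lip] int) auto
  then have "(\<lambda>\<mu>. measure \<mu> C) \<in> borel_measurable P2_borel"
    by (rule borel_measurable_LIMSEQ_real[rotated]) (use lim in auto)
  then have "(\<lambda>\<mu>. ennreal (measure \<mu> C)) \<in> borel_measurable P2_borel" by simp
  moreover have "emeasure \<mu> C = ennreal (measure \<mu> C)" if "\<mu> \<in> P2" for \<mu>
  proof -
    interpret prob_space \<mu> using P2_D(2)[OF that] .
    show ?thesis by (rule emeasure_eq_measure)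
  qed
  ultimately show ?thesis by (subst measurable_cong[where g="\<lambda>\<mu>. ennreal (measure \<mu> C)"]) auto
qed simp

text \<open>Closed sets form an intersection-stable generator of the Borel sets. Regarding
  \<open>\<mu>\<close> as a kernel over \<open>P2\<close> is what makes integrals of
  \<open>\<rho>\<close> against \<open>\<mu>\<close> measurable in \<open>\<mu>\<close>.\<close>

lemma measurable_P2_kernel: "(\<lambda>\<mu>. \<mu>) \<in> measurable P2_borel (subprob_algebra (borel :: (real ^ 'd) measure))"
proof (rule measurable_subprob_algebra_generated[where \<Omega>=UNIV and G="Collect closed"])
  show "sets (borel :: (real ^ 'd) measure) = sigma_sets UNIV (Collect closed)"
    by (subst borel_eq_closed) simp
  show "Int_stable (Collect closed :: (real ^ 'd) set set)" by (auto simp: Int_stable_def)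
  show "subprob_space \<mu>" if "\<mu> \<in> space P2_borel" for \<mu> :: "(real ^ 'd) measure"
    using that P2_D(2)[of \<mu>] by (simp add: prob_space_imp_subprob_space)
  show "sets \<mu> = sets borel" if "\<mu> \<in> space P2_borel" for \<mu> :: "(real ^ 'd) measure"
    using that P2_D(1)[of \<mu>] by simp
qed (auto intro: measurable_emeasure_closed_P2)

section \<open>Chain rule along push-forwards\<close>

lemma L2_simple_approx:
  fixes f :: "'a \<Rightarrow> 'b::euclidean_space"
  assumes f: "f \<in> L2_space M"
  obtains F where "\<And>n. simple_function M (F n)" "\<And>n. F n \<in> L2_space M"
    "(\<lambda>n. L2_norm M (\<lambda>x. F n x - f x)) \<longlonglongrightarrow> 0"
proof -
  have fm[measurable]: "f \<in> borel_measurable M" using f by (rule L2_measurable)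
  obtain F where F: "\<And>n. simple_function M (F n)" "\<And>x. x \<in> space M \<Longrightarrow> (\<lambda>n. F n x) \<longlonglongrightarrow> f x"
    "\<And>n x. x \<in> space M \<Longrightarrow> dist (F n x) 0 \<le> 2 * dist (f x) 0"
    using borel_measurable_implies_sequence_metric[OF fm, of 0] by blast
  have Fm[measurable]: "F n \<in> borel_measurable M" for n using F(1) by (rule borel_measurable_simple_function)
  have L: "F n \<in> L2_space M" for n
    by (rule L2_bound[OF Fm L2_scaleR[OF f, of 2]]) (use F(3)[of _ n] in \<open>auto intro!: AE_I2\<close>)
  have "(\<lambda>n. \<integral>x. (norm (F n x - f x))\<^sup>2 \<partial>M) \<longlonglongrightarrow> (\<integral>x. 0 \<partial>M)"
  proof (rule integral_dominated_convergence[where w="\<lambda>x. 9 * (norm (f x))\<^sup>2"])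
    show "integrable M (\<lambda>x. 9 * (norm (f x))\<^sup>2)" using L2_integrable_sq[OF f] by simp
    show "AE x in M. (\<lambda>n. (norm (F n x - f x))\<^sup>2) \<longlonglongrightarrow> 0"
    proof (rule AE_I2)
      fix x assume "x \<in> space M"
      then have "(\<lambda>n. (norm (F n x - f x))\<^sup>2) \<longlonglongrightarrow> (norm (f x - f x))\<^sup>2"
        by (intro tendsto_intros F(2))
      then show "(\<lambda>n. (norm (F n x - f x))\<^sup>2) \<longlonglongrightarrow> 0" by simp
    qed
    fix n
    show "AE x in M. norm ((norm (F n x - f x))\<^sup>2) \<le> 9 * (norm (f x))\<^sup>2"
    proof (rule AE_I2)
      fix x assume x: "x \<in> space M"
      have "norm (F n x - f x) \<le> norm (F n x) + norm (f x)" by (rule norm_triangle_ineq4)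
      also have "\<dots> \<le> 3 * norm (f x)" using F(3)[OF x, of n] by simp
      finally have "(norm (F n x - f x))\<^sup>2 \<le> (3 * norm (f x))\<^sup>2" by (intro power_mono) auto
      then show "norm ((norm (F n x - f x))\<^sup>2) \<le> 9 * (norm (f x))\<^sup>2" by (simp add: power_mult_distrib)
    qed
  qed auto
  then have "(\<lambda>n. sqrt ((L2_norm M (\<lambda>x. F n x - f x))\<^sup>2)) \<longlonglongrightarrow> sqrt 0"
    unfolding L2_norm_sq_integral by (intro tendsto_real_sqrt) simp
  then have "(\<lambda>n. L2_norm M (\<lambda>x. F n x - f x)) \<longlonglongrightarrow> 0" by simp
  with F(1) L show ?thesis using that by blast
qed

text \<open>The Riesz representation of the bounded linear functional
  \<open>dir_deriv u \<mu>\<close> supplies a witness for the choice in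
  \<open>gradient\<close>.\<close>

lemma gradient_dir_deriv:
  assumes u: "intrinsically_differentiable u" and \<mu>: "\<mu> \<in> P2"
  shows "gradient u \<mu> \<in> L2_space \<mu>"
    "\<And>f. f \<in> L2_space \<mu> \<Longrightarrow> dir_deriv u \<mu> f = L2_inner \<mu> (gradient u \<mu>) f"
proof -
  interpret prob_space \<mu> using P2_D(2)[OF \<mu>] .
  obtain C where C: "\<forall>f\<in>L2_space \<mu>. \<bar>dir_deriv u \<mu> f\<bar> \<le> C * L2_norm \<mu> f"
    using u \<mu> unfolding intrinsically_differentiable_def by blast
  obtain w where "w \<in> L2_space \<mu>" "\<And>f. f \<in> L2_space \<mu> \<Longrightarrow> dir_deriv u \<mu> f = L2_inner \<mu> w f"
  proof (rule L2_Riesz)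
    show "dir_deriv u \<mu> (\<lambda>x. a *\<^sub>R f x + b *\<^sub>R g x) = a * dir_deriv u \<mu> f + b * dir_deriv u \<mu> g"
      if "f \<in> L2_space \<mu>" "g \<in> L2_space \<mu>" for f g a b
      using u \<mu> that unfolding intrinsically_differentiable_def by blast
    show "\<bar>dir_deriv u \<mu> f\<bar> \<le> C * L2_norm \<mu> f" if "f \<in> L2_space \<mu>" for f
      using C that by blast
  qed blast
  then have "\<exists>w. w \<in> L2_space \<mu> \<and> (\<forall>f\<in>L2_space \<mu>. dir_deriv u \<mu> f = L2_inner \<mu> w f)" by blast
  from someI_ex[OF this] show "gradient u \<mu> \<in> L2_space \<mu>"
    "\<And>f. f \<in> L2_space \<mu> \<Longrightarrow> dir_deriv u \<mu> f = L2_inner \<mu> (gradient u \<mu>) f"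
    unfolding gradient_def by blast+
qed

text \<open>Testing with the difference of two representatives shows that its norm is zero, so the
  arbitrary choice in \<open>gradient\<close> matters on null sets only.\<close>

lemma gradient_unique:
  assumes w: "w \<in> L2_space \<mu>" and d: "\<And>f. f \<in> L2_space \<mu> \<Longrightarrow> dir_deriv u \<mu> f = L2_inner \<mu> w f"
  shows "gradient u \<mu> \<in> L2_space \<mu>" "AE x in \<mu>. gradient u \<mu> x = w x"
proof -
  have "\<exists>w. w \<in> L2_space \<mu> \<and> (\<forall>f\<in>L2_space \<mu>. dir_deriv u \<mu> f = L2_inner \<mu> w f)" using assms by blast
  from someI_ex[OF this] have g: "gradient u \<mu> \<in> L2_space \<mu>"
    "\<And>f. f \<in> L2_space \<mu> \<Longrightarrow> dir_deriv u \<mu> f = L2_inner \<mu> (gradient u \<mu>) f"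
    unfolding gradient_def by blast+
  show "gradient u \<mu> \<in> L2_space \<mu>" by fact
  define h where "h = (\<lambda>x. gradient u \<mu> x - w x)"
  have h: "h \<in> L2_space \<mu>" unfolding h_def by (intro L2_diff g w)
  have "L2_inner \<mu> h h = L2_inner \<mu> (gradient u \<mu>) h - L2_inner \<mu> w h"
    by (subst (1) h_def) (rule L2_inner_diff_left[OF g(1) w h])
  also have "\<dots> = 0" using g(2)[OF h] d[OF h] by simp
  finally have "L2_norm \<mu> h = 0" by (simp add: L2_norm_def)
  then have "AE x in \<mu>. h x = 0" using L2_norm_eq_0_iff[OF h] by simp
  then show "AE x in \<mu>. gradient u \<mu> x = w x" by eventually_elim (simp add: h_def)
qed

lemma difference_quotient_tendsto:
  assumes "intrinsically_differentiable u" "\<mu> \<in> P2" "f \<in> L2_space \<mu>"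
  shows "(difference_quotient u \<mu> f \<longlongrightarrow> dir_deriv u \<mu> f) (at 0)"
proof -
  obtain l where l: "(difference_quotient u \<mu> f \<longlongrightarrow> l) (at 0)"
    using assms unfolding intrinsically_differentiable_def by blast
  then have "dir_deriv u \<mu> f = l" unfolding dir_deriv_def by (intro tendsto_Lim) simp_all
  with l show ?thesis by simp
qed

lemma gradient_diff:
  assumes u: "intrinsically_differentiable u" and v: "intrinsically_differentiable v" and \<mu>: "\<mu> \<in> P2"
  shows "gradient (\<lambda>\<mu>. u \<mu> - v \<mu>) \<mu> \<in> L2_space \<mu>"
    "AE x in \<mu>. gradient (\<lambda>\<mu>. u \<mu> - v \<mu>) \<mu> x = gradient u \<mu> x - gradient v \<mu> x"
proof -
  note gu = gradient_dir_deriv[OF u \<mu>] and gv = gradient_dir_deriv[OF v \<mu>]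
  have w: "(\<lambda>x. gradient u \<mu> x - gradient v \<mu> x) \<in> L2_space \<mu>" by (intro L2_diff gu gv)
  have d: "dir_deriv (\<lambda>\<mu>. u \<mu> - v \<mu>) \<mu> f = L2_inner \<mu> (\<lambda>x. gradient u \<mu> x - gradient v \<mu> x) f"
    if f: "f \<in> L2_space \<mu>" for f
  proof -
    have "((\<lambda>\<epsilon>. difference_quotient u \<mu> f \<epsilon> - difference_quotient v \<mu> f \<epsilon>) \<longlongrightarrow> dir_deriv u \<mu> f - dir_deriv v \<mu> f) (at 0)"
      by (intro tendsto_diff difference_quotient_tendsto u v \<mu> f)
    moreover have "(\<lambda>\<epsilon>. difference_quotient u \<mu> f \<epsilon> - difference_quotient v \<mu> f \<epsilon>) = difference_quotient (\<lambda>\<mu>. u \<mu> - v \<mu>) \<mu> f"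
      by (auto simp: difference_quotient_def diff_divide_distrib[symmetric] algebra_simps)
    ultimately have "dir_deriv (\<lambda>\<mu>. u \<mu> - v \<mu>) \<mu> f = dir_deriv u \<mu> f - dir_deriv v \<mu> f"
      unfolding dir_deriv_def[of "\<lambda>\<mu>. u \<mu> - v \<mu>"] by (intro tendsto_Lim) simp_all
    then show ?thesis using gu gv f by (simp add: L2_inner_diff_left)
  qed
  show "gradient (\<lambda>\<mu>. u \<mu> - v \<mu>) \<mu> \<in> L2_space \<mu>"
    "AE x in \<mu>. gradient (\<lambda>\<mu>. u \<mu> - v \<mu>) \<mu> x = gradient u \<mu> x - gradient v \<mu> x"
    using gradient_unique[OF w d] by auto
qed

text \<open>By \<open>chain_rule\<close> this is the \<open>L2\<close> gradient of
  \<open>f \<mapsto> u (push lam f)\<close>.\<close>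

definition pull_gradient ::
  "((real ^ 'd) measure \<Rightarrow> real) \<Rightarrow> (real ^ 'd) measure \<Rightarrow> (real ^ 'd \<Rightarrow> real ^ 'd) \<Rightarrow> real ^ 'd \<Rightarrow> real ^ 'd" where
  "pull_gradient u lam f = gradient u (push lam f) \<circ> f"

locale C1b_on_P2 =
  fixes lam :: "(real ^ 'd) measure" and u :: "(real ^ 'd) measure \<Rightarrow> real"
  assumes lam: "lam \<in> P2" and u: "u \<in> C1b_P2"
begin

sublocale prob_space lam using P2_D(2)[OF lam] .

lemma idiff: "intrinsically_differentiable u" using u by (simp add: C1b_P2_def)

lemma pull_gradient_L2: "f \<in> L2_space lam \<Longrightarrow> pull_gradient u lam f \<in> L2_space lam"
  unfolding pull_gradient_def comp_def
  by (rule L2_push(2)[OF lam _ gradient_dir_deriv(1)[OF idiff push_P2[OF lam]]])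

lemma continuous_bounded_version:
  obtains w C where "continuous_map (prod_topology P2_topology euclidean) euclidean (\<lambda>(\<mu>, x). w \<mu> x)"
    "\<And>\<mu> x. \<mu> \<in> P2 \<Longrightarrow> norm (w \<mu> x) \<le> C" "\<And>\<mu>. \<mu> \<in> P2 \<Longrightarrow> \<bar>u \<mu>\<bar> \<le> C"
    "\<And>f. f \<in> L2_space lam \<Longrightarrow> AE x in lam. pull_gradient u lam f x = w (push lam f) (f x)"
proof -
  obtain w C where w: "continuous_gradient_version u w" and C: "\<forall>\<mu>\<in>P2. \<forall>x. \<bar>u \<mu>\<bar> + norm (w \<mu> x) \<le> C"
    using u unfolding C1b_P2_def by blast
  have "norm (w \<mu> x) \<le> C" "\<bar>u \<mu>\<bar> \<le> C" if "\<mu> \<in> P2" for \<mu> x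
    using C[rule_format, OF that, of x] norm_ge_zero[of "w \<mu> x"] abs_ge_zero[of "u \<mu>"] by linarith+
  moreover have "AE x in lam. pull_gradient u lam f x = w (push lam f) (f x)" if f: "f \<in> L2_space lam" for f
  proof -
    have "AE x in push lam f. w (push lam f) x = gradient u (push lam f) x"
      using w push_P2[OF lam f] unfolding continuous_gradient_version_def by blast
    from AE_push[OF lam f this] show ?thesis by eventually_elim (simp add: pull_gradient_def)
  qed
  ultimately show ?thesis using that w unfolding continuous_gradient_version_def by blast
qed

lemma bounds:
  obtains C where "\<And>f. f \<in> L2_space lam \<Longrightarrow> \<bar>u (push lam f)\<bar> \<le> C"
    "\<And>f. f \<in> L2_space lam \<Longrightarrow> L2_norm lam (pull_gradient u lam f) \<le> C"
proof -
  obtain w C where "continuous_map (prod_topology P2_topology euclidean) euclidean (\<lambda>(\<mu>, x). w \<mu> x)"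
    and C: "\<And>\<mu> x. \<mu> \<in> P2 \<Longrightarrow> norm (w \<mu> x) \<le> C" "\<And>\<mu>. \<mu> \<in> P2 \<Longrightarrow> \<bar>u \<mu>\<bar> \<le> C"
    "\<And>f. f \<in> L2_space lam \<Longrightarrow> AE x in lam. pull_gradient u lam f x = w (push lam f) (f x)"
    by (rule continuous_bounded_version) blast
  have C0: "C \<ge> 0" using C(2)[OF lam] by linarith
  have "L2_norm lam (pull_gradient u lam f) \<le> C" if f: "f \<in> L2_space lam" for f
  proof -
    have c: "(\<lambda>x. C) \<in> L2_space lam" by (rule L2_const) unfold_locales
    have "L2_norm lam (pull_gradient u lam f) \<le> L2_norm lam (\<lambda>x. C)"
    proof (rule L2_norm_mono[OF pull_gradient_L2[OF f] c])
      show "AE x in lam. norm (pull_gradient u lam f x) \<le> norm C"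
        using C(3)[OF f] by eventually_elim (use C(1)[OF push_P2[OF lam f]] C0 in auto)
    qed
    also have "\<dots> = C" using C0 by (simp add: L2_norm_def L2_inner_def prob_space)
    finally show ?thesis .
  qed
  moreover have "\<bar>u (push lam f)\<bar> \<le> C" if "f \<in> L2_space lam" for f using C(2)[OF push_P2[OF lam that]] .
  ultimately show ?thesis using that by blast
qed

lemma u_push_tendsto:
  assumes "f \<in> L2_space lam" "\<And>n. F n \<in> L2_space lam" "(\<lambda>n. L2_norm lam (\<lambda>x. F n x - f x)) \<longlonglongrightarrow> 0"
  shows "(\<lambda>n. u (push lam (F n))) \<longlonglongrightarrow> u (push lam f)"
proof -
  have "continuous_map P2_topology euclideanreal u" using idiff by (simp add: intrinsically_differentiable_def)
  from continuous_map_limit[OF this limitin_push[OF lam assms]] show ?thesis by (simp add: comp_def)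
qed

text \<open>Joint continuity of the gradient version in measure and point gives almost everywhere
  convergence along subsequences, and its boundedness upgrades this to \<open>L2\<close>
  convergence.\<close>

lemma pull_gradient_tendsto:
  assumes f: "f \<in> L2_space lam" and F: "\<And>n. F n \<in> L2_space lam"
    and lim: "(\<lambda>n. L2_norm lam (\<lambda>x. F n x - f x)) \<longlonglongrightarrow> 0"
  shows "(\<lambda>n. L2_norm lam (\<lambda>x. pull_gradient u lam (F n) x - pull_gradient u lam f x)) \<longlonglongrightarrow> 0"
proof (rule tendsto_subsubseq)
  obtain w C where w: "continuous_map (prod_topology P2_topology euclidean) euclidean (\<lambda>(\<mu>, x). w \<mu> x)"
    and C: "\<And>\<mu> x. \<mu> \<in> P2 \<Longrightarrow> norm (w \<mu> x) \<le> C" and "\<And>\<mu>. \<mu> \<in> P2 \<Longrightarrow> \<bar>u \<mu>\<bar> \<le> C"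
    and ae: "\<And>f. f \<in> L2_space lam \<Longrightarrow> AE x in lam. pull_gradient u lam f x = w (push lam f) (f x)"
    by (rule continuous_bounded_version) blast
  fix r :: "nat \<Rightarrow> nat" assume r: "strict_mono r"
  have limr: "(\<lambda>n. L2_norm lam (\<lambda>x. F (r n) x - f x)) \<longlonglongrightarrow> 0"
    using LIMSEQ_subseq_LIMSEQ[OF lim r] by (simp add: comp_def)
  obtain s where s: "strict_mono s" "AE x in lam. (\<lambda>n. F (r (s n)) x) \<longlonglongrightarrow> f x"
    using L2_AE_subseq[of "\<lambda>n. F (r n)", OF F f limr] by blast
  have lims: "limitin P2_topology (\<lambda>n. push lam (F (r (s n)))) (push lam f) sequentially"
    using limitin_push[OF lam f, of "\<lambda>n. F (r (s n))"] F LIMSEQ_subseq_LIMSEQ[OF limr s(1)] by (simp add: comp_def)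
  have "AE x in lam. \<forall>n. pull_gradient u lam (F (r (s n))) x = w (push lam (F (r (s n)))) (F (r (s n)) x)"
    unfolding AE_all_countable using ae F by blast
  then have conv: "AE x in lam. (\<lambda>n. (norm (pull_gradient u lam (F (r (s n))) x - pull_gradient u lam f x))\<^sup>2) \<longlonglongrightarrow> 0"
    using s(2) ae[OF f]
  proof eventually_elim
    case (elim x)
    have "limitin (prod_topology P2_topology euclidean) (\<lambda>n. (push lam (F (r (s n))), F (r (s n)) x)) (push lam f, f x) sequentially"
      unfolding limitin_pairwise using lims elim(2) by (simp add: comp_def)
    from continuous_map_limit[OF w this]
    have "(\<lambda>n. pull_gradient u lam (F (r (s n))) x) \<longlonglongrightarrow> pull_gradient u lam f x"
      using elim(1,3) by (simp add: comp_def)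
    then have "(\<lambda>n. (norm (pull_gradient u lam (F (r (s n))) x - pull_gradient u lam f x))\<^sup>2) \<longlonglongrightarrow>
        (norm (pull_gradient u lam f x - pull_gradient u lam f x))\<^sup>2"
      by (intro tendsto_intros)
    then show ?case by simp
  qed
  note m = L2_measurable[OF pull_gradient_L2]
  have "(\<lambda>n. \<integral>x. (norm (pull_gradient u lam (F (r (s n))) x - pull_gradient u lam f x))\<^sup>2 \<partial>lam) \<longlonglongrightarrow> (\<integral>x. 0 \<partial>lam)"
  proof (rule integral_dominated_convergence[where w="\<lambda>x. (2 * C)\<^sup>2"])
    show "AE x in lam. norm ((norm (pull_gradient u lam (F (r (s n))) x - pull_gradient u lam f x))\<^sup>2) \<le> (2 * C)\<^sup>2" for n
      using ae[OF f] ae[OF F[of "r (s n)"]]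
    proof eventually_elim
      case (elim x)
      have "norm (pull_gradient u lam (F (r (s n))) x - pull_gradient u lam f x) \<le> C + C"
        unfolding elim
        by (intro order_trans[OF norm_triangle_ineq4] add_mono C push_P2 lam f F)
      then have "(norm (pull_gradient u lam (F (r (s n))) x - pull_gradient u lam f x))\<^sup>2 \<le> (2 * C)\<^sup>2"
        by (intro power_mono) auto
      then show ?case by simp
    qed
    show "(\<lambda>x. (norm (pull_gradient u lam (F (r (s n))) x - pull_gradient u lam f x))\<^sup>2) \<in> borel_measurable lam" for n
      using m[OF F[of "r (s n)"]] m[OF f] by measurable
  qed (use conv in auto)
  then have "(\<lambda>n. sqrt ((L2_norm lam (\<lambda>x. pull_gradient u lam (F (r (s n))) x - pull_gradient u lam f x))\<^sup>2)) \<longlonglongrightarrow> sqrt 0"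
    unfolding L2_norm_sq_integral by (intro tendsto_real_sqrt) simp
  then have "(\<lambda>n. L2_norm lam (\<lambda>x. pull_gradient u lam (F (r (s n))) x - pull_gradient u lam f x)) \<longlonglongrightarrow> 0" by simp
  with s(1) show "\<exists>s. strict_mono s \<and> (\<lambda>n. L2_norm lam (\<lambda>x. pull_gradient u lam (F (r (s n))) x - pull_gradient u lam f x)) \<longlonglongrightarrow> 0"
    by blast
qed

lemma line_tendsto:
  assumes "h \<in> L2_space lam" "t \<longlonglongrightarrow> s"
  shows "(\<lambda>n. L2_norm lam (\<lambda>x. (f x + t n *\<^sub>R h x) - (f x + s *\<^sub>R h x))) \<longlonglongrightarrow> 0"
proof -
  have "(\<lambda>n. \<bar>t n - s\<bar> * L2_norm lam h) \<longlonglongrightarrow> 0"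
    using assms(2) by (intro tendsto_mult_left_zero tendsto_rabs_zero LIM_zero)
  moreover have "L2_norm lam (\<lambda>x. (f x + t n *\<^sub>R h x) - (f x + s *\<^sub>R h x)) = \<bar>t n - s\<bar> * L2_norm lam h" for n
    using L2_norm_scaleR[of lam "t n - s" h] by (simp add: scaleR_diff_left)
  ultimately show ?thesis by simp
qed

lemma isCont_u_line:
  assumes "f \<in> L2_space lam" "h \<in> L2_space lam"
  shows "isCont (\<lambda>t. u (push lam (\<lambda>x. f x + t *\<^sub>R h x))) s"
  by (rule continuous_at_sequentiallyI) (intro u_push_tendsto line_tendsto L2_add_scaleR assms)

lemma isCont_pull_gradient_line:
  assumes "f \<in> L2_space lam" "h \<in> L2_space lam" "k \<in> L2_space lam"
  shows "isCont (\<lambda>t. L2_inner lam (pull_gradient u lam (\<lambda>x. f x + t *\<^sub>R h x)) k) s"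
  by (rule continuous_at_sequentiallyI)
    (intro tendsto_inner_L2 pull_gradient_tendsto line_tendsto pull_gradient_L2 L2_add_scaleR assms)

text \<open>Away from the finitely many times \<open>s\<close> at which two of the lines \<open>s \<mapsto> f x + s h x\<close> meet, the
  direction \<open>h\<close> is a function of \<open>f + s h\<close>, hence an intrinsic direction at \<open>push lam (f + s h)\<close>.\<close>

lemma chain_rule_simple:
  assumes f: "simple_function lam f" "f \<in> L2_space lam" and h: "simple_function lam h" "h \<in> L2_space lam"
    and ab: "a \<le> b"
  shows "((\<lambda>t. L2_inner lam (pull_gradient u lam (\<lambda>x. f x + t *\<^sub>R h x)) h) has_integral
      u (push lam (\<lambda>x. f x + b *\<^sub>R h x)) - u (push lam (\<lambda>x. f x + a *\<^sub>R h x))) {a..b}"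
proof -
  have sp: "space lam = UNIV" using P2_D(4)[OF lam] .
  have finf: "finite (range f)" "finite (range h)"
    using f(1) h(1) by (auto simp: simple_function_def sp)
  define Bad where "Bad = {s. \<exists>x y. f x + s *\<^sub>R h x = f y + s *\<^sub>R h y \<and> h x \<noteq> h y}"
  have "Bad \<subseteq> (\<Union>p\<in>(range f \<times> range h) \<times> (range f \<times> range h).
      {s. fst (fst p) + s *\<^sub>R snd (fst p) = fst (snd p) + s *\<^sub>R snd (snd p) \<and> snd (fst p) \<noteq> snd (snd p)})"
    unfolding Bad_def by fastforce
  moreover have "finite (\<Union>p\<in>(range f \<times> range h) \<times> (range f \<times> range h).
      {s. fst (fst p) + s *\<^sub>R snd (fst p) = fst (snd p) + s *\<^sub>R snd (snd p) \<and> snd (fst p) \<noteq> snd (snd p)})"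
  proof (rule finite_UN_I)
    \<comment> \<open>Two lines with different velocities \<open>e\<close> and \<open>e'\<close>
      meet at most once; the only possible time is the one picked by \<open>SOME\<close>.\<close>
    have one: "finite {s. c + s *\<^sub>R e = c' + s *\<^sub>R e' \<and> e \<noteq> e'}" for c e c' e' :: "real ^ 'd"
    proof (rule finite_subset[of _ "{SOME s. c + s *\<^sub>R e = c' + s *\<^sub>R e'}"])
      show "{s. c + s *\<^sub>R e = c' + s *\<^sub>R e' \<and> e \<noteq> e'} \<subseteq> {SOME s. c + s *\<^sub>R e = c' + s *\<^sub>R e'}"
      proof
        fix s assume "s \<in> {s. c + s *\<^sub>R e = c' + s *\<^sub>R e' \<and> e \<noteq> e'}"
        then have s: "c + s *\<^sub>R e = c' + s *\<^sub>R e'" "e \<noteq> e'" by auto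
        define r where "r = (SOME s. c + s *\<^sub>R e = c' + s *\<^sub>R e')"
        have r: "c + r *\<^sub>R e = c' + r *\<^sub>R e'" unfolding r_def using s(1) by (rule someI)
        have "(s - r) *\<^sub>R (e - e') = (c + s *\<^sub>R e) - (c + r *\<^sub>R e) - ((c' + s *\<^sub>R e') - (c' + r *\<^sub>R e'))"
          by (simp add: algebra_simps)
        also have "\<dots> = 0" unfolding s(1) r by simp
        finally show "s \<in> {SOME s. c + s *\<^sub>R e = c' + s *\<^sub>R e'}" using s(2) by (simp add: r_def)
      qed
    qed simp
    then show "finite {s. fst (fst p) + s *\<^sub>R snd (fst p) = fst (snd p) + s *\<^sub>R snd (snd p) \<and> snd (fst p) \<noteq> snd (snd p)}"
      for p :: "((real ^ 'd) \<times> (real ^ 'd)) \<times> ((real ^ 'd) \<times> (real ^ 'd))" .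
  qed (use finf in auto)
  ultimately have fin: "finite Bad" by (rule finite_subset)
  define \<phi> where "\<phi> t = u (push lam (\<lambda>x. f x + t *\<^sub>R h x))" for t
  have deriv: "(\<phi> has_real_derivative L2_inner lam (pull_gradient u lam (\<lambda>x. f x + s *\<^sub>R h x)) h) (at s)"
    if s: "s \<notin> Bad" for s
  proof -
    define f' where "f' = (\<lambda>x. f x + s *\<^sub>R h x)"
    have f': "f' \<in> L2_space lam" unfolding f'_def by (intro L2_add_scaleR f h)
    have finf': "finite (range f')"
    proof (rule finite_subset)
      show "range f' \<subseteq> (\<lambda>(c, e). c + s *\<^sub>R e) ` (range f \<times> range h)" by (auto simp: f'_def)
    qed (use finf in simp)
    \<comment> \<open>\<open>v\<close> carries \<open>h\<close> over to positions by reading it off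
      at some point of the fibre of \<open>f'\<close>. For \<open>s\<close> outside
      \<open>Bad\<close> the choice of that point does not matter.\<close>
    define v where "v y = (\<Sum>z\<in>range f'. indicator {z} y *\<^sub>R h (SOME x. f' x = z))" for y
    have vm: "v \<in> borel_measurable borel"
      unfolding v_def by (intro borel_measurable_sum borel_measurable_scaleR borel_measurable_indicator) auto
    have vf: "v (f' x) = h x" for x
    proof -
      have "v (f' x) = (\<Sum>z\<in>range f'. if z = f' x then h (SOME x. f' x = z) else 0)"
        unfolding v_def by (intro sum.cong) (auto simp: indicator_def)
      also have "\<dots> = h (SOME x'. f' x' = f' x)"
        using finf' by (simp add: sum.delta)
      also have "\<dots> = h x"
      proof -
        have "f' (SOME x'. f' x' = f' x) = f' x" by (rule someI) simp
        then show ?thesis using s unfolding Bad_def f'_def by blast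
      qed
      finally show ?thesis .
    qed
    have vL: "v \<in> L2_space (push lam f')" by (rule L2_pushI[OF lam f' vm]) (simp add: vf h)
    have P': "push lam f' \<in> P2" by (rule push_P2[OF lam f'])
    have g: "gradient u (push lam f') \<in> borel_measurable borel"
      by (rule L2_push(1)[OF lam f' gradient_dir_deriv(1)[OF idiff P']])
    have dd: "dir_deriv u (push lam f') v = L2_inner lam (pull_gradient u lam f') h"
      using gradient_dir_deriv(2)[OF idiff P' vL] L2_inner_push[OF lam f' g vm]
      by (simp add: vf pull_gradient_def comp_def)
    have pp: "push (push lam f') (\<lambda>x. x + \<epsilon> *\<^sub>R v x) = push lam (\<lambda>x. f x + (s + \<epsilon>) *\<^sub>R h x)" for \<epsilon>
    proof -
      have "push (push lam f') (\<lambda>x. x + \<epsilon> *\<^sub>R v x) = distr lam borel ((\<lambda>x. x + \<epsilon> *\<^sub>R v x) \<circ> f')"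
        unfolding push_def using vm L2_measurable[OF f'] by (intro distr_distr) auto
      also have "(\<lambda>x. x + \<epsilon> *\<^sub>R v x) \<circ> f' = (\<lambda>x. f x + (s + \<epsilon>) *\<^sub>R h x)"
      proof (rule ext)
        fix x
        show "((\<lambda>x. x + \<epsilon> *\<^sub>R v x) \<circ> f') x = f x + (s + \<epsilon>) *\<^sub>R h x"
          unfolding comp_def vf by (simp add: f'_def scaleR_add_left)
      qed
      finally show ?thesis by (simp add: push_def)
    qed
    have "(difference_quotient u (push lam f') v \<longlongrightarrow> L2_inner lam (pull_gradient u lam f') h) (at 0)"
      using difference_quotient_tendsto[OF idiff P' vL] dd by simp
    moreover have "difference_quotient u (push lam f') v = (\<lambda>\<epsilon>. (\<phi> (s + \<epsilon>) - \<phi> s) / \<epsilon>)"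
      by (rule ext, simp only: difference_quotient_def pp \<phi>_def) (simp only: f'_def)
    ultimately show ?thesis unfolding DERIV_def f'_def by simp
  qed
  have "((\<lambda>t. L2_inner lam (pull_gradient u lam (\<lambda>x. f x + t *\<^sub>R h x)) h) has_integral \<phi> b - \<phi> a) {a..b}"
  \<comment> \<open>Continuity of \<open>\<phi>\<close> on the whole interval bridges the finitely
    many times in \<open>Bad\<close>, where no derivative has been computed.\<close>
  proof (rule fundamental_theorem_of_calculus_interior_strong[OF fin ab])
    show "(\<phi> has_vector_derivative L2_inner lam (pull_gradient u lam (\<lambda>x. f x + s *\<^sub>R h x)) h) (at s)"
      if "s \<in> {a<..<b} - Bad" for s
      using deriv that by (simp add: has_real_derivative_iff_has_vector_derivative)
    show "continuous_on {a..b} \<phi>"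
      unfolding \<phi>_def by (intro continuous_at_imp_continuous_on ballI isCont_u_line f h)
  qed
  then show ?thesis by (simp add: \<phi>_def)
qed

text \<open>The integrated form is stable under \<open>L2\<close> limits: both endpoints converge by
  continuity of \<open>u\<close>, and the integrands converge boundedly on the interval.\<close>

lemma chain_rule_integral:
  assumes f: "f \<in> L2_space lam" and h: "h \<in> L2_space lam" and ab: "a \<le> b"
  shows "u (push lam (\<lambda>x. f x + b *\<^sub>R h x)) - u (push lam (\<lambda>x. f x + a *\<^sub>R h x)) =
     integral {a..b} (\<lambda>t. L2_inner lam (pull_gradient u lam (\<lambda>x. f x + t *\<^sub>R h x)) h)"
proof -
  obtain F where F: "\<And>n. simple_function lam (F n)" "\<And>n. F n \<in> L2_space lam"
    "(\<lambda>n. L2_norm lam (\<lambda>x. F n x - f x)) \<longlonglongrightarrow> 0" using L2_simple_approx[OF f] by blast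
  obtain H where H: "\<And>n. simple_function lam (H n)" "\<And>n. H n \<in> L2_space lam"
    "(\<lambda>n. L2_norm lam (\<lambda>x. H n x - h x)) \<longlonglongrightarrow> 0" using L2_simple_approx[OF h] by blast
  obtain C where "\<And>f. f \<in> L2_space lam \<Longrightarrow> \<bar>u (push lam f)\<bar> \<le> C"
    and C: "\<And>f. f \<in> L2_space lam \<Longrightarrow> L2_norm lam (pull_gradient u lam f) \<le> C"
    by (rule bounds) blast
  have C0: "C \<ge> 0" using order_trans[OF L2_norm_nonneg C[OF f]] .
  note L = L2_add_scaleR[OF F(2) H(2)] L2_add_scaleR[OF f h]
  have lim: "(\<lambda>n. L2_norm lam (\<lambda>x. (F n x + t *\<^sub>R H n x) - (f x + t *\<^sub>R h x))) \<longlonglongrightarrow> 0" for t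
  proof (rule Lim_null_comparison)
    show "\<forall>\<^sub>F n in sequentially. norm (L2_norm lam (\<lambda>x. (F n x + t *\<^sub>R H n x) - (f x + t *\<^sub>R h x)))
        \<le> L2_norm lam (\<lambda>x. F n x - f x) + \<bar>t\<bar> * L2_norm lam (\<lambda>x. H n x - h x)"
    proof (intro always_eventually allI)
      fix n
      have "L2_norm lam (\<lambda>x. (F n x - f x) + t *\<^sub>R (H n x - h x)) \<le>
          L2_norm lam (\<lambda>x. F n x - f x) + L2_norm lam (\<lambda>x. t *\<^sub>R (H n x - h x))"
        by (intro L2_norm_triangle L2_diff L2_scaleR F H f h)
      then show "norm (L2_norm lam (\<lambda>x. (F n x + t *\<^sub>R H n x) - (f x + t *\<^sub>R h x)))
        \<le> L2_norm lam (\<lambda>x. F n x - f x) + \<bar>t\<bar> * L2_norm lam (\<lambda>x. H n x - h x)"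
        unfolding L2_norm_scaleR by (simp add: algebra_simps)
    qed
    have "(\<lambda>n. L2_norm lam (\<lambda>x. F n x - f x) + \<bar>t\<bar> * L2_norm lam (\<lambda>x. H n x - h x)) \<longlonglongrightarrow> 0 + \<bar>t\<bar> * 0"
      by (intro tendsto_intros F H)
    then show "(\<lambda>n. L2_norm lam (\<lambda>x. F n x - f x) + \<bar>t\<bar> * L2_norm lam (\<lambda>x. H n x - h x)) \<longlonglongrightarrow> 0" by simp
  qed
  have "Bseq (\<lambda>n. L2_norm lam (H n))"
    by (rule convergent_imp_Bseq) (use tendsto_norm_L2[OF H(2) h H(3)] in \<open>auto simp: convergent_def\<close>)
  then obtain K where K: "\<And>n. L2_norm lam (H n) \<le> K" unfolding Bseq_def by (auto simp: abs_le_iff)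
  define \<psi> where "\<psi> n t = L2_inner lam (pull_gradient u lam (\<lambda>x. F n x + t *\<^sub>R H n x)) (H n)" for n t
  define \<psi>\<^sub>0 where "\<psi>\<^sub>0 t = L2_inner lam (pull_gradient u lam (\<lambda>x. f x + t *\<^sub>R h x)) h" for t
  have I: "(\<psi> n has_integral u (push lam (\<lambda>x. F n x + b *\<^sub>R H n x)) - u (push lam (\<lambda>x. F n x + a *\<^sub>R H n x))) {a..b}" for n
    unfolding \<psi>_def by (rule chain_rule_simple[OF F(1,2) H(1,2) ab])
  have bnd: "norm (\<psi> n t) \<le> C * K" for n t
  proof -
    have Ln: "(\<lambda>x. F n x + t *\<^sub>R H n x) \<in> L2_space lam" by (intro L2_add_scaleR F H)
    have "\<bar>\<psi> n t\<bar> \<le> L2_norm lam (pull_gradient u lam (\<lambda>x. F n x + t *\<^sub>R H n x)) * L2_norm lam (H n)"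
      unfolding \<psi>_def by (intro L2_Cauchy_Schwarz pull_gradient_L2 Ln H)
    also have "\<dots> \<le> C * K" by (intro mult_mono C Ln K C0 L2_norm_nonneg)
    finally show ?thesis by simp
  qed
  have conv: "(\<lambda>n. \<psi> n t) \<longlonglongrightarrow> \<psi>\<^sub>0 t" for t
  proof -
    let ?G = "\<lambda>n. pull_gradient u lam (\<lambda>x. F n x + t *\<^sub>R H n x)"
    let ?g = "pull_gradient u lam (\<lambda>x. f x + t *\<^sub>R h x)"
    have "(\<lambda>n. L2_inner lam (?G n) h) \<longlonglongrightarrow> \<psi>\<^sub>0 t"
      unfolding \<psi>\<^sub>0_def by (intro tendsto_inner_L2 pull_gradient_tendsto pull_gradient_L2 L h lim)
    moreover have "(\<lambda>n. L2_inner lam (?G n) (\<lambda>x. H n x - h x)) \<longlonglongrightarrow> 0"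
    proof (rule Lim_null_comparison)
      show "\<forall>\<^sub>F n in sequentially. norm (L2_inner lam (?G n) (\<lambda>x. H n x - h x)) \<le> C * L2_norm lam (\<lambda>x. H n x - h x)"
      proof (intro always_eventually allI)
        fix n
        have "\<bar>L2_inner lam (?G n) (\<lambda>x. H n x - h x)\<bar> \<le> L2_norm lam (?G n) * L2_norm lam (\<lambda>x. H n x - h x)"
          by (intro L2_Cauchy_Schwarz pull_gradient_L2 L L2_diff H h)
        also have "\<dots> \<le> C * L2_norm lam (\<lambda>x. H n x - h x)" by (intro mult_right_mono C L) simp
        finally show "norm (L2_inner lam (?G n) (\<lambda>x. H n x - h x)) \<le> C * L2_norm lam (\<lambda>x. H n x - h x)" by simp
      qed
      show "(\<lambda>n. C * L2_norm lam (\<lambda>x. H n x - h x)) \<longlonglongrightarrow> 0" using tendsto_mult_right_zero[OF H(3)] by simp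
    qed
    ultimately have "(\<lambda>n. L2_inner lam (?G n) h + L2_inner lam (?G n) (\<lambda>x. H n x - h x)) \<longlonglongrightarrow> \<psi>\<^sub>0 t + 0"
      by (rule tendsto_add)
    then show ?thesis
      unfolding \<psi>_def by (simp add: L2_inner_diff_right pull_gradient_L2 L H h)
  qed
  have "(\<lambda>n. integral {a..b} (\<psi> n)) \<longlonglongrightarrow> integral {a..b} \<psi>\<^sub>0"
    by (rule dominated_convergence(2)[where h="\<lambda>t. C * K"]) (use I bnd conv in \<open>auto intro: has_integral_integrable\<close>)
  moreover have "integral {a..b} (\<psi> n) = u (push lam (\<lambda>x. F n x + b *\<^sub>R H n x)) - u (push lam (\<lambda>x. F n x + a *\<^sub>R H n x))" for n
    using I by (rule integral_unique)
  moreover have "(\<lambda>n. u (push lam (\<lambda>x. F n x + b *\<^sub>R H n x)) - u (push lam (\<lambda>x. F n x + a *\<^sub>R H n x))) \<longlonglongrightarrow>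
      u (push lam (\<lambda>x. f x + b *\<^sub>R h x)) - u (push lam (\<lambda>x. f x + a *\<^sub>R h x))"
    by (intro tendsto_diff u_push_tendsto L lim)
  ultimately show ?thesis unfolding \<psi>\<^sub>0_def[abs_def] using LIMSEQ_unique by simp
qed

lemma chain_rule:
  assumes f: "f \<in> L2_space lam" and h: "h \<in> L2_space lam"
  shows "((\<lambda>t. u (push lam (\<lambda>x. f x + t *\<^sub>R h x))) has_real_derivative
     L2_inner lam (pull_gradient u lam (\<lambda>x. f x + s *\<^sub>R h x)) h) (at s)"
proof -
  define \<psi> where "\<psi> t = L2_inner lam (pull_gradient u lam (\<lambda>x. f x + t *\<^sub>R h x)) h" for t
  \<comment> \<open>An interval with \<open>s\<close> in its interior, so that the derivative within
    it is the derivative at \<open>s\<close>.\<close>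
  define a b where "a = s - 1" and "b = s + 1"
  have c: "continuous_on {a..b} \<psi>"
    unfolding \<psi>_def by (intro continuous_at_imp_continuous_on ballI isCont_pull_gradient_line f h)
  have "((\<lambda>x. u (push lam (\<lambda>y. f y + a *\<^sub>R h y)) + integral {a..x} \<psi>) has_real_derivative 0 + \<psi> s) (at s within {a..b})"
    by (intro DERIV_add DERIV_const integral_has_real_derivative[OF c]) (auto simp: a_def b_def)
  then have D: "((\<lambda>x. u (push lam (\<lambda>y. f y + a *\<^sub>R h y)) + integral {a..x} \<psi>) has_real_derivative \<psi> s) (at s within {a..b})"
    by simp
  have "((\<lambda>x. u (push lam (\<lambda>y. f y + x *\<^sub>R h y))) has_real_derivative \<psi> s) (at s within {a..b})"
  proof (rule has_field_derivative_transform_within[OF D zero_less_one])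
    show "s \<in> {a..b}" by (simp add: a_def b_def)
    fix x assume "x \<in> {a..b}"
    then have "a \<le> x" by simp
    from chain_rule_integral[OF f h this]
    show "u (push lam (\<lambda>y. f y + a *\<^sub>R h y)) + integral {a..x} \<psi> = u (push lam (\<lambda>y. f y + x *\<^sub>R h y))"
      unfolding \<psi>_def[abs_def] by simp
  qed
  then have "((\<lambda>x. u (push lam (\<lambda>y. f y + x *\<^sub>R h y))) has_real_derivative \<psi> s) (at s)"
    by (subst (asm) at_within_Icc_at) (auto simp: a_def b_def)
  then show ?thesis by (simp add: \<psi>_def)
qed

end

section \<open>Closability of the coordinate form\<close>

lemma L2_Cauchy_bounded:
  assumes p: "\<And>k. p k \<in> L2_space M"
    and cauchy: "\<And>e. e > 0 \<Longrightarrow> \<exists>N. \<forall>m\<ge>N. \<forall>n\<ge>N. L2_norm M (\<lambda>x. p m x - p n x) < e"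
  obtains B where "\<And>k::nat. L2_norm M (p k) \<le> B"
proof -
  obtain N where N: "\<forall>m\<ge>N. \<forall>n\<ge>N. L2_norm M (\<lambda>x. p m x - p n x) < 1" using cauchy[of 1] by auto
  define B where "B = 1 + L2_norm M (p N) + (\<Sum>k<N. L2_norm M (p k))"
  have "L2_norm M (p k) \<le> B" for k
  proof (cases "k < N")
    case True
    then have "L2_norm M (p k) \<le> (\<Sum>k<N. L2_norm M (p k))" by (intro member_le_sum) auto
    then show ?thesis using L2_norm_nonneg[of M "p N"] unfolding B_def by linarith
  next
    case False
    then have "L2_norm M (\<lambda>x. p k x - p N x) < 1" using N by simp
    moreover have "0 \<le> (\<Sum>k<N. L2_norm M (p k))" by (intro sum_nonneg) simp
    ultimately show ?thesis using L2_norm_le_diff[OF p[of k] p[of N]] unfolding B_def by linarith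
  qed
  then show ?thesis using that by blast
qed

text \<open>Boundedness of \<open>p\<close> makes the error of replacing \<open>q'\<close> by
  \<open>q j\<close> uniform in \<open>k\<close>.\<close>

lemma L2_weak_null_dense:
  assumes p: "\<And>k. p k \<in> L2_space M" and B: "\<And>k::nat. L2_norm M (p k) \<le> B"
    and q: "\<And>j::nat. q j \<in> L2_space M" "q' \<in> L2_space M"
    and lim: "(\<lambda>j. L2_norm M (\<lambda>x. q j x - q' x)) \<longlonglongrightarrow> 0"
    and weak: "\<And>j. (\<lambda>k. L2_inner M (p k) (q j)) \<longlonglongrightarrow> 0"
  shows "(\<lambda>k. L2_inner M (p k) q') \<longlonglongrightarrow> 0"
proof (rule LIMSEQ_I)
  fix e :: real assume e: "e > 0"
  have B0: "B \<ge> 0" using order_trans[OF L2_norm_nonneg B] .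
  obtain j where j: "L2_norm M (\<lambda>x. q j x - q' x) < e / (2 * (B + 1))"
    using LIMSEQ_D[OF lim, of "e / (2 * (B + 1))"] e B0 by auto
  obtain N where N: "\<And>k. k \<ge> N \<Longrightarrow> \<bar>L2_inner M (p k) (q j)\<bar> < e / 2"
    using LIMSEQ_D[OF weak[of j], of "e / 2"] e by auto
  have "norm (L2_inner M (p k) q' - 0) < e" if "k \<ge> N" for k
  proof -
    have "L2_inner M (p k) q' = L2_inner M (p k) (q j) - L2_inner M (p k) (\<lambda>x. q j x - q' x)"
      by (simp add: L2_inner_diff_right p q)
    moreover have "\<bar>L2_inner M (p k) (\<lambda>x. q j x - q' x)\<bar> \<le> e / 2"
    proof -
      have "\<bar>L2_inner M (p k) (\<lambda>x. q j x - q' x)\<bar> \<le> L2_norm M (p k) * L2_norm M (\<lambda>x. q j x - q' x)"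
        by (intro L2_Cauchy_Schwarz p L2_diff q)
      also have "\<dots> \<le> B * (e / (2 * (B + 1)))"
        using j B0 by (intro mult_mono B) auto
      also have "\<dots> \<le> e / 2" using e B0 by (simp add: field_simps)
      finally show ?thesis .
    qed
    ultimately show ?thesis using N[OF that] by (simp del: less_divide_eq_numeral1)
  qed
  then show "\<exists>N. \<forall>k\<ge>N. norm (L2_inner M (p k) q' - 0) < e" by blast
qed

text \<open>The abstract core of closability. The squared norm of \<open>p k\<close> is its pairing
  with \<open>p k - p m\<close>, small by the Cauchy property, plus its pairing with a fixed
  \<open>p m\<close>, small by weak convergence.\<close>

lemma L2_Cauchy_weak_null:
  assumes p: "\<And>k. p k \<in> L2_space M"
    and cauchy: "\<And>e. e > 0 \<Longrightarrow> \<exists>N. \<forall>m\<ge>N. \<forall>n\<ge>N. L2_norm M (\<lambda>x. p m x - p n x) < e"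
    and weak: "\<And>m::nat. (\<lambda>k. L2_inner M (p k) (p m)) \<longlonglongrightarrow> 0"
  shows "(\<lambda>k. L2_norm M (p k)) \<longlonglongrightarrow> 0"
proof (rule LIMSEQ_I)
  fix e :: real assume e: "e > 0"
  obtain B where B: "\<And>k. L2_norm M (p k) \<le> B" using L2_Cauchy_bounded[OF p cauchy] by blast
  have B0: "B \<ge> 0" using order_trans[OF L2_norm_nonneg B] .
  \<comment> \<open>Chosen so that \<open>B * d \<le> e\<^sup>2 / 2\<close>; the summand 1 covers
    \<open>B = 0\<close>.\<close>
  define d where "d = e\<^sup>2 / (2 * (B + 1))"
  have d: "d > 0" using e B0 by (simp add: d_def)
  obtain m where m: "\<forall>k\<ge>m. \<forall>n\<ge>m. L2_norm M (\<lambda>x. p k x - p n x) < d" using cauchy[OF d] by blast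
  obtain N where N: "\<And>k. k \<ge> N \<Longrightarrow> \<bar>L2_inner M (p k) (p m)\<bar> < e\<^sup>2 / 2"
    using LIMSEQ_D[OF weak[of m], of "e\<^sup>2 / 2"] e by auto
  have "norm (L2_norm M (p k) - 0) < e" if k: "k \<ge> max N m" for k
  proof -
    have "(L2_norm M (p k))\<^sup>2 = L2_inner M (p k) (\<lambda>x. p k x - p m x) + L2_inner M (p k) (p m)"
      by (simp add: L2_norm_sq L2_inner_diff_right p)
    also have "\<dots> < L2_norm M (p k) * L2_norm M (\<lambda>x. p k x - p m x) + e\<^sup>2 / 2"
      using L2_Cauchy_Schwarz[OF p[of k] L2_diff[OF p[of k] p[of m]]] N[of k] k by (simp add: abs_le_iff abs_less_iff) linarith
    also have "L2_norm M (p k) * L2_norm M (\<lambda>x. p k x - p m x) \<le> B * d"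
      using m k B0 by (intro mult_mono B) (auto intro: less_imp_le)
    also have "B * d \<le> e\<^sup>2 / 2" using e B0 by (simp add: d_def field_simps)
    finally have "(L2_norm M (p k))\<^sup>2 < e\<^sup>2" by simp
    then show ?thesis using e by (simp add: power2_less_imp_less)
  qed
  then show "\<exists>N. \<forall>k\<ge>N. norm (L2_norm M (p k) - 0) < e" by blast
qed

context L2_gaussian
begin

text \<open>A vector field on \<open>L\<^sup>2\<close> is identified with its coordinates, a function on \<open>\<nat> \<times> L\<^sup>2\<close>. For the
  weights \<open>\<alpha>\<close> on \<open>\<nat>\<close>, the form \<open>\<integral> \<langle>V, S W\<rangle> dG\<close> becomes the inner product of \<open>L\<^sup>2\<close> functions.\<close>

definition NG :: "(nat \<times> ('a \<Rightarrow> 'b)) measure" where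
  "NG = density (count_space UNIV) (\<lambda>n. ennreal (\<alpha> n)) \<Otimes>\<^sub>M G"

definition coords :: "(('a \<Rightarrow> 'b) \<Rightarrow> 'a \<Rightarrow> 'b) \<Rightarrow> nat \<times> ('a \<Rightarrow> 'b) \<Rightarrow> real" where
  "coords V = (\<lambda>(n, f). coord n (V f))"

text \<open>Measurability of the field itself is demanded coordinate by coordinate, which is the
  form that \<open>coords\<close> needs.\<close>

definition L2_field :: "(('a \<Rightarrow> 'b) \<Rightarrow> 'a \<Rightarrow> 'b) \<Rightarrow> bool" where
  "L2_field V \<longleftrightarrow> (\<forall>f\<in>L2_space M. V f \<in> L2_space M) \<and> (\<forall>n. (\<lambda>f. coord n (V f)) \<in> borel_measurable G) \<and>
     integrable G (\<lambda>f. (L2_norm M (V f))\<^sup>2)"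

abbreviation weights :: "nat measure" where
  "weights \<equiv> density (count_space UNIV) (\<lambda>n. ennreal (\<alpha> n))"

section \<open>Coordinates of vector fields as elements of \<open>L2_space NG\<close>\<close>

lemma \<alpha>_le: "\<alpha> n \<le> suminf \<alpha>"
  using sum_le_suminf[OF \<alpha>_summable, of "{n}"] \<alpha>_pos by (auto intro: less_imp_le)

lemma finite_weights: "finite_measure weights"
proof
  have "emeasure weights (space weights) = (\<Sum>n. ennreal (\<alpha> n))"
    by (simp add: emeasure_density nn_integral_count_space_nat)
  also have "\<dots> = ennreal (suminf \<alpha>)"
    using \<alpha>_pos \<alpha>_summable by (intro suminf_ennreal2) (auto intro: less_imp_le)
  finally show "emeasure weights (space weights) \<noteq> \<infinity>" by simp
qed

sublocale W: finite_measure weights by (rule finite_weights)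
sublocale WG: pair_sigma_finite weights G ..

lemma measurable_NG:
  assumes "\<And>n. (\<lambda>f. p (n, f)) \<in> borel_measurable G"
  shows "p \<in> borel_measurable NG"
proof -
  have "p \<in> borel_measurable (count_space UNIV \<Otimes>\<^sub>M G)"
    by (rule measurable_pair_measure_countable1) (use assms in auto)
  also have "borel_measurable (count_space UNIV \<Otimes>\<^sub>M G) = borel_measurable NG"
    unfolding NG_def by (intro measurable_cong_sets sets_pair_measure_cong) auto
  finally show ?thesis .
qed

lemma integral_weights:
  fixes c :: "nat \<Rightarrow> real"
  assumes "summable (\<lambda>n. \<bar>\<alpha> n * c n\<bar>)"
  shows "(\<integral>n. c n \<partial>weights) = (\<Sum>n. \<alpha> n * c n)"
proof -
  have "(\<integral>n. c n \<partial>weights) = (\<integral>n. \<alpha> n * c n \<partial>count_space UNIV)"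
    using \<alpha>_pos by (subst integral_density) (auto intro: less_imp_le)
  also have "\<dots> = (\<Sum>n. \<alpha> n * c n)"
    by (rule integral_count_space_nat) (use assms in \<open>simp add: integrable_count_space_nat_iff\<close>)
  finally show ?thesis .
qed

text \<open>Every single weight is at most \<open>suminf \<alpha>\<close>, so Parseval's identity
  bounds the weighted sum of the squared coordinates.\<close>

lemma coords_L2:
  assumes V: "L2_field V"
  shows "coords V \<in> L2_space NG" "(L2_norm NG (coords V))\<^sup>2 \<le> suminf \<alpha> * (\<integral>f. (L2_norm M (V f))\<^sup>2 \<partial>G)"
proof -
  have VL: "V f \<in> L2_space M" if "f \<in> L2_space M" for f using V that by (auto simp: L2_field_def)
  have m[measurable]: "coords V \<in> borel_measurable NG"
    by (rule measurable_NG) (use V in \<open>auto simp: coords_def L2_field_def\<close>)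
  have A0: "suminf \<alpha> \<ge> 0" using \<alpha>_le[of 0] \<alpha>_pos[of 0] by linarith
  have in_le: "(\<integral>\<^sup>+n. ennreal ((coord n h)\<^sup>2) \<partial>weights) \<le> ennreal (suminf \<alpha> * (L2_norm M h)\<^sup>2)"
    if h: "h \<in> L2_space M" for h
  proof -
    have "(\<integral>\<^sup>+n. ennreal ((coord n h)\<^sup>2) \<partial>weights) = (\<Sum>n. ennreal (\<alpha> n * (coord n h)\<^sup>2))"
      using \<alpha>_pos by (subst nn_integral_density) (auto simp: nn_integral_count_space_nat ennreal_mult' less_imp_le)
    also have "\<dots> \<le> (\<Sum>n. ennreal (suminf \<alpha> * (coord n h)\<^sup>2))"
      using \<alpha>_le by (intro suminf_le allI ennreal_leI mult_right_mono) auto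
    also have "\<dots> = ennreal (\<Sum>n. suminf \<alpha> * (coord n h)\<^sup>2)"
      using A0 summable_coord_sq[OF h] by (intro suminf_ennreal2 summable_mult) auto
    also have "(\<Sum>n. suminf \<alpha> * (coord n h)\<^sup>2) = suminf \<alpha> * (L2_norm M h)\<^sup>2"
      using sums_unique[OF Parseval[OF h]] summable_coord_sq[OF h] by (simp add: suminf_mult)
    finally show ?thesis .
  qed
  have "(\<integral>\<^sup>+z. ennreal ((norm (coords V z))\<^sup>2) \<partial>NG) = (\<integral>\<^sup>+f. (\<integral>\<^sup>+n. ennreal ((norm (coords V (n, f)))\<^sup>2) \<partial>weights) \<partial>G)"
    unfolding NG_def using m[unfolded NG_def] by (subst WG.nn_integral_snd[symmetric]) auto
  also have "\<dots> \<le> (\<integral>\<^sup>+f. ennreal (suminf \<alpha> * (L2_norm M (V f))\<^sup>2) \<partial>G)"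
    by (intro nn_integral_mono) (use in_le[OF VL] in \<open>simp add: coords_def\<close>)
  also have "\<dots> = ennreal (\<integral>f. suminf \<alpha> * (L2_norm M (V f))\<^sup>2 \<partial>G)"
    using V A0 by (intro nn_integral_eq_integral) (auto simp: L2_field_def)
  finally have le: "(\<integral>\<^sup>+z. ennreal ((norm (coords V z))\<^sup>2) \<partial>NG) \<le> ennreal (suminf \<alpha> * (\<integral>f. (L2_norm M (V f))\<^sup>2 \<partial>G))"
    by simp
  have "integrable NG (\<lambda>z. (norm (coords V z))\<^sup>2)"
    by (rule integrableI_bounded) (use le in \<open>auto intro: le_less_trans\<close>)
  then show L: "coords V \<in> L2_space NG" by (simp add: L2_space_def)
  have "ennreal ((L2_norm NG (coords V))\<^sup>2) \<le> ennreal (suminf \<alpha> * (\<integral>f. (L2_norm M (V f))\<^sup>2 \<partial>G))"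
    unfolding L2_norm_sq_integral[of NG] using le L2_integrable_sq[OF L] by (subst (asm) nn_integral_eq_integral) auto
  then show "(L2_norm NG (coords V))\<^sup>2 \<le> suminf \<alpha> * (\<integral>f. (L2_norm M (V f))\<^sup>2 \<partial>G)"
    using A0 by (subst (asm) ennreal_le_iff) (auto intro!: mult_nonneg_nonneg Bochner_Integration.integral_nonneg)
qed

lemma coords_inner_abs_summable:
  assumes "f \<in> L2_space M" "h \<in> L2_space M"
  shows "summable (\<lambda>n. \<bar>\<alpha> n * (coord n f * coord n h)\<bar>)"
proof (rule summable_comparison_test')
  show "summable (\<lambda>n. suminf \<alpha> * ((coord n f)\<^sup>2 + (coord n h)\<^sup>2))"
    by (intro summable_mult summable_add summable_coord_sq assms)
  fix n :: nat
  have "2 * \<bar>coord n f * coord n h\<bar> \<le> (coord n f)\<^sup>2 + (coord n h)\<^sup>2"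
    using sum_squares_bound[of "\<bar>coord n f\<bar>" "\<bar>coord n h\<bar>"] by (simp add: abs_mult)
  then have "\<bar>coord n f * coord n h\<bar> \<le> (coord n f)\<^sup>2 + (coord n h)\<^sup>2"
    using abs_ge_zero[of "coord n f * coord n h"] by linarith
  then have "\<bar>\<alpha> n * (coord n f * coord n h)\<bar> \<le> suminf \<alpha> * ((coord n f)\<^sup>2 + (coord n h)\<^sup>2)"
    unfolding abs_mult[of "\<alpha> n"] using \<alpha>_le[of n] \<alpha>_pos[of n] by (intro mult_mono) auto
  then show "norm \<bar>\<alpha> n * (coord n f * coord n h)\<bar> \<le> suminf \<alpha> * ((coord n f)\<^sup>2 + (coord n h)\<^sup>2)" by simp
qed

lemma coords_inner:
  assumes V: "L2_field V" and W: "L2_field W"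
  shows "L2_inner NG (coords V) (coords W) = (\<integral>f. L2_inner M (V f) (S (W f)) \<partial>G)"
proof -
  have VL: "V f \<in> L2_space M" "W f \<in> L2_space M" if "f \<in> L2_space M" for f using V W that by (auto simp: L2_field_def)
  have i: "integrable (weights \<Otimes>\<^sub>M G) (\<lambda>(n, f). coord n (V f) * coord n (W f))"
    using L2_integrable_inner[OF coords_L2(1)[OF V] coords_L2(1)[OF W]] by (simp add: NG_def coords_def split_beta')
  have "L2_inner NG (coords V) (coords W) = (\<integral>f. (\<integral>n. coord n (V f) * coord n (W f) \<partial>weights) \<partial>G)"
    unfolding WG.integral_snd[OF i] by (simp add: L2_inner_def NG_def coords_def split_beta')
  also have "\<dots> = (\<integral>f. L2_inner M (V f) (S (W f)) \<partial>G)"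
  proof (rule Bochner_Integration.integral_cong[OF refl])
    fix f assume "f \<in> space G"
    then have f: "V f \<in> L2_space M" "W f \<in> L2_space M" using VL by auto
    show "(\<integral>n. coord n (V f) * coord n (W f) \<partial>weights) = L2_inner M (V f) (S (W f))"
      unfolding integral_weights[OF coords_inner_abs_summable[OF f]]
      using sums_unique[OF S_inner[OF f]] by (simp add: mult.assoc)
  qed
  finally show ?thesis .
qed

text \<open>Cutting off all but \<open>N\<close> directions turns the inner product over
  \<open>NG\<close> into a finite sum of integrals over \<open>G\<close>, to which integration by
  parts in a single direction applies.\<close>

lemma inner_NG_truncated:
  assumes p: "p \<in> L2_space NG" and q: "q \<in> L2_space NG"
  shows "L2_inner NG p (\<lambda>z. if fst z < N then q z else 0) = (\<Sum>n<N. \<alpha> n * (\<integral>f. p (n, f) * q (n, f) \<partial>G))"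
proof -
  have m: "(\<lambda>z. if fst z < N then q z else 0) \<in> borel_measurable NG"
  proof -
    have "(\<lambda>z. fst z) \<in> measurable NG (count_space UNIV)" unfolding NG_def
      by (rule measurable_compose[OF measurable_fst]) simp
    then show ?thesis using L2_measurable[OF q] by measurable
  qed
  have tr: "(\<lambda>z. if fst z < N then q z else 0) \<in> L2_space NG"
    by (rule L2_bound[OF m q]) simp
  have i: "integrable (weights \<Otimes>\<^sub>M G) (\<lambda>(n, f). p (n, f) * (if n < N then q (n, f) else 0))"
    using L2_integrable_inner[OF p tr] by (simp add: NG_def split_beta' cong: if_cong)
  have "L2_inner NG p (\<lambda>z. if fst z < N then q z else 0) = (\<integral>n. (\<integral>f. p (n, f) * (if n < N then q (n, f) else 0) \<partial>G) \<partial>weights)"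
    unfolding WG.integral_fst[OF i] by (simp add: L2_inner_def NG_def split_beta' cong: if_cong)
  also have "\<dots> = (\<integral>n. (if n < N then \<integral>f. p (n, f) * q (n, f) \<partial>G else 0) \<partial>weights)"
    by (intro Bochner_Integration.integral_cong refl) auto
  also have "\<dots> = (\<Sum>n. \<alpha> n * (if n < N then \<integral>f. p (n, f) * q (n, f) \<partial>G else 0))"
    by (rule integral_weights, rule summable_finite[of "{..<N}"]) auto
  also have "\<dots> = (\<Sum>n<N. \<alpha> n * (\<integral>f. p (n, f) * q (n, f) \<partial>G))"
    by (subst suminf_finite[of "{..<N}"]) auto
  finally show ?thesis .
qed

lemma truncation_tendsto:
  assumes q: "q \<in> L2_space NG"
  shows "(\<lambda>z. if fst z < N then q z else 0) \<in> L2_space NG"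
    "(\<lambda>N. L2_norm NG (\<lambda>z. (if fst z < N then q z else 0) - q z)) \<longlonglongrightarrow> 0"
proof -
  have m: "(\<lambda>z. if fst z < N then q z else 0) \<in> borel_measurable NG" for N
  proof -
    have "(\<lambda>z. fst z) \<in> measurable NG (count_space UNIV)" unfolding NG_def
      by (rule measurable_compose[OF measurable_fst]) simp
    then show ?thesis using L2_measurable[OF q] by measurable
  qed
  show "(\<lambda>z. if fst z < N then q z else 0) \<in> L2_space NG"
    by (rule L2_bound[OF m q]) simp
  have "(\<lambda>N. \<integral>z. (norm ((if fst z < N then q z else 0) - q z))\<^sup>2 \<partial>NG) \<longlonglongrightarrow> (\<integral>z. 0 \<partial>NG)"
  proof (rule integral_dominated_convergence[where w="\<lambda>z. (norm (q z))\<^sup>2"])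
    show "integrable NG (\<lambda>z. (norm (q z))\<^sup>2)" by (rule L2_integrable_sq[OF q])
    show "(\<lambda>z. (norm ((if fst z < N then q z else 0) - q z))\<^sup>2) \<in> borel_measurable NG" for N
      using m L2_measurable[OF q] by measurable
    have "(\<lambda>N. (norm ((if fst z < N then q z else 0) - q z))\<^sup>2) \<longlonglongrightarrow> 0" for z
      by (rule tendsto_eventually) (auto simp: eventually_sequentially intro!: exI[of _ "Suc (fst z)"])
    then show "AE z in NG. (\<lambda>N. (norm ((if fst z < N then q z else 0) - q z))\<^sup>2) \<longlonglongrightarrow> 0" by simp
  qed auto
  then have "(\<lambda>N. sqrt ((L2_norm NG (\<lambda>z. (if fst z < N then q z else 0) - q z))\<^sup>2)) \<longlonglongrightarrow> sqrt 0"
    unfolding L2_norm_sq_integral by (intro tendsto_real_sqrt) simp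
  then show "(\<lambda>N. L2_norm NG (\<lambda>z. (if fst z < N then q z else 0) - q z)) \<longlonglongrightarrow> 0" by simp
qed

lemma shift_measurable [measurable]: "(\<lambda>f x. f x + t *\<^sub>R g n x) \<in> measurable G G"
proof -
  have "(\<lambda>f x. f x + t *\<^sub>R g n x) \<in> measurable G (L2_borel M)"
  proof (rule measurable_into_L2_borel)
    fix i
    have "(\<lambda>f. coord i (\<lambda>x. f x + t *\<^sub>R g n x)) \<in> borel_measurable G \<longleftrightarrow>
        (\<lambda>f. coord i f + t * L2_inner M (g n) (g i)) \<in> borel_measurable G"
      by (rule measurable_cong) (auto simp: L2_inner_add_left L2_scaleR L2_inner_scaleR_left)
    also have "\<dots>" by measurable
    finally show "(\<lambda>f. coord i (\<lambda>x. f x + t *\<^sub>R g n x)) \<in> borel_measurable G" .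
  qed (auto intro: L2_add_scaleR)
  then show ?thesis using measurable_cong_sets[OF refl sets_G] by blast
qed

text \<open>What the Gaussian argument uses of the pull-back of a function in \<open>C1b_P2\<close>.
  Differentiability is a condition on lines in basis directions, matching
  \<open>Gaussian_integration_by_parts\<close>, and the class is stable under differences.\<close>

definition C1b_functional :: "(('a \<Rightarrow> 'b) \<Rightarrow> real) \<Rightarrow> (('a \<Rightarrow> 'b) \<Rightarrow> 'a \<Rightarrow> 'b) \<Rightarrow> bool" where
  "C1b_functional F V \<longleftrightarrow> F \<in> borel_measurable G \<and> L2_field V \<and>
     (\<forall>n. \<forall>f\<in>L2_space M. \<forall>t.
        ((\<lambda>t. F (\<lambda>x. f x + t *\<^sub>R g n x)) has_real_derivative coord n (V (\<lambda>x. f x + t *\<^sub>R g n x))) (at t) \<and>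
        isCont (\<lambda>t. coord n (V (\<lambda>x. f x + t *\<^sub>R g n x))) t) \<and>
     (\<exists>C. \<forall>f\<in>L2_space M. \<bar>F f\<bar> \<le> C \<and> L2_norm M (V f) \<le> C)"

lemma C1b_functionalD:
  assumes "C1b_functional F V"
  shows "F \<in> borel_measurable G" "L2_field V"
    "\<And>f. f \<in> L2_space M \<Longrightarrow> V f \<in> L2_space M" "(\<lambda>f. coord n (V f)) \<in> borel_measurable G"
    "\<And>f. f \<in> L2_space M \<Longrightarrow>
      ((\<lambda>t. F (\<lambda>x. f x + t *\<^sub>R g n x)) has_real_derivative coord n (V (\<lambda>x. f x + t *\<^sub>R g n x))) (at t)"
    "\<And>f. f \<in> L2_space M \<Longrightarrow> isCont (\<lambda>t. coord n (V (\<lambda>x. f x + t *\<^sub>R g n x))) t"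
  using assms by (auto simp: C1b_functional_def L2_field_def)

lemma C1b_functional_bound:
  assumes "C1b_functional F V"
  obtains C where "C \<ge> 0" "\<And>f. f \<in> L2_space M \<Longrightarrow> \<bar>F f\<bar> \<le> C"
    "\<And>f. f \<in> L2_space M \<Longrightarrow> L2_norm M (V f) \<le> C" "\<And>f n. f \<in> L2_space M \<Longrightarrow> \<bar>coord n (V f)\<bar> \<le> C"
proof -
  obtain C where C: "\<forall>f\<in>L2_space M. \<bar>F f\<bar> \<le> C \<and> L2_norm M (V f) \<le> C"
    using assms by (auto simp: C1b_functional_def)
  have "C \<ge> 0" using C L2_zero order_trans[OF L2_norm_nonneg] by blast
  moreover have "\<bar>coord n (V f)\<bar> \<le> C" if "f \<in> L2_space M" for f n
    using L2_Cauchy_Schwarz[OF C1b_functionalD(3)[OF assms that] g_L2[of n]] C that by fastforce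
  ultimately show ?thesis using that C by blast
qed

lemma C1b_functional_L2:
  assumes "C1b_functional F V"
  shows "F \<in> L2_space G" "(\<lambda>f. coord n (V f)) \<in> L2_space G"
proof -
  obtain C where C: "C \<ge> 0" "\<And>f. f \<in> L2_space M \<Longrightarrow> \<bar>F f\<bar> \<le> C"
    "\<And>f. f \<in> L2_space M \<Longrightarrow> L2_norm M (V f) \<le> C" "\<And>f n. f \<in> L2_space M \<Longrightarrow> \<bar>coord n (V f)\<bar> \<le> C"
    using C1b_functional_bound[OF assms] by blast
  show "F \<in> L2_space G" "(\<lambda>f. coord n (V f)) \<in> L2_space G"
    by (rule G.L2_I_bounded[where C=C]; use C C1b_functionalD[OF assms] in simp)+
qed

lemma C1b_functional_lipschitz:
  assumes FV: "C1b_functional F V" and C: "\<And>f n. f \<in> L2_space M \<Longrightarrow> \<bar>coord n (V f)\<bar> \<le> C" and f: "f \<in> L2_space M"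
  shows "\<bar>F (\<lambda>x. f x + t *\<^sub>R g n x) - F f\<bar> \<le> C * \<bar>t\<bar>"
proof -
  have "norm (F (\<lambda>x. f x + t *\<^sub>R g n x) - F (\<lambda>x. f x + 0 *\<^sub>R g n x)) \<le> C * norm (t - 0)"
    by (rule field_differentiable_bound[of UNIV "\<lambda>t. F (\<lambda>x. f x + t *\<^sub>R g n x)" "\<lambda>t. coord n (V (\<lambda>x. f x + t *\<^sub>R g n x))"])
      (use C1b_functionalD(5)[OF FV f] C[OF L2_add_scaleR[OF f g_L2]] in auto)
  then show ?thesis by simp
qed

text \<open>Moving the derivative off \<open>W k\<close> would require a second derivative of
  \<open>F\<close>. The test function is therefore replaced by the difference quotients
  \<open>K j\<close> of \<open>F\<close>, which are themselves differentiable along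
  \<open>g n\<close> and converge to the derivative in \<open>L2\<close> by bounded
  convergence.\<close>

lemma partial_derivative_weak_null:
  assumes W: "\<And>k. C1b_functional (W k) (V k)"
    and null: "(\<lambda>k. L2_norm G (W k)) \<longlonglongrightarrow> 0"
    and B: "\<And>k::nat. L2_norm G (\<lambda>f. coord n (V k f)) \<le> B"
    and FU: "C1b_functional F U"
  shows "(\<lambda>k. L2_inner G (\<lambda>f. coord n (V k f)) (\<lambda>f. coord n (U f))) \<longlonglongrightarrow> 0"
proof -
  obtain C where C: "C \<ge> 0" "\<And>f. f \<in> L2_space M \<Longrightarrow> \<bar>F f\<bar> \<le> C"
    "\<And>f. f \<in> L2_space M \<Longrightarrow> L2_norm M (U f) \<le> C" "\<And>f n. f \<in> L2_space M \<Longrightarrow> \<bar>coord n (U f)\<bar> \<le> C"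
    using C1b_functional_bound[OF FU] by blast
  define t where "t j = inverse (real (Suc j))" for j
  have tpos: "t j > 0" for j by (simp add: t_def)
  have t0: "t \<longlonglongrightarrow> 0" unfolding t_def by (rule LIMSEQ_inverse_real_of_nat)
  define K where "K j f = (F (\<lambda>x. f x + t j *\<^sub>R g n x) - F f) / t j" for j f
  define K' where "K' j f = (coord n (U (\<lambda>x. f x + t j *\<^sub>R g n x)) - coord n (U f)) / t j" for j f
  note [measurable] = C1b_functionalD(1,4)[OF FU] C1b_functionalD(1,4)[OF W]
  have [measurable]: "(\<lambda>f. F (\<lambda>x. f x + t j *\<^sub>R g n x)) \<in> borel_measurable G"
    "(\<lambda>f. coord n (U (\<lambda>x. f x + t j *\<^sub>R g n x))) \<in> borel_measurable G" for j
    using measurable_compose[OF shift_measurable C1b_functionalD(1)[OF FU]]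
      measurable_compose[OF shift_measurable C1b_functionalD(4)[OF FU]] by auto
  have K[measurable]: "K j \<in> borel_measurable G" "K' j \<in> borel_measurable G" for j
    unfolding K_def K'_def by measurable
  have Kb: "\<bar>K j f\<bar> \<le> C" if "f \<in> L2_space M" for j f
    using C1b_functional_lipschitz[OF FU C(4) that, of "t j" n] tpos[of j]
    by (simp add: K_def abs_divide field_simps)
  have K'b: "\<bar>K' j f\<bar> \<le> 2 * C / t j" if f: "f \<in> L2_space M" for j f
  proof -
    have "\<bar>coord n (U (\<lambda>x. f x + t j *\<^sub>R g n x)) - coord n (U f)\<bar> \<le> C + C"
      by (intro order_trans[OF abs_triangle_ineq4] add_mono C f L2_add_scaleR g_L2)
    then show ?thesis using tpos[of j] by (simp add: K'_def abs_divide divide_right_mono)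
  qed
  have cV: "(\<lambda>f. coord n (V k f)) \<in> L2_space G" for k by (rule C1b_functional_L2[OF W])
  have cU: "(\<lambda>f. coord n (U f)) \<in> L2_space G" by (rule C1b_functional_L2[OF FU])
  have KL: "K j \<in> L2_space G" for j
    by (rule G.L2_I_bounded[where C=C]) (use Kb in auto)
  have KU: "(\<lambda>j. L2_norm G (\<lambda>f. K j f - coord n (U f))) \<longlonglongrightarrow> 0"
  proof -
    have "(\<lambda>j. \<integral>f. (norm (K j f - coord n (U f)))\<^sup>2 \<partial>G) \<longlonglongrightarrow> (\<integral>f. 0 \<partial>G)"
    proof (rule integral_dominated_convergence[where w="\<lambda>f. (2 * C)\<^sup>2"])
      show "AE f in G. (\<lambda>j. (norm (K j f - coord n (U f)))\<^sup>2) \<longlonglongrightarrow> 0"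
      proof (rule AE_I2)
        fix f assume "f \<in> space G"
        then have f: "f \<in> L2_space M" by simp
        have "((\<lambda>h. (F (\<lambda>x. f x + (0 + h) *\<^sub>R g n x) - F (\<lambda>x. f x + 0 *\<^sub>R g n x)) / h) \<longlongrightarrow> coord n (U f)) (at 0)"
          using C1b_functionalD(5)[OF FU f, where n=n and t=0] by (simp add: DERIV_def)
        moreover have "filterlim t (at 0) sequentially"
          using t0 tpos by (simp add: filterlim_at less_imp_neq[THEN not_sym])
        ultimately have "(\<lambda>j. K j f) \<longlonglongrightarrow> coord n (U f)"
          unfolding K_def by (auto dest: filterlim_compose)
        then have "(\<lambda>j. (norm (K j f - coord n (U f)))\<^sup>2) \<longlonglongrightarrow> (norm (coord n (U f) - coord n (U f)))\<^sup>2"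
          by (intro tendsto_intros)
        then show "(\<lambda>j. (norm (K j f - coord n (U f)))\<^sup>2) \<longlonglongrightarrow> 0" by simp
      qed
      show "AE f in G. norm ((norm (K j f - coord n (U f)))\<^sup>2) \<le> (2 * C)\<^sup>2" for j
      proof (rule AE_I2)
        fix f assume "f \<in> space G"
        then have f: "f \<in> L2_space M" by simp
        have "\<bar>K j f - coord n (U f)\<bar> \<le> C + C"
          by (intro order_trans[OF abs_triangle_ineq4] add_mono C f Kb)
        then have "\<bar>K j f - coord n (U f)\<bar>\<^sup>2 \<le> (2 * C)\<^sup>2" by (intro power_mono) auto
        then show "norm ((norm (K j f - coord n (U f)))\<^sup>2) \<le> (2 * C)\<^sup>2" by simp
      qed
    qed auto
    then have "(\<lambda>j. sqrt ((L2_norm G (\<lambda>f. K j f - coord n (U f)))\<^sup>2)) \<longlonglongrightarrow> sqrt 0"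
      unfolding L2_norm_sq_integral by (intro tendsto_real_sqrt) simp
    then show ?thesis by simp
  qed
  have "(\<lambda>k. L2_inner G (\<lambda>f. coord n (V k f)) (K j)) \<longlonglongrightarrow> 0" for j
  proof -
    \<comment> \<open>The Gaussian adjoint of differentiation along \<open>g n\<close>, applied to
      \<open>K j\<close>. It does not depend on \<open>k\<close>, so convergence of
      \<open>W k\<close> to zero is enough.\<close>
    define R where "R f = K j f * coord n f / \<alpha> n - K' j f" for f
    have RL: "R \<in> L2_space G"
    proof -
      have c: "coord n \<in> L2_space G"
      proof (rule L2_bound[OF measurable_G(2)[OF g_L2], where g="L2_norm M"])
        have [measurable]: "L2_norm M \<in> borel_measurable G" by simp
        have "integrable G (\<lambda>f. (L2_norm M f)\<^sup>2)"
        proof (rule integrable_norm_bound[of _ 1])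
          fix f :: "'a \<Rightarrow> 'b"
          have "0 \<le> ((L2_norm M f)\<^sup>2 - 1/2)\<^sup>2" by simp
          then have "(L2_norm M f)\<^sup>2 \<le> (L2_norm M f) ^ 4 + 1/4"
            by (simp add: power2_eq_square power4_eq_xxxx algebra_simps)
          then show "\<bar>(L2_norm M f)\<^sup>2\<bar> \<le> 1 * (1 + (L2_norm M f) ^ 4)" by simp
        qed simp
        then show "L2_norm M \<in> L2_space G" by (simp add: L2_space_def)
        show "AE f in G. norm (coord n f) \<le> norm (L2_norm M f)"
          by (rule AE_I2) (use L2_Cauchy_Schwarz[OF _ g_L2[of n]] in fastforce)
      qed
      have "(\<lambda>f. K j f * coord n f / \<alpha> n) \<in> L2_space G"
      proof (rule L2_bound[OF _ L2_scaleR[OF c, of "C / \<alpha> n"]])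
        show "AE f in G. norm (K j f * coord n f / \<alpha> n) \<le> norm ((C / \<alpha> n) *\<^sub>R coord n f)"
          by (rule AE_I2) (use Kb[of _ j] C(1) \<alpha>_pos[of n] in
            \<open>auto simp: abs_mult abs_divide field_simps intro!: mult_right_mono\<close>)
      qed measurable
      moreover have "K' j \<in> L2_space G" by (rule G.L2_I_bounded[where C="2 * C / t j"]) (use K'b in auto)
      ultimately show ?thesis unfolding R_def by (rule L2_diff)
    qed
    have "L2_inner G (\<lambda>f. coord n (V k f)) (K j) = L2_inner G (W k) R" for k
    proof -
      obtain D where D: "D \<ge> 0" "\<And>f. f \<in> L2_space M \<Longrightarrow> \<bar>W k f\<bar> \<le> D"
        "\<And>f. f \<in> L2_space M \<Longrightarrow> L2_norm M (V k f) \<le> D" "\<And>f n. f \<in> L2_space M \<Longrightarrow> \<bar>coord n (V k f)\<bar> \<le> D"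
        using C1b_functional_bound[OF W] by blast
      define Q where "Q = D * C + D * (2 * C / t j)"
      have Q: "Q \<ge> 0" using C(1) D(1) tpos[of j] by (simp add: Q_def)
      \<comment> \<open>Integration by parts for the product \<open>W k * K j\<close>, to be solved
        for the term that contains the derivative of \<open>W k\<close>.\<close>
      have "(\<integral>f. (W k f * K j f) * coord n f \<partial>G) = \<alpha> n * (\<integral>f. coord n (V k f) * K j f + W k f * K' j f \<partial>G)"
      proof (rule Gaussian_integration_by_parts[where C=Q])
        fix f :: "'a \<Rightarrow> 'b" and s :: real assume f: "f \<in> L2_space M"
        have sh: "(\<lambda>x. f x + s *\<^sub>R g n x + t j *\<^sub>R g n x) = (\<lambda>x. f x + (s + t j) *\<^sub>R g n x)" for s
          by (simp add: scaleR_add_left add.assoc)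
        have dF: "((\<lambda>s. F (\<lambda>x. f x + (s + t j) *\<^sub>R g n x)) has_real_derivative coord n (U (\<lambda>x. f x + (s + t j) *\<^sub>R g n x))) (at s)"
          using C1b_functionalD(5)[OF FU f, where n=n and t="s + t j"] by (simp add: DERIV_shift)
        have dK: "((\<lambda>s. K j (\<lambda>x. f x + s *\<^sub>R g n x)) has_real_derivative K' j (\<lambda>x. f x + s *\<^sub>R g n x)) (at s)"
          unfolding K_def K'_def sh
          by (intro DERIV_cdivide DERIV_diff dF C1b_functionalD(5)[OF FU f])
        show "((\<lambda>s. W k (\<lambda>x. f x + s *\<^sub>R g n x) * K j (\<lambda>x. f x + s *\<^sub>R g n x)) has_real_derivative
            coord n (V k (\<lambda>x. f x + s *\<^sub>R g n x)) * K j (\<lambda>x. f x + s *\<^sub>R g n x)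
            + W k (\<lambda>x. f x + s *\<^sub>R g n x) * K' j (\<lambda>x. f x + s *\<^sub>R g n x)) (at s)"
          by (rule DERIV_cong[OF DERIV_mult[OF C1b_functionalD(5)[OF W f] dK]]) simp
        have cU: "isCont (\<lambda>s. coord n (U (\<lambda>x. f x + (s + t j) *\<^sub>R g n x))) s"
          using isCont_o2[of s "\<lambda>s. s + t j", OF _ C1b_functionalD(6)[OF FU f, where n=n and t="s + t j"]] by simp
        have cK': "isCont (\<lambda>s. K' j (\<lambda>x. f x + s *\<^sub>R g n x)) s"
          unfolding K'_def sh using tpos[of j]
          by (intro continuous_divide continuous_diff cU C1b_functionalD(6)[OF FU f] continuous_const) auto
        show "isCont (\<lambda>s. coord n (V k (\<lambda>x. f x + s *\<^sub>R g n x)) * K j (\<lambda>x. f x + s *\<^sub>R g n x)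
            + W k (\<lambda>x. f x + s *\<^sub>R g n x) * K' j (\<lambda>x. f x + s *\<^sub>R g n x)) s"
          by (intro continuous_add continuous_mult C1b_functionalD(6)[OF W f] DERIV_isCont[OF dK]
              DERIV_isCont[OF C1b_functionalD(5)[OF W f]] cK')
      next
        fix f :: "'a \<Rightarrow> 'b" assume f: "f \<in> L2_space M"
        have le: "Q \<le> Q * (1 + L2_norm M f)" using Q by (simp add: algebra_simps)
        have "\<bar>W k f * K j f\<bar> \<le> D * C" unfolding abs_mult by (intro mult_mono D Kb f) auto
        also have "\<dots> \<le> Q" using C(1) D(1) tpos[of j] by (simp add: Q_def)
        finally show "\<bar>W k f * K j f\<bar> \<le> Q * (1 + L2_norm M f)" using le by linarith
        have "\<bar>coord n (V k f) * K j f + W k f * K' j f\<bar> \<le> \<bar>coord n (V k f)\<bar> * \<bar>K j f\<bar> + \<bar>W k f\<bar> * \<bar>K' j f\<bar>"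
          unfolding abs_mult[symmetric] by (rule abs_triangle_ineq)
        also have "\<dots> \<le> Q" unfolding Q_def by (intro add_mono mult_mono D Kb K'b f) auto
        finally show "\<bar>coord n (V k f) * K j f + W k f * K' j f\<bar> \<le> Q * (1 + L2_norm M f)" using le by linarith
      qed measurable
      moreover have i1: "integrable G (\<lambda>f. coord n (V k f) * K j f)"
        using L2_integrable_inner[OF C1b_functional_L2(2)[OF W] KL] by simp
      moreover have i2: "integrable G (\<lambda>f. W k f * K' j f)"
        using L2_integrable_inner[OF C1b_functional_L2(1)[OF W], of "K' j"] G.L2_I_bounded[of "K' j" "2 * C / t j"] K'b by simp
      moreover have i3: "integrable G (\<lambda>f. W k f * R f)"
        using L2_integrable_inner[OF C1b_functional_L2(1)[OF W] RL] by simp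
      have "(\<lambda>f. W k f * R f + W k f * K' j f) = (\<lambda>f. (1 / \<alpha> n) * ((W k f * K j f) * coord n f))"
        by (auto simp: R_def algebra_simps)
      then have "(1 / \<alpha> n) * (\<integral>f. (W k f * K j f) * coord n f \<partial>G) = (\<integral>f. W k f * R f \<partial>G) + (\<integral>f. W k f * K' j f \<partial>G)"
        using Bochner_Integration.integral_add[OF i3 i2] by simp
      ultimately have "(\<integral>f. coord n (V k f) * K j f \<partial>G) = (\<integral>f. W k f * R f \<partial>G)"
        using \<alpha>_pos[of n] by simp
      then show ?thesis by (simp add: L2_inner_def)
    qed
    moreover have "(\<lambda>k. L2_inner G (W k) R) \<longlonglongrightarrow> L2_inner G (\<lambda>f. 0) R"
      by (rule tendsto_inner_L2) (use C1b_functional_L2(1)[OF W] RL null in auto)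
    ultimately show ?thesis by simp
  qed
  then show ?thesis by (rule L2_weak_null_dense[OF cV B KL cU KU])
qed

text \<open>\<open>L2_Cauchy_weak_null\<close> asks for pairings with members of the sequence
  itself. Truncating the member reduces such a pairing to finitely many directions, each covered by
  \<open>partial_derivative_weak_null\<close>.\<close>

theorem closable:
  assumes W: "\<And>k. C1b_functional (W k) (V k)"
    and null: "(\<lambda>k. L2_norm G (W k)) \<longlonglongrightarrow> 0"
    and cauchy: "\<And>e. e > 0 \<Longrightarrow> \<exists>N. \<forall>m\<ge>N. \<forall>k\<ge>N. L2_norm NG (\<lambda>z. coords (V m) z - coords (V k) z) < e"
  shows "(\<lambda>k::nat. L2_norm NG (coords (V k))) \<longlonglongrightarrow> 0"
proof (rule L2_Cauchy_weak_null[OF _ cauchy])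
  have VL: "coords (V k) \<in> L2_space NG" for k by (rule coords_L2(1)[OF C1b_functionalD(2)[OF W]])
  show "coords (V k) \<in> L2_space NG" for k by (rule VL)
  obtain B where B: "\<And>k. L2_norm NG (coords (V k)) \<le> B"
    using L2_Cauchy_bounded[OF VL cauchy] by blast
  have cV: "(\<lambda>f. coord n (V k f)) \<in> L2_space G" for n k by (rule C1b_functional_L2[OF W])
  have Bn: "L2_norm G (\<lambda>f. coord n (V k f)) \<le> sqrt (B\<^sup>2 / \<alpha> n)" for n k
  proof -
    \<comment> \<open>Truncation at \<open>Suc n\<close> still contains direction \<open>n\<close>;
      its summand is bounded by the whole nonnegative sum, and dividing by \<open>\<alpha> n\<close>
      isolates it.\<close>
    have "(\<Sum>i<Suc n. \<alpha> i * (\<integral>f. coords (V k) (i, f) * coords (V k) (i, f) \<partial>G)) =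
        L2_inner NG (coords (V k)) (\<lambda>z. if fst z < Suc n then coords (V k) z else 0)"
      by (rule inner_NG_truncated[OF VL VL, symmetric])
    also have "\<dots> \<le> L2_norm NG (coords (V k)) * L2_norm NG (\<lambda>z. if fst z < Suc n then coords (V k) z else 0)"
      using L2_Cauchy_Schwarz[OF VL truncation_tendsto(1)[OF VL]] by (meson abs_le_D1)
    also have "\<dots> \<le> L2_norm NG (coords (V k)) * L2_norm NG (coords (V k))"
      by (intro mult_left_mono L2_norm_mono truncation_tendsto(1) VL) auto
    also have "\<dots> \<le> B * B" using order_trans[OF L2_norm_nonneg B] by (intro mult_mono B) auto
    finally have s: "(\<Sum>i<Suc n. \<alpha> i * (\<integral>f. (coord i (V k f))\<^sup>2 \<partial>G)) \<le> B\<^sup>2"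
      by (simp add: coords_def power2_eq_square)
    have "\<alpha> n * (\<integral>f. (coord n (V k f))\<^sup>2 \<partial>G) \<le> (\<Sum>i<Suc n. \<alpha> i * (\<integral>f. (coord i (V k f))\<^sup>2 \<partial>G))"
      by (rule member_le_sum) (use \<alpha>_pos in \<open>auto intro!: mult_nonneg_nonneg simp: less_imp_le\<close>)
    with s have "\<alpha> n * (\<integral>f. (coord n (V k f))\<^sup>2 \<partial>G) \<le> B\<^sup>2" by linarith
    then have "(L2_norm G (\<lambda>f. coord n (V k f)))\<^sup>2 \<le> B\<^sup>2 / \<alpha> n"
      using \<alpha>_pos[of n] by (simp add: L2_norm_sq_integral field_simps)
    then show ?thesis by (rule real_le_rsqrt)
  qed
  show "(\<lambda>k. L2_inner NG (coords (V k)) (coords (V m))) \<longlonglongrightarrow> 0" for m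
  proof (rule L2_weak_null_dense[OF VL B truncation_tendsto(1)[OF VL] VL truncation_tendsto(2)[OF VL]])
    fix N
    have "(\<lambda>k. \<Sum>n<N. \<alpha> n * L2_inner G (\<lambda>f. coord n (V k f)) (\<lambda>f. coord n (V m f))) \<longlonglongrightarrow> (\<Sum>n<N. \<alpha> n * 0)"
      by (intro tendsto_sum tendsto_mult tendsto_const partial_derivative_weak_null[OF W null Bn W])
    then show "(\<lambda>k. L2_inner NG (coords (V k)) (\<lambda>z. if fst z < N then coords (V m) z else 0)) \<longlonglongrightarrow> 0"
      unfolding inner_NG_truncated[OF VL VL] by (simp add: L2_inner_def[of G] coords_def)
  qed
qed

end

section \<open>Integral functionals of functions with Lipschitz gradient\<close>

definition grad :: "(real ^ 'd \<Rightarrow> real) \<Rightarrow> real ^ 'd \<Rightarrow> real ^ 'd" where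
  "grad \<phi> x = (\<chi> k. partial_deriv k \<phi> x)"

section \<open>Differential calculus for functions with continuous partial derivatives\<close>

lemma C1_fun_partial_line:
  assumes "C1_fun \<phi>"
  shows "((\<lambda>t. \<phi> (x + t *\<^sub>R axis k 1)) has_real_derivative partial_deriv k \<phi> (x + s *\<^sub>R axis k 1)) (at s)"
proof -
  have "((\<lambda>t. \<phi> ((x + s *\<^sub>R axis k 1) + t *\<^sub>R axis k 1)) has_real_derivative partial_deriv k \<phi> (x + s *\<^sub>R axis k 1)) (at 0)"
    unfolding partial_deriv_def DERIV_deriv_iff_field_differentiable using assms by (simp add: C1_fun_def)
  moreover have "(x + s *\<^sub>R axis k 1) + t *\<^sub>R axis k 1 = x + (t + s) *\<^sub>R axis k 1" for t
    by (simp add: scaleR_add_left)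
  ultimately have "((\<lambda>t. \<phi> (x + (t + s) *\<^sub>R axis k 1)) has_real_derivative partial_deriv k \<phi> (x + s *\<^sub>R axis k 1)) (at 0)"
    by simp
  then show ?thesis
    using DERIV_shift[of "\<lambda>t. \<phi> (x + t *\<^sub>R axis k 1)" _ 0 s] by simp
qed

text \<open>The coordinates of the increment are switched on one at a time: \<open>r I h\<close>
  keeps those in \<open>I\<close>. Each new coordinate costs a one-dimensional mean value estimate
  with error \<open>e / 2\<close>, by continuity of the partial derivative at \<open>x\<close>; the
  other half of \<open>e\<close> goes to the induction hypothesis.\<close>

lemma C1_fun_has_derivative:
  fixes \<phi> :: "real ^ 'd \<Rightarrow> real"
  assumes C: "C1_fun \<phi>"
  shows "(\<phi> has_derivative (\<lambda>h. grad \<phi> x \<bullet> h)) (at x)"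
proof -
  define r where "r I h = (\<chi> i. if i \<in> I then h $ i else 0)" for I and h :: "real ^ 'd"
  have norm_r: "norm (r I h) \<le> norm h" for I h
    by (rule norm_le_componentwise_cart) (simp add: r_def)
  have key: "\<exists>d>0. \<forall>h. norm h < d \<longrightarrow> \<bar>\<phi> (x + r I h) - \<phi> x - (\<Sum>i\<in>I. partial_deriv i \<phi> x * h $ i)\<bar> \<le> e * norm h"
    if "e > 0" for I e
    using finite[of I] that
  proof (induction I arbitrary: e rule: finite_induct)
    case empty
    have "r {} h = 0" for h by (simp add: r_def vec_eq_iff)
    then show ?case using empty by (intro exI[of _ 1]) simp
  next
    case (insert j I)
    obtain d1 where d1: "d1 > 0" "\<And>h. norm h < d1 \<Longrightarrow>
        \<bar>\<phi> (x + r I h) - \<phi> x - (\<Sum>i\<in>I. partial_deriv i \<phi> x * h $ i)\<bar> \<le> e / 2 * norm h"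
      using insert.IH[of "e / 2"] insert.prems by (metis half_gt_zero)
    have "isCont (partial_deriv j \<phi>) x"
      using C by (simp add: C1_fun_def continuous_on_eq_continuous_at)
    then obtain d2 where d2: "d2 > 0" "\<And>y. norm (y - x) < d2 \<Longrightarrow> \<bar>partial_deriv j \<phi> y - partial_deriv j \<phi> x\<bar> < e / 2"
      unfolding continuous_at_eps_delta using insert.prems
      by (metis dist_norm dist_real_def half_gt_zero)
    have "\<bar>\<phi> (x + r (insert j I) h) - \<phi> x - (\<Sum>i\<in>insert j I. partial_deriv i \<phi> x * h $ i)\<bar> \<le> e * norm h"
      if h: "norm h < min d1 d2" for h
    proof -
      define y where "y = x + r I h"
      have rj: "x + r (insert j I) h = y + h $ j *\<^sub>R axis j 1"
        using insert.hyps by (auto simp: y_def r_def vec_eq_iff axis_def)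
      define F where "F t = \<phi> (y + t *\<^sub>R axis j 1) - partial_deriv j \<phi> x * t" for t
      have "norm (F (h $ j) - F 0) \<le> e / 2 * norm (h $ j - 0)"
      proof (rule field_differentiable_bound[of "cball 0 \<bar>h $ j\<bar>" F "\<lambda>t. partial_deriv j \<phi> (y + t *\<^sub>R axis j 1) - partial_deriv j \<phi> x"])
        fix t :: real assume t: "t \<in> cball 0 \<bar>h $ j\<bar>"
        show "(F has_real_derivative partial_deriv j \<phi> (y + t *\<^sub>R axis j 1) - partial_deriv j \<phi> x) (at t within cball 0 \<bar>h $ j\<bar>)"
          unfolding F_def
          by (intro DERIV_diff has_field_derivative_at_within[OF C1_fun_partial_line[OF C]])
            (auto intro!: derivative_eq_intros)
        have "norm (y + t *\<^sub>R axis j 1 - x) \<le> norm h"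
          by (rule norm_le_componentwise_cart) (use t insert.hyps in \<open>auto simp: y_def r_def axis_def\<close>)
        then show "norm (partial_deriv j \<phi> (y + t *\<^sub>R axis j 1) - partial_deriv j \<phi> x) \<le> e / 2"
          using d2(2)[of "y + t *\<^sub>R axis j 1"] h by simp
      qed auto
      then have "\<bar>F (h $ j) - F 0\<bar> \<le> e / 2 * \<bar>h $ j\<bar>" by simp
      also have "\<dots> \<le> e / 2 * norm h"
        using insert.prems by (intro mult_left_mono component_le_norm_cart) auto
      finally have 1: "\<bar>F (h $ j) - F 0\<bar> \<le> e / 2 * norm h" .
      have 2: "\<bar>\<phi> y - \<phi> x - (\<Sum>i\<in>I. partial_deriv i \<phi> x * h $ i)\<bar> \<le> e / 2 * norm h"
        using d1(2)[of h] h by (simp add: y_def)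
      have "\<phi> (x + r (insert j I) h) - \<phi> x - (\<Sum>i\<in>insert j I. partial_deriv i \<phi> x * h $ i)
          = (F (h $ j) - F 0) + (\<phi> y - \<phi> x - (\<Sum>i\<in>I. partial_deriv i \<phi> x * h $ i))"
        using insert.hyps by (simp add: rj F_def)
      then have "\<bar>\<phi> (x + r (insert j I) h) - \<phi> x - (\<Sum>i\<in>insert j I. partial_deriv i \<phi> x * h $ i)\<bar>
          \<le> e / 2 * norm h + e / 2 * norm h"
        using 1 2 abs_triangle_ineq[of "F (h $ j) - F 0" "\<phi> y - \<phi> x - (\<Sum>i\<in>I. partial_deriv i \<phi> x * h $ i)"] by linarith
      then show ?thesis by simp
    qed
    then show ?case using d1(1) d2(1) by (intro exI[of _ "min d1 d2"]) auto
  qed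
  show ?thesis
    unfolding has_derivative_at_alt
  proof (intro conjI allI impI)
    show "bounded_linear (\<lambda>h. grad \<phi> x \<bullet> h)" by (rule bounded_linear_inner_right)
    fix e :: real assume "e > 0"
    then obtain d where d: "d > 0" "\<And>h. norm h < d \<Longrightarrow>
        \<bar>\<phi> (x + r UNIV h) - \<phi> x - (\<Sum>i\<in>UNIV. partial_deriv i \<phi> x * h $ i)\<bar> \<le> e * norm h"
      using key by meson
    have "r UNIV h = h" for h by (simp add: r_def vec_eq_iff)
    then have "norm (\<phi> y - \<phi> x - grad \<phi> x \<bullet> (y - x)) \<le> e * norm (y - x)" if "norm (y - x) < d" for y
      using d(2)[OF that] by (simp add: grad_def inner_vec_def)
    then show "\<exists>d>0. \<forall>y. norm (y - x) < d \<longrightarrow> norm (\<phi> y - \<phi> x - grad \<phi> x \<bullet> (y - x)) \<le> e * norm (y - x)"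
      using d(1) by blast
  qed
qed

text \<open>The sum of all bounds on second derivatives serves at once as a Lipschitz constant for
  the gradient and as a common bound on the Hessian.\<close>

lemma C2_fun_grad_Lipschitz:
  fixes \<phi> :: "real ^ 'd \<Rightarrow> real"
  assumes C2: "C2_fun \<phi>" and bd: "\<And>k l. bounded (range (partial_deriv k (partial_deriv l \<phi>)))"
  obtains H where "H \<ge> 0" "\<And>x y. norm (grad \<phi> x - grad \<phi> y) \<le> H * norm (x - y)"
    "\<And>k l x. \<bar>partial_deriv k (partial_deriv l \<phi>) x\<bar> \<le> H"
proof -
  obtain b where b: "\<And>k l x. \<bar>partial_deriv k (partial_deriv l \<phi>) x\<bar> \<le> b k l"
    using bd unfolding bounded_iff by (metis rangeI real_norm_def)
  have b0: "b k l \<ge> 0" for k l using order_trans[OF abs_ge_zero b] .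
  define H where "H = (\<Sum>l\<in>UNIV. \<Sum>k\<in>UNIV. b k l)"
  have H0: "H \<ge> 0" unfolding H_def by (intro sum_nonneg b0)
  have L: "\<bar>partial_deriv l \<phi> x - partial_deriv l \<phi> y\<bar> \<le> (\<Sum>k\<in>UNIV. b k l) * norm (x - y)" for l x y
  proof -
    have "norm (partial_deriv l \<phi> x - partial_deriv l \<phi> y) \<le> (\<Sum>k\<in>UNIV. b k l) * norm (x - y)"
    proof (rule differentiable_bound[of UNIV])
      fix z
      show "(partial_deriv l \<phi> has_derivative (\<lambda>h. grad (partial_deriv l \<phi>) z \<bullet> h)) (at z within UNIV)"
        using C1_fun_has_derivative[of "partial_deriv l \<phi>" z] C2 by (simp add: C2_fun_def)
      show "onorm (\<lambda>h. grad (partial_deriv l \<phi>) z \<bullet> h) \<le> (\<Sum>k\<in>UNIV. b k l)"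
      proof (rule onorm_le)
        fix h
        have "norm (grad (partial_deriv l \<phi>) z) \<le> (\<Sum>k\<in>UNIV. \<bar>grad (partial_deriv l \<phi>) z $ k\<bar>)" by (rule norm_le_l1_cart)
        also have "\<dots> \<le> (\<Sum>k\<in>UNIV. b k l)" by (intro sum_mono) (simp add: grad_def b)
        finally show "norm (grad (partial_deriv l \<phi>) z \<bullet> h) \<le> (\<Sum>k\<in>UNIV. b k l) * norm h"
          by (intro order_trans[OF Cauchy_Schwarz_ineq2[folded real_norm_def]] mult_right_mono) auto
      qed
    qed auto
    then show ?thesis by simp
  qed
  have "norm (grad \<phi> x - grad \<phi> y) \<le> H * norm (x - y)" for x y
  proof -
    have "norm (grad \<phi> x - grad \<phi> y) \<le> (\<Sum>l\<in>UNIV. \<bar>(grad \<phi> x - grad \<phi> y) $ l\<bar>)" by (rule norm_le_l1_cart)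
    also have "\<dots> \<le> (\<Sum>l\<in>UNIV. (\<Sum>k\<in>UNIV. b k l) * norm (x - y))"
      by (intro sum_mono) (simp add: grad_def L)
    also have "\<dots> = H * norm (x - y)" by (simp add: H_def sum_distrib_right)
    finally show ?thesis .
  qed
  moreover have "\<bar>partial_deriv k (partial_deriv l \<phi>) x\<bar> \<le> H" for k l x
  proof -
    have "b k l \<le> (\<Sum>k\<in>UNIV. b k l)" by (intro member_le_sum) (auto simp: b0)
    also have "\<dots> \<le> H" unfolding H_def by (rule member_le_sum[of l UNIV]) (auto intro: sum_nonneg b0)
    finally show ?thesis using b[of k l x] by linarith
  qed
  ultimately show ?thesis using that H0 by blast
qed

text \<open>Phrased with a gradient \<open>D\<close> and its Lipschitz constant so that it covers
  \<open>\<phi>\<close> as well as its bounded approximations, for which second derivatives are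
  never computed.\<close>

locale Lipschitz_gradient =
  fixes \<phi> :: "real ^ 'd \<Rightarrow> real" and D :: "real ^ 'd \<Rightarrow> real ^ 'd" and H :: real
  assumes deriv: "\<And>x. (\<phi> has_derivative (\<lambda>h. D x \<bullet> h)) (at x)"
    and lip: "\<And>x y. norm (D x - D y) \<le> H * norm (x - y)" and H0: "H \<ge> 0"
begin

lemma cont_D: "continuous_on UNIV D"
  by (rule lipschitz_on_continuous_on[of H]) (use lip H0 in \<open>auto simp: lipschitz_on_def dist_norm\<close>)

lemma cont_\<phi>: "continuous_on UNIV \<phi>"
  using deriv by (intro continuous_at_imp_continuous_on ballI has_derivative_continuous) blast

lemma measurable_D [measurable]: "D \<in> borel_measurable borel" "\<phi> \<in> borel_measurable borel"
  using cont_D cont_\<phi> by (auto intro: borel_measurable_continuous_onI)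

lemma onorm_D: "onorm (\<lambda>h. D x \<bullet> h) \<le> norm (D x)"
  by (rule onorm_le) (simp add: Cauchy_Schwarz_ineq2)

text \<open>On the ball of radius \<open>norm h\<close> around \<open>x\<close> the derivative moves
  by at most \<open>H * norm h\<close>, and the mean value estimate for the linearisation multiplies
  this by \<open>norm h\<close>.\<close>

lemma Taylor: "\<bar>\<phi> (x + h) - \<phi> x - D x \<bullet> h\<bar> \<le> H * (norm h)\<^sup>2"
proof -
  have "norm (\<phi> (x + h) - \<phi> x - D x \<bullet> ((x + h) - x)) \<le> norm ((x + h) - x) * (H * norm h)"
  proof (rule differentiable_bound_linearization[where S="cball x (norm h)" and f'="\<lambda>z v. D z \<bullet> v"])
    show "x + t *\<^sub>R (x + h - x) \<in> cball x (norm h)" if "t \<in> {0..1}" for t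
      using that by (auto simp: dist_norm intro!: mult_left_le_one_le)
    show "(\<phi> has_derivative (\<lambda>h. D z \<bullet> h)) (at z within cball x (norm h))" for z
      using deriv by (rule has_derivative_at_withinI)
    show "onorm ((\<lambda>h. D z \<bullet> h) - (\<lambda>h. D x \<bullet> h)) \<le> H * norm h" if "z \<in> cball x (norm h)" for z
    proof (rule onorm_le)
      fix v
      have "norm (D z - D x) \<le> H * norm h"
      proof -
        have "norm (z - x) \<le> norm h" using that by (simp add: dist_norm norm_minus_commute)
        then have "H * norm (z - x) \<le> H * norm h" using H0 by (rule mult_left_mono)
        with lip[of z x] show ?thesis by linarith
      qed
      then have "norm ((D z - D x) \<bullet> v) \<le> H * norm h * norm v"
        by (intro order_trans[OF Cauchy_Schwarz_ineq2[folded real_norm_def]] mult_right_mono) auto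
      then show "norm (((\<lambda>h. D z \<bullet> h) - (\<lambda>h. D x \<bullet> h)) v) \<le> H * norm h * norm v"
        by (simp add: inner_diff_left)
    qed
  qed simp
  then show ?thesis by (simp add: power2_eq_square mult_ac)
qed

text \<open>The constant of linear growth of \<open>D\<close>; the later growth bounds on
  \<open>\<phi>\<close>, \<open>u\<close> and the drift are expressed through it.\<close>

definition c where "c = norm (D 0) + H"

lemma c0: "c \<ge> 0" using H0 by (simp add: c_def)

lemma D_growth: "norm (D x) \<le> c * (1 + norm x)"
proof -
  have "norm (D x) \<le> norm (D 0) + norm (D x - D 0)" using norm_triangle_ineq[of "D 0" "D x - D 0"] by simp
  also have "\<dots> \<le> norm (D 0) + H * norm x" using lip[of x 0] by simp
  also have "\<dots> \<le> c * (1 + norm x)" using H0 by (simp add: c_def algebra_simps)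
  finally show ?thesis .
qed

text \<open>On the ball of radius \<open>norm x + norm y\<close>, which contains both points, the
  gradient is at most \<open>c * (1 + norm x + norm y)\<close>.\<close>

lemma \<phi>_local_lip: "\<bar>\<phi> x - \<phi> y\<bar> \<le> c * ((1 + norm x + norm y) * norm (x - y))"
proof -
  have "norm (\<phi> x - \<phi> y) \<le> c * (1 + norm x + norm y) * norm (x - y)"
  proof (rule differentiable_bound[where S="cball 0 (norm x + norm y)"])
    show "(\<phi> has_derivative (\<lambda>h. D z \<bullet> h)) (at z within cball 0 (norm x + norm y))" for z
      using deriv by (rule has_derivative_at_withinI)
    show "onorm (\<lambda>h. D z \<bullet> h) \<le> c * (1 + norm x + norm y)" if "z \<in> cball 0 (norm x + norm y)" for z
    proof -
      have "c * (1 + norm z) \<le> c * (1 + norm x + norm y)" using that c0 by (intro mult_left_mono) auto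
      then show ?thesis using onorm_D[of z] D_growth[of z] by linarith
    qed
  qed auto
  then show ?thesis by (simp add: mult.assoc)
qed

lemma \<phi>_growth: "\<bar>\<phi> x\<bar> \<le> (\<bar>\<phi> 0\<bar> + 2 * c) * (1 + (norm x)\<^sup>2)"
proof -
  have "\<bar>\<phi> x\<bar> \<le> \<bar>\<phi> 0\<bar> + c * ((1 + norm x) * norm x)" using \<phi>_local_lip[of x 0] by simp
  also have "(1 + norm x) * norm x \<le> 2 * (1 + (norm x)\<^sup>2)"
  proof -
    have "0 \<le> (norm x - 1/2)\<^sup>2" by simp
    then have "norm x \<le> (norm x)\<^sup>2 + 1/4" by (simp add: power2_eq_square algebra_simps)
    then show ?thesis by (simp add: power2_eq_square algebra_simps)
  qed
  then have "\<bar>\<phi> 0\<bar> + c * ((1 + norm x) * norm x) \<le> \<bar>\<phi> 0\<bar> + c * (2 * (1 + (norm x)\<^sup>2))"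
    using c0 by (intro add_left_mono mult_left_mono)
  also have "\<dots> \<le> (\<bar>\<phi> 0\<bar> + 2 * c) * (1 + (norm x)\<^sup>2)"
    by (simp add: algebra_simps)
  finally show ?thesis .
qed

lemma integrable_P2:
  assumes "\<mu> \<in> P2"
  shows "integrable \<mu> \<phi>"
proof -
  interpret prob_space \<mu> using P2_D(2)[OF assms] .
  note P2_D(1)[OF assms, measurable_cong]
  show ?thesis
  proof (rule Bochner_Integration.integrable_bound)
    show "integrable \<mu> (\<lambda>x. (\<bar>\<phi> 0\<bar> + 2 * c) * (1 + (norm x)\<^sup>2))"
      using P2_D(3)[OF assms] by (intro integrable_mult_right Bochner_Integration.integrable_add) simp_all
    show "AE x in \<mu>. norm (\<phi> x) \<le> norm ((\<bar>\<phi> 0\<bar> + 2 * c) * (1 + (norm x)\<^sup>2))"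
      using \<phi>_growth by (auto intro!: AE_I2 order_trans[OF _ abs_ge_self])
  qed measurable
qed

lemma continuous_map_integral: "continuous_map P2_topology euclideanreal (\<lambda>\<mu>. \<integral>x. \<phi> x \<partial>\<mu>)"
  by (rule continuous_map_P2_integral[OF measurable_D(2) c0 \<phi>_local_lip integrable_P2])

lemma D_L2: "D \<in> L2_space \<mu>" if "\<mu> \<in> P2"
proof -
  interpret prob_space \<mu> using P2_D(2)[OF that] .
  note P2_D(1)[OF that, measurable_cong]
  have 1: "(\<lambda>x. c *\<^sub>R (1::real)) \<in> L2_space \<mu>" by (intro L2_scaleR L2_const) unfold_locales
  have "(\<lambda>x. c *\<^sub>R norm x) \<in> L2_space \<mu>"
    by (intro L2_scaleR) (use P2_D(3)[OF that] in \<open>simp add: L2_space_def\<close>)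
  from L2_add[OF 1 this] have s: "(\<lambda>x. c * (1 + norm x)) \<in> L2_space \<mu>" by (simp add: algebra_simps)
  show ?thesis
    by (rule L2_bound[OF _ s]) (use D_growth in \<open>auto intro!: order_trans[OF _ abs_ge_self]\<close>)
qed

text \<open>Taylor's formula integrated over \<open>\<mu>\<close>. The quadratic remainder yields
  both the directional derivative and the Frechet condition.\<close>

lemma push_expansion:
  assumes \<mu>: "\<mu> \<in> P2" and f: "f \<in> L2_space \<mu>"
  shows "\<bar>(\<integral>x. \<phi> x \<partial>push \<mu> (\<lambda>x. x + f x)) - (\<integral>x. \<phi> x \<partial>\<mu>) - L2_inner \<mu> D f\<bar> \<le> H * (L2_norm \<mu> f)\<^sup>2"
proof -
  have idf: "(\<lambda>x. x + f x) \<in> L2_space \<mu>" by (intro L2_add P2_id_L2 \<mu> f)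
  have i1: "integrable \<mu> (\<lambda>x. \<phi> (x + f x))"
    using integrable_P2[OF push_P2[OF \<mu> idf]] L2_measurable[OF idf]
    by (simp add: push_def integrable_distr_eq)
  have i3: "integrable \<mu> (\<lambda>x. D x \<bullet> f x)" by (rule L2_integrable_inner[OF D_L2[OF \<mu>] f])
  have "(\<integral>x. \<phi> x \<partial>push \<mu> (\<lambda>x. x + f x)) - (\<integral>x. \<phi> x \<partial>\<mu>) - L2_inner \<mu> D f
      = (\<integral>x. \<phi> (x + f x) - \<phi> x - D x \<bullet> f x \<partial>\<mu>)"
    using i1 i3 integrable_P2[OF \<mu>] by (simp add: integral_push[OF \<mu> idf] L2_inner_def)
  also have "\<bar>\<dots>\<bar> \<le> (\<integral>x. \<bar>\<phi> (x + f x) - \<phi> x - D x \<bullet> f x\<bar> \<partial>\<mu>)" by (rule integral_abs_bound)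
  also have "\<dots> \<le> (\<integral>x. H * (norm (f x))\<^sup>2 \<partial>\<mu>)"
    using i1 i3 integrable_P2[OF \<mu>] L2_integrable_sq[OF f] Taylor by (intro integral_mono) auto
  also have "\<dots> = H * (L2_norm \<mu> f)\<^sup>2" by (simp add: L2_norm_sq_integral)
  finally show ?thesis .
qed

lemma difference_quotient_integral:
  assumes \<mu>: "\<mu> \<in> P2" and f: "f \<in> L2_space \<mu>"
  shows "(difference_quotient (\<lambda>\<mu>. \<integral>x. \<phi> x \<partial>\<mu>) \<mu> f \<longlongrightarrow> L2_inner \<mu> D f) (at 0)"
proof -
  have "((\<lambda>\<epsilon>. difference_quotient (\<lambda>\<mu>. \<integral>x. \<phi> x \<partial>\<mu>) \<mu> f \<epsilon> - L2_inner \<mu> D f) \<longlongrightarrow> 0) (at 0)"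
  proof (rule Lim_null_comparison)
    show "((\<lambda>\<epsilon>. \<bar>\<epsilon>\<bar> * (H * (L2_norm \<mu> f)\<^sup>2)) \<longlongrightarrow> 0) (at 0)"
      by (rule tendsto_eq_intros refl | simp)+
    have "norm (difference_quotient (\<lambda>\<mu>. \<integral>x. \<phi> x \<partial>\<mu>) \<mu> f \<epsilon> - L2_inner \<mu> D f) \<le> \<bar>\<epsilon>\<bar> * (H * (L2_norm \<mu> f)\<^sup>2)"
      if \<epsilon>: "\<epsilon> \<noteq> 0" for \<epsilon>
    proof -
      have "\<bar>(\<integral>x. \<phi> x \<partial>push \<mu> (\<lambda>x. x + \<epsilon> *\<^sub>R f x)) - (\<integral>x. \<phi> x \<partial>\<mu>) - \<epsilon> * L2_inner \<mu> D f\<bar> \<le> \<epsilon>\<^sup>2 * (H * (L2_norm \<mu> f)\<^sup>2)"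
        using push_expansion[OF \<mu> L2_scaleR[OF f, of \<epsilon>]]
        by (simp add: L2_inner_scaleR_right L2_norm_scaleR power_mult_distrib mult_ac)
      then have "\<bar>(\<integral>x. \<phi> x \<partial>push \<mu> (\<lambda>x. x + \<epsilon> *\<^sub>R f x)) - (\<integral>x. \<phi> x \<partial>\<mu>) - \<epsilon> * L2_inner \<mu> D f\<bar> / \<bar>\<epsilon>\<bar>
          \<le> \<epsilon>\<^sup>2 * (H * (L2_norm \<mu> f)\<^sup>2) / \<bar>\<epsilon>\<bar>"
        by (rule divide_right_mono) simp
      also have "\<epsilon>\<^sup>2 * (H * (L2_norm \<mu> f)\<^sup>2) / \<bar>\<epsilon>\<bar> = \<bar>\<epsilon>\<bar> * (H * (L2_norm \<mu> f)\<^sup>2)"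
        using \<epsilon> by (simp add: power2_eq_square field_simps abs_if)
      finally show ?thesis
        using \<epsilon> by (simp add: difference_quotient_def abs_divide[symmetric] diff_divide_distrib)
    qed
    then show "\<forall>\<^sub>F \<epsilon> in at 0. norm (difference_quotient (\<lambda>\<mu>. \<integral>x. \<phi> x \<partial>\<mu>) \<mu> f \<epsilon> - L2_inner \<mu> D f) \<le> \<bar>\<epsilon>\<bar> * (H * (L2_norm \<mu> f)\<^sup>2)"
      unfolding eventually_at_filter by (intro always_eventually) blast
  qed
  then show ?thesis by (simp add: LIM_zero_iff)
qed

lemma dir_deriv_integral:
  "\<mu> \<in> P2 \<Longrightarrow> f \<in> L2_space \<mu> \<Longrightarrow> dir_deriv (\<lambda>\<mu>. \<integral>x. \<phi> x \<partial>\<mu>) \<mu> f = L2_inner \<mu> D f"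
  unfolding dir_deriv_def by (rule tendsto_Lim[OF _ difference_quotient_integral]) simp_all

lemma gradient_integral:
  assumes "\<mu> \<in> P2"
  shows "gradient (\<lambda>\<mu>. \<integral>x. \<phi> x \<partial>\<mu>) \<mu> \<in> L2_space \<mu>" "AE x in \<mu>. gradient (\<lambda>\<mu>. \<integral>x. \<phi> x \<partial>\<mu>) \<mu> x = D x"
  using gradient_unique[OF D_L2[OF assms] dir_deriv_integral[OF assms]] by auto

lemma intrinsically_differentiable_integral: "intrinsically_differentiable (\<lambda>\<mu>. \<integral>x. \<phi> x \<partial>\<mu>)"
  unfolding intrinsically_differentiable_def
proof (intro conjI ballI allI continuous_map_integral)
  fix \<mu> :: "(real ^ 'd) measure" assume \<mu>: "\<mu> \<in> P2"
  show "\<exists>l. (difference_quotient (\<lambda>\<mu>. \<integral>x. \<phi> x \<partial>\<mu>) \<mu> f \<longlongrightarrow> l) (at 0)" if "f \<in> L2_space \<mu>" for f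
    using difference_quotient_integral[OF \<mu> that] by blast
  show "dir_deriv (\<lambda>\<mu>. \<integral>x. \<phi> x \<partial>\<mu>) \<mu> (\<lambda>x. a *\<^sub>R f x + b *\<^sub>R g x) =
      a * dir_deriv (\<lambda>\<mu>. \<integral>x. \<phi> x \<partial>\<mu>) \<mu> f + b * dir_deriv (\<lambda>\<mu>. \<integral>x. \<phi> x \<partial>\<mu>) \<mu> g"
    if f: "f \<in> L2_space \<mu>" and g: "g \<in> L2_space \<mu>" for f g a b
    using L2_scaleR[OF f, of a] L2_scaleR[OF g, of b] f g D_L2[OF \<mu>]
    by (simp add: dir_deriv_integral[OF \<mu>] L2_add L2_inner_add_right L2_inner_scaleR_right)
  show "\<exists>C. \<forall>f\<in>L2_space \<mu>. \<bar>dir_deriv (\<lambda>\<mu>. \<integral>x. \<phi> x \<partial>\<mu>) \<mu> f\<bar> \<le> C * L2_norm \<mu> f"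
    using L2_Cauchy_Schwarz[OF D_L2[OF \<mu>]] by (auto simp: dir_deriv_integral[OF \<mu>])
qed

lemma integral_C1b:
  assumes b\<phi>: "\<And>x. \<bar>\<phi> x\<bar> \<le> B" and bD: "\<And>x. norm (D x) \<le> B"
  shows "(\<lambda>\<mu>. \<integral>x. \<phi> x \<partial>\<mu>) \<in> C1b_P2"
proof -
  have fr: "frechet_condition (\<lambda>\<mu>. \<integral>x. \<phi> x \<partial>\<mu>)"
    unfolding frechet_condition_def
  proof (intro ballI allI impI)
    fix \<mu> :: "(real ^ 'd) measure" and f :: "nat \<Rightarrow> real ^ 'd \<Rightarrow> real ^ 'd"
    assume \<mu>: "\<mu> \<in> P2" and f: "\<forall>n. f n \<in> L2_space \<mu> \<and> L2_norm \<mu> (f n) \<noteq> 0"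
      and lim: "(\<lambda>n. L2_norm \<mu> (f n)) \<longlonglongrightarrow> 0"
    show "(\<lambda>n. \<bar>(\<integral>x. \<phi> x \<partial>push \<mu> (\<lambda>x. x + f n x)) - (\<integral>x. \<phi> x \<partial>\<mu>) - dir_deriv (\<lambda>\<mu>. \<integral>x. \<phi> x \<partial>\<mu>) \<mu> (f n)\<bar> / L2_norm \<mu> (f n)) \<longlonglongrightarrow> 0"
    proof (rule Lim_null_comparison)
      show "(\<lambda>n. H * L2_norm \<mu> (f n)) \<longlonglongrightarrow> 0" using tendsto_mult_right_zero[OF lim] .
      have "\<bar>(\<integral>x. \<phi> x \<partial>push \<mu> (\<lambda>x. x + f n x)) - (\<integral>x. \<phi> x \<partial>\<mu>) - dir_deriv (\<lambda>\<mu>. \<integral>x. \<phi> x \<partial>\<mu>) \<mu> (f n)\<bar> / L2_norm \<mu> (f n) \<le> H * L2_norm \<mu> (f n)" for n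
      proof -
        have fn: "f n \<in> L2_space \<mu>" and pos: "L2_norm \<mu> (f n) > 0" using f L2_norm_nonneg[of \<mu> "f n"] by (auto simp: less_le)
        show ?thesis
          using push_expansion[OF \<mu> fn] pos
          by (simp add: dir_deriv_integral[OF \<mu> fn] pos_divide_le_eq power2_eq_square mult.assoc)
      qed
      then show "\<forall>\<^sub>F n in sequentially. norm (\<bar>(\<integral>x. \<phi> x \<partial>push \<mu> (\<lambda>x. x + f n x)) - (\<integral>x. \<phi> x \<partial>\<mu>) - dir_deriv (\<lambda>\<mu>. \<integral>x. \<phi> x \<partial>\<mu>) \<mu> (f n)\<bar> / L2_norm \<mu> (f n)) \<le> H * L2_norm \<mu> (f n)"
        by (simp add: abs_divide)
    qed
  qed
  \<comment> \<open>The version \<open>D\<close> of the gradient does not depend on the measure, so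
    joint continuity is continuity of \<open>D\<close>.\<close>
  have "continuous_map (prod_topology (P2_topology :: (real ^ 'd) measure topology) euclidean) euclidean (D \<circ> snd)"
    by (rule continuous_map_compose[OF continuous_map_snd]) (simp add: cont_D)
  moreover have "D \<circ> snd = (\<lambda>(\<mu>::(real ^ 'd) measure, x). D x)" by auto
  moreover have "AE x in \<mu>. D x = gradient (\<lambda>\<mu>. \<integral>x. \<phi> x \<partial>\<mu>) \<mu> x" if "\<mu> \<in> P2" for \<mu>
    using gradient_integral(2)[OF that] by eventually_elim simp
  ultimately have ver: "continuous_gradient_version (\<lambda>\<mu>. \<integral>x. \<phi> x \<partial>\<mu>) (\<lambda>\<mu>. D)"
    by (simp add: continuous_gradient_version_def)
  have "\<bar>\<integral>x. \<phi> x \<partial>\<mu>\<bar> + norm (D x) \<le> B + B" if "\<mu> \<in> P2" for \<mu> x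
  proof -
    interpret prob_space \<mu> using P2_D(2)[OF that] .
    have "\<bar>\<integral>x. \<phi> x \<partial>\<mu>\<bar> \<le> (\<integral>x. \<bar>\<phi> x\<bar> \<partial>\<mu>)" by (rule integral_abs_bound)
    also have "\<dots> \<le> (\<integral>x. B \<partial>\<mu>)" using integrable_P2[OF that] b\<phi> by (intro integral_mono) auto
    finally show ?thesis using bD[of x] by (simp add: prob_space)
  qed
  with ver show ?thesis
    unfolding C1b_P2_def using intrinsically_differentiable_integral fr by blast
qed

end

text \<open>Bounded approximations of a function with Lipschitz gradient, obtained by precomposition with
  \<open>x\<^sub>i \<mapsto> k arctan (x\<^sub>i / k)\<close>, a contraction that converges to the identity and has bounded range.\<close>

definition squash :: "real \<Rightarrow> real ^ 'd \<Rightarrow> real ^ 'd" where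
  "squash k x = (\<chi> i. k * arctan (x $ i / k))"

definition squash_deriv :: "real \<Rightarrow> real \<Rightarrow> real" where
  "squash_deriv k t = inverse (1 + (t / k)\<^sup>2)"

lemma squash_deriv_bounds: "0 \<le> squash_deriv k t" "squash_deriv k t \<le> 1"
  unfolding squash_deriv_def by (simp_all add: inverse_le_1_iff)

lemma DERIV_squash: "k > 0 \<Longrightarrow> ((\<lambda>t. k * arctan (t / k)) has_real_derivative squash_deriv k t) (at t)"
  unfolding squash_deriv_def
  by (rule DERIV_cong[OF DERIV_cmult[OF DERIV_chain2[OF DERIV_arctan DERIV_cdivide[OF DERIV_ident]]]]) simp

lemma squash_component_lip:
  assumes k: "k > 0"
  shows "\<bar>k * arctan (s / k) - k * arctan (t / k)\<bar> \<le> \<bar>s - t\<bar>"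
proof -
  have "norm (k * arctan (s / k) - k * arctan (t / k)) \<le> 1 * norm (s - t)"
  proof (rule field_differentiable_bound[of UNIV "\<lambda>t. k * arctan (t / k)" "squash_deriv k"])
    show "norm (squash_deriv k z) \<le> 1" for z using squash_deriv_bounds[of k z] by simp
  qed (use DERIV_squash[OF k] in auto)
  then show ?thesis by simp
qed

lemma squash_deriv_lip:
  assumes k: "k > 0"
  shows "\<bar>squash_deriv k s - squash_deriv k t\<bar> \<le> (1 / k) * \<bar>s - t\<bar>"
proof -
  define d where "d t = - (2 * (t / k) / k) / (1 + (t / k)\<^sup>2)\<^sup>2" for t
  have pos: "1 + (t / k)\<^sup>2 > 0" for t by (simp add: add_pos_nonneg)
  have "norm (squash_deriv k s - squash_deriv k t) \<le> (1 / k) * norm (s - t)"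
  proof (rule field_differentiable_bound[of UNIV "squash_deriv k" d])
    fix z
    show "(squash_deriv k has_real_derivative d z) (at z within UNIV)"
      unfolding squash_deriv_def[abs_def] d_def using pos[of z] k
      by (auto intro!: derivative_eq_intros simp: power2_eq_square divide_simps)
    \<comment> \<open>Together with \<open>1 + s\<^sup>2 \<ge> 1\<close> this shows that
      \<open>2 |s| / (1 + s\<^sup>2)\<^sup>2\<close> is at most 1; the inner derivative of
      \<open>t / k\<close> contributes the factor \<open>1 / k\<close>.\<close>
    have "2 * \<bar>s\<bar> \<le> 1 + s\<^sup>2" for s :: real using sum_squares_bound[of 1 "\<bar>s\<bar>"] by simp
    then have "2 * \<bar>z / k\<bar> \<le> 1 + (z / k)\<^sup>2" .
    also have "\<dots> \<le> (1 + (z / k)\<^sup>2)\<^sup>2"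
    proof -
      have "1 + s \<le> (1 + s)\<^sup>2" if "s \<ge> 0" for s :: real
        using that by (simp add: power2_eq_square algebra_simps)
      then show ?thesis by simp
    qed
    finally have "2 * \<bar>z / k\<bar> / (1 + (z / k)\<^sup>2)\<^sup>2 \<le> 1" 
      using zero_less_power[OF pos[of z], of 2] by (simp only: pos_divide_le_eq mult_1_left)
    moreover have "norm (d z) = (1 / k) * (2 * \<bar>z / k\<bar> / (1 + (z / k)\<^sup>2)\<^sup>2)"
      unfolding d_def using k by (simp add: abs_mult abs_divide)
    ultimately show "norm (d z) \<le> 1 / k"
      using mult_left_le[of "2 * \<bar>z / k\<bar> / (1 + (z / k)\<^sup>2)\<^sup>2" "1 / k"] k by (simp only:) simp
  qed auto
  then show ?thesis by simp
qed

lemma norm_squash_le: "k > 0 \<Longrightarrow> norm (squash k x) \<le> norm x"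
  by (rule norm_le_componentwise_cart) (use squash_component_lip[of k _ 0] in \<open>auto simp: squash_def\<close>)

lemma squash_lip: "k > 0 \<Longrightarrow> norm (squash k x - squash k y) \<le> norm (x - y)"
  by (rule norm_le_componentwise_cart) (use squash_component_lip[of k] in \<open>auto simp: squash_def\<close>)

lemma squash_bounded:
  fixes x :: "real ^ 'd"
  assumes k: "k > 0" shows "norm (squash k x) \<le> real CARD('d) * (k * 2)"
proof -
  have "norm (squash k x) \<le> (\<Sum>i\<in>UNIV. \<bar>squash k x $ i\<bar>)" by (rule norm_le_l1_cart)
  also have "\<dots> \<le> (\<Sum>i\<in>(UNIV::'d set). k * 2)"
  proof (rule sum_mono)
    fix i
    have "\<bar>arctan (x $ i / k)\<bar> \<le> 2"
      using arctan_bounded[of "x $ i / k"] pi_half_less_two by (simp add: abs_le_iff)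
    then show "\<bar>squash k x $ i\<bar> \<le> k * 2" using k by (simp add: squash_def abs_mult)
  qed
  finally show ?thesis by simp
qed

context Lipschitz_gradient
begin

text \<open>The gradient of the composition of \<open>\<phi>\<close> with \<open>squash k\<close>,
  whose Jacobian is diagonal.\<close>

definition D_squash :: "real \<Rightarrow> real ^ 'd \<Rightarrow> real ^ 'd" where
  "D_squash k x = (\<chi> i. D (squash k x) $ i * squash_deriv k (x $ i))"

text \<open>\<open>squash k\<close> does not increase the norm and its derivative is at most 1. The
  bound is uniform in \<open>k\<close>, as dominated convergence for growing \<open>k\<close>
  requires.\<close>

lemma D_squash_le: "k > 0 \<Longrightarrow> norm (D_squash k x) \<le> c * (1 + norm x)"
proof -
  assume k: "k > 0"
  have "norm (D_squash k x) \<le> norm (D (squash k x))"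
    by (rule norm_le_componentwise_cart)
      (use squash_deriv_bounds in \<open>auto simp: D_squash_def abs_mult intro!: mult_left_le\<close>)
  also have "\<dots> \<le> c * (1 + norm (squash k x))" by (rule D_growth)
  also have "\<dots> \<le> c * (1 + norm x)" using norm_squash_le[OF k] c0 by (intro mult_left_mono) auto
  finally show ?thesis .
qed

lemma squash_has_derivative:
  assumes k: "k > 0"
  shows "((\<lambda>x. \<phi> (squash k x)) has_derivative (\<lambda>h. D_squash k x \<bullet> h)) (at x)"
proof -
  have "(squash k has_derivative (\<lambda>h. \<chi> i. squash_deriv k (x $ i) * h $ i)) (at x)"
    unfolding has_derivative_componentwise_within[of "squash k"]
  proof
    fix b :: "real ^ 'd" assume "b \<in> Basis"
    then obtain i where b: "b = axis i 1" by (auto simp: Basis_vec_def)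
    have "((\<lambda>t. k * arctan (t / k)) has_derivative (\<lambda>h. h * squash_deriv k (x $ i))) (at (x $ i))"
      using DERIV_squash[OF k, of "x $ i"] by (simp add: has_field_derivative_def mult.commute[of "squash_deriv k (x $ i)"] mult_commute_abs)
    from has_derivative_compose[OF bounded_linear_imp_has_derivative[OF bounded_linear_vec_nth[of i]], of "\<lambda>t. k * arctan (t / k)", OF this]
    show "((\<lambda>x. squash k x \<bullet> b) has_derivative (\<lambda>h. (\<chi> i. squash_deriv k (x $ i) * h $ i) \<bullet> b)) (at x)"
      by (simp add: b inner_axis squash_def mult.commute)
  qed
  from has_derivative_compose[OF this deriv]
  have "((\<lambda>x. \<phi> (squash k x)) has_derivative (\<lambda>h. D (squash k x) \<bullet> (\<chi> i. squash_deriv k (x $ i) * h $ i))) (at x)" .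
  then show ?thesis by (simp add: D_squash_def inner_vec_def mult_ac)
qed

text \<open>\<open>D\<close> may be unbounded, but it is evaluated on the bounded range of
  \<open>squash k\<close>, so \<open>D_squash k\<close> is a product of bounded Lipschitz factors.
  The constants depend on \<open>k\<close> and are used for each fixed \<open>k\<close>
  only.\<close>

lemma squash_Lipschitz_gradient:
  assumes k: "k > 0"
  obtains H' B where "Lipschitz_gradient (\<lambda>x. \<phi> (squash k x)) (D_squash k) H'"
    "\<And>x. \<bar>\<phi> (squash k x)\<bar> \<le> B" "\<And>x. norm (D_squash k x) \<le> B"
proof -
  define R where "R = real CARD('d) * (k * 2)"
  have R: "norm (squash k x) \<le> R" for x :: "real ^ 'd" unfolding R_def by (rule squash_bounded[OF k])
  have R0: "R \<ge> 0" using k by (simp add: R_def)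
  have DB: "norm (D (squash k x)) \<le> c * (1 + R)" for x
    using D_growth[of "squash k x"] mult_left_mono[OF _ c0, of "1 + norm (squash k x)" "1 + R"] R[of x] by simp
  have DsB: "norm (D_squash k x) \<le> c * (1 + R)" for x
  proof -
    have "norm (D_squash k x) \<le> norm (D (squash k x))"
      by (rule norm_le_componentwise_cart)
        (use squash_deriv_bounds in \<open>auto simp: D_squash_def abs_mult intro!: mult_left_le\<close>)
    with DB[of x] show ?thesis by linarith
  qed
  have \<phi>B: "\<bar>\<phi> (squash k x)\<bar> \<le> (\<bar>\<phi> 0\<bar> + 2 * c) * (1 + R\<^sup>2)" for x
  proof -
    have "(norm (squash k x))\<^sup>2 \<le> R\<^sup>2" using R by (intro power_mono) auto
    then have "(\<bar>\<phi> 0\<bar> + 2 * c) * (1 + (norm (squash k x))\<^sup>2) \<le> (\<bar>\<phi> 0\<bar> + 2 * c) * (1 + R\<^sup>2)"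
      using c0 by (intro mult_left_mono) auto
    with \<phi>_growth[of "squash k x"] show ?thesis by linarith
  qed
  define H' where "H' = real CARD('d) * (H + c * (1 + R) * (1 / k))"
  have "norm (D_squash k x - D_squash k y) \<le> H' * norm (x - y)" for x y
  proof -
    have "\<bar>(D_squash k x - D_squash k y) $ i\<bar> \<le> (H + c * (1 + R) * (1 / k)) * norm (x - y)" for i
    proof -
      have a: "\<bar>D (squash k x) $ i - D (squash k y) $ i\<bar> \<le> H * norm (x - y)"
      proof -
        have "\<bar>(D (squash k x) - D (squash k y)) $ i\<bar> \<le> norm (D (squash k x) - D (squash k y))" by (rule component_le_norm_cart)
        also have "\<dots> \<le> H * norm (squash k x - squash k y)" by (rule lip)
        also have "\<dots> \<le> H * norm (x - y)" by (intro mult_left_mono squash_lip k H0)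
        finally show ?thesis by simp
      qed
      have b: "\<bar>squash_deriv k (x $ i) - squash_deriv k (y $ i)\<bar> \<le> (1 / k) * norm (x - y)"
      proof -
        have "\<bar>x $ i - y $ i\<bar> \<le> norm (x - y)" using component_le_norm_cart[of "x - y" i] by simp
        then have "(1 / k) * \<bar>x $ i - y $ i\<bar> \<le> (1 / k) * norm (x - y)" using k by (intro mult_left_mono) auto
        with squash_deriv_lip[OF k, of "x $ i" "y $ i"] show ?thesis by linarith
      qed
      have "(D_squash k x - D_squash k y) $ i = (D (squash k x) $ i - D (squash k y) $ i) * squash_deriv k (x $ i)
          + D (squash k y) $ i * (squash_deriv k (x $ i) - squash_deriv k (y $ i))"
        by (simp add: D_squash_def algebra_simps)
      also have "\<bar>\<dots>\<bar> \<le> \<bar>D (squash k x) $ i - D (squash k y) $ i\<bar> * \<bar>squash_deriv k (x $ i)\<bar>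
          + \<bar>D (squash k y) $ i\<bar> * \<bar>squash_deriv k (x $ i) - squash_deriv k (y $ i)\<bar>"
        unfolding abs_mult[symmetric] by (rule abs_triangle_ineq)
      also have "\<dots> \<le> (H * norm (x - y)) * 1 + (c * (1 + R)) * ((1 / k) * norm (x - y))"
        using squash_deriv_bounds[of k "x $ i"] H0 c0 R0
        by (intro add_mono mult_mono a b order_trans[OF component_le_norm_cart DB]) auto
      also have "\<dots> = (H + c * (1 + R) * (1 / k)) * norm (x - y)" by (simp add: algebra_simps)
      finally show ?thesis .
    qed
    then have "(\<Sum>i\<in>UNIV. \<bar>(D_squash k x - D_squash k y) $ i\<bar>) \<le> (\<Sum>i\<in>(UNIV::'d set). (H + c * (1 + R) * (1 / k)) * norm (x - y))"
      by (intro sum_mono)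
    then show ?thesis using norm_le_l1_cart[of "D_squash k x - D_squash k y"] by (simp add: H'_def mult.assoc)
  qed
  moreover have "H' \<ge> 0" using H0 c0 R0 k by (simp add: H'_def)
  ultimately have "Lipschitz_gradient (\<lambda>x. \<phi> (squash k x)) (D_squash k) H'"
    using squash_has_derivative[OF k] by unfold_locales auto
  then show ?thesis
    using that[of H' "max (c * (1 + R)) ((\<bar>\<phi> 0\<bar> + 2 * c) * (1 + R\<^sup>2))"] DsB \<phi>B
    by (meson max.cobounded1 max.cobounded2 order_trans)
qed

lemma squash_tendsto: "(\<lambda>n. squash (real (Suc n)) x) \<longlonglongrightarrow> x" for x :: "real ^ 'd"
proof (rule vec_tendstoI)
  fix i
  have "(\<lambda>n. real (Suc n) * arctan (t / real (Suc n))) \<longlonglongrightarrow> t" for t :: real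
    by (cases t "0::real" rule: linorder_cases) (simp_all, real_asymp+)
  then show "(\<lambda>n. squash (real (Suc n)) x $ i) \<longlonglongrightarrow> x $ i" by (simp add: squash_def)
qed

lemma D_squash_tendsto: "(\<lambda>n. D_squash (real (Suc n)) x) \<longlonglongrightarrow> D x"
proof (rule vec_tendstoI)
  fix i
  have "isCont D x" using cont_D by (simp add: continuous_on_eq_continuous_at)
  then have "(\<lambda>n. D (squash (real (Suc n)) x)) \<longlonglongrightarrow> D x" by (rule isCont_tendsto_compose[OF _ squash_tendsto])
  then have "(\<lambda>n. D (squash (real (Suc n)) x) $ i) \<longlonglongrightarrow> D x $ i" by (rule tendsto_vec_nth)
  moreover have "(\<lambda>n. squash_deriv (real (Suc n)) t) \<longlonglongrightarrow> 1" for t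
  proof -
    have "(\<lambda>n. t / real (Suc n)) \<longlonglongrightarrow> 0" using tendsto_mult_left[OF LIMSEQ_inverse_real_of_nat, of t] by (simp add: field_simps)
    then have "(\<lambda>n. inverse (1 + (t / real (Suc n))\<^sup>2)) \<longlonglongrightarrow> inverse (1 + 0\<^sup>2)" by (intro tendsto_intros) auto
    then show ?thesis by (simp add: squash_deriv_def)
  qed
  ultimately have "(\<lambda>n. D (squash (real (Suc n)) x) $ i * squash_deriv (real (Suc n)) (x $ i)) \<longlonglongrightarrow> D x $ i * 1"
    by (intro tendsto_mult)
  then show "(\<lambda>n. D_squash (real (Suc n)) x $ i) \<longlonglongrightarrow> D x $ i" by (simp add: D_squash_def)
qed

end

section \<open>The form on the Wasserstein space\<close>

lemma AE_summable_norm: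
  fixes f :: "nat \<Rightarrow> 'a \<Rightarrow> real"
  assumes int: "\<And>i. integrable M (f i)" and sum: "summable (\<lambda>i. \<integral>x. \<bar>f i x\<bar> \<partial>M)"
  shows "AE x in M. summable (\<lambda>i. \<bar>f i x\<bar>)"
proof -
  have [measurable]: "f i \<in> borel_measurable M" for i using int by simp
  have "(\<integral>\<^sup>+x. (\<Sum>i. ennreal \<bar>f i x\<bar>) \<partial>M) = (\<Sum>i. \<integral>\<^sup>+x. ennreal \<bar>f i x\<bar> \<partial>M)"
    by (rule nn_integral_suminf) simp
  also have "\<dots> = (\<Sum>i. ennreal (\<integral>x. \<bar>f i x\<bar> \<partial>M))"
    using int by (intro arg_cong[where f=suminf] ext nn_integral_eq_integral) auto
  also have "\<dots> = ennreal (\<Sum>i. \<integral>x. \<bar>f i x\<bar> \<partial>M)"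
    by (rule suminf_ennreal2) (use sum in auto)
  finally have "(\<integral>\<^sup>+x. (\<Sum>i. ennreal \<bar>f i x\<bar>) \<partial>M) \<noteq> \<infinity>" by simp
  then have "AE x in M. (\<Sum>i. ennreal \<bar>f i x\<bar>) \<noteq> \<infinity>" by (intro nn_integral_PInf_AE) auto
  then show ?thesis by eventually_elim (rule summable_suminf_not_top, auto)
qed

lemma tendsto_L2_null_from_integral:
  assumes "(\<lambda>n. \<integral>x. (norm (f n x))\<^sup>2 \<partial>M) \<longlonglongrightarrow> 0"
  shows "(\<lambda>n. L2_norm M (f n)) \<longlonglongrightarrow> 0"
proof -
  have "(\<lambda>n. sqrt ((L2_norm M (f n))\<^sup>2)) \<longlonglongrightarrow> sqrt 0"
    unfolding L2_norm_sq_integral by (intro tendsto_real_sqrt assms)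
  then show ?thesis by simp
qed

lemma L2_Cauchy_of_limit:
  assumes p: "\<And>n::nat. p n \<in> L2_space M" and q: "q \<in> L2_space M"
    and lim: "(\<lambda>n. L2_norm M (\<lambda>x. p n x - q x)) \<longlonglongrightarrow> 0" and e: "e > 0"
  shows "\<exists>N. \<forall>m\<ge>N. \<forall>n\<ge>N. L2_norm M (\<lambda>x. p m x - p n x) < e"
proof -
  obtain N where N: "\<And>n. n \<ge> N \<Longrightarrow> L2_norm M (\<lambda>x. p n x - q x) < e / 2"
    using LIMSEQ_D[OF lim, of "e / 2"] e by auto
  have "L2_norm M (\<lambda>x. p m x - p n x) < e" if "m \<ge> N" "n \<ge> N" for m n
    using L2_norm_diff_triangle[OF p[of m] q p[of n]] N[OF that(1)] N[OF that(2)]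
    by (simp add: L2_norm_minus_commute[of M q])
  then show ?thesis by blast
qed

context L2_gaussian
begin

lemma measurable_G_seq:
  fixes \<Phi> :: "('a \<Rightarrow> 'b) \<Rightarrow> real"
  assumes "\<And>f F. f \<in> L2_space M \<Longrightarrow> (\<And>n. F n \<in> L2_space M) \<Longrightarrow>
      (\<lambda>n. L2_norm M (\<lambda>x. F n x - f x)) \<longlonglongrightarrow> 0 \<Longrightarrow> (\<lambda>n. \<Phi> (F n)) \<longlonglongrightarrow> \<Phi> f"
  shows "\<Phi> \<in> borel_measurable G"
  using measurable_L2_borel_seq[of M \<Phi>] assms measurable_cong_sets[OF sets_G refl] by blast

text \<open>Consequences of the nonnegativity of squares; they reduce the growth rates below to the
  fourth power, which is integrable over \<open>G\<close>.\<close>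

lemma one_plus_power4: "1 + x \<le> 2 * (1 + x ^ 4)" "(1 + x)\<^sup>2 \<le> 4 * (1 + x ^ 4)" "(1 + x\<^sup>2)\<^sup>2 \<le> 2 * (1 + x ^ 4)"
  "1 + x\<^sup>2 \<le> 2 * (1 + x ^ 4)" for x :: real
proof -
  have "0 \<le> (x\<^sup>2 - 1/2)\<^sup>2" "0 \<le> (x - 1/2)\<^sup>2" "0 \<le> (x - 1)\<^sup>2" "0 \<le> (x\<^sup>2 - 1)\<^sup>2" by simp_all
  then have q: "x\<^sup>2 \<le> x ^ 4 + 1/4" "x \<le> x\<^sup>2 + 1/4" "2 * x \<le> 1 + x\<^sup>2" "2 * x\<^sup>2 \<le> 1 + x ^ 4"
    by (simp_all add: power2_eq_square power4_eq_xxxx algebra_simps)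
  have e: "(1 + x)\<^sup>2 = 1 + 2 * x + x\<^sup>2" "(1 + x\<^sup>2)\<^sup>2 = 1 + 2 * x\<^sup>2 + x ^ 4"
    by (simp_all add: power2_eq_square power4_eq_xxxx algebra_simps)
  have "0 \<le> x ^ 4" by simp
  with q e show "1 + x \<le> 2 * (1 + x ^ 4)" "(1 + x)\<^sup>2 \<le> 4 * (1 + x ^ 4)" "(1 + x\<^sup>2)\<^sup>2 \<le> 2 * (1 + x ^ 4)"
     "1 + x\<^sup>2 \<le> 2 * (1 + x ^ 4)"
    unfolding distrib_left by linarith+
qed

lemma measurable_norm_of_coords:
  assumes V: "\<And>f. f \<in> L2_space M \<Longrightarrow> V f \<in> L2_space M" and m: "\<And>n. (\<lambda>f. coord n (V f)) \<in> borel_measurable G"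
  shows "(\<lambda>f. (L2_norm M (V f))\<^sup>2) \<in> borel_measurable G"
proof -
  have "(\<lambda>f. (L2_norm M (V f))\<^sup>2) \<in> borel_measurable G \<longleftrightarrow> (\<lambda>f. \<Sum>n. (coord n (V f))\<^sup>2) \<in> borel_measurable G"
    by (rule measurable_cong) (use sums_unique[OF Parseval[OF V]] in auto)
  also have "\<dots>" using m by measurable
  finally show ?thesis .
qed

lemma L2_fieldI:
  assumes V: "\<And>f. f \<in> L2_space M \<Longrightarrow> V f \<in> L2_space M" and m: "\<And>n. (\<lambda>f. coord n (V f)) \<in> borel_measurable G"
    and b: "\<And>f. f \<in> L2_space M \<Longrightarrow> L2_norm M (V f) \<le> C * (1 + L2_norm M f)"
  shows "L2_field V"
  unfolding L2_field_def
proof (intro conjI ballI allI V m integrable_norm_bound)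
  show "(\<lambda>f. (L2_norm M (V f))\<^sup>2) \<in> borel_measurable G" by (rule measurable_norm_of_coords[OF V m])
  show "\<bar>(L2_norm M (V f))\<^sup>2\<bar> \<le> (C\<^sup>2 * 4) * (1 + (L2_norm M f) ^ 4)" if "f \<in> L2_space M" for f
  proof -
    have "(L2_norm M (V f))\<^sup>2 \<le> (C * (1 + L2_norm M f))\<^sup>2" using b[OF that] by (intro power_mono) auto
    also have "\<dots> \<le> C\<^sup>2 * (4 * (1 + (L2_norm M f) ^ 4))"
      unfolding power_mult_distrib by (intro mult_left_mono one_plus_power4) simp
    finally show ?thesis by (simp add: mult.assoc)
  qed
qed auto

lemma L2_field_diff:
  assumes V: "L2_field V" and W: "L2_field W"
  shows "L2_field (\<lambda>f x. V f x - W f x)"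
  unfolding L2_field_def
proof (intro conjI ballI allI)
  have L: "V f \<in> L2_space M" "W f \<in> L2_space M" if "f \<in> L2_space M" for f using V W that by (auto simp: L2_field_def)
  then show D: "(\<lambda>x. V f x - W f x) \<in> L2_space M" if "f \<in> L2_space M" for f using that by (intro L2_diff) auto
  show m: "(\<lambda>f. coord n (\<lambda>x. V f x - W f x)) \<in> borel_measurable G" for n
  proof -
    have "(\<lambda>f. coord n (\<lambda>x. V f x - W f x)) \<in> borel_measurable G \<longleftrightarrow> (\<lambda>f. coord n (V f) - coord n (W f)) \<in> borel_measurable G"
      by (rule measurable_cong) (simp add: L2_inner_diff_left L)
    also have "\<dots>" using V W by (auto simp: L2_field_def intro!: borel_measurable_diff)
    finally show ?thesis .
  qed
  show "integrable G (\<lambda>f. (L2_norm M (\<lambda>x. V f x - W f x))\<^sup>2)"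
  proof (rule Bochner_Integration.integrable_bound)
    show "integrable G (\<lambda>f. 2 * (L2_norm M (V f))\<^sup>2 + 2 * (L2_norm M (W f))\<^sup>2)"
      using V W by (auto simp: L2_field_def)
    show "AE f in G. norm ((L2_norm M (\<lambda>x. V f x - W f x))\<^sup>2) \<le> norm (2 * (L2_norm M (V f))\<^sup>2 + 2 * (L2_norm M (W f))\<^sup>2)"
    proof (rule AE_I2)
      fix f assume "f \<in> space G"
      then have f: "f \<in> L2_space M" by simp
      have "(L2_norm M (\<lambda>x. V f x - W f x))\<^sup>2 + (L2_norm M (\<lambda>x. V f x + W f x))\<^sup>2 = 2 * (L2_norm M (V f))\<^sup>2 + 2 * (L2_norm M (W f))\<^sup>2"
        using L2_norm_diff_sq[OF L[OF f]] L2_norm_add_sq[OF L[OF f]] by simp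
      then have "(L2_norm M (\<lambda>x. V f x - W f x))\<^sup>2 \<le> 2 * (L2_norm M (V f))\<^sup>2 + 2 * (L2_norm M (W f))\<^sup>2"
        using zero_le_power2[of "L2_norm M (\<lambda>x. V f x + W f x)"] by linarith
      then show "norm ((L2_norm M (\<lambda>x. V f x - W f x))\<^sup>2) \<le> norm (2 * (L2_norm M (V f))\<^sup>2 + 2 * (L2_norm M (W f))\<^sup>2)"
        by simp
    qed
  qed (rule measurable_norm_of_coords[OF D m])
qed

lemma coords_diff:
  assumes V: "L2_field V" and W: "L2_field W"
  shows "L2_norm NG (\<lambda>z. coords V z - coords W z) = L2_norm NG (coords (\<lambda>f x. V f x - W f x))"
proof (rule L2_norm_cong_AE)
  have L: "V f \<in> L2_space M" "W f \<in> L2_space M" if "f \<in> L2_space M" for f using V W that by (auto simp: L2_field_def)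
  show "AE z in NG. coords V z - coords W z = coords (\<lambda>f x. V f x - W f x) z"
    by (rule AE_I2) (auto simp: NG_def space_pair_measure coords_def L2_inner_diff_left L)
qed (use coords_L2(1)[OF V] coords_L2(1)[OF W] coords_L2(1)[OF L2_field_diff[OF V W]] in
    \<open>auto intro!: borel_measurable_diff dest: L2_measurable\<close>)

text \<open>Closability concerns the difference of two approximating sequences, so the class must
  admit differences.\<close>

lemma C1b_functional_diff:
  assumes F: "C1b_functional F V" and K: "C1b_functional K W"
  shows "C1b_functional (\<lambda>f. F f - K f) (\<lambda>f x. V f x - W f x)"
  unfolding C1b_functional_def
proof (intro conjI allI ballI)
  show "(\<lambda>f. F f - K f) \<in> borel_measurable G"
    using C1b_functionalD(1)[OF F] C1b_functionalD(1)[OF K] by simp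
  show "L2_field (\<lambda>f x. V f x - W f x)"
    by (rule L2_field_diff[OF C1b_functionalD(2)[OF F] C1b_functionalD(2)[OF K]])
  fix n t and f :: "'a \<Rightarrow> 'b" assume f: "f \<in> L2_space M"
  have cd: "coord n (\<lambda>x. V (\<lambda>x. f x + t *\<^sub>R g n x) x - W (\<lambda>x. f x + t *\<^sub>R g n x) x) =
      coord n (V (\<lambda>x. f x + t *\<^sub>R g n x)) - coord n (W (\<lambda>x. f x + t *\<^sub>R g n x))" for t
    by (rule L2_inner_diff_left) (intro C1b_functionalD(3)[OF F] C1b_functionalD(3)[OF K] L2_add_scaleR f g_L2)+
  show "((\<lambda>t. F (\<lambda>x. f x + t *\<^sub>R g n x) - K (\<lambda>x. f x + t *\<^sub>R g n x)) has_real_derivative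
      coord n (\<lambda>x. V (\<lambda>x. f x + t *\<^sub>R g n x) x - W (\<lambda>x. f x + t *\<^sub>R g n x) x)) (at t)"
    unfolding cd by (intro DERIV_diff C1b_functionalD(5)[OF F f] C1b_functionalD(5)[OF K f])
  show "isCont (\<lambda>t. coord n (\<lambda>x. V (\<lambda>x. f x + t *\<^sub>R g n x) x - W (\<lambda>x. f x + t *\<^sub>R g n x) x)) t"
    unfolding cd by (intro continuous_diff C1b_functionalD(6)[OF F f] C1b_functionalD(6)[OF K f])
next
  obtain C where C: "C \<ge> 0" "\<And>f. f \<in> L2_space M \<Longrightarrow> \<bar>F f\<bar> \<le> C"
    "\<And>f. f \<in> L2_space M \<Longrightarrow> L2_norm M (V f) \<le> C" "\<And>f n. f \<in> L2_space M \<Longrightarrow> \<bar>coord n (V f)\<bar> \<le> C"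
    using C1b_functional_bound[OF F] by blast
  obtain E where E: "E \<ge> 0" "\<And>f. f \<in> L2_space M \<Longrightarrow> \<bar>K f\<bar> \<le> E"
    "\<And>f. f \<in> L2_space M \<Longrightarrow> L2_norm M (W f) \<le> E" "\<And>f n. f \<in> L2_space M \<Longrightarrow> \<bar>coord n (W f)\<bar> \<le> E"
    using C1b_functional_bound[OF K] by blast
  have "\<bar>F f - K f\<bar> \<le> C + E \<and> L2_norm M (\<lambda>x. V f x - W f x) \<le> C + E" if f: "f \<in> L2_space M" for f
  proof
    show "\<bar>F f - K f\<bar> \<le> C + E" using C(2)[OF f] E(2)[OF f] by linarith
    have "L2_norm M (\<lambda>x. V f x - W f x) \<le> L2_norm M (\<lambda>x. V f x - 0) + L2_norm M (\<lambda>x. 0 - W f x)"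
      by (rule L2_norm_diff_triangle) (use C1b_functionalD(3)[OF F f] C1b_functionalD(3)[OF K f] in auto)
    then show "L2_norm M (\<lambda>x. V f x - W f x) \<le> C + E"
      using C(3)[OF f] E(3)[OF f] L2_norm_minus_commute[of M "\<lambda>x. 0" "W f"] by simp
  qed
  then show "\<exists>C. \<forall>f\<in>L2_space M. \<bar>F f - K f\<bar> \<le> C \<and> L2_norm M (\<lambda>x. V f x - W f x) \<le> C" by blast
qed

end

locale wasserstein_gaussian = L2_gaussian lam g \<alpha> S G
  for lam :: "(real ^ 'd) measure" and g :: "nat \<Rightarrow> real ^ 'd \<Rightarrow> real ^ 'd" and \<alpha> S G +
  assumes lam_P2: "lam \<in> P2"
begin

section \<open>Transfer between \<open>\<Lambda>\<close> and \<open>G\<close>\<close>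

lemma push_measurable_G [measurable]: "push lam \<in> measurable G P2_borel"
  using measurable_push[OF lam_P2] measurable_cong_sets[OF sets_G refl] by blast

abbreviation \<Lambda> :: "(real ^ 'd) measure measure" where "\<Lambda> \<equiv> Lambda_measure lam G"

lemma prob_\<Lambda>: "prob_space \<Lambda>"
  unfolding Lambda_measure_def by (rule G.prob_space_distr) measurable

lemma sets_\<Lambda> [simp, measurable_cong]: "sets \<Lambda> = sets P2_borel"
  by (simp add: Lambda_measure_def)

lemma integral_\<Lambda>:
  fixes v :: "_ \<Rightarrow> real"
  assumes "v \<in> borel_measurable P2_borel"
  shows "(\<integral>\<mu>. v \<mu> \<partial>\<Lambda>) = (\<integral>f. v (push lam f) \<partial>G)" "integrable \<Lambda> v \<longleftrightarrow> integrable G (\<lambda>f. v (push lam f))"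
  unfolding Lambda_measure_def by (rule integral_distr[OF push_measurable_G assms] integrable_distr_eq[OF push_measurable_G assms])+

lemma L2_\<Lambda>:
  fixes v w :: "_ \<Rightarrow> real"
  assumes "v \<in> borel_measurable P2_borel"
  shows "v \<in> L2_space \<Lambda> \<longleftrightarrow> (\<lambda>f. v (push lam f)) \<in> L2_space G"
    "L2_norm \<Lambda> v = L2_norm G (\<lambda>f. v (push lam f))"
    "w \<in> borel_measurable P2_borel \<Longrightarrow> L2_inner \<Lambda> v w = L2_inner G (\<lambda>f. v (push lam f)) (\<lambda>f. w (push lam f))"
proof -
  note assms[measurable]
  show "v \<in> L2_space \<Lambda> \<longleftrightarrow> (\<lambda>f. v (push lam f)) \<in> L2_space G"
    unfolding L2_space_def mem_Collect_eq by (subst integral_\<Lambda>(2)) auto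
  show "L2_norm \<Lambda> v = L2_norm G (\<lambda>f. v (push lam f))"
    unfolding L2_norm_def L2_inner_def by (subst integral_\<Lambda>(1)) auto
  assume [measurable]: "w \<in> borel_measurable P2_borel"
  show "L2_inner \<Lambda> v w = L2_inner G (\<lambda>f. v (push lam f)) (\<lambda>f. w (push lam f))"
    unfolding L2_inner_def by (subst integral_\<Lambda>(1)) auto
qed

text \<open>The bridge from intrinsic calculus on \<open>P2\<close> to Gaussian calculus on
  \<open>L2\<close>: the line derivatives are instances of \<open>chain_rule\<close>.\<close>

lemma C1b_functional_push:
  assumes "U \<in> C1b_P2"
  shows "C1b_functional (\<lambda>f. U (push lam f)) (pull_gradient U lam)"
proof -
  interpret U: C1b_on_P2 lam U by unfold_locales (use lam_P2 assms in auto)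
  obtain C where C: "\<And>f. f \<in> L2_space lam \<Longrightarrow> \<bar>U (push lam f)\<bar> \<le> C"
    "\<And>f. f \<in> L2_space lam \<Longrightarrow> L2_norm lam (pull_gradient U lam f) \<le> C"
    by (rule U.bounds) blast
  have C0: "C \<ge> 0" using order_trans[OF L2_norm_nonneg C(2)[OF L2_zero]] .
  show ?thesis
    unfolding C1b_functional_def
  proof (intro conjI allI ballI)
    show "(\<lambda>f. U (push lam f)) \<in> borel_measurable G"
      by (rule measurable_G_seq) (rule U.u_push_tendsto)
    show "L2_field (pull_gradient U lam)"
    proof (rule L2_fieldI[where C=C])
      show "(\<lambda>f. coord n (pull_gradient U lam f)) \<in> borel_measurable G" for n
        by (rule measurable_G_seq) (intro tendsto_inner_L2 U.pull_gradient_tendsto U.pull_gradient_L2 g_L2)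
      show "L2_norm lam (pull_gradient U lam f) \<le> C * (1 + L2_norm lam f)" if "f \<in> L2_space lam" for f
        using C(2)[OF that] C0 mult_left_mono[of 1 "1 + L2_norm lam f" C] by simp
    qed (rule U.pull_gradient_L2)
    show "((\<lambda>t. U (push lam (\<lambda>x. f x + t *\<^sub>R g n x))) has_real_derivative
        coord n (pull_gradient U lam (\<lambda>x. f x + t *\<^sub>R g n x))) (at t)" if "f \<in> L2_space lam" for n f t
      by (rule U.chain_rule[OF that g_L2])
    show "isCont (\<lambda>t. coord n (pull_gradient U lam (\<lambda>x. f x + t *\<^sub>R g n x))) t" if "f \<in> L2_space lam" for n f t
      by (rule U.isCont_pull_gradient_line[OF that g_L2 g_L2])
    show "\<exists>C. \<forall>f\<in>L2_space lam. \<bar>U (push lam f)\<bar> \<le> C \<and> L2_norm lam (pull_gradient U lam f) \<le> C"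
      using C by blast
  qed
qed

lemma C1b_measurable: "U \<in> C1b_P2 \<Longrightarrow> U \<in> borel_measurable P2_borel"
  by (rule continuous_map_P2_measurable) (simp add: C1b_P2_def intrinsically_differentiable_def)

lemma C1b_L2: "U \<in> C1b_P2 \<Longrightarrow> U \<in> L2_space \<Lambda>"
  by (subst L2_\<Lambda>(1)) (auto intro: C1b_measurable C1b_functional_L2(1)[OF C1b_functional_push])

lemma pre_form_coords:
  assumes "U \<in> C1b_P2" "V \<in> C1b_P2"
  shows "pre_form lam S G U V = L2_inner NG (coords (pull_gradient U lam)) (coords (pull_gradient V lam))"
  unfolding pre_form_def pull_gradient_def[symmetric]
  by (rule coords_inner[symmetric]) (intro C1b_functionalD(2)[OF C1b_functional_push] assms)+

text \<open>\<open>gradient\<close> is a choice, so the gradient of a difference equals the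
  difference of the gradients only almost everywhere; coordinates erase the discrepancy. Cauchy
  sequences for the form thus become Cauchy sequences in \<open>L2_space NG\<close>.\<close>

lemma pre_form_diff:
  assumes U: "U \<in> C1b_P2" and V: "V \<in> C1b_P2"
  shows "pre_form lam S G (\<lambda>\<mu>. U \<mu> - V \<mu>) (\<lambda>\<mu>. U \<mu> - V \<mu>) =
    (L2_norm NG (\<lambda>z. coords (pull_gradient U lam) z - coords (pull_gradient V lam) z))\<^sup>2"
proof -
  let ?W = "pull_gradient (\<lambda>\<mu>. U \<mu> - V \<mu>) lam"
  define E where "E = (\<lambda>f x. pull_gradient U lam f x - pull_gradient V lam f x)"
  note fU = C1b_functionalD(2)[OF C1b_functional_push[OF U]] and fV = C1b_functionalD(2)[OF C1b_functional_push[OF V]]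
  have E: "L2_field E" unfolding E_def by (rule L2_field_diff[OF fU fV])
  have iU: "intrinsically_differentiable U" and iV: "intrinsically_differentiable V"
    using U V by (auto simp: C1b_P2_def)
  have W: "?W f \<in> L2_space lam" "AE x in lam. ?W f x = E f x" if f: "f \<in> L2_space lam" for f
  proof -
    note gd = gradient_diff[OF iU iV push_P2[OF lam_P2 f]]
    show "?W f \<in> L2_space lam"
      unfolding pull_gradient_def comp_def by (rule L2_push(2)[OF lam_P2 f gd(1)])
    show "AE x in lam. ?W f x = E f x"
      using AE_push[OF lam_P2 f gd(2)] by eventually_elim (simp add: pull_gradient_def E_def)
  qed
  have "pre_form lam S G (\<lambda>\<mu>. U \<mu> - V \<mu>) (\<lambda>\<mu>. U \<mu> - V \<mu>) = (\<integral>f. L2_inner lam (?W f) (S (?W f)) \<partial>G)"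
    by (simp add: pre_form_def pull_gradient_def)
  also have "\<dots> = (\<integral>f. L2_inner lam (E f) (S (E f)) \<partial>G)"
  proof (rule Bochner_Integration.integral_cong[OF refl])
    fix f assume "f \<in> space G"
    then have f: "f \<in> L2_space lam" by simp
    have Ef: "E f \<in> L2_space lam" using E f by (auto simp: L2_field_def)
    have "coord n (?W f) = coord n (E f)" for n
      by (rule L2_inner_cong_AE) (use W[OF f] Ef in \<open>auto dest: L2_measurable intro: L2_measurable[OF g_L2]\<close>)
    then have "(\<lambda>n. \<alpha> n * coord n (E f) * coord n (E f)) sums L2_inner lam (?W f) (S (?W f))"
      using S_inner[OF W(1)[OF f] W(1)[OF f]] by simp
    then show "L2_inner lam (?W f) (S (?W f)) = L2_inner lam (E f) (S (E f))"
      using S_inner[OF Ef Ef] by (rule sums_unique2)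
  qed
  also have "\<dots> = (L2_norm NG (coords E))\<^sup>2"
    using coords_inner[OF E E] by (simp add: L2_norm_sq)
  also have "L2_norm NG (coords E) = L2_norm NG (\<lambda>z. coords (pull_gradient U lam) z - coords (pull_gradient V lam) z)"
    unfolding E_def by (rule coords_diff[OF fU fV, symmetric])
  finally show ?thesis .
qed

text \<open>\<open>closable\<close> is applied to the difference of the two sequences, formed on the
  level of functionals of \<open>f\<close>. It makes the coordinates of any two approximations of
  the same function asymptotically equal.\<close>

lemma C1b_closable:
  assumes U: "\<And>k. U k \<in> C1b_P2" and V: "\<And>k. V k \<in> C1b_P2"
    and null: "(\<lambda>k. L2_norm \<Lambda> (\<lambda>\<mu>. U k \<mu> - V k \<mu>)) \<longlonglongrightarrow> 0"
    and cU: "\<And>e. e > 0 \<Longrightarrow> \<exists>N. \<forall>m\<ge>N. \<forall>k\<ge>N. L2_norm NG (\<lambda>z. coords (pull_gradient (U m) lam) z - coords (pull_gradient (U k) lam) z) < e"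
    and cV: "\<And>e. e > 0 \<Longrightarrow> \<exists>N. \<forall>m\<ge>N. \<forall>k\<ge>N. L2_norm NG (\<lambda>z. coords (pull_gradient (V m) lam) z - coords (pull_gradient (V k) lam) z) < e"
  shows "(\<lambda>k::nat. L2_norm NG (\<lambda>z. coords (pull_gradient (U k) lam) z - coords (pull_gradient (V k) lam) z)) \<longlonglongrightarrow> 0"
proof -
  define u v where "u k = pull_gradient (U k) lam" and "v k = pull_gradient (V k) lam" for k
  note FU = C1b_functional_push[OF U, folded u_def] and FV = C1b_functional_push[OF V, folded v_def]
  note fu = C1b_functionalD(2)[OF FU] and fv = C1b_functionalD(2)[OF FV]
  note Lu = coords_L2(1)[OF fu] and Lv = coords_L2(1)[OF fv]
  have W: "C1b_functional (\<lambda>f. U k (push lam f) - V k (push lam f)) (\<lambda>f x. u k f x - v k f x)" for k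
    by (rule C1b_functional_diff[OF FU FV])
  have "(\<lambda>k. L2_norm NG (coords (\<lambda>f x. u k f x - v k f x))) \<longlonglongrightarrow> 0"
  proof (rule closable[OF W])
    show "(\<lambda>k. L2_norm G (\<lambda>f. U k (push lam f) - V k (push lam f))) \<longlonglongrightarrow> 0"
      using null C1b_measurable[OF U] C1b_measurable[OF V] by (subst (asm) L2_\<Lambda>(2)) auto
    fix e :: real assume e: "e > 0"
    obtain N where N: "\<And>m k. m \<ge> N \<Longrightarrow> k \<ge> N \<Longrightarrow> L2_norm NG (\<lambda>z. coords (u m) z - coords (u k) z) < e / 2"
      using cU[of "e / 2"] e unfolding u_def by auto
    obtain N' where N': "\<And>m k. m \<ge> N' \<Longrightarrow> k \<ge> N' \<Longrightarrow> L2_norm NG (\<lambda>z. coords (v m) z - coords (v k) z) < e / 2"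
      using cV[of "e / 2"] e unfolding v_def by auto
    have "L2_norm NG (\<lambda>z. coords (\<lambda>f x. u m f x - v m f x) z - coords (\<lambda>f x. u k f x - v k f x) z) < e"
      if mk: "m \<ge> max N N'" "k \<ge> max N N'" for m k
    proof -
      have cd: "coords (\<lambda>f x. u k f x - v k f x) z = coords (u k) z - coords (v k) z" if "z \<in> space NG" for k z
        using that C1b_functionalD(3)[OF FU] C1b_functionalD(3)[OF FV]
        by (auto simp: NG_def space_pair_measure coords_def L2_inner_diff_left)
      have "L2_norm NG (\<lambda>z. coords (\<lambda>f x. u m f x - v m f x) z - coords (\<lambda>f x. u k f x - v k f x) z)
          = L2_norm NG (\<lambda>z. (coords (u m) z - coords (u k) z) - (coords (v m) z - coords (v k) z))"
        unfolding L2_norm_def L2_inner_def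
        by (intro arg_cong[where f=sqrt] Bochner_Integration.integral_cong refl) (simp add: cd algebra_simps)
      also have "\<dots> \<le> L2_norm NG (\<lambda>z. (coords (u m) z - coords (u k) z) - 0) + L2_norm NG (\<lambda>z. 0 - (coords (v m) z - coords (v k) z))"
        by (intro L2_norm_diff_triangle L2_diff Lu Lv L2_zero)
      also have "L2_norm NG (\<lambda>z. 0 - (coords (v m) z - coords (v k) z)) = L2_norm NG (\<lambda>z. coords (v m) z - coords (v k) z)"
        using L2_norm_minus_commute[of NG "\<lambda>z. 0" "\<lambda>z. coords (v m) z - coords (v k) z"] by simp
      finally show ?thesis using N[of m k] N'[of m k] mk by simp
    qed
    then show "\<exists>N. \<forall>m\<ge>N. \<forall>k\<ge>N. L2_norm NG (\<lambda>z. coords (\<lambda>f x. u m f x - v m f x) z - coords (\<lambda>f x. u k f x - v k f x) z) < e"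
      by blast
  qed
  then show ?thesis using coords_diff[OF fu fv] by (simp add: u_def v_def)
qed

end

locale wasserstein_gaussian_function = wasserstein_gaussian lam g \<alpha> S G + Lipschitz_gradient \<phi> D H
  for lam :: "(real ^ 'd) measure" and g :: "nat \<Rightarrow> real ^ 'd \<Rightarrow> real ^ 'd" and \<alpha> S G
    and \<phi> :: "real ^ 'd \<Rightarrow> real" and D :: "real ^ 'd \<Rightarrow> real ^ 'd" and H
begin

abbreviation u :: "(real ^ 'd) measure \<Rightarrow> real" where "u \<equiv> \<lambda>\<mu>. \<integral>x. \<phi> x \<partial>\<mu>"

text \<open>The would-be \<open>pull_gradient\<close> of \<open>u\<close>; since
  \<open>\<phi>\<close> may be unbounded, \<open>u\<close> need not lie in
  \<open>C1b_P2\<close>.\<close>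

definition DF :: "(real ^ 'd \<Rightarrow> real ^ 'd) \<Rightarrow> real ^ 'd \<Rightarrow> real ^ 'd" where
  "DF f = (\<lambda>x. D (f x))"

lemma norm_plus_one_L2:
  assumes f: "f \<in> L2_space lam"
  shows "(\<lambda>x. 1 + norm (f x)) \<in> L2_space lam" "L2_norm lam (\<lambda>x. 1 + norm (f x)) \<le> 1 + L2_norm lam f"
proof -
  have n: "(\<lambda>x. norm (f x)) \<in> L2_space lam" "L2_norm lam (\<lambda>x. norm (f x)) = L2_norm lam f"
  proof -
    show "(\<lambda>x. norm (f x)) \<in> L2_space lam"
      by (rule L2_bound[OF _ f]) (use L2_measurable[OF f] in auto)
    show "L2_norm lam (\<lambda>x. norm (f x)) = L2_norm lam f"
      by (simp add: L2_norm_def L2_inner_def power2_norm_eq_inner[symmetric] power2_eq_square[symmetric])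
  qed
  have o: "(\<lambda>x. 1::real) \<in> L2_space lam" by (rule L2_const) unfold_locales
  show "(\<lambda>x. 1 + norm (f x)) \<in> L2_space lam" by (rule L2_add[OF o n(1)])
  have "L2_norm lam (\<lambda>x. 1::real) = 1" by (simp add: L2_norm_def L2_inner_def prob_space)
  then show "L2_norm lam (\<lambda>x. 1 + norm (f x)) \<le> 1 + L2_norm lam f"
    using L2_norm_triangle[OF o n(1)] n(2) by simp
qed

lemma DF_L2: assumes f: "f \<in> L2_space lam" shows "DF f \<in> L2_space lam" "L2_norm lam (DF f) \<le> c * (1 + L2_norm lam f)"
proof -
  have s: "(\<lambda>x. c *\<^sub>R (1 + norm (f x))) \<in> L2_space lam" by (rule L2_scaleR[OF norm_plus_one_L2(1)[OF f]])
  have ae: "AE x in lam. norm (DF f x) \<le> norm (c *\<^sub>R (1 + norm (f x)))"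
    using D_growth c0 by (auto simp: DF_def)
  show L: "DF f \<in> L2_space lam"
    by (rule L2_bound[OF _ s ae]) (use L2_measurable[OF f] in \<open>auto simp: DF_def\<close>)
  have "L2_norm lam (DF f) \<le> L2_norm lam (\<lambda>x. c *\<^sub>R (1 + norm (f x)))" by (rule L2_norm_mono[OF L s ae])
  also have "\<dots> = c * L2_norm lam (\<lambda>x. 1 + norm (f x))" using c0 by (simp only: L2_norm_scaleR abs_of_nonneg)
  also have "\<dots> \<le> c * (1 + L2_norm lam f)" by (intro mult_left_mono norm_plus_one_L2 f c0)
  finally show "L2_norm lam (DF f) \<le> c * (1 + L2_norm lam f)" .
qed

lemma DF_lip:
  assumes "f \<in> L2_space lam" "h \<in> L2_space lam"
  shows "L2_norm lam (\<lambda>x. DF f x - DF h x) \<le> H * L2_norm lam (\<lambda>x. f x - h x)"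
proof -
  have "L2_norm lam (\<lambda>x. DF f x - DF h x) \<le> L2_norm lam (\<lambda>x. H *\<^sub>R (f x - h x))"
    by (intro L2_norm_mono L2_diff L2_scaleR DF_L2 assms) (use lip H0 in \<open>auto simp: DF_def\<close>)
  also have "\<dots> = H * L2_norm lam (\<lambda>x. f x - h x)" using H0 L2_norm_scaleR[of lam H "\<lambda>x. f x - h x"] by simp
  finally show ?thesis .
qed

lemma DF_tendsto:
  assumes "f \<in> L2_space lam" "\<And>n. F n \<in> L2_space lam" "(\<lambda>n. L2_norm lam (\<lambda>x. F n x - f x)) \<longlonglongrightarrow> 0"
  shows "(\<lambda>n. L2_norm lam (\<lambda>x. DF (F n) x - DF f x)) \<longlonglongrightarrow> 0"
proof (rule Lim_null_comparison)
  show "\<forall>\<^sub>F n in sequentially. norm (L2_norm lam (\<lambda>x. DF (F n) x - DF f x)) \<le> H * L2_norm lam (\<lambda>x. F n x - f x)"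
    using DF_lip[OF assms(2,1)] by simp
  show "(\<lambda>n. H * L2_norm lam (\<lambda>x. F n x - f x)) \<longlonglongrightarrow> 0" using tendsto_mult_right_zero[OF assms(3)] .
qed

lemma DF_field: "L2_field DF"
proof (rule L2_fieldI[where C=c])
  show "(\<lambda>f. coord n (DF f)) \<in> borel_measurable G" for n
    by (rule measurable_G_seq) (intro tendsto_inner_L2 DF_tendsto DF_L2 g_L2)
qed (use DF_L2 in auto)

section \<open>Growth of \<open>u\<close> and its approximation from \<open>C1b_P2\<close>\<close>

lemma u_push: "f \<in> L2_space lam \<Longrightarrow> u (push lam f) = (\<integral>x. \<phi> (f x) \<partial>lam)"
  by (rule integral_push[OF lam_P2 _ measurable_D(2)])

lemma u_measurable: "u \<in> borel_measurable P2_borel"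
  by (rule continuous_map_P2_measurable[OF continuous_map_integral])

lemma integrable_sq_plus_one:
  assumes "f \<in> L2_space lam"
  shows "integrable lam (\<lambda>x. K * (1 + (norm (f x))\<^sup>2))" "(\<integral>x. K * (1 + (norm (f x))\<^sup>2) \<partial>lam) = K * (1 + (L2_norm lam f)\<^sup>2)"
proof -
  have i: "integrable lam (\<lambda>x. (norm (f x))\<^sup>2)" by (rule L2_integrable_sq[OF assms])
  then show "integrable lam (\<lambda>x. K * (1 + (norm (f x))\<^sup>2))"
    by (intro integrable_mult_right Bochner_Integration.integrable_add) simp_all
  show "(\<integral>x. K * (1 + (norm (f x))\<^sup>2) \<partial>lam) = K * (1 + (L2_norm lam f)\<^sup>2)"
    using i by (simp add: L2_norm_sq_integral prob_space)
qed

lemma u_bound: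
  assumes f: "f \<in> L2_space lam"
  shows "\<bar>u (push lam f)\<bar> \<le> (\<bar>\<phi> 0\<bar> + 2 * c) * (1 + (L2_norm lam f)\<^sup>2)"
proof -
  note isp = integrable_sq_plus_one[OF f, of "\<bar>\<phi> 0\<bar> + 2 * c"]
  have i: "integrable lam (\<lambda>x. \<phi> (f x))"
    using integrable_P2[OF push_P2[OF lam_P2 f]] L2_measurable[OF f] by (simp add: push_def integrable_distr_eq)
  have "\<bar>u (push lam f)\<bar> \<le> (\<integral>x. \<bar>\<phi> (f x)\<bar> \<partial>lam)" unfolding u_push[OF f] by (rule integral_abs_bound)
  also have "\<dots> \<le> (\<integral>x. (\<bar>\<phi> 0\<bar> + 2 * c) * (1 + (norm (f x))\<^sup>2) \<partial>lam)"
    using i isp(1) \<phi>_growth by (intro integral_mono) auto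
  finally show ?thesis by (simp only: isp(2))
qed

text \<open>Quadratic growth squares to order four, the order of the moment in
  \<open>integrable_norm_power4\<close>.\<close>

lemma sq_bound_L2:
  assumes [measurable]: "v \<in> borel_measurable G" and b: "\<And>f. f \<in> L2_space lam \<Longrightarrow> \<bar>v f\<bar> \<le> K * (1 + (L2_norm lam f)\<^sup>2)"
  shows "v \<in> L2_space G" "\<And>f. f \<in> L2_space lam \<Longrightarrow> (v f)\<^sup>2 \<le> K\<^sup>2 * 2 * (1 + (L2_norm lam f) ^ 4)"
proof -
  show vb: "(v f)\<^sup>2 \<le> K\<^sup>2 * 2 * (1 + (L2_norm lam f) ^ 4)" if "f \<in> L2_space lam" for f
  proof -
    have "\<bar>v f\<bar>\<^sup>2 \<le> (K * (1 + (L2_norm lam f)\<^sup>2))\<^sup>2" using b[OF that] by (intro power_mono) auto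
    also have "\<dots> \<le> K\<^sup>2 * (2 * (1 + (L2_norm lam f) ^ 4))"
      unfolding power_mult_distrib by (intro mult_left_mono one_plus_power4) simp
    finally show ?thesis by (simp only: power2_abs mult.assoc)
  qed
  have "integrable G (\<lambda>f. (v f)\<^sup>2)" by (rule integrable_norm_bound[of _ "K\<^sup>2 * 2"]) (use vb in auto)
  then show "v \<in> L2_space G" by (simp add: L2_space_def)
qed

lemma u_push_measurable: "(\<lambda>f. u (push lam f)) \<in> borel_measurable G"
  by (rule measurable_compose[OF push_measurable_G u_measurable])

lemma u_L2: "u \<in> L2_space \<Lambda>"
  unfolding L2_\<Lambda>(1)[OF u_measurable] by (rule sq_bound_L2(1)[OF u_push_measurable u_bound])

text \<open>\<open>Suc k\<close> keeps the parameter of \<open>squash\<close> positive.\<close>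

definition u_approx :: "nat \<Rightarrow> (real ^ 'd) measure \<Rightarrow> real" where
  "u_approx k = (\<lambda>\<mu>. \<integral>x. \<phi> (squash (real (Suc k)) x) \<partial>\<mu>)"

lemma u_approx_C1b: "u_approx k \<in> C1b_P2"
proof -
  obtain H' B where "Lipschitz_gradient (\<lambda>x. \<phi> (squash (real (Suc k)) x)) (D_squash (real (Suc k))) H'"
    and B: "\<And>x. \<bar>\<phi> (squash (real (Suc k)) x)\<bar> \<le> B" "\<And>x. norm (D_squash (real (Suc k)) x) \<le> B"
    by (rule squash_Lipschitz_gradient[of "real (Suc k)"]) auto
  then show ?thesis unfolding u_approx_def by (intro Lipschitz_gradient.integral_C1b)
qed

lemma u_approx_gradient:
  assumes f: "f \<in> L2_space lam"
  shows "AE x in lam. pull_gradient (u_approx k) lam f x = D_squash (real (Suc k)) (f x)"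
proof -
  obtain H' B where L: "Lipschitz_gradient (\<lambda>x. \<phi> (squash (real (Suc k)) x)) (D_squash (real (Suc k))) H'"
    and B: "\<And>x. \<bar>\<phi> (squash (real (Suc k)) x)\<bar> \<le> B" "\<And>x. norm (D_squash (real (Suc k)) x) \<le> B"
    by (rule squash_Lipschitz_gradient[of "real (Suc k)"]) auto
  show ?thesis
    using AE_push[OF lam_P2 f Lipschitz_gradient.gradient_integral(2)[OF L push_P2[OF lam_P2 f]]]
    by eventually_elim (simp add: pull_gradient_def u_approx_def)
qed

text \<open>Dominated convergence on two levels: over \<open>lam\<close> for fixed \<open>f\<close>,
  with a quadratic bound in \<open>norm (f x)\<close>, and over \<open>G\<close>, with the fourth
  power of the norm of \<open>f\<close>.\<close>

lemma u_approx_L2: "(\<lambda>k. L2_norm \<Lambda> (\<lambda>\<mu>. u_approx k \<mu> - u \<mu>)) \<longlonglongrightarrow> 0"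
proof -
  let ?K = "\<bar>\<phi> 0\<bar> + 2 * c"
  have m: "(\<lambda>f. u_approx k (push lam f)) \<in> borel_measurable G" for k
    by (rule measurable_compose[OF push_measurable_G C1b_measurable[OF u_approx_C1b]])
  have msq: "(\<lambda>x. \<phi> (squash (real (Suc k)) x)) \<in> borel_measurable borel" for k
  proof -
    have "continuous_on UNIV (squash (real (Suc k)) :: real ^ 'd \<Rightarrow> _)"
      unfolding squash_def[abs_def] by (intro continuous_intros) auto
    then have "continuous_on UNIV (\<lambda>x. \<phi> (squash (real (Suc k)) x))"
      by (rule continuous_on_compose2[OF cont_\<phi>]) auto
    then show ?thesis by (rule borel_measurable_continuous_onI)
  qed
  have ap: "u_approx k (push lam f) = (\<integral>x. \<phi> (squash (real (Suc k)) (f x)) \<partial>lam)" if "f \<in> L2_space lam" for f k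
    unfolding u_approx_def by (rule integral_push[OF lam_P2 that msq])
  have b: "\<bar>\<phi> (squash (real (Suc k)) y)\<bar> \<le> ?K * (1 + (norm y)\<^sup>2)" for y k
  proof -
    have "?K * (1 + (norm (squash (real (Suc k)) y))\<^sup>2) \<le> ?K * (1 + (norm y)\<^sup>2)"
      using norm_squash_le[of "real (Suc k)" y] c0 by (intro mult_left_mono add_left_mono power_mono) auto
    with \<phi>_growth[of "squash (real (Suc k)) y"] show ?thesis by linarith
  qed
  have lim: "(\<lambda>k. u_approx k (push lam f)) \<longlonglongrightarrow> u (push lam f)" if f: "f \<in> L2_space lam" for f
    unfolding ap[OF f] u_push[OF f]
  proof (rule integral_dominated_convergence[where w="\<lambda>x. ?K * (1 + (norm (f x))\<^sup>2)"])
    note [measurable] = L2_measurable[OF f] msq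
    show "(\<lambda>x. \<phi> (f x)) \<in> borel_measurable lam" by measurable
    show "(\<lambda>x. \<phi> (squash (real (Suc k)) (f x))) \<in> borel_measurable lam" for k
      by (rule measurable_compose[OF L2_measurable[OF f] msq])
    show "integrable lam (\<lambda>x. ?K * (1 + (norm (f x))\<^sup>2))" by (rule integrable_sq_plus_one(1)[OF f])
    have "isCont \<phi> y" for y using cont_\<phi> by (simp add: continuous_on_eq_continuous_at)
    then show "AE x in lam. (\<lambda>k. \<phi> (squash (real (Suc k)) (f x))) \<longlonglongrightarrow> \<phi> (f x)"
      by (intro AE_I2 isCont_tendsto_compose[OF _ squash_tendsto])
    show "AE x in lam. norm (\<phi> (squash (real (Suc k)) (f x))) \<le> ?K * (1 + (norm (f x))\<^sup>2)" for k
      using b by simp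
  qed
  have bd: "\<bar>u_approx k (push lam f) - u (push lam f)\<bar> \<le> (2 * ?K) * (1 + (L2_norm lam f)\<^sup>2)" if f: "f \<in> L2_space lam" for f k
  proof -
    note isp = integrable_sq_plus_one[OF f, of ?K]
    have "\<bar>u_approx k (push lam f)\<bar> \<le> (\<integral>x. \<bar>\<phi> (squash (real (Suc k)) (f x))\<bar> \<partial>lam)"
      unfolding ap[OF f] by (rule integral_abs_bound)
    also have "\<dots> \<le> (\<integral>x. ?K * (1 + (norm (f x))\<^sup>2) \<partial>lam)"
    proof (rule integral_mono[OF _ isp(1)])
      show "integrable lam (\<lambda>x. \<bar>\<phi> (squash (real (Suc k)) (f x))\<bar>)"
      proof (rule Bochner_Integration.integrable_bound[OF isp(1)])
        show "AE x in lam. norm \<bar>\<phi> (squash (real (Suc k)) (f x))\<bar> \<le> norm (?K * (1 + (norm (f x))\<^sup>2))"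
          using b by (auto intro!: AE_I2 order_trans[OF _ abs_ge_self])
      qed (intro borel_measurable_abs measurable_compose[OF L2_measurable[OF f] msq])
    qed (rule b)
    finally have "\<bar>u_approx k (push lam f)\<bar> \<le> ?K * (1 + (L2_norm lam f)\<^sup>2)" by (simp only: isp(2))
    with u_bound[OF f] show ?thesis by (simp add: algebra_simps abs_le_iff)
  qed
  have dm: "(\<lambda>f. u_approx k (push lam f) - u (push lam f)) \<in> borel_measurable G" for k
    using m u_push_measurable by simp
  have "(\<lambda>k. \<integral>f. (norm (u_approx k (push lam f) - u (push lam f)))\<^sup>2 \<partial>G) \<longlonglongrightarrow> (\<integral>f. 0 \<partial>G)"
  proof (rule integral_dominated_convergence[where w="\<lambda>f. (2 * ?K)\<^sup>2 * 2 * (1 + (L2_norm lam f) ^ 4)"])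
    show "(\<lambda>f. (norm (u_approx k (push lam f) - u (push lam f)))\<^sup>2) \<in> borel_measurable G" for k
      using dm by measurable
    show "integrable G (\<lambda>f. (2 * ?K)\<^sup>2 * 2 * (1 + (L2_norm lam f) ^ 4))"
      by (intro integrable_mult_right Bochner_Integration.integrable_add integrable_norm_power4) simp
    show "AE f in G. (\<lambda>k. (norm (u_approx k (push lam f) - u (push lam f)))\<^sup>2) \<longlonglongrightarrow> 0"
    proof (rule AE_I2)
      fix f assume "f \<in> space G"
      then have "(\<lambda>k. (norm (u_approx k (push lam f) - u (push lam f)))\<^sup>2) \<longlonglongrightarrow> (norm (u (push lam f) - u (push lam f)))\<^sup>2"
        by (intro tendsto_intros lim) simp
      then show "(\<lambda>k. (norm (u_approx k (push lam f) - u (push lam f)))\<^sup>2) \<longlonglongrightarrow> 0" by simp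
    qed
    show "AE f in G. norm ((norm (u_approx k (push lam f) - u (push lam f)))\<^sup>2) \<le> (2 * ?K)\<^sup>2 * 2 * (1 + (L2_norm lam f) ^ 4)" for k
      by (rule AE_I2) (use sq_bound_L2(2)[OF dm bd, of _ k] in simp)
  qed simp
  then have "(\<lambda>k. L2_norm G (\<lambda>f. u_approx k (push lam f) - u (push lam f))) \<longlonglongrightarrow> 0"
    by (intro tendsto_L2_null_from_integral) simp
  moreover have "L2_norm \<Lambda> (\<lambda>\<mu>. u_approx k \<mu> - u \<mu>) = L2_norm G (\<lambda>f. u_approx k (push lam f) - u (push lam f))" for k
    by (rule L2_\<Lambda>(2)) (intro borel_measurable_diff C1b_measurable u_approx_C1b u_measurable)
  ultimately show ?thesis by simp
qed

text \<open>The same two levels of dominated convergence for the gradients; \<open>coords_L2\<close>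
  transfers the result to \<open>NG\<close>. It makes \<open>u_approx\<close> Cauchy for the form
  and identifies the limit of its coordinates.\<close>

lemma u_approx_coords: "(\<lambda>k. L2_norm NG (\<lambda>z. coords (pull_gradient (u_approx k) lam) z - coords DF z)) \<longlonglongrightarrow> 0"
proof -
  define E where "E k = (\<lambda>f x. pull_gradient (u_approx k) lam f x - DF f x)" for k
  note fu = C1b_functionalD(2)[OF C1b_functional_push[OF u_approx_C1b]]
  have E: "L2_field (E k)" for k unfolding E_def by (rule L2_field_diff[OF fu DF_field])
  have EL: "E k f \<in> L2_space lam" if "f \<in> L2_space lam" for k f using E that by (auto simp: L2_field_def)
  have Eb: "AE x in lam. norm (E k f x) \<le> norm ((2 * c) *\<^sub>R (1 + norm (f x)))" if f: "f \<in> L2_space lam" for k f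
    using u_approx_gradient[OF f, of k]
  proof eventually_elim
    case (elim x)
    have "norm (E k f x) \<le> norm (D_squash (real (Suc k)) (f x)) + norm (D (f x))"
      unfolding E_def DF_def elim by (rule norm_triangle_ineq4)
    also have "\<dots> \<le> c * (1 + norm (f x)) + c * (1 + norm (f x))"
      by (intro add_mono D_squash_le D_growth) simp
    finally show ?case using c0 by simp
  qed
  have Elim: "(\<lambda>k. (L2_norm lam (E k f))\<^sup>2) \<longlonglongrightarrow> 0" if f: "f \<in> L2_space lam" for f
  proof -
    have s: "(\<lambda>x. (2 * c) *\<^sub>R (1 + norm (f x))) \<in> L2_space lam" by (rule L2_scaleR[OF norm_plus_one_L2(1)[OF f]])
    have "(\<lambda>k. \<integral>x. (norm (E k f x))\<^sup>2 \<partial>lam) \<longlonglongrightarrow> (\<integral>x. 0 \<partial>lam)"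
    proof (rule integral_dominated_convergence[where w="\<lambda>x. (norm ((2 * c) *\<^sub>R (1 + norm (f x))))\<^sup>2"])
      show "integrable lam (\<lambda>x. (norm ((2 * c) *\<^sub>R (1 + norm (f x))))\<^sup>2)" by (rule L2_integrable_sq[OF s])
      show "(\<lambda>x. (norm (E k f x))\<^sup>2) \<in> borel_measurable lam" for k using L2_measurable[OF EL[OF f]] by measurable
      show "AE x in lam. norm ((norm (E k f x))\<^sup>2) \<le> (norm ((2 * c) *\<^sub>R (1 + norm (f x))))\<^sup>2" for k
        using Eb[OF f, of k] by eventually_elim (use power_mono[OF _ norm_ge_zero, of _ _ 2] in force)
      have "AE x in lam. \<forall>k. pull_gradient (u_approx k) lam f x = D_squash (real (Suc k)) (f x)"
        unfolding AE_all_countable using u_approx_gradient[OF f] by blast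
      then show "AE x in lam. (\<lambda>k. (norm (E k f x))\<^sup>2) \<longlonglongrightarrow> 0"
      proof eventually_elim
        case (elim x)
        have "(\<lambda>k. (norm (D_squash (real (Suc k)) (f x) - D (f x)))\<^sup>2) \<longlonglongrightarrow> (norm (D (f x) - D (f x)))\<^sup>2"
          by (intro tendsto_intros D_squash_tendsto)
        then show ?case using elim by (simp add: E_def DF_def)
      qed
    qed simp
    then show ?thesis by (simp add: L2_norm_sq_integral)
  qed
  have Eb2: "(L2_norm lam (E k f))\<^sup>2 \<le> ((2 * c)\<^sup>2 * 4) * (1 + (L2_norm lam f) ^ 4)" if f: "f \<in> L2_space lam" for f k
  proof -
    have s: "(\<lambda>x. (2 * c) *\<^sub>R (1 + norm (f x))) \<in> L2_space lam" by (rule L2_scaleR[OF norm_plus_one_L2(1)[OF f]])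
    have "L2_norm lam (E k f) \<le> L2_norm lam (\<lambda>x. (2 * c) *\<^sub>R (1 + norm (f x)))" by (rule L2_norm_mono[OF EL[OF f] s Eb[OF f]])
    also have "\<dots> = (2 * c) * L2_norm lam (\<lambda>x. 1 + norm (f x))" using c0 by (simp only: L2_norm_scaleR)
    also have "\<dots> \<le> (2 * c) * (1 + L2_norm lam f)" using c0 by (intro mult_left_mono norm_plus_one_L2 f) simp
    finally have "(L2_norm lam (E k f))\<^sup>2 \<le> ((2 * c) * (1 + L2_norm lam f))\<^sup>2" by (intro power_mono) auto
    also have "\<dots> \<le> (2 * c)\<^sup>2 * (4 * (1 + (L2_norm lam f) ^ 4))"
      unfolding power_mult_distrib[of "2 * c"] by (intro mult_left_mono one_plus_power4) simp
    finally show ?thesis by (simp only: mult.assoc)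
  qed
  have "(\<lambda>k. \<integral>f. (L2_norm lam (E k f))\<^sup>2 \<partial>G) \<longlonglongrightarrow> (\<integral>f. 0 \<partial>G)"
  proof (rule integral_dominated_convergence[where w="\<lambda>f. ((2 * c)\<^sup>2 * 4) * (1 + (L2_norm lam f) ^ 4)"])
    show "(\<lambda>f. (L2_norm lam (E k f))\<^sup>2) \<in> borel_measurable G" for k using E[of k] by (auto simp: L2_field_def)
    show "integrable G (\<lambda>f. ((2 * c)\<^sup>2 * 4) * (1 + (L2_norm lam f) ^ 4))"
      by (intro integrable_mult_right Bochner_Integration.integrable_add integrable_norm_power4) simp
    show "AE f in G. (\<lambda>k. (L2_norm lam (E k f))\<^sup>2) \<longlonglongrightarrow> 0" by (rule AE_I2, rule Elim) simp
    show "AE f in G. norm ((L2_norm lam (E k f))\<^sup>2) \<le> ((2 * c)\<^sup>2 * 4) * (1 + (L2_norm lam f) ^ 4)" for k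
      by (rule AE_I2) (use Eb2 in simp)
  qed simp
  then have "(\<lambda>k. suminf \<alpha> * (\<integral>f. (L2_norm lam (E k f))\<^sup>2 \<partial>G)) \<longlonglongrightarrow> suminf \<alpha> * 0" by (intro tendsto_intros) simp
  then have lim: "(\<lambda>k. suminf \<alpha> * (\<integral>f. (L2_norm lam (E k f))\<^sup>2 \<partial>G)) \<longlonglongrightarrow> 0" by simp
  have "(\<lambda>k. (L2_norm NG (coords (E k)))\<^sup>2) \<longlonglongrightarrow> 0"
  proof (rule Lim_null_comparison[OF _ lim], intro always_eventually allI)
    show "norm ((L2_norm NG (coords (E k)))\<^sup>2) \<le> suminf \<alpha> * (\<integral>f. (L2_norm lam (E k f))\<^sup>2 \<partial>G)" for k
      using coords_L2(2)[OF E[of k]] by simp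
  qed
  then have "(\<lambda>k. sqrt ((L2_norm NG (coords (E k)))\<^sup>2)) \<longlonglongrightarrow> sqrt 0" by (rule tendsto_real_sqrt)
  then show ?thesis using coords_diff[OF fu DF_field] by (simp add: E_def)
qed

end

section \<open>Integration by parts for \<open>\<mu> \<mapsto> \<mu>(\<phi>)\<close>\<close>

context L2_gaussian
begin

text \<open>Intended for \<open>r\<close> a second derivative of \<open>\<phi>\<close> and
  \<open>q\<close> merely integrable: boundedness of \<open>r\<close> leaves \<open>|q|\<close> as
  the dominating function.\<close>

lemma integral_bounded_continuous_tendsto:
  fixes r :: "'b \<Rightarrow> real" and q :: "'a \<Rightarrow> real"
  assumes r: "continuous_on UNIV r" and B: "\<And>y. \<bar>r y\<bar> \<le> B" and q: "integrable M q"
    and f: "f \<in> L2_space M" and F: "\<And>n. F n \<in> L2_space M" and lim: "(\<lambda>n. L2_norm M (\<lambda>x. F n x - f x)) \<longlonglongrightarrow> 0"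
  shows "(\<lambda>n. \<integral>x. r (F n x) * q x \<partial>M) \<longlonglongrightarrow> (\<integral>x. r (f x) * q x \<partial>M)"
proof (rule tendsto_subsubseq)
  fix s :: "nat \<Rightarrow> nat" assume s: "strict_mono s"
  have lims: "(\<lambda>n. L2_norm M (\<lambda>x. F (s n) x - f x)) \<longlonglongrightarrow> 0"
    using LIMSEQ_subseq_LIMSEQ[OF lim s] by (simp add: comp_def)
  obtain t where t: "strict_mono t" "AE x in M. (\<lambda>n. F (s (t n)) x) \<longlonglongrightarrow> f x"
    using L2_AE_subseq[of "\<lambda>n. F (s n)", OF F f lims] by blast
  have rm[measurable]: "r \<in> borel_measurable borel" using r by (rule borel_measurable_continuous_onI)
  have qm[measurable]: "q \<in> borel_measurable M" using q by simp
  have "(\<lambda>n. \<integral>x. r (F (s (t n)) x) * q x \<partial>M) \<longlonglongrightarrow> (\<integral>x. r (f x) * q x \<partial>M)"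
  proof (rule integral_dominated_convergence[where w="\<lambda>x. B * \<bar>q x\<bar>"])
    show "(\<lambda>x. r (f x) * q x) \<in> borel_measurable M" using L2_measurable[OF f] by measurable
    show "(\<lambda>x. r (F (s (t n)) x) * q x) \<in> borel_measurable M" for n using L2_measurable[OF F] by measurable
    show "integrable M (\<lambda>x. B * \<bar>q x\<bar>)" using q by simp
    show "AE x in M. (\<lambda>n. r (F (s (t n)) x) * q x) \<longlonglongrightarrow> r (f x) * q x"
      using t(2)
    proof eventually_elim
      case (elim x)
      have "isCont r (f x)" using r by (simp add: continuous_on_eq_continuous_at)
      then show ?case by (intro tendsto_mult tendsto_const isCont_tendsto_compose[OF _ elim])
    qed
    show "AE x in M. norm (r (F (s (t n)) x) * q x) \<le> B * \<bar>q x\<bar>" for n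
      using B by (intro AE_I2) (simp add: abs_mult mult_right_mono)
  qed
  with t(1) show "\<exists>t. strict_mono t \<and> (\<lambda>n. \<integral>x. r (F (s (t n)) x) * q x \<partial>M) \<longlonglongrightarrow> (\<integral>x. r (f x) * q x \<partial>M)" by blast
qed

end

locale wasserstein_gaussian_C2 = wasserstein_gaussian_function lam g \<alpha> S G \<phi> "grad \<phi>" H
  for lam :: "(real ^ 'd) measure" and g :: "nat \<Rightarrow> real ^ 'd \<Rightarrow> real ^ 'd" and \<alpha> S G
    and \<phi> :: "real ^ 'd \<Rightarrow> real" and H +
  assumes C2: "C2_fun \<phi>" and hess_bound: "\<And>k l x. \<bar>partial_deriv k (partial_deriv l \<phi>) x\<bar> \<le> H"
begin

abbreviation hess :: "'d \<Rightarrow> 'd \<Rightarrow> real ^ 'd \<Rightarrow> real" where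
  "hess k l \<equiv> partial_deriv k (partial_deriv l \<phi>)"

abbreviation q :: "'d \<Rightarrow> 'd \<Rightarrow> real ^ 'd \<Rightarrow> real" where
  "q \<equiv> q_coeff \<alpha> g"

lemma hess_continuous: "continuous_on UNIV (hess k l)"
  using C2 by (simp add: C2_fun_def C1_fun_def)

lemma hess_measurable [measurable]: "hess k l \<in> borel_measurable borel"
  by (rule borel_measurable_continuous_onI[OF hess_continuous])

lemma g_product:
  shows "integrable lam (\<lambda>x. g n x $ k * g n x $ l)" "(\<integral>x. \<bar>g n x $ k * g n x $ l\<bar> \<partial>lam) \<le> 1"
proof -
  have [measurable]: "g n \<in> borel_measurable lam" by (rule L2_measurable[OF g_L2])
  have m: "(\<lambda>x. g n x $ k * g n x $ l) \<in> borel_measurable lam"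
    unfolding cart_eq_inner_axis by measurable
  have b: "\<bar>g n x $ k * g n x $ l\<bar> \<le> (norm (g n x))\<^sup>2" for x
    unfolding abs_mult power2_eq_square by (intro mult_mono component_le_norm_cart) auto
  show i: "integrable lam (\<lambda>x. g n x $ k * g n x $ l)"
    by (rule Bochner_Integration.integrable_bound[OF L2_integrable_sq[OF g_L2[of n]] m]) (use b in auto)
  have "(\<integral>x. \<bar>g n x $ k * g n x $ l\<bar> \<partial>lam) \<le> (\<integral>x. (norm (g n x))\<^sup>2 \<partial>lam)"
    using i b by (intro integral_mono L2_integrable_sq g_L2) auto
  also have "\<dots> = 1" using L2_norm_sq_integral[of lam "g n"] by simp
  finally show "(\<integral>x. \<bar>g n x $ k * g n x $ l\<bar> \<partial>lam) \<le> 1" .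
qed

text \<open>Each product of components of \<open>g n\<close> has \<open>L1\<close> norm at most 1,
  so the series of \<open>L1\<close> norms is dominated by \<open>\<alpha>\<close> and may be
  integrated term by term against a bounded function.\<close>

lemma q_integral:
  assumes [measurable]: "r \<in> borel_measurable lam" and B: "\<And>x. \<bar>r x\<bar> \<le> B"
  shows "integrable lam (q k l)" "(\<lambda>n. \<alpha> n * (\<integral>x. r x * (g n x $ k * g n x $ l) \<partial>lam)) sums (\<integral>x. r x * q k l x \<partial>lam)"
proof -
  have i0: "integrable lam (\<lambda>x. \<alpha> n * (g n x $ k) * (g n x $ l))" for n
    using integrable_mult_right[OF g_product(1)[of n k l], of "\<alpha> n"] by (simp add: mult.assoc)
  have e0: "(\<integral>x. \<bar>\<alpha> n * (g n x $ k) * (g n x $ l)\<bar> \<partial>lam) = \<alpha> n * (\<integral>x. \<bar>g n x $ k * g n x $ l\<bar> \<partial>lam)" for n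
    using \<alpha>_pos[of n] by (simp add: abs_mult mult.assoc)
  have s0: "summable (\<lambda>n. \<integral>x. \<bar>\<alpha> n * (g n x $ k) * (g n x $ l)\<bar> \<partial>lam)"
  proof (rule summable_comparison_test'[OF \<alpha>_summable])
    show "norm (\<integral>x. \<bar>\<alpha> n * (g n x $ k) * (g n x $ l)\<bar> \<partial>lam) \<le> \<alpha> n" for n
      unfolding e0 using g_product(2)[of n k l] \<alpha>_pos[of n] mult_left_le[of "\<integral>x. \<bar>g n x $ k * g n x $ l\<bar> \<partial>lam" "\<alpha> n"]
      by (simp add: abs_mult less_imp_le)
  qed
  have ae: "AE x in lam. summable (\<lambda>n. \<bar>\<alpha> n * (g n x $ k) * (g n x $ l)\<bar>)"
    by (rule AE_summable_norm[OF i0 s0])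
  show "integrable lam (q k l)"
    unfolding q_coeff_def[abs_def] using i0 ae s0 by (intro integrable_suminf) auto
  have B0: "B \<ge> 0" using order_trans[OF abs_ge_zero B] .
  have i1: "integrable lam (\<lambda>x. r x * (\<alpha> n * (g n x $ k) * (g n x $ l)))" for n
  proof (rule Bochner_Integration.integrable_bound)
    show "integrable lam (\<lambda>x. B * (\<alpha> n * (g n x $ k) * (g n x $ l)))" by (intro integrable_mult_right i0)
    show "(\<lambda>x. r x * (\<alpha> n * (g n x $ k) * (g n x $ l))) \<in> borel_measurable lam"
      using borel_measurable_integrable[OF i0[of n]] by measurable
    show "AE x in lam. norm (r x * (\<alpha> n * (g n x $ k) * (g n x $ l))) \<le> norm (B * (\<alpha> n * (g n x $ k) * (g n x $ l)))"
      using B B0 by (intro AE_I2) (simp add: abs_mult mult_right_mono)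
  qed
  have "(\<lambda>n. \<integral>x. r x * (\<alpha> n * (g n x $ k) * (g n x $ l)) \<partial>lam) sums (\<integral>x. (\<Sum>n. r x * (\<alpha> n * (g n x $ k) * (g n x $ l))) \<partial>lam)"
  proof (rule sums_integral[OF i1])
    show "AE x in lam. summable (\<lambda>n. norm (r x * (\<alpha> n * (g n x $ k) * (g n x $ l))))"
      using ae by eventually_elim (simp add: abs_mult summable_mult)
    show "summable (\<lambda>n. \<integral>x. norm (r x * (\<alpha> n * (g n x $ k) * (g n x $ l))) \<partial>lam)"
    proof (rule summable_comparison_test'[OF summable_mult[OF s0, of B]])
      fix n
      have "(\<integral>x. norm (r x * (\<alpha> n * (g n x $ k) * (g n x $ l))) \<partial>lam) \<le> (\<integral>x. B * \<bar>\<alpha> n * (g n x $ k) * (g n x $ l)\<bar> \<partial>lam)"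
        using i1 i0 B by (intro integral_mono integrable_norm integrable_mult_right)
          (auto simp: abs_mult[of "r _"] intro!: mult_right_mono)
      then show "norm (\<integral>x. norm (r x * (\<alpha> n * (g n x $ k) * (g n x $ l))) \<partial>lam) \<le> B * (\<integral>x. \<bar>\<alpha> n * (g n x $ k) * (g n x $ l)\<bar> \<partial>lam)"
        by simp
    qed
  qed
  moreover have "(\<integral>x. r x * (\<alpha> n * (g n x $ k) * (g n x $ l)) \<partial>lam) = \<alpha> n * (\<integral>x. r x * (g n x $ k * g n x $ l) \<partial>lam)" for n
    by (subst integral_mult_right_zero[symmetric]) (rule Bochner_Integration.integral_cong, auto simp: mult_ac)
  moreover have "(\<integral>x. (\<Sum>n. r x * (\<alpha> n * (g n x $ k) * (g n x $ l))) \<partial>lam) = (\<integral>x. r x * q k l x \<partial>lam)"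
  proof (rule integral_cong_AE)
    show "AE x in lam. (\<Sum>n. r x * (\<alpha> n * (g n x $ k) * (g n x $ l))) = r x * q k l x"
      using ae
    proof eventually_elim
      case (elim x)
      then have "summable (\<lambda>n. \<alpha> n * (g n x $ k) * (g n x $ l))" by (rule summable_rabs_cancel)
      then show ?case unfolding q_coeff_def by (rule suminf_mult)
    qed
    show "(\<lambda>x. \<Sum>n. r x * (\<alpha> n * (g n x $ k) * (g n x $ l))) \<in> borel_measurable lam"
      using borel_measurable_integrable[OF i1] by measurable
    show "(\<lambda>x. r x * q k l x) \<in> borel_measurable lam"
      using borel_measurable_integrable[OF \<open>integrable lam (q k l)\<close>] by measurable
  qed
  ultimately show "(\<lambda>n. \<alpha> n * (\<integral>x. r x * (g n x $ k * g n x $ l) \<partial>lam)) sums (\<integral>x. r x * q k l x \<partial>lam)" by simp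
qed

text \<open>The derivative of \<open>coord n (DF f)\<close> along \<open>g n\<close>: the Hessian of
  \<open>\<phi>\<close> at \<open>f\<close> applied twice to \<open>g n\<close>, integrated over
  \<open>lam\<close>.\<close>

definition Kd :: "nat \<Rightarrow> (real ^ 'd \<Rightarrow> real ^ 'd) \<Rightarrow> real" where
  "Kd n f = (\<Sum>k\<in>UNIV. \<Sum>l\<in>UNIV. \<integral>x. hess k l (f x) * (g n x $ k * g n x $ l) \<partial>lam)"

definition Q :: "(real ^ 'd \<Rightarrow> real ^ 'd) \<Rightarrow> real" where
  "Q f = (\<Sum>k\<in>UNIV. \<Sum>l\<in>UNIV. \<integral>x. hess k l (f x) * q k l x \<partial>lam)"

text \<open>\<open>d\<^sup>2\<close> copies of \<open>H\<close>, the bound for a double sum of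
  Hessian terms.\<close>

definition Hd :: real where "Hd = (\<Sum>k\<in>(UNIV::'d set). \<Sum>l\<in>(UNIV::'d set). H)"

lemma Kd_tendsto:
  assumes "f \<in> L2_space lam" "\<And>n. F n \<in> L2_space lam" "(\<lambda>n. L2_norm lam (\<lambda>x. F n x - f x)) \<longlonglongrightarrow> 0"
  shows "(\<lambda>j. Kd n (F j)) \<longlonglongrightarrow> Kd n f"
  unfolding Kd_def
  by (intro tendsto_sum integral_bounded_continuous_tendsto[OF hess_continuous hess_bound g_product(1)] assms)

lemma Kd_measurable: "Kd n \<in> borel_measurable G"
  by (rule measurable_G_seq) (rule Kd_tendsto)

lemma Q_measurable: "Q \<in> borel_measurable G"
proof (rule measurable_G_seq)
  fix f :: "real ^ 'd \<Rightarrow> real ^ 'd" and F :: "nat \<Rightarrow> real ^ 'd \<Rightarrow> real ^ 'd"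
  assume "f \<in> L2_space lam" "\<And>n. F n \<in> L2_space lam" "(\<lambda>n. L2_norm lam (\<lambda>x. F n x - f x)) \<longlonglongrightarrow> 0"
  then show "(\<lambda>n. Q (F n)) \<longlonglongrightarrow> Q f"
    unfolding Q_def
    by (intro tendsto_sum integral_bounded_continuous_tendsto[OF hess_continuous hess_bound q_integral(1)[of "\<lambda>x. 0" 0]]) auto
qed

lemma hess_f_measurable: "f \<in> L2_space lam \<Longrightarrow> (\<lambda>x. hess k l (f x)) \<in> borel_measurable lam"
  by (rule measurable_compose[OF L2_measurable hess_measurable])

lemma Kd_bound:
  assumes f: "f \<in> L2_space lam"
  shows "\<bar>Kd n f\<bar> \<le> Hd"
proof -
  have *: "\<bar>\<integral>x. hess k l (f x) * (g n x $ k * g n x $ l) \<partial>lam\<bar> \<le> H" for k l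
  proof -
    note [measurable] = hess_f_measurable[OF f] borel_measurable_integrable[OF g_product(1)]
    have "\<bar>\<integral>x. hess k l (f x) * (g n x $ k * g n x $ l) \<partial>lam\<bar> \<le> (\<integral>x. \<bar>hess k l (f x) * (g n x $ k * g n x $ l)\<bar> \<partial>lam)"
      by (rule integral_abs_bound)
    also have "\<dots> \<le> (\<integral>x. H * \<bar>g n x $ k * g n x $ l\<bar> \<partial>lam)"
    proof (rule integral_mono)
      show i: "integrable lam (\<lambda>x. H * \<bar>g n x $ k * g n x $ l\<bar>)" using g_product(1) by simp
      show b: "\<bar>hess k l (f x) * (g n x $ k * g n x $ l)\<bar> \<le> H * \<bar>g n x $ k * g n x $ l\<bar>" for x
        unfolding abs_mult[of "hess k l (f x)"] by (rule mult_right_mono[OF hess_bound]) simp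
      show "integrable lam (\<lambda>x. \<bar>hess k l (f x) * (g n x $ k * g n x $ l)\<bar>)"
        by (rule Bochner_Integration.integrable_bound[OF i]) (use b in \<open>auto intro!: AE_I2 order_trans[OF b]\<close>)
    qed
    also have "\<dots> \<le> H" using g_product(2)[of n k l] H0 by (simp add: mult_left_le)
    finally show ?thesis .
  qed
  show ?thesis
    unfolding Kd_def Hd_def by (intro order_trans[OF sum_abs] sum_mono) (rule *)
qed

text \<open>Termwise integration pulls the sum over the eigendirections under the integral, where it
  becomes the coefficient \<open>q k l\<close>.\<close>

lemma Kd_sums_Q:
  assumes f: "f \<in> L2_space lam"
  shows "(\<lambda>n. \<alpha> n * Kd n f) sums Q f"
proof -
  have "(\<lambda>n. \<Sum>k\<in>UNIV. \<Sum>l\<in>UNIV. \<alpha> n * (\<integral>x. hess k l (f x) * (g n x $ k * g n x $ l) \<partial>lam)) sums Q f"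
    unfolding Q_def by (intro sums_sum q_integral(2)[OF hess_f_measurable[OF f] hess_bound])
  then show ?thesis by (simp add: Kd_def sum_distrib_left)
qed

text \<open>The bound is uniform in \<open>N\<close> and \<open>f\<close>. It dominates the partial
  sums in the integration by parts, and its limit version is what the second order term inherits
  from \<open>Q\<close>.\<close>

lemma sum_Kd_bound:
  assumes f: "f \<in> L2_space lam"
  shows "\<bar>\<Sum>n<N. \<alpha> n * Kd n f\<bar> \<le> suminf \<alpha> * Hd" "\<bar>Q f\<bar> \<le> suminf \<alpha> * Hd"
proof -
  have Hd0: "Hd \<ge> 0" using order_trans[OF abs_ge_zero Kd_bound[OF f]] .
  show b: "\<bar>\<Sum>n<N. \<alpha> n * Kd n f\<bar> \<le> suminf \<alpha> * Hd" for N
  proof -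
    have "\<bar>\<Sum>n<N. \<alpha> n * Kd n f\<bar> \<le> (\<Sum>n<N. \<bar>\<alpha> n * Kd n f\<bar>)" by (rule sum_abs)
    also have "\<dots> \<le> (\<Sum>n<N. \<alpha> n * Hd)"
      using \<alpha>_pos Kd_bound[OF f] by (intro sum_mono) (simp add: abs_mult less_imp_le mult_left_mono)
    also have "\<dots> \<le> suminf \<alpha> * Hd"
      unfolding sum_distrib_right[symmetric] using \<alpha>_pos
      by (intro mult_right_mono sum_le_suminf \<alpha>_summable Hd0) (auto intro: less_imp_le)
    finally show ?thesis .
  qed
  have "(\<lambda>N. \<bar>\<Sum>n<N. \<alpha> n * Kd n f\<bar>) \<longlonglongrightarrow> \<bar>Q f\<bar>"
    using Kd_sums_Q[OF f] unfolding sums_def by (rule tendsto_rabs)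
  then show "\<bar>Q f\<bar> \<le> suminf \<alpha> * Hd" by (rule LIMSEQ_le_const2) (use b in blast)
qed

lemma grad_line_derivative:
  "((\<lambda>s. grad \<phi> (y + s *\<^sub>R v) \<bullet> v) has_real_derivative (\<Sum>k\<in>UNIV. \<Sum>l\<in>UNIV. hess k l y * (v $ k * v $ l))) (at 0)"
proof -
  have d: "((\<lambda>s. partial_deriv l \<phi> (y + s *\<^sub>R v)) has_real_derivative (\<Sum>k\<in>UNIV. hess k l y * v $ k)) (at 0)" for l
  proof -
    have line: "((\<lambda>s::real. y + s *\<^sub>R v) has_derivative (\<lambda>s. s *\<^sub>R v)) (at 0)"
      by (auto intro!: derivative_eq_intros)
    have "(partial_deriv l \<phi> has_derivative (\<lambda>h. grad (partial_deriv l \<phi>) y \<bullet> h)) (at (y + 0 *\<^sub>R v))"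
      using C1_fun_has_derivative[of "partial_deriv l \<phi>" y] C2 by (simp add: C2_fun_def)
    from has_derivative_compose[OF line this]
    have "((\<lambda>s. partial_deriv l \<phi> (y + s *\<^sub>R v)) has_derivative (\<lambda>s. grad (partial_deriv l \<phi>) y \<bullet> (s *\<^sub>R v))) (at 0)" .
    moreover have "(\<lambda>s. grad (partial_deriv l \<phi>) y \<bullet> (s *\<^sub>R v)) = (*) (\<Sum>k\<in>UNIV. hess k l y * v $ k)"
      by (rule ext) (simp add: grad_def inner_vec_def sum_distrib_left sum_distrib_right mult_ac)
    ultimately show ?thesis by (simp add: has_field_derivative_def)
  qed
  have "((\<lambda>s. \<Sum>l\<in>UNIV. partial_deriv l \<phi> (y + s *\<^sub>R v) * v $ l) has_real_derivative
      (\<Sum>l\<in>UNIV. (\<Sum>k\<in>UNIV. hess k l y * v $ k) * v $ l)) (at 0)"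
    by (intro DERIV_sum DERIV_cmult_right d)
  also have "(\<Sum>l\<in>UNIV. (\<Sum>k\<in>UNIV. hess k l y * v $ k) * v $ l) = (\<Sum>k\<in>UNIV. \<Sum>l\<in>UNIV. hess k l y * (v $ k * v $ l))"
    by (subst sum.swap) (simp add: sum_distrib_right mult.assoc)
  finally show ?thesis by (simp add: inner_vec_def grad_def)
qed

text \<open>Differentiation under the integral: the Lipschitz gradient bounds the difference
  quotients by \<open>H * (norm (g n x))\<^sup>2\<close>. Other base points on the line follow by
  translation of \<open>f\<close>.\<close>

lemma coord_DF_derivative0:
  assumes f: "f \<in> L2_space lam"
  shows "((\<lambda>h. (coord n (DF (\<lambda>x. f x + h *\<^sub>R g n x)) - coord n (DF f)) / h) \<longlongrightarrow> Kd n f) (at 0)"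
  unfolding tendsto_at_iff_sequentially comp_def
proof (intro allI impI)
  fix X :: "nat \<Rightarrow> real" assume X: "\<forall>i. X i \<in> UNIV - {0}" "X \<longlonglongrightarrow> 0"
  have X0: "X i \<noteq> 0" for i using X(1) by auto
  have fl: "filterlim X (at 0) sequentially" using X X0 by (simp add: filterlim_at)
  note [measurable] = L2_measurable[OF f] L2_measurable[OF g_L2]
  define e where "e i x = (grad \<phi> (f x + X i *\<^sub>R g n x) \<bullet> g n x - grad \<phi> (f x) \<bullet> g n x) / X i" for i x
  have fX: "(\<lambda>x. f x + X i *\<^sub>R g n x) \<in> L2_space lam" for i by (intro L2_add_scaleR f g_L2)
  have quot: "(coord n (DF (\<lambda>x. f x + X i *\<^sub>R g n x)) - coord n (DF f)) / X i = (\<integral>x. e i x \<partial>lam)" for i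
    using L2_integrable_inner[OF DF_L2(1)[OF fX] g_L2] L2_integrable_inner[OF DF_L2(1)[OF f] g_L2]
    unfolding e_def L2_inner_def DF_def by simp
  have "(\<lambda>i. \<integral>x. e i x \<partial>lam) \<longlonglongrightarrow> (\<integral>x. (\<Sum>k\<in>UNIV. \<Sum>l\<in>UNIV. hess k l (f x) * (g n x $ k * g n x $ l)) \<partial>lam)"
  proof (rule integral_dominated_convergence[where w="\<lambda>x. H * (norm (g n x))\<^sup>2"])
    show "(\<lambda>x. \<Sum>k\<in>UNIV. \<Sum>l\<in>UNIV. hess k l (f x) * (g n x $ k * g n x $ l)) \<in> borel_measurable lam"
      using hess_f_measurable[OF f] borel_measurable_integrable[OF g_product(1)] by measurable
    show "e i \<in> borel_measurable lam" for i unfolding e_def by measurable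
    show "integrable lam (\<lambda>x. H * (norm (g n x))\<^sup>2)" using L2_integrable_sq[OF g_L2] by simp
    show "AE x in lam. (\<lambda>i. e i x) \<longlonglongrightarrow> (\<Sum>k\<in>UNIV. \<Sum>l\<in>UNIV. hess k l (f x) * (g n x $ k * g n x $ l))"
    proof (rule AE_I2)
      fix x
      have "((\<lambda>h. (grad \<phi> (f x + (0 + h) *\<^sub>R g n x) \<bullet> g n x - grad \<phi> (f x + 0 *\<^sub>R g n x) \<bullet> g n x) / h) \<longlongrightarrow>
          (\<Sum>k\<in>UNIV. \<Sum>l\<in>UNIV. hess k l (f x) * (g n x $ k * g n x $ l))) (at 0)"
        using grad_line_derivative[of "f x" "g n x"] unfolding DERIV_def .
      from filterlim_compose[OF this fl]
      show "(\<lambda>i. e i x) \<longlonglongrightarrow> (\<Sum>k\<in>UNIV. \<Sum>l\<in>UNIV. hess k l (f x) * (g n x $ k * g n x $ l))"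
        by (simp add: e_def)
    qed
    have "\<bar>e i x\<bar> \<le> H * (norm (g n x))\<^sup>2" for i x
    proof -
      have "\<bar>(grad \<phi> (f x + X i *\<^sub>R g n x) - grad \<phi> (f x)) \<bullet> g n x\<bar> \<le> norm (grad \<phi> (f x + X i *\<^sub>R g n x) - grad \<phi> (f x)) * norm (g n x)"
        by (rule Cauchy_Schwarz_ineq2)
      also have "\<dots> \<le> (H * norm (X i *\<^sub>R g n x)) * norm (g n x)"
        using lip[of "f x + X i *\<^sub>R g n x" "f x"] by (intro mult_right_mono) auto
      also have "\<dots> = \<bar>X i\<bar> * (H * (norm (g n x))\<^sup>2)" by (simp add: power2_eq_square)
      finally show ?thesis
        using X0[of i] unfolding e_def inner_diff_left[symmetric] abs_divide
        by (simp add: pos_divide_le_eq mult.commute)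
    qed
    then show "AE x in lam. norm (e i x) \<le> H * (norm (g n x))\<^sup>2" for i by simp
  qed
  also have "(\<integral>x. (\<Sum>k\<in>UNIV. \<Sum>l\<in>UNIV. hess k l (f x) * (g n x $ k * g n x $ l)) \<partial>lam) = Kd n f"
  proof -
    have i: "integrable lam (\<lambda>x. hess k l (f x) * (g n x $ k * g n x $ l))" for k l
    proof (rule Bochner_Integration.integrable_bound[OF integrable_mult_right[OF g_product(1)[of n k l], of H]])
      show "(\<lambda>x. hess k l (f x) * (g n x $ k * g n x $ l)) \<in> borel_measurable lam"
        using hess_f_measurable[OF f] borel_measurable_integrable[OF g_product(1)] by measurable
      show "AE x in lam. norm (hess k l (f x) * (g n x $ k * g n x $ l)) \<le> norm (H * (g n x $ k * g n x $ l))"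
        using hess_bound H0 by (intro AE_I2) (simp add: abs_mult mult_right_mono)
    qed
    then show ?thesis unfolding Kd_def by simp
  qed
  finally show "(\<lambda>i. (coord n (DF (\<lambda>x. f x + X i *\<^sub>R g n x)) - coord n (DF f)) / X i) \<longlonglongrightarrow> Kd n f"
    unfolding quot .
qed

lemma coord_DF_derivative:
  assumes f: "f \<in> L2_space lam"
  shows "((\<lambda>t. coord n (DF (\<lambda>x. f x + t *\<^sub>R g n x))) has_real_derivative Kd n (\<lambda>x. f x + t *\<^sub>R g n x)) (at t)"
proof -
  have "(\<lambda>x. (f x + t *\<^sub>R g n x) + h *\<^sub>R g n x) = (\<lambda>x. f x + (t + h) *\<^sub>R g n x)" for h
    by (simp add: scaleR_add_left add.assoc)
  with coord_DF_derivative0[OF L2_add_scaleR[OF f g_L2[of n], of t], of n] show ?thesis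
    unfolding DERIV_def by simp
qed

lemma line_seq:
  assumes "t \<longlonglongrightarrow> s"
  shows "(\<lambda>j. L2_norm lam (\<lambda>x. (f x + t j *\<^sub>R g n x) - (f x + s *\<^sub>R g n x))) \<longlonglongrightarrow> 0"
proof -
  have "(\<lambda>x. (f x + t j *\<^sub>R g n x) - (f x + s *\<^sub>R g n x)) = (\<lambda>x. (t j - s) *\<^sub>R g n x)" for j
    by (simp add: scaleR_diff_left)
  then have "L2_norm lam (\<lambda>x. (f x + t j *\<^sub>R g n x) - (f x + s *\<^sub>R g n x)) = \<bar>t j - s\<bar>" for j
    by (simp only: L2_norm_scaleR) simp
  then show ?thesis using tendsto_rabs_zero[OF LIM_zero[OF assms]] by simp
qed

lemma isCont_Kd:
  assumes f: "f \<in> L2_space lam"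
  shows "isCont (\<lambda>t. Kd n (\<lambda>x. f x + t *\<^sub>R g n x)) s"
  by (rule continuous_at_sequentiallyI) (intro Kd_tendsto L2_add_scaleR f g_L2 line_seq)

text \<open>Integration by parts in every coordinate direction; the sums over the directions are then
  recognised as \<open>Q\<close> and, by Parseval's identity, as an inner product.\<close>

theorem integration_by_parts_u:
  assumes U: "U \<in> C1b_P2"
  shows "L2_inner NG (coords (pull_gradient U lam)) (coords DF) =
    (\<integral>f. U (push lam f) * (L2_inner lam (DF f) f - Q f) \<partial>G)"
proof -
  define F where "F f = U (push lam f)" for f
  define V where "V = pull_gradient U lam"
  have FV: "C1b_functional F V" unfolding F_def[abs_def] V_def by (rule C1b_functional_push[OF U])
  obtain C where C: "C \<ge> 0" "\<And>f. f \<in> L2_space lam \<Longrightarrow> \<bar>F f\<bar> \<le> C"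
    "\<And>f. f \<in> L2_space lam \<Longrightarrow> L2_norm lam (V f) \<le> C" "\<And>f n. f \<in> L2_space lam \<Longrightarrow> \<bar>coord n (V f)\<bar> \<le> C"
    using C1b_functional_bound[OF FV] by blast
  have Fm[measurable]: "F \<in> borel_measurable G" by (rule C1b_functionalD(1)[OF FV])
  have Vm[measurable]: "(\<lambda>f. coord n (V f)) \<in> borel_measurable G" for n by (rule C1b_functionalD(4)[OF FV])
  have DFm[measurable]: "(\<lambda>f. coord n (DF f)) \<in> borel_measurable G" for n using DF_field by (auto simp: L2_field_def)
  have Kdm[measurable]: "Kd n \<in> borel_measurable G" for n by (rule Kd_measurable)
  have cb: "\<bar>coord n (DF f)\<bar> \<le> c * (1 + L2_norm lam f)" if f: "f \<in> L2_space lam" for f n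
    using L2_Cauchy_Schwarz[OF DF_L2(1)[OF f] g_L2[of n]] DF_L2(2)[OF f] by simp
  have Hd0: "Hd \<ge> 0" using order_trans[OF abs_ge_zero Kd_bound[OF L2_zero]] .
  note LV = coords_L2(1)[OF C1b_functionalD(2)[OF FV]] and LD = coords_L2(1)[OF DF_field]
  let ?K = "C * c + C * Hd"
  have K0: "?K \<ge> 0" using C(1) c0 Hd0 by simp
  have gr: "C * (c * (1 + L2_norm lam f)) + C * Hd \<le> ?K * (1 + L2_norm lam f)" for f
    using C(1) Hd0 by (simp add: algebra_simps)
  \<comment> \<open>The product of \<open>F\<close> and \<open>coord n (DF f)\<close> is
    differentiated along \<open>g n\<close>; one term comes from the chain rule for
    \<open>U\<close>, the other from the Hessian of \<open>\<phi>\<close>.\<close>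
  have ibp: "(\<integral>f. (F f * coord n (DF f)) * coord n f \<partial>G) = \<alpha> n * (\<integral>f. coord n (V f) * coord n (DF f) + F f * Kd n f \<partial>G)" for n
  proof (rule Gaussian_integration_by_parts[where C="?K"])
    fix f :: "real ^ 'd \<Rightarrow> real ^ 'd" and t :: real assume f: "f \<in> L2_space lam"
    show "((\<lambda>t. F (\<lambda>x. f x + t *\<^sub>R g n x) * coord n (DF (\<lambda>x. f x + t *\<^sub>R g n x))) has_real_derivative
        coord n (V (\<lambda>x. f x + t *\<^sub>R g n x)) * coord n (DF (\<lambda>x. f x + t *\<^sub>R g n x))
        + F (\<lambda>x. f x + t *\<^sub>R g n x) * Kd n (\<lambda>x. f x + t *\<^sub>R g n x)) (at t)"
      by (rule DERIV_cong[OF DERIV_mult[OF C1b_functionalD(5)[OF FV f] coord_DF_derivative[OF f]]]) simp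
    show "isCont (\<lambda>t. coord n (V (\<lambda>x. f x + t *\<^sub>R g n x)) * coord n (DF (\<lambda>x. f x + t *\<^sub>R g n x))
        + F (\<lambda>x. f x + t *\<^sub>R g n x) * Kd n (\<lambda>x. f x + t *\<^sub>R g n x)) t"
      by (intro continuous_add continuous_mult C1b_functionalD(6)[OF FV f] isCont_Kd[OF f]
          DERIV_isCont[OF coord_DF_derivative[OF f]] DERIV_isCont[OF C1b_functionalD(5)[OF FV f]])
  next
    fix f :: "real ^ 'd \<Rightarrow> real ^ 'd" assume f: "f \<in> L2_space lam"
    have 1: "\<bar>F f * coord n (DF f)\<bar> \<le> C * (c * (1 + L2_norm lam f))"
      unfolding abs_mult by (intro mult_mono C cb f) auto
    then show "\<bar>F f * coord n (DF f)\<bar> \<le> ?K * (1 + L2_norm lam f)"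
      using gr[of f] mult_nonneg_nonneg[OF C(1) Hd0] by linarith
    have 2: "\<bar>coord n (V f) * coord n (DF f)\<bar> \<le> C * (c * (1 + L2_norm lam f))"
      unfolding abs_mult by (intro mult_mono C cb f) auto
    have 3: "\<bar>F f * Kd n f\<bar> \<le> C * Hd" unfolding abs_mult by (intro mult_mono C Kd_bound f) auto
    show "\<bar>coord n (V f) * coord n (DF f) + F f * Kd n f\<bar> \<le> ?K * (1 + L2_norm lam f)"
      using abs_triangle_ineq[of "coord n (V f) * coord n (DF f)" "F f * Kd n f"] 2 3 gr[of f] by linarith
  qed measurable
  have FL: "F \<in> L2_space G" by (rule C1b_functional_L2[OF FV])
  have VL: "(\<lambda>f. coord n (V f)) \<in> L2_space G" for n by (rule C1b_functional_L2[OF FV])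
  have nL: "(\<lambda>f. 1 + L2_norm lam f) \<in> L2_space G"
  proof -
    have "integrable G (\<lambda>f. (1 + L2_norm lam f)\<^sup>2)"
      by (rule integrable_norm_bound[of _ 4]) (use one_plus_power4(2) in auto)
    then show ?thesis by (simp add: L2_space_def)
  qed
  have DL: "(\<lambda>f. coord n (DF f)) \<in> L2_space G" for n
    by (rule L2_bound[OF DFm L2_scaleR[OF nL, of c]]) (use cb c0 in \<open>auto simp: abs_mult\<close>)
  have i1: "integrable G (\<lambda>f. coord n (V f) * coord n (DF f))" for n
    using L2_integrable_inner[OF VL DL] by simp
  have KL: "Kd n \<in> L2_space G" for n by (rule G.L2_I_bounded[OF Kdm, where C=Hd]) (simp add: Kd_bound)
  have i2: "integrable G (\<lambda>f. F f * Kd n f)" for n using L2_integrable_inner[OF FL KL] by simp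
  have i3: "integrable G (\<lambda>f. (F f * coord n (DF f)) * coord n f)" for n
  proof (rule integrable_norm_bound[where C="C * c * 4"])
    fix f :: "real ^ 'd \<Rightarrow> real ^ 'd" assume f: "f \<in> L2_space lam"
    have "\<bar>(F f * coord n (DF f)) * coord n f\<bar> \<le> (C * (c * (1 + L2_norm lam f))) * (1 + L2_norm lam f)"
      unfolding abs_mult using L2_Cauchy_Schwarz[OF f g_L2[of n]] C(1) c0
      by (intro mult_mono C cb f) (auto intro!: mult_nonneg_nonneg)
    also have "\<dots> = C * c * (1 + L2_norm lam f)\<^sup>2" by (simp add: power2_eq_square)
    also have "\<dots> \<le> C * c * (4 * (1 + L2_norm lam f ^ 4))"
      using C(1) c0 by (intro mult_left_mono one_plus_power4) simp
    finally show "\<bar>(F f * coord n (DF f)) * coord n f\<bar> \<le> C * c * 4 * (1 + L2_norm lam f ^ 4)" by (simp only: mult.assoc)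
  qed measurable
  \<comment> \<open>Solving \<open>ibp\<close> for the term with the derivative of \<open>F\<close>
    and summing over the first \<open>N\<close> directions.\<close>
  have partial: "L2_inner NG (coords V) (\<lambda>z. if fst z < N then coords DF z else 0) =
      (\<integral>f. F f * ((\<Sum>n<N. coord n (DF f) * coord n f) - (\<Sum>n<N. \<alpha> n * Kd n f)) \<partial>G)" for N
  proof -
    have "\<alpha> n * (\<integral>f. coord n (V f) * coord n (DF f) \<partial>G) = (\<integral>f. (F f * coord n (DF f)) * coord n f - \<alpha> n * (F f * Kd n f) \<partial>G)" for n
    proof -
      have "\<alpha> n * (\<integral>f. coord n (V f) * coord n (DF f) \<partial>G) + \<alpha> n * (\<integral>f. F f * Kd n f \<partial>G) = (\<integral>f. (F f * coord n (DF f)) * coord n f \<partial>G)"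
        unfolding ibp using i1 i2 by (simp add: distrib_left)
      then show ?thesis using i2 i3 by simp
    qed
    then have "L2_inner NG (coords V) (\<lambda>z. if fst z < N then coords DF z else 0)
        = (\<Sum>n<N. \<integral>f. (F f * coord n (DF f)) * coord n f - \<alpha> n * (F f * Kd n f) \<partial>G)"
      unfolding inner_NG_truncated[OF LV LD] by (simp add: coords_def)
    also have "\<dots> = (\<integral>f. (\<Sum>n<N. (F f * coord n (DF f)) * coord n f - \<alpha> n * (F f * Kd n f)) \<partial>G)"
      using i2 i3 by (intro Bochner_Integration.integral_sum[symmetric]) simp
    also have "\<dots> = (\<integral>f. F f * ((\<Sum>n<N. coord n (DF f) * coord n f) - (\<Sum>n<N. \<alpha> n * Kd n f)) \<partial>G)"
      by (intro Bochner_Integration.integral_cong refl)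
        (simp add: sum_subtractf sum_distrib_left right_diff_distrib mult_ac)
    finally show ?thesis .
  qed
  have lim1: "(\<lambda>N. L2_inner NG (coords V) (\<lambda>z. if fst z < N then coords DF z else 0)) \<longlonglongrightarrow> L2_inner NG (coords V) (coords DF)"
    unfolding L2_inner_commute[of NG "coords V"]
    by (rule tendsto_inner_L2[OF truncation_tendsto(1)[OF LD] LD LV truncation_tendsto(2)[OF LD]])
  \<comment> \<open>The partial sum is a pairing with the projection of \<open>DF f\<close>, which
    is no longer than \<open>DF f\<close>; hence the bound is uniform in \<open>N\<close>.\<close>
  have bessel: "\<bar>\<Sum>n<N. coord n (DF f) * coord n f\<bar> \<le> L2_norm lam (DF f) * L2_norm lam f" if f: "f \<in> L2_space lam" for f N
  proof -
    have "(\<Sum>n<N. coord n (DF f) * coord n f) = L2_inner lam (P N (DF f)) f" by (rule P_inner[OF f, symmetric])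
    also have "\<bar>\<dots>\<bar> \<le> L2_norm lam (P N (DF f)) * L2_norm lam f" by (rule L2_Cauchy_Schwarz[OF P_L2 f])
    also have "\<dots> \<le> L2_norm lam (DF f) * L2_norm lam f"
    proof (rule mult_right_mono[OF _ L2_norm_nonneg], rule power2_le_imp_le[OF _ L2_norm_nonneg])
      show "(L2_norm lam (P N (DF f)))\<^sup>2 \<le> (L2_norm lam (DF f))\<^sup>2"
        unfolding P_norm_sq by (rule Bessel[OF DF_L2(1)[OF f]])
    qed
    finally show ?thesis .
  qed
  \<comment> \<open>\<open>c * 4\<close> stems from
    \<open>(1 + x)\<^sup>2 \<le> 4 * (1 + x ^ 4)\<close>, the other summand from the bound on the
    partial sums of \<open>Q\<close>.\<close>
  define B where "B = C * (c * 4 + suminf \<alpha> * Hd)"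
  have lim2: "(\<lambda>N. \<integral>f. F f * ((\<Sum>n<N. coord n (DF f) * coord n f) - (\<Sum>n<N. \<alpha> n * Kd n f)) \<partial>G) \<longlonglongrightarrow>
      (\<integral>f. F f * (L2_inner lam (DF f) f - Q f) \<partial>G)"
  proof (rule integral_dominated_convergence[where w="\<lambda>f. B * (1 + L2_norm lam f ^ 4)"])
    show "(\<lambda>f. F f * ((\<Sum>n<N. coord n (DF f) * coord n f) - (\<Sum>n<N. \<alpha> n * Kd n f))) \<in> borel_measurable G" for N
      by measurable
    have cv: "(\<lambda>N. F f * ((\<Sum>n<N. coord n (DF f) * coord n f) - (\<Sum>n<N. \<alpha> n * Kd n f))) \<longlonglongrightarrow> F f * (L2_inner lam (DF f) f - Q f)"
      if f: "f \<in> L2_space lam" for f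
      using Parseval_inner[OF DF_L2(1)[OF f] f] Kd_sums_Q[OF f] unfolding sums_def by (intro tendsto_intros)
    then show "AE f in G. (\<lambda>N. F f * ((\<Sum>n<N. coord n (DF f) * coord n f) - (\<Sum>n<N. \<alpha> n * Kd n f))) \<longlonglongrightarrow> F f * (L2_inner lam (DF f) f - Q f)"
      by (intro AE_I2) simp
    show "(\<lambda>f. F f * (L2_inner lam (DF f) f - Q f)) \<in> borel_measurable G"
      by (rule borel_measurable_LIMSEQ_real[OF cv]) (simp, measurable)
    show "integrable G (\<lambda>f. B * (1 + L2_norm lam f ^ 4))"
      by (intro integrable_mult_right Bochner_Integration.integrable_add integrable_norm_power4) simp
    show "AE f in G. norm (F f * ((\<Sum>n<N. coord n (DF f) * coord n f) - (\<Sum>n<N. \<alpha> n * Kd n f))) \<le> B * (1 + L2_norm lam f ^ 4)" for N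
    proof (rule AE_I2)
      fix f assume "f \<in> space G"
      then have f: "f \<in> L2_space lam" by simp
      have A0: "suminf \<alpha> * Hd \<ge> 0" using order_trans[OF abs_ge_zero sum_Kd_bound(2)[OF f]] .
      have "L2_norm lam (DF f) * L2_norm lam f \<le> (c * (1 + L2_norm lam f)) * (1 + L2_norm lam f)"
        using c0 by (intro mult_mono DF_L2 f) auto
      also have "\<dots> = c * (1 + L2_norm lam f)\<^sup>2" by (simp add: power2_eq_square)
      also have "\<dots> \<le> c * (4 * (1 + L2_norm lam f ^ 4))" by (intro mult_left_mono one_plus_power4 c0)
      finally have a: "\<bar>\<Sum>n<N. coord n (DF f) * coord n f\<bar> \<le> c * 4 * (1 + L2_norm lam f ^ 4)"
        using bessel[OF f, of N] by (simp only: mult.assoc)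
      have b: "\<bar>\<Sum>n<N. \<alpha> n * Kd n f\<bar> \<le> suminf \<alpha> * Hd * (1 + L2_norm lam f ^ 4)"
        using sum_Kd_bound(1)[OF f, of N] A0 mult_left_mono[of 1 "1 + L2_norm lam f ^ 4" "suminf \<alpha> * Hd"] by simp
      have "\<bar>(\<Sum>n<N. coord n (DF f) * coord n f) - (\<Sum>n<N. \<alpha> n * Kd n f)\<bar> \<le> (c * 4 + suminf \<alpha> * Hd) * (1 + L2_norm lam f ^ 4)"
        unfolding distrib_right[of "c * 4"] by (rule order_trans[OF abs_triangle_ineq4 add_mono[OF a b]])
      then have "\<bar>F f\<bar> * \<bar>(\<Sum>n<N. coord n (DF f) * coord n f) - (\<Sum>n<N. \<alpha> n * Kd n f)\<bar> \<le> C * ((c * 4 + suminf \<alpha> * Hd) * (1 + L2_norm lam f ^ 4))"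
        by (intro mult_mono C f) auto
      then show "norm (F f * ((\<Sum>n<N. coord n (DF f) * coord n f) - (\<Sum>n<N. \<alpha> n * Kd n f))) \<le> B * (1 + L2_norm lam f ^ 4)"
        unfolding B_def real_norm_def abs_mult by (simp only: mult.assoc)
    qed
  qed
  have "L2_inner NG (coords V) (coords DF) = (\<integral>f. F f * (L2_inner lam (DF f) f - Q f) \<partial>G)"
    using lim1 lim2 unfolding partial by (rule LIMSEQ_unique)
  then show ?thesis by (simp add: V_def F_def)
qed

end

section \<open>The generator\<close>

text \<open>The law of \<open>(\<mu>, x)\<close> for \<open>x\<close> drawn from
  \<open>\<mu>\<close> is a measurable kernel into the product space, and integrating a fixed
  measurable function against a kernel is measurable.\<close>

lemma integral_measurable_P2:
  fixes f :: "(real ^ 'd) measure \<Rightarrow> real ^ 'd \<Rightarrow> real"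
  assumes f[measurable]: "(\<lambda>(\<mu>, x). f \<mu> x) \<in> borel_measurable (P2_borel \<Otimes>\<^sub>M borel)"
  shows "(\<lambda>\<mu>. \<integral>x. f \<mu> x \<partial>\<mu>) \<in> borel_measurable P2_borel"
proof -
  have "(\<lambda>\<mu>. distr \<mu> (P2_borel \<Otimes>\<^sub>M borel) (\<lambda>x. (\<mu>, x))) \<in> measurable P2_borel (subprob_algebra (P2_borel \<Otimes>\<^sub>M (borel :: (real ^ 'd) measure)))"
    by (rule measurable_distr2[OF _ measurable_P2_kernel]) (simp add: split_beta')
  from measurable_compose[OF this integral_measurable_subprob_algebra[OF f]]
  have "(\<lambda>\<mu>. \<integral>z. (\<lambda>(\<mu>, x). f \<mu> x) z \<partial>distr \<mu> (P2_borel \<Otimes>\<^sub>M borel) (\<lambda>x. (\<mu>, x))) \<in> borel_measurable P2_borel" .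
  moreover have "(\<integral>z. (\<lambda>(\<mu>, x). f \<mu> x) z \<partial>distr \<mu> (P2_borel \<Otimes>\<^sub>M borel) (\<lambda>x. (\<mu>, x))) = (\<integral>x. f \<mu> x \<partial>\<mu>)"
    if \<mu>: "\<mu> \<in> space P2_borel" for \<mu> :: "(real ^ 'd) measure"
  proof -
    have "(\<lambda>x. (\<mu>, x)) \<in> measurable \<mu> (P2_borel \<Otimes>\<^sub>M borel)"
      using measurable_Pair1'[OF \<mu>, of borel] P2_D(1)[of \<mu>] \<mu> measurable_cong_sets[of \<mu> borel] by auto
    then show ?thesis by (simp add: integral_distr[OF _ f])
  qed
  ultimately show ?thesis by (subst (asm) measurable_cong) auto
qed

context wasserstein_gaussian
begin

text \<open>Testing with the set where \<open>v\<close> exceeds \<open>C\<close> gives a nonpositive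
  integral of the positive excess, so the set is null. In probabilistic terms, the conditional
  expectation of \<open>Z\<close> given \<open>push lam f\<close> inherits the bound on
  \<open>Z\<close>.\<close>

lemma AE_le_by_testing:
  fixes v :: "(real ^ 'd) measure \<Rightarrow> real"
  assumes v[measurable]: "v \<in> borel_measurable P2_borel" and i: "integrable \<Lambda> v"
    and Z[measurable]: "Z \<in> borel_measurable G" and b: "\<And>f. f \<in> L2_space lam \<Longrightarrow> \<bar>Z f\<bar> \<le> C"
    and test: "\<And>A. A \<in> sets P2_borel \<Longrightarrow> (\<integral>\<mu>. indicator A \<mu> * v \<mu> \<partial>\<Lambda>) = (\<integral>f. indicator A (push lam f) * Z f \<partial>G)"
  shows "AE \<mu> in \<Lambda>. v \<mu> \<le> C"
proof -
  interpret \<Lambda>: prob_space \<Lambda> by (rule prob_\<Lambda>)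
  define A where "A = {\<mu> \<in> space P2_borel. v \<mu> > C}"
  have A[measurable]: "A \<in> sets P2_borel" unfolding A_def by measurable
  have i1: "integrable \<Lambda> (\<lambda>\<mu>. indicator A \<mu> * v \<mu>)"
    using integrable_mult_indicator[of A \<Lambda> v] A i by simp
  have i2: "integrable \<Lambda> (\<lambda>\<mu>. indicator A \<mu> * C)"
    by (rule \<Lambda>.integrable_const_bound[of _ "\<bar>C\<bar>"]) (auto simp: indicator_def)
  have j1: "integrable G (\<lambda>f. indicator A (push lam f) * Z f)"
    by (rule G.integrable_const_bound[of _ "\<bar>C\<bar>"]) (use b in \<open>auto simp: indicator_def intro!: AE_I2 order_trans[OF b abs_ge_self]\<close>)
  have j2: "integrable G (\<lambda>f. indicator A (push lam f) * C)"
    by (rule G.integrable_const_bound[of _ "\<bar>C\<bar>"]) (auto simp: indicator_def)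
  have "(\<integral>\<mu>. indicator A \<mu> * v \<mu> - indicator A \<mu> * C \<partial>\<Lambda>)
      = (\<integral>f. indicator A (push lam f) * Z f \<partial>G) - (\<integral>f. indicator A (push lam f) * C \<partial>G)"
  proof -
    have "(\<integral>\<mu>. indicator A \<mu> * C \<partial>\<Lambda>) = (\<integral>f. indicator A (push lam f) * C \<partial>G)"
      by (rule integral_\<Lambda>(1)) measurable
    then show ?thesis using i1 i2 test[OF A] by simp
  qed
  also have "\<dots> = (\<integral>f. indicator A (push lam f) * Z f - indicator A (push lam f) * C \<partial>G)"
    using j1 j2 by simp
  also have "\<dots> \<le> (\<integral>f. 0 \<partial>G)"
  proof (rule integral_mono)
    show "indicator A (push lam f) * Z f - indicator A (push lam f) * C \<le> 0" if "f \<in> space G" for f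
      using b[of f] that by (auto simp: indicator_def abs_le_iff)
  qed (use j1 j2 in auto)
  finally have le: "(\<integral>\<mu>. indicator A \<mu> * v \<mu> - indicator A \<mu> * C \<partial>\<Lambda>) \<le> 0" by simp
  have nn: "AE \<mu> in \<Lambda>. 0 \<le> indicator A \<mu> * v \<mu> - indicator A \<mu> * C"
    by (rule AE_I2) (auto simp: A_def indicator_def)
  have "(\<integral>\<mu>. indicator A \<mu> * v \<mu> - indicator A \<mu> * C \<partial>\<Lambda>) = 0"
    using le integral_nonneg_AE[OF nn] by simp
  then have "AE \<mu> in \<Lambda>. indicator A \<mu> * v \<mu> - indicator A \<mu> * C = 0"
    using integral_nonneg_eq_0_iff_AE[OF _ nn] i1 i2 by simp
  then show ?thesis
    using AE_space
  proof eventually_elim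
    case (elim \<mu>)
    have "\<mu> \<in> space P2_borel" using elim(2) sets_eq_imp_space_eq[OF sets_\<Lambda>] by simp
    with elim(1) show ?case by (cases "\<mu> \<in> A") (auto simp: A_def)
  qed
qed

end

locale wasserstein_gaussian_rho = wasserstein_gaussian_C2 lam g \<alpha> S G \<phi> H
  for lam :: "(real ^ 'd) measure" and g :: "nat \<Rightarrow> real ^ 'd \<Rightarrow> real ^ 'd" and \<alpha> S G
    and \<phi> :: "real ^ 'd \<Rightarrow> real" and H +
  fixes evl :: "(real ^ 'd \<Rightarrow> real ^ 'd) \<Rightarrow> real ^ 'd \<Rightarrow> real ^ 'd"
    and \<rho> :: "(real ^ 'd) measure \<Rightarrow> 'd \<Rightarrow> 'd \<Rightarrow> real ^ 'd \<Rightarrow> real"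
  assumes evl: "evaluation_version lam G evl"
    and \<rho>: "rho_coefficients lam G evl (q_coeff \<alpha> g) \<rho>"
begin

sublocale GL: pair_sigma_finite G lam ..

section \<open>Slices of \<open>\<rho>\<close> and the second order term\<close>

lemma evl_measurable [measurable]: "(\<lambda>z. evl (fst z) (snd z)) \<in> borel_measurable (G \<Otimes>\<^sub>M lam)"
  using evl by (simp add: evaluation_version_def split_beta')

lemma evl_AE: "AE f in G. AE x in lam. evl f x = f x"
  using evl by (simp add: evaluation_version_def)

lemma vec_push_measurable [measurable]: "vec_push lam evl \<in> measurable (G \<Otimes>\<^sub>M lam) (P2_borel \<Otimes>\<^sub>M borel)"
  unfolding vec_push_def split_beta' by measurable

lemma \<rho>_measurable [measurable]: "(\<lambda>z. \<rho> (fst z) k l (snd z)) \<in> borel_measurable (P2_borel \<Otimes>\<^sub>M borel)"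
  using \<rho> by (simp add: rho_coefficients_def split_beta')

lemma \<rho>_slice: "\<mu> \<in> P2 \<Longrightarrow> (\<lambda>x. \<rho> \<mu> k l x) \<in> borel_measurable borel"
  using measurable_Pair2[OF \<rho>_measurable, of \<mu>] by simp

lemma \<rho>_evl_integrable: "integrable (G \<Otimes>\<^sub>M lam) (\<lambda>z. \<rho> (push lam (fst z)) k l (evl (fst z) (snd z)))"
proof -
  have "integrable (distr (G \<Otimes>\<^sub>M lam) (P2_borel \<Otimes>\<^sub>M borel) (vec_push lam evl)) (\<lambda>z. \<rho> (fst z) k l (snd z))"
    using \<rho> by (simp add: rho_coefficients_def split_beta')
  from integrable_distr[OF vec_push_measurable this] show ?thesis
    by (simp add: vec_push_def split_beta')
qed

text \<open>Fubini needs the jointly measurable \<open>evl\<close>, whereas integrals against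
  \<open>push lam f\<close> involve \<open>f\<close> itself. For almost every \<open>f\<close> the
  two agree almost everywhere, which transfers integrability and the Hessian integral.\<close>

lemma \<rho>_good:
  "AE f in G. integrable lam (\<lambda>x. \<rho> (push lam f) k l (f x)) \<and>
     (\<integral>x. \<rho> (push lam f) k l (f x) * hess k l (f x) \<partial>lam) = (\<integral>x. \<rho> (push lam f) k l (evl f x) * hess k l (evl f x) \<partial>lam)"
  using GL.AE_integrable_fst'[OF \<rho>_evl_integrable[of k l]] evl_AE AE_space
proof eventually_elim
  case (elim f)
  have f: "f \<in> L2_space lam" using elim(3) by simp
  note [measurable] = L2_measurable[OF f] \<rho>_slice[OF push_P2[OF lam_P2 f]]
  have e[measurable]: "evl f \<in> borel_measurable lam"
    using measurable_Pair2[OF evl_measurable, of f] elim(3) by simp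
  have i: "integrable lam (\<lambda>x. \<rho> (push lam f) k l (evl f x))" using elim(1) by simp
  have "integrable lam (\<lambda>x. \<rho> (push lam f) k l (f x))"
    by (subst integrable_cong_AE[where g="\<lambda>x. \<rho> (push lam f) k l (evl f x)"])
      (use elim(2) i in \<open>auto elim!: eventually_mono\<close>)
  moreover have "(\<integral>x. \<rho> (push lam f) k l (f x) * hess k l (f x) \<partial>lam) = (\<integral>x. \<rho> (push lam f) k l (evl f x) * hess k l (evl f x) \<partial>lam)"
    by (rule integral_cong_AE) (use elim(2) in \<open>auto elim!: eventually_mono\<close>)
  ultimately show ?case by blast
qed

definition hess_rho :: "'d \<Rightarrow> 'd \<Rightarrow> (real ^ 'd) measure \<Rightarrow> real" where
  "hess_rho k l \<mu> = (\<integral>x. \<rho> \<mu> k l x * hess k l x \<partial>\<mu>)"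

lemma hess_rho_measurable [measurable]: "hess_rho k l \<in> borel_measurable P2_borel"
  unfolding hess_rho_def[abs_def] by (rule integral_measurable_P2) (simp add: split_beta')

lemma hess_rho_push: "f \<in> L2_space lam \<Longrightarrow> hess_rho k l (push lam f) = (\<integral>x. \<rho> (push lam f) k l (f x) * hess k l (f x) \<partial>lam)"
  unfolding hess_rho_def by (rule integral_push[OF lam_P2]) (auto intro!: borel_measurable_times \<rho>_slice push_P2 lam_P2)

text \<open>Fubini for the evaluation version gives plain integrability only; square integrability
  of the sum over \<open>k\<close> and \<open>l\<close> comes later from
  \<open>diffusion_bound\<close>.\<close>

lemma hess_rho_integrable: "integrable \<Lambda> (hess_rho k l)"
proof -
  have "integrable (G \<Otimes>\<^sub>M lam) (\<lambda>z. \<rho> (push lam (fst z)) k l (evl (fst z) (snd z)) * hess k l (evl (fst z) (snd z)))"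
  proof (rule Bochner_Integration.integrable_bound[OF integrable_mult_right[OF \<rho>_evl_integrable[of k l], of H]])
    show "(\<lambda>z. \<rho> (push lam (fst z)) k l (evl (fst z) (snd z)) * hess k l (evl (fst z) (snd z))) \<in> borel_measurable (G \<Otimes>\<^sub>M lam)"
      using borel_measurable_integrable[OF \<rho>_evl_integrable[of k l]] by measurable
    show "AE z in G \<Otimes>\<^sub>M lam. norm (\<rho> (push lam (fst z)) k l (evl (fst z) (snd z)) * hess k l (evl (fst z) (snd z)))
        \<le> norm (H * \<rho> (push lam (fst z)) k l (evl (fst z) (snd z)))"
      by (rule AE_I2) (use hess_bound H0 in \<open>auto simp: abs_mult mult.commute[of H] intro!: mult_left_mono\<close>)
  qed
  from GL.integrable_fst'[OF this]
  have i: "integrable G (\<lambda>f. \<integral>x. \<rho> (push lam f) k l (evl f x) * hess k l (evl f x) \<partial>lam)" by simp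
  have "integrable G (\<lambda>f. hess_rho k l (push lam f))"
  proof (subst integrable_cong_AE[where g="\<lambda>f. \<integral>x. \<rho> (push lam f) k l (evl f x) * hess k l (evl f x) \<partial>lam"])
    show "AE f in G. hess_rho k l (push lam f) = (\<integral>x. \<rho> (push lam f) k l (evl f x) * hess k l (evl f x) \<partial>lam)"
      using \<rho>_good[of k l] AE_space by eventually_elim (simp add: hess_rho_push)
  qed (use i in auto)
  then show ?thesis by (simp add: integral_\<Lambda>(2))
qed

lemma hess_q_measurable: "(\<lambda>f. \<integral>x. hess k l (f x) * q k l x \<partial>lam) \<in> borel_measurable G"
proof (rule measurable_G_seq)
  fix f :: "real ^ 'd \<Rightarrow> real ^ 'd" and F :: "nat \<Rightarrow> real ^ 'd \<Rightarrow> real ^ 'd"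
  assume "f \<in> L2_space lam" "\<And>n. F n \<in> L2_space lam" "(\<lambda>n. L2_norm lam (\<lambda>x. F n x - f x)) \<longlonglongrightarrow> 0"
  then show "(\<lambda>n. \<integral>x. hess k l (F n x) * q k l x \<partial>lam) \<longlonglongrightarrow> (\<integral>x. hess k l (f x) * q k l x \<partial>lam)"
    by (intro integral_bounded_continuous_tendsto[OF hess_continuous hess_bound q_integral(1)[of "\<lambda>x. 0" 0]]) auto
qed

lemma q_measurable [measurable]: "q k l \<in> borel_measurable lam"
  using q_integral(1)[of "\<lambda>x. 0" 0 k l] by auto

lemma hess_q_bound:
  assumes f: "f \<in> L2_space lam"
  shows "\<bar>\<integral>x. hess k l (f x) * q k l x \<partial>lam\<bar> \<le> H * (\<integral>x. \<bar>q k l x\<bar> \<partial>lam)"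
proof -
  note [measurable] = hess_f_measurable[OF f]
  have qi: "integrable lam (q k l)" using q_integral(1)[of "\<lambda>x. 0" 0 k l] by simp
  have b: "\<bar>hess k l (f x) * q k l x\<bar> \<le> H * \<bar>q k l x\<bar>" for x
    unfolding abs_mult by (rule mult_right_mono[OF hess_bound]) simp
  have i: "integrable lam (\<lambda>x. H * \<bar>q k l x\<bar>)" using qi by simp
  have "integrable lam (\<lambda>x. hess k l (f x) * q k l x)"
    by (rule Bochner_Integration.integrable_bound[OF i]) (use b in \<open>auto intro!: AE_I2 order_trans[OF b]\<close>)
  then have "\<bar>\<integral>x. hess k l (f x) * q k l x \<partial>lam\<bar> \<le> (\<integral>x. H * \<bar>q k l x\<bar> \<partial>lam)"
    by (intro order_trans[OF integral_abs_bound] integral_mono i b integrable_abs)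
  then show ?thesis by simp
qed

text \<open>The defining identity of \<open>\<rho>\<close> with a product test function. On the
  right-hand side \<open>evl f\<close> is replaced by \<open>f\<close> outside a null set.\<close>

lemma hess_rho_test:
  fixes F :: "(real ^ 'd) measure \<Rightarrow> real"
  assumes F[measurable]: "F \<in> borel_measurable P2_borel" and B: "\<And>\<mu>. \<bar>F \<mu>\<bar> \<le> B"
  shows "(\<integral>\<mu>. F \<mu> * hess_rho k l \<mu> \<partial>\<Lambda>) = (\<integral>f. F (push lam f) * (\<integral>x. hess k l (f x) * q k l x \<partial>lam) \<partial>G)"
proof -
  \<comment> \<open>Admissible because the second derivatives of \<open>\<phi>\<close> are bounded;
    the factor \<open>F\<close> leaves both inner integrals.\<close>
  define h where "h = (\<lambda>z. F (fst z) * hess k l (snd z))"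
  have h: "h \<in> borel_measurable (P2_borel \<Otimes>\<^sub>M borel)" unfolding h_def by measurable
  have "\<bar>h z\<bar> \<le> B * H" for z
    unfolding h_def abs_mult by (intro mult_mono B hess_bound order_trans[OF abs_ge_zero B]) simp
  then have id: "(\<integral>\<mu>. (\<integral>x. h (\<mu>, x) * \<rho> \<mu> k l x \<partial>\<mu>) \<partial>\<Lambda>) = (\<integral>f. (\<integral>x. h (vec_push lam evl (f, x)) * q k l x \<partial>lam) \<partial>G)"
    using \<rho> h unfolding rho_coefficients_def by blast
  have "(\<integral>x. h (\<mu>, x) * \<rho> \<mu> k l x \<partial>\<mu>) = F \<mu> * hess_rho k l \<mu>" for \<mu>
    unfolding hess_rho_def h_def by (simp add: mult.assoc mult.commute[of "hess k l _"])
  moreover have "(\<integral>x. h (vec_push lam evl (f, x)) * q k l x \<partial>lam) = F (push lam f) * (\<integral>x. hess k l (evl f x) * q k l x \<partial>lam)" for f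
    unfolding h_def vec_push_def by (simp add: mult.assoc)
  ultimately have "(\<integral>\<mu>. F \<mu> * hess_rho k l \<mu> \<partial>\<Lambda>) = (\<integral>f. F (push lam f) * (\<integral>x. hess k l (evl f x) * q k l x \<partial>lam) \<partial>G)"
    using id by simp
  also have "\<dots> = (\<integral>f. F (push lam f) * (\<integral>x. hess k l (f x) * q k l x \<partial>lam) \<partial>G)"
  proof (rule integral_cong_AE)
    have "(\<lambda>f. \<integral>x. hess k l (evl f x) * q k l x \<partial>lam) \<in> borel_measurable G"
      by (rule borel_measurable_lebesgue_integral) (simp add: split_beta')
    then show "(\<lambda>f. F (push lam f) * (\<integral>x. hess k l (evl f x) * q k l x \<partial>lam)) \<in> borel_measurable G" by measurable
    show "(\<lambda>f. F (push lam f) * (\<integral>x. hess k l (f x) * q k l x \<partial>lam)) \<in> borel_measurable G"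
      using hess_q_measurable by measurable
    show "AE f in G. F (push lam f) * (\<integral>x. hess k l (evl f x) * q k l x \<partial>lam) = F (push lam f) * (\<integral>x. hess k l (f x) * q k l x \<partial>lam)"
      using evl_AE AE_space
    proof eventually_elim
      case (elim f)
      have f: "f \<in> L2_space lam" using elim(2) by simp
      have [measurable]: "evl f \<in> borel_measurable lam"
        using measurable_Pair2[OF evl_measurable, of f] elim(2) by simp
      note [measurable] = L2_measurable[OF f]
      have "(\<integral>x. hess k l (evl f x) * q k l x \<partial>lam) = (\<integral>x. hess k l (f x) * q k l x \<partial>lam)"
        by (rule integral_cong_AE) (use elim(1) in \<open>auto elim!: eventually_mono\<close>)
      then show ?case by simp
    qed
  qed
  finally show ?thesis .
qed

definition diffusion :: "(real ^ 'd) measure \<Rightarrow> real" where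
  "diffusion \<mu> = (\<Sum>k\<in>UNIV. \<Sum>l\<in>UNIV. hess_rho k l \<mu>)"

lemma diffusion_measurable [measurable]: "diffusion \<in> borel_measurable P2_borel"
  unfolding diffusion_def[abs_def] by measurable

lemma diffusion_integrable: "integrable \<Lambda> diffusion"
  unfolding diffusion_def[abs_def] by (intro Bochner_Integration.integrable_sum hess_rho_integrable)

lemma diffusion_test:
  fixes F :: "(real ^ 'd) measure \<Rightarrow> real"
  assumes F[measurable]: "F \<in> borel_measurable P2_borel" and B: "\<And>\<mu>. \<bar>F \<mu>\<bar> \<le> B"
  shows "(\<integral>\<mu>. F \<mu> * diffusion \<mu> \<partial>\<Lambda>) = (\<integral>f. F (push lam f) * Q f \<partial>G)"
proof -
  have B0: "B \<ge> 0" using order_trans[OF abs_ge_zero B] .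
  have i: "integrable \<Lambda> (\<lambda>\<mu>. F \<mu> * hess_rho k l \<mu>)" for k l
  proof (rule Bochner_Integration.integrable_bound[OF integrable_mult_right[OF hess_rho_integrable[of k l], of B]])
    show "AE \<mu> in \<Lambda>. norm (F \<mu> * hess_rho k l \<mu>) \<le> norm (B * hess_rho k l \<mu>)"
      using B B0 by (intro AE_I2) (simp add: abs_mult mult_right_mono)
  qed measurable
  have j: "integrable G (\<lambda>f. F (push lam f) * (\<integral>x. hess k l (f x) * q k l x \<partial>lam))" for k l
  proof (rule G.integrable_const_bound[where B="B * (H * (\<integral>x. \<bar>q k l x\<bar> \<partial>lam))"])
    show "AE f in G. norm (F (push lam f) * (\<integral>x. hess k l (f x) * q k l x \<partial>lam)) \<le> B * (H * (\<integral>x. \<bar>q k l x\<bar> \<partial>lam))"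
      by (rule AE_I2) (auto simp: abs_mult intro!: mult_mono B hess_q_bound B0)
  qed (use hess_q_measurable in measurable)
  have "(\<integral>\<mu>. F \<mu> * diffusion \<mu> \<partial>\<Lambda>) = (\<Sum>k\<in>UNIV. \<Sum>l\<in>UNIV. \<integral>\<mu>. F \<mu> * hess_rho k l \<mu> \<partial>\<Lambda>)"
    unfolding diffusion_def sum_distrib_left using i by (simp add: Bochner_Integration.integral_sum Bochner_Integration.integrable_sum)
  also have "\<dots> = (\<Sum>k\<in>UNIV. \<Sum>l\<in>UNIV. \<integral>f. F (push lam f) * (\<integral>x. hess k l (f x) * q k l x \<partial>lam) \<partial>G)"
    by (intro sum.cong refl hess_rho_test[OF F B])
  also have "\<dots> = (\<integral>f. F (push lam f) * Q f \<partial>G)"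
    unfolding Q_def sum_distrib_left using j by (simp add: Bochner_Integration.integral_sum Bochner_Integration.integrable_sum)
  finally show ?thesis .
qed

text \<open>\<open>diffusion\<close> composed with \<open>push lam\<close> acts as the conditional
  expectation of \<open>Q\<close>; the two signs are tested separately.\<close>

lemma diffusion_bound: "AE \<mu> in \<Lambda>. \<bar>diffusion \<mu>\<bar> \<le> suminf \<alpha> * Hd"
proof -
  note [measurable] = Q_measurable
  have t: "(\<integral>\<mu>. indicator A \<mu> * diffusion \<mu> \<partial>\<Lambda>) = (\<integral>f. indicator A (push lam f) * Q f \<partial>G)" if "A \<in> sets P2_borel" for A
    by (rule diffusion_test[where B=1]) (use that in \<open>auto simp: indicator_def\<close>)
  have "AE \<mu> in \<Lambda>. diffusion \<mu> \<le> suminf \<alpha> * Hd"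
    by (rule AE_le_by_testing[where Z=Q]) (use sum_Kd_bound(2) diffusion_integrable t in auto)
  moreover have "AE \<mu> in \<Lambda>. - diffusion \<mu> \<le> suminf \<alpha> * Hd"
    by (rule AE_le_by_testing[where Z="\<lambda>f. - Q f"]) (use sum_Kd_bound(2) diffusion_integrable t in auto)
  ultimately show ?thesis by eventually_elim (simp add: abs_le_iff)
qed

definition drift :: "(real ^ 'd) measure \<Rightarrow> real" where
  "drift \<mu> = (\<integral>x. x \<bullet> grad \<phi> x \<partial>\<mu>)"

lemma drift_measurable [measurable]: "drift \<in> borel_measurable P2_borel"
  unfolding drift_def[abs_def] by (rule integral_measurable_P2) (simp add: split_beta')

lemma drift_push: "f \<in> L2_space lam \<Longrightarrow> drift (push lam f) = L2_inner lam (DF f) f"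
  unfolding drift_def by (subst integral_push[OF lam_P2]) (auto simp: L2_inner_def DF_def inner_commute)

lemma drift_bound:
  assumes f: "f \<in> L2_space lam"
  shows "\<bar>drift (push lam f)\<bar> \<le> (2 * c) * (1 + (L2_norm lam f)\<^sup>2)"
proof -
  let ?n = "L2_norm lam f"
  have "\<bar>drift (push lam f)\<bar> \<le> L2_norm lam (DF f) * ?n"
    unfolding drift_push[OF f] by (rule L2_Cauchy_Schwarz[OF DF_L2(1)[OF f] f])
  also have "\<dots> \<le> (c * (1 + ?n)) * ?n" by (rule mult_right_mono[OF DF_L2(2)[OF f]]) simp
  also have "\<dots> = c * (?n + ?n\<^sup>2)" by (simp add: algebra_simps power2_eq_square)
  also have "\<dots> \<le> c * (2 * (1 + ?n\<^sup>2))"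
  proof (rule mult_left_mono[OF _ c0])
    have "0 \<le> (?n - 1/2)\<^sup>2" by simp
    then have "?n \<le> ?n\<^sup>2 + 1/4" by (simp add: power2_eq_square algebra_simps)
    then show "?n + ?n\<^sup>2 \<le> 2 * (1 + ?n\<^sup>2)" unfolding distrib_left by linarith
  qed
  finally show ?thesis by (simp only: mult_ac)
qed

lemma drift_L2: "drift \<in> L2_space \<Lambda>"
  unfolding L2_\<Lambda>(1)[OF drift_measurable] by (rule sq_bound_L2(1)[OF _ drift_bound]) measurable

lemma diffusion_L2: "diffusion \<in> L2_space \<Lambda>"
proof -
  interpret \<Lambda>: prob_space \<Lambda> by (rule prob_\<Lambda>)
  have k: "(\<lambda>\<mu>. suminf \<alpha> * Hd) \<in> L2_space \<Lambda>" by (rule L2_const) unfold_locales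
  show ?thesis
    by (rule L2_bound[OF _ k]) (use diffusion_bound in \<open>auto elim!: eventually_mono\<close>)
qed

definition gen_u :: "(real ^ 'd) measure \<Rightarrow> real" where
  "gen_u \<mu> = diffusion \<mu> - drift \<mu>"

lemma gen_u_L2: "gen_u \<in> L2_space \<Lambda>"
  unfolding gen_u_def[abs_def] by (rule L2_diff[OF diffusion_L2 drift_L2])

text \<open>For almost every \<open>\<mu>\<close> all \<open>\<rho> \<mu> k l\<close> are
  integrable, so the integral of the operator splits into its second order and drift parts.\<close>

lemma gen_u_diffusion:
  "AE \<mu> in \<Lambda>. integrable \<mu> (diffusion_operator (\<rho> \<mu>) \<phi>) \<and> gen_u \<mu> = (\<integral>x. diffusion_operator (\<rho> \<mu>) \<phi> x \<partial>\<mu>)"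
proof -
  have "AE \<mu> in \<Lambda>. integrable \<mu> (\<rho> \<mu> k l)" for k l
  proof -
    \<comment> \<open>Integrability is restated as finiteness of a nonnegative integral, which makes
      the set of good \<open>\<mu>\<close> measurable; transferring the almost everywhere statement
      from \<open>G\<close> to its image measure requires this.\<close>
    have eq: "integrable \<mu> (\<rho> \<mu> k l) \<longleftrightarrow> (\<integral>\<^sup>+x. ennreal \<bar>\<rho> \<mu> k l x\<bar> \<partial>\<mu>) < \<infinity>" if "\<mu> \<in> P2" for \<mu>
      using \<rho>_slice[OF that, of k l] measurable_cong_sets[OF P2_D(1)[OF that] refl]
      by (auto simp: integrable_iff_bounded)
    have "(\<lambda>\<mu>. \<integral>\<^sup>+x. ennreal \<bar>\<rho> \<mu> k l x\<bar> \<partial>\<mu>) \<in> borel_measurable P2_borel"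
      by (rule nn_integral_measurable_subprob_algebra2[OF _ measurable_P2_kernel]) (simp add: split_beta')
    then have "{\<mu> \<in> space P2_borel. (\<integral>\<^sup>+x. ennreal \<bar>\<rho> \<mu> k l x\<bar> \<partial>\<mu>) < \<infinity>} \<in> sets P2_borel" by measurable
    moreover have "{\<mu> \<in> space P2_borel. (\<integral>\<^sup>+x. ennreal \<bar>\<rho> \<mu> k l x\<bar> \<partial>\<mu>) < \<infinity>} = {\<mu> \<in> space P2_borel. integrable \<mu> (\<rho> \<mu> k l)}"
      using eq by auto
    ultimately have M: "{\<mu> \<in> space P2_borel. integrable \<mu> (\<rho> \<mu> k l)} \<in> sets P2_borel" by simp
    have "AE f in G. integrable (push lam f) (\<rho> (push lam f) k l)"
      using \<rho>_good[of k l] AE_space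
    proof eventually_elim
      case (elim f)
      then have f: "f \<in> L2_space lam" by simp
      note [measurable] = L2_measurable[OF f]
      have [measurable]: "\<rho> (push lam f) k l \<in> borel_measurable borel" by (rule \<rho>_slice[OF push_P2[OF lam_P2 f]])
      have "integrable lam (\<lambda>x. \<rho> (push lam f) k l (f x))" using elim by simp
      then have "integrable (distr lam borel f) (\<rho> (push lam f) k l)" by (subst integrable_distr_eq) auto
      then show ?case by (simp add: push_def[of lam f, symmetric])
    qed
    then show ?thesis unfolding Lambda_measure_def by (subst AE_distr_iff[OF push_measurable_G M])
  qed
  then have "AE \<mu> in \<Lambda>. \<forall>k\<in>UNIV. \<forall>l\<in>UNIV. integrable \<mu> (\<rho> \<mu> k l)"
    by (intro AE_finite_allI finite)
  then show ?thesis
    using AE_space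
  proof eventually_elim
    case (elim \<mu>)
    have \<mu>: "\<mu> \<in> P2" using elim(2) sets_eq_imp_space_eq[OF sets_\<Lambda>] by simp
    note P2_D(1)[OF \<mu>, measurable_cong]
    note [measurable] = \<rho>_slice[OF \<mu>]
    have i: "integrable \<mu> (\<lambda>x. \<rho> \<mu> k l x * hess k l x)" for k l
    proof (rule Bochner_Integration.integrable_bound[OF integrable_mult_right[of H \<mu> "\<rho> \<mu> k l"]])
      show "integrable \<mu> (\<rho> \<mu> k l)" using elim(1) by blast
      show "AE x in \<mu>. norm (\<rho> \<mu> k l x * hess k l x) \<le> norm (H * \<rho> \<mu> k l x)"
        by (rule AE_I2) (use hess_bound H0 in \<open>auto simp: abs_mult mult.commute[of H] intro!: mult_left_mono\<close>)
    qed measurable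
    have im: "integrable \<mu> (\<lambda>x. x \<bullet> grad \<phi> x)"
      by (rule L2_integrable_inner[OF P2_id_L2[OF \<mu>] D_L2[OF \<mu>]])
    have d: "diffusion_operator (\<rho> \<mu>) \<phi> x = (\<Sum>k\<in>UNIV. \<Sum>l\<in>UNIV. \<rho> \<mu> k l x * hess k l x) - x \<bullet> grad \<phi> x" for x
      by (simp add: diffusion_operator_def sum_subtractf inner_vec_def grad_def)
    have isum: "integrable \<mu> (\<lambda>x. \<Sum>k\<in>UNIV. \<Sum>l\<in>UNIV. \<rho> \<mu> k l x * hess k l x)"
      by (intro Bochner_Integration.integrable_sum i)
    have "integrable \<mu> (diffusion_operator (\<rho> \<mu>) \<phi>)"
      unfolding d[abs_def] by (rule Bochner_Integration.integrable_diff[OF isum im])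
    moreover have "(\<integral>x. diffusion_operator (\<rho> \<mu>) \<phi> x \<partial>\<mu>) = gen_u \<mu>"
      unfolding d Bochner_Integration.integral_diff[OF isum im] gen_u_def diffusion_def drift_def hess_rho_def
      using i by (simp add: Bochner_Integration.integral_sum Bochner_Integration.integrable_sum)
    ultimately show ?case by simp
  qed
qed

text \<open>Integration by parts transported to \<open>\<Lambda>\<close>: \<open>Q\<close> turns
  into \<open>diffusion\<close> because a bounded \<open>U\<close> is an admissible test function,
  and the pairing of \<open>DF f\<close> with \<open>f\<close> is \<open>drift\<close>.\<close>

lemma form_u:
  assumes U: "U \<in> C1b_P2"
  shows "L2_inner NG (coords (pull_gradient U lam)) (coords DF) = - L2_inner \<Lambda> U gen_u"
proof -
  have Um[measurable]: "U \<in> borel_measurable P2_borel" by (rule C1b_measurable[OF U])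
  note [measurable] = Q_measurable
  obtain C where C: "\<forall>\<mu>\<in>P2. \<bar>U \<mu>\<bar> \<le> C"
  proof -
    obtain v B where B: "\<forall>\<mu>\<in>P2. \<forall>x :: real ^ 'd. \<bar>U \<mu>\<bar> + norm (v \<mu> x :: real ^ 'd) \<le> B"
      using U unfolding C1b_P2_def by blast
    then have "\<bar>U \<mu>\<bar> \<le> B" if "\<mu> \<in> P2" for \<mu>
      using B[rule_format, OF that, of 0] norm_ge_zero[of "v \<mu> 0"] by linarith
    then show ?thesis using that by blast
  qed
  \<comment> \<open>The bound on \<open>U\<close> holds on \<open>P2\<close> only, while
    \<open>diffusion_test\<close> asks for a bound everywhere; the cut-off changes nothing on
    \<open>P2\<close>.\<close>
  define U' where "U' \<mu> = indicator P2 \<mu> * U \<mu>" for \<mu>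
  have P2s: "P2 \<in> sets P2_borel" using sets.top[of P2_borel] by simp
  have [measurable]: "U' \<in> borel_measurable P2_borel" unfolding U'_def[abs_def] using P2s by measurable
  have U'b: "\<bar>U' \<mu>\<bar> \<le> \<bar>C\<bar>" for \<mu> using C by (auto simp: U'_def indicator_def intro: order_trans[OF _ abs_ge_self])
  have UU: "U' (push lam f) = U (push lam f)" if "f \<in> L2_space lam" for f
    using push_P2[OF lam_P2 that] by (simp add: U'_def)
  have i1: "integrable \<Lambda> (\<lambda>\<mu>. U \<mu> * diffusion \<mu>)" "integrable \<Lambda> (\<lambda>\<mu>. U \<mu> * drift \<mu>)"
    using L2_integrable_inner[OF C1b_L2[OF U] diffusion_L2] L2_integrable_inner[OF C1b_L2[OF U] drift_L2] by auto
  have de: "(\<integral>\<mu>. U \<mu> * diffusion \<mu> \<partial>\<Lambda>) = (\<integral>f. U (push lam f) * Q f \<partial>G)"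
  proof -
    have "(\<integral>\<mu>. U \<mu> * diffusion \<mu> \<partial>\<Lambda>) = (\<integral>\<mu>. U' \<mu> * diffusion \<mu> \<partial>\<Lambda>)"
      by (rule Bochner_Integration.integral_cong) (use sets_eq_imp_space_eq[OF sets_\<Lambda>] in \<open>auto simp: U'_def\<close>)
    also have "\<dots> = (\<integral>f. U' (push lam f) * Q f \<partial>G)" by (rule diffusion_test[OF _ U'b]) measurable
    also have "\<dots> = (\<integral>f. U (push lam f) * Q f \<partial>G)"
      by (rule Bochner_Integration.integral_cong) (auto simp: UU)
    finally show ?thesis .
  qed
  have me: "(\<integral>\<mu>. U \<mu> * drift \<mu> \<partial>\<Lambda>) = (\<integral>f. U (push lam f) * drift (push lam f) \<partial>G)"
    by (rule integral_\<Lambda>(1)) measurable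
  have i2: "integrable G (\<lambda>f. U (push lam f) * drift (push lam f))"
    using i1(2) by (subst (asm) integral_\<Lambda>(2)) auto
  have i3: "integrable G (\<lambda>f. U (push lam f) * Q f)"
  proof (rule G.integrable_const_bound[where B="\<bar>C\<bar> * (suminf \<alpha> * Hd)"])
    show "AE f in G. norm (U (push lam f) * Q f) \<le> \<bar>C\<bar> * (suminf \<alpha> * Hd)"
    proof (rule AE_I2)
      fix f assume "f \<in> space G"
      then have f: "f \<in> L2_space lam" by simp
      have "\<bar>U (push lam f)\<bar> \<le> \<bar>C\<bar>" using C push_P2[OF lam_P2 f] by force
      then show "norm (U (push lam f) * Q f) \<le> \<bar>C\<bar> * (suminf \<alpha> * Hd)"
        unfolding real_norm_def abs_mult by (rule mult_mono[OF _ sum_Kd_bound(2)[OF f]]) auto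
    qed
  qed measurable
  have "L2_inner \<Lambda> U gen_u = (\<integral>\<mu>. U \<mu> * diffusion \<mu> - U \<mu> * drift \<mu> \<partial>\<Lambda>)"
    by (simp add: L2_inner_def gen_u_def right_diff_distrib)
  also have "\<dots> = (\<integral>f. U (push lam f) * Q f \<partial>G) - (\<integral>f. U (push lam f) * drift (push lam f) \<partial>G)"
    using i1 de me by simp
  also have "\<dots> = (\<integral>f. U (push lam f) * Q f - U (push lam f) * drift (push lam f) \<partial>G)"
    using i2 i3 by simp
  also have "\<dots> = (\<integral>f. - (U (push lam f) * (L2_inner lam (DF f) f - Q f)) \<partial>G)"
    by (rule Bochner_Integration.integral_cong) (auto simp: drift_push algebra_simps)
  also have "\<dots> = - L2_inner NG (coords (pull_gradient U lam)) (coords DF)"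
    unfolding integration_by_parts_u[OF U] by simp
  finally show ?thesis by simp
qed

section \<open>Approximating sequences and the value of the closed form\<close>

lemma form_approx_Cauchy:
  assumes "form_approx \<Lambda> (pre_form lam S G) C1b_P2 U f" and e: "e > 0"
  shows "\<exists>N. \<forall>m\<ge>N. \<forall>k\<ge>N. L2_norm NG (\<lambda>z. coords (pull_gradient (U m) lam) z - coords (pull_gradient (U k) lam) z) < e"
proof -
  have UC: "U n \<in> C1b_P2" for n using assms(1) by (auto simp: form_approx_def)
  obtain N where N: "\<forall>m\<ge>N. \<forall>k\<ge>N. pre_form lam S G (\<lambda>x. U m x - U k x) (\<lambda>x. U m x - U k x) < e\<^sup>2"
    using assms(1) zero_less_power[OF e, of 2] unfolding form_approx_def by blast
  have "L2_norm NG (\<lambda>z. coords (pull_gradient (U m) lam) z - coords (pull_gradient (U k) lam) z) < e"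
    if "m \<ge> N" "k \<ge> N" for m k
  proof (rule power2_less_imp_less)
    show "(L2_norm NG (\<lambda>z. coords (pull_gradient (U m) lam) z - coords (pull_gradient (U k) lam) z))\<^sup>2 < e\<^sup>2"
      using N that by (simp add: pre_form_diff[OF UC UC, symmetric])
  qed (use e in simp)
  then show ?thesis by blast
qed

lemma form_approx_u: "form_approx \<Lambda> (pre_form lam S G) C1b_P2 u_approx u"
  unfolding form_approx_def
proof (intro conjI allI impI u_L2 u_approx_L2)
  show "range u_approx \<subseteq> C1b_P2" using u_approx_C1b by blast
  fix e :: real assume e: "e > 0"
  note L = coords_L2(1)[OF C1b_functionalD(2)[OF C1b_functional_push[OF u_approx_C1b]]]
  obtain N where N: "\<forall>m\<ge>N. \<forall>k\<ge>N. L2_norm NG (\<lambda>z. coords (pull_gradient (u_approx m) lam) z - coords (pull_gradient (u_approx k) lam) z) < sqrt e"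
    using L2_Cauchy_of_limit[OF L coords_L2(1)[OF DF_field] u_approx_coords, of "sqrt e"] e by auto
  have "pre_form lam S G (\<lambda>x. u_approx m x - u_approx k x) (\<lambda>x. u_approx m x - u_approx k x) < e"
    if mk: "m \<ge> N" "k \<ge> N" for m k
  proof -
    let ?n = "L2_norm NG (\<lambda>z. coords (pull_gradient (u_approx m) lam) z - coords (pull_gradient (u_approx k) lam) z)"
    have "?n < sqrt e" using N mk by blast
    then have "?n\<^sup>2 < (sqrt e)\<^sup>2" by (rule power_strict_mono) auto
    then show ?thesis using e by (simp add: pre_form_diff[OF u_approx_C1b u_approx_C1b])
  qed
  then show "\<exists>N. \<forall>m\<ge>N. \<forall>n\<ge>N. pre_form lam S G (\<lambda>x. u_approx m x - u_approx n x) (\<lambda>x. u_approx m x - u_approx n x) < e"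
    by blast
qed

text \<open>The sequence \<open>V\<close> is arbitrary: closability compares its coordinates with
  those of \<open>u_approx\<close>, so they converge to \<open>coords DF\<close>. The coordinates of
  \<open>U\<close> stay bounded, and their pairing with \<open>coords DF\<close> is known from
  \<open>form_u\<close>.\<close>

lemma pre_form_tendsto:
  assumes U: "form_approx \<Lambda> (pre_form lam S G) C1b_P2 U f" and V: "form_approx \<Lambda> (pre_form lam S G) C1b_P2 V u"
  shows "(\<lambda>n. pre_form lam S G (U n) (V n)) \<longlonglongrightarrow> - L2_inner \<Lambda> f gen_u"
proof -
  have UC: "U n \<in> C1b_P2" for n using U by (auto simp: form_approx_def)
  have VC: "V n \<in> C1b_P2" for n using V by (auto simp: form_approx_def)
  have fL: "f \<in> L2_space \<Lambda>" and Uf: "(\<lambda>n. L2_norm \<Lambda> (\<lambda>x. U n x - f x)) \<longlonglongrightarrow> 0"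
    and Vu: "(\<lambda>n. L2_norm \<Lambda> (\<lambda>x. V n x - u x)) \<longlonglongrightarrow> 0"
    using U V by (auto simp: form_approx_def)
  define p where "p W = coords (pull_gradient W lam)" for W
  have L: "p W \<in> L2_space NG" if "W \<in> C1b_P2" for W
    unfolding p_def by (rule coords_L2(1)[OF C1b_functionalD(2)[OF C1b_functional_push[OF that]]])
  have LD: "coords DF \<in> L2_space NG" by (rule coords_L2(1)[OF DF_field])
  have null: "(\<lambda>n. L2_norm \<Lambda> (\<lambda>\<mu>. V n \<mu> - u_approx n \<mu>)) \<longlonglongrightarrow> 0"
  proof (rule Lim_null_comparison)
    show "\<forall>\<^sub>F n in sequentially. norm (L2_norm \<Lambda> (\<lambda>\<mu>. V n \<mu> - u_approx n \<mu>))
        \<le> L2_norm \<Lambda> (\<lambda>x. V n x - u x) + L2_norm \<Lambda> (\<lambda>\<mu>. u_approx n \<mu> - u \<mu>)"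
      using L2_norm_diff_triangle[OF C1b_L2[OF VC] u_L2 C1b_L2[OF u_approx_C1b]]
      by (simp add: L2_norm_minus_commute[of \<Lambda> u])
    show "(\<lambda>n. L2_norm \<Lambda> (\<lambda>x. V n x - u x) + L2_norm \<Lambda> (\<lambda>\<mu>. u_approx n \<mu> - u \<mu>)) \<longlonglongrightarrow> 0"
      using tendsto_add[OF Vu u_approx_L2] by simp
  qed
  have VA: "(\<lambda>n. L2_norm NG (\<lambda>z. p (V n) z - p (u_approx n) z)) \<longlonglongrightarrow> 0"
    unfolding p_def
    by (rule C1b_closable[OF VC u_approx_C1b null form_approx_Cauchy[OF V] form_approx_Cauchy[OF form_approx_u]])
  have VD: "(\<lambda>n. L2_norm NG (\<lambda>z. p (V n) z - coords DF z)) \<longlonglongrightarrow> 0"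
  proof (rule Lim_null_comparison)
    show "\<forall>\<^sub>F n in sequentially. norm (L2_norm NG (\<lambda>z. p (V n) z - coords DF z))
        \<le> L2_norm NG (\<lambda>z. p (V n) z - p (u_approx n) z) + L2_norm NG (\<lambda>z. p (u_approx n) z - coords DF z)"
      using L2_norm_diff_triangle[OF L[OF VC] L[OF u_approx_C1b] LD] by simp
    show "(\<lambda>n. L2_norm NG (\<lambda>z. p (V n) z - p (u_approx n) z) + L2_norm NG (\<lambda>z. p (u_approx n) z - coords DF z)) \<longlonglongrightarrow> 0"
      using tendsto_add[OF VA u_approx_coords[folded p_def]] by simp
  qed
  obtain B where B: "\<And>n. L2_norm NG (p (U n)) \<le> B"
    using L2_Cauchy_bounded[OF L[OF UC] form_approx_Cauchy[OF U, folded p_def]] by blast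
  have "(\<lambda>n. L2_inner NG (p (U n)) (\<lambda>z. p (V n) z - coords DF z)) \<longlonglongrightarrow> 0"
  proof (rule Lim_null_comparison)
    have "\<bar>L2_inner NG (p (U n)) (\<lambda>z. p (V n) z - coords DF z)\<bar> \<le> B * L2_norm NG (\<lambda>z. p (V n) z - coords DF z)" for n
      by (rule order_trans[OF L2_Cauchy_Schwarz[OF L[OF UC] L2_diff[OF L[OF VC] LD]] mult_right_mono[OF B]]) simp
    then show "\<forall>\<^sub>F n in sequentially. norm (L2_inner NG (p (U n)) (\<lambda>z. p (V n) z - coords DF z)) \<le> B * L2_norm NG (\<lambda>z. p (V n) z - coords DF z)"
      by simp
    show "(\<lambda>n. B * L2_norm NG (\<lambda>z. p (V n) z - coords DF z)) \<longlonglongrightarrow> 0" using tendsto_mult_right_zero[OF VD] .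
  qed
  moreover have "(\<lambda>n. L2_inner NG (p (U n)) (coords DF)) \<longlonglongrightarrow> - L2_inner \<Lambda> f gen_u"
    unfolding p_def form_u[OF UC]
    by (intro tendsto_minus tendsto_inner_L2[OF C1b_L2[OF UC] fL gen_u_L2 Uf])
  ultimately have "(\<lambda>n. L2_inner NG (p (U n)) (\<lambda>z. p (V n) z - coords DF z) + L2_inner NG (p (U n)) (coords DF)) \<longlonglongrightarrow> 0 + - L2_inner \<Lambda> f gen_u"
    by (rule tendsto_add)
  moreover have "L2_inner NG (p (U n)) (\<lambda>z. p (V n) z - coords DF z) + L2_inner NG (p (U n)) (coords DF) = pre_form lam S G (U n) (V n)" for n
    unfolding pre_form_coords[OF UC VC] p_def[symmetric]
    by (simp add: L2_inner_diff_right[OF L[OF VC] LD L[OF UC]])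
  ultimately show ?thesis by simp
qed

lemma u_domain: "u \<in> dirichlet_domain lam S G"
  unfolding dirichlet_domain_def closure_domain_def using form_approx_u by blast

text \<open>Uniqueness in the description by \<open>THE\<close> rests on the existence of
  approximating sequences for both arguments; otherwise every real number would qualify.\<close>

lemma dirichlet_form_u:
  assumes "f \<in> dirichlet_domain lam S G"
  shows "dirichlet_form lam S G f u = - L2_inner \<Lambda> f gen_u"
  unfolding dirichlet_form_def closure_form_def
proof (rule the_equality)
  show "\<forall>U V. form_approx \<Lambda> (pre_form lam S G) C1b_P2 U f \<longrightarrow> form_approx \<Lambda> (pre_form lam S G) C1b_P2 V u \<longrightarrow>
      (\<lambda>n. pre_form lam S G (U n) (V n)) \<longlonglongrightarrow> - L2_inner \<Lambda> f gen_u"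
    using pre_form_tendsto by blast
  fix e assume lim: "\<forall>U V. form_approx \<Lambda> (pre_form lam S G) C1b_P2 U f \<longrightarrow> form_approx \<Lambda> (pre_form lam S G) C1b_P2 V u \<longrightarrow>
      (\<lambda>n. pre_form lam S G (U n) (V n)) \<longlonglongrightarrow> e"
  obtain U where U: "form_approx \<Lambda> (pre_form lam S G) C1b_P2 U f"
    using assms unfolding dirichlet_domain_def closure_domain_def by blast
  show "e = - L2_inner \<Lambda> f gen_u"
    using lim U form_approx_u pre_form_tendsto[OF U form_approx_u] LIMSEQ_unique by blast
qed

text \<open>Since the generator is self-adjoint, \<open>\<langle>L f, u\<rangle> = \<langle>f, gen_u\<rangle>\<close> on its domain already forces
  \<open>u\<close> to lie in the domain and \<open>L u = gen_u\<close>.\<close>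

theorem generator_u:
  assumes L: "form_generator \<Lambda> (dirichlet_form lam S G) (dirichlet_domain lam S G) L DL"
  shows "u \<in> DL" "AE \<mu> in \<Lambda>. gen_u \<mu> = L u \<mu>"
proof -
  have sa: "self_adjoint_operator \<Lambda> L DL" and dom: "DL \<subseteq> dirichlet_domain lam S G"
    and gen: "\<And>f v. f \<in> DL \<Longrightarrow> v \<in> dirichlet_domain lam S G \<Longrightarrow> dirichlet_form lam S G f v = - (\<integral>x. L f x * v x \<partial>\<Lambda>)"
    using L by (auto simp: form_generator_def)
  have "\<forall>f\<in>DL. L2_inner \<Lambda> (L f) u = L2_inner \<Lambda> f gen_u"
  proof
    fix f assume f: "f \<in> DL"
    have "dirichlet_form lam S G f u = - L2_inner \<Lambda> (L f) u"
      using gen[OF f u_domain] by (simp add: L2_inner_def)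
    then show "L2_inner \<Lambda> (L f) u = L2_inner \<Lambda> f gen_u"
      using dirichlet_form_u f dom by auto
  qed
  then have "u \<in> DL \<and> (AE \<mu> in \<Lambda>. gen_u \<mu> = L u \<mu>)"
    using sa u_L2 gen_u_L2 unfolding self_adjoint_operator_def by blast
  then show "u \<in> DL" "AE \<mu> in \<Lambda>. gen_u \<mu> = L u \<mu>" by auto
qed

end

section \<open>From the operator \<open>A\<close> to its eigenvalues\<close>

lemma inverse_operator_props:
  assumes bij: "bijective_operator M A DA" and h: "h \<in> L2_space M"
  shows "inverse_operator M A DA h \<in> DA" "AE x in M. A (inverse_operator M A DA h) x = h x"
proof -
  have "\<exists>f. f \<in> DA \<and> (AE x in M. A f x = h x)" using bij h unfolding bijective_operator_def by blast
  from someI_ex[OF this] show "inverse_operator M A DA h \<in> DA" "AE x in M. A (inverse_operator M A DA h) x = h x"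
    unfolding inverse_operator_def by blast+
qed

text \<open>Symmetry of \<open>A\<close> on the preimages of \<open>f\<close> and \<open>g\<close>,
  which both lie in \<open>DA\<close>, moves the inverse across the inner product, where the
  eigenvalue equation applies.\<close>

lemma inverse_operator_eigen_coord:
  assumes sa: "self_adjoint_operator M A DA" and bij: "bijective_operator M A DA"
    and g: "g \<in> L2_space M" and eig: "AE x in M. inverse_operator M A DA g x = a *\<^sub>R g x"
    and f: "f \<in> L2_space M"
  shows "inverse_operator M A DA f \<in> L2_space M" "L2_inner M (inverse_operator M A DA f) g = a * L2_inner M f g"
proof -
  let ?S = "inverse_operator M A DA"
  have D: "DA \<subseteq> L2_space M" "\<And>f. f \<in> DA \<Longrightarrow> A f \<in> L2_space M"
    using sa unfolding self_adjoint_operator_def linear_operator_def by blast+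
  note Sf = inverse_operator_props[OF bij f] and Sg = inverse_operator_props[OF bij g]
  have L: "?S f \<in> L2_space M" "?S g \<in> L2_space M" using Sf Sg D by auto
  show "?S f \<in> L2_space M" by fact
  have sym: "L2_inner M (A (?S f)) (?S g) = L2_inner M (?S f) (A (?S g))"
  proof -
    have "\<And>g h. g \<in> L2_space M \<Longrightarrow> h \<in> L2_space M \<Longrightarrow> (\<forall>f\<in>DA. L2_inner M (A f) g = L2_inner M f h) \<longleftrightarrow>
        g \<in> DA \<and> (AE x in M. h x = A g x)"
      using sa unfolding self_adjoint_operator_def by blast
    from this[OF L(2) D(2)[OF Sg(1)]] show ?thesis using Sg(1) Sf(1) by simp
  qed
  note m = L2_measurable[OF L(1)] L2_measurable[OF L(2)] L2_measurable[OF f] L2_measurable[OF g]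
    L2_measurable[OF D(2)[OF Sf(1)]] L2_measurable[OF D(2)[OF Sg(1)]] L2_measurable[OF L2_scaleR[OF g, of a]]
  have "L2_inner M (?S f) g = L2_inner M (?S f) (A (?S g))"
    by (rule L2_inner_cong_AE) (use Sg(2) m in \<open>auto elim!: eventually_mono\<close>)
  also have "\<dots> = L2_inner M (A (?S f)) (?S g)" by (rule sym[symmetric])
  also have "\<dots> = L2_inner M f (\<lambda>x. a *\<^sub>R g x)"
    by (rule L2_inner_cong_AE) (use Sf(2) eig m in \<open>auto elim!: eventually_mono\<close>)
  finally show "L2_inner M (?S f) g = a * L2_inner M f g" by (simp add: L2_inner_scaleR_right)
qed

text \<open>The nuclear expansion writes \<open>\<alpha> n\<close> as the sum over \<open>m\<close>
  of \<open>\<langle>g n, a m\<rangle> \<langle>b m, g n\<rangle>\<close>. Summed over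
  \<open>n < N\<close>, each term is at most \<open>|a m| |b m|\<close> by Cauchy-Schwarz and
  Bessel, a summable bound independent of \<open>N\<close>.\<close>

lemma (in L2_basis) trace_class_summable:
  assumes tc: "trace_class_operator M S" and pos: "\<And>n. \<alpha> n \<ge> 0"
    and eig: "\<And>n. coord n (S (g n)) = \<alpha> n"
  shows "summable \<alpha>"
proof -
  obtain a b :: "nat \<Rightarrow> 'a \<Rightarrow> 'b" where ab: "range a \<subseteq> L2_space M" "range b \<subseteq> L2_space M"
    and sm: "summable (\<lambda>m. L2_norm M (a m) * L2_norm M (b m))"
    and l: "\<forall>f\<in>L2_space M. (\<lambda>N. L2_norm M (\<lambda>x. S f x - (\<Sum>m<N. L2_inner M f (a m) *\<^sub>R b m x))) \<longlonglongrightarrow> 0"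
    using tc unfolding trace_class_operator_def by (elim conjE exE)
  have SL: "S f \<in> L2_space M" if "f \<in> L2_space M" for f
    using tc that unfolding trace_class_operator_def image_subset_iff by (elim conjE bspec)
  have a: "a m \<in> L2_space M" and b: "b m \<in> L2_space M" for m using ab by auto
  have lim: "(\<lambda>N. L2_norm M (\<lambda>x. S f x - (\<Sum>m<N. L2_inner M f (a m) *\<^sub>R b m x))) \<longlonglongrightarrow> 0"
    if "f \<in> L2_space M" for f
    by (rule l[rule_format, OF that])
  have sums: "(\<lambda>m. L2_inner M (g n) (a m) * coord n (b m)) sums \<alpha> n" for n
  proof -
    have P: "(\<lambda>x. \<Sum>m<N. L2_inner M (g n) (a m) *\<^sub>R b m x) \<in> L2_space M" for N
      by (intro L2_sum L2_scaleR b)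
    have "(\<lambda>N. coord n (\<lambda>x. \<Sum>m<N. L2_inner M (g n) (a m) *\<^sub>R b m x)) \<longlonglongrightarrow> coord n (S (g n))"
      by (rule tendsto_inner_L2[OF P SL[OF g_L2] g_L2]) (use lim[OF g_L2[of n]] in \<open>simp add: L2_norm_minus_commute[of M "S (g n)"]\<close>)
    moreover have "coord n (\<lambda>x. \<Sum>m<N. L2_inner M (g n) (a m) *\<^sub>R b m x) = (\<Sum>m<N. L2_inner M (g n) (a m) * coord n (b m))" for N
      by (subst L2_inner_sum_left) (auto intro: L2_scaleR b simp: L2_inner_scaleR_left)
    ultimately show ?thesis unfolding sums_def eig by simp
  qed
  have bd: "(\<Sum>n<N. L2_inner M (g n) (a m) * coord n (b m)) \<le> L2_norm M (a m) * L2_norm M (b m)" for N m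
  proof -
    have "(\<Sum>n<N. L2_inner M (g n) (a m) * coord n (b m)) = L2_inner M (P N (a m)) (b m)"
      unfolding P_inner[OF b] L2_inner_commute[of M "g _" "a m"] ..
    also have "\<dots> \<le> L2_norm M (P N (a m)) * L2_norm M (b m)"
      using L2_Cauchy_Schwarz[OF P_L2 b] by (rule order_trans[OF abs_ge_self])
    also have "\<dots> \<le> L2_norm M (a m) * L2_norm M (b m)"
    proof (rule mult_right_mono[OF _ L2_norm_nonneg], rule power2_le_imp_le[OF _ L2_norm_nonneg])
      show "(L2_norm M (P N (a m)))\<^sup>2 \<le> (L2_norm M (a m))\<^sup>2"
        unfolding P_norm_sq by (rule Bessel[OF a])
    qed
    finally show ?thesis .
  qed
  have "(\<Sum>n<N. \<alpha> n) \<le> (\<Sum>m. L2_norm M (a m) * L2_norm M (b m))" for N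
  proof -
    have "(\<lambda>m. \<Sum>n<N. L2_inner M (g n) (a m) * coord n (b m)) sums (\<Sum>n<N. \<alpha> n)"
      by (intro sums_sum sums)
    from sums_le[OF bd this summable_sums[OF sm]] show ?thesis .
  qed
  then show ?thesis by (intro summableI_nonneg_bounded[of \<alpha>]) (use pos in auto)
qed

theorem proposition3p6:
  fixes lam :: "(real ^ 'd) measure"
    and A :: "(real ^ 'd \<Rightarrow> real ^ 'd) \<Rightarrow> (real ^ 'd \<Rightarrow> real ^ 'd)"
    and DA :: "(real ^ 'd \<Rightarrow> real ^ 'd) set"
    and G :: "(real ^ 'd \<Rightarrow> real ^ 'd) measure"
    and g :: "nat \<Rightarrow> real ^ 'd \<Rightarrow> real ^ 'd"
    and \<alpha> :: "nat \<Rightarrow> real"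
    and evl :: "(real ^ 'd \<Rightarrow> real ^ 'd) \<Rightarrow> real ^ 'd \<Rightarrow> real ^ 'd"
    and \<rho> :: "(real ^ 'd) measure \<Rightarrow> 'd \<Rightarrow> 'd \<Rightarrow> real ^ 'd \<Rightarrow> real"
    and L :: "((real ^ 'd) measure \<Rightarrow> real) \<Rightarrow> ((real ^ 'd) measure \<Rightarrow> real)"
    and DL :: "((real ^ 'd) measure \<Rightarrow> real) set"
    and \<phi> :: "real ^ 'd \<Rightarrow> real"
  assumes lam: "lam \<in> P2" "absolutely_continuous lborel lam"
    and A: "self_adjoint_operator lam A DA" "strictly_positive_operator lam A DA"
      "bijective_operator lam A DA"
    and Ainv: "trace_class_operator lam (inverse_operator lam A DA)"
    and G: "centered_gaussian lam (inverse_operator lam A DA) G"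
    and g: "orthonormal_basis lam g"
    and \<alpha>: "\<And>n. \<alpha> n > 0" "\<And>n. AE x in lam. inverse_operator lam A DA (g n) x = \<alpha> n *\<^sub>R g n x"
    and evl: "evaluation_version lam G evl"
    and \<rho>: "rho_coefficients lam G evl (q_coeff \<alpha> g) \<rho>"
    and L: "form_generator (Lambda_measure lam G)
              (dirichlet_form lam (inverse_operator lam A DA) G)
              (dirichlet_domain lam (inverse_operator lam A DA) G) L DL"
    and \<phi>: "C2_fun \<phi>" "\<And>k l. bounded (range (partial_deriv k (partial_deriv l \<phi>)))"
  shows "(\<lambda>\<mu>. \<integral>x. \<phi> x \<partial>\<mu>) \<in> DL \<and>
    (AE \<mu> in Lambda_measure lam G.
       integrable \<mu> (diffusion_operator (\<rho> \<mu>) \<phi>) \<and>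
       L (\<lambda>\<mu>. \<integral>x. \<phi> x \<partial>\<mu>) \<mu> = (\<integral>x. diffusion_operator (\<rho> \<mu>) \<phi> x \<partial>\<mu>))"
proof -
  let ?S = "inverse_operator lam A DA"
  interpret L2_basis lam g
    by (intro L2_basis.intro L2_basis_axioms.intro g P2_D(2)[OF lam(1)])
  \<comment> \<open>Two facts about the inverse of \<open>A\<close> feed the locales: it is diagonal
    in the basis \<open>g\<close>, and its eigenvalues are summable.\<close>
  note eig = inverse_operator_eigen_coord[OF A(1,3) g_L2 \<alpha>(2)]
  have "L2_inner lam (?S (g n)) (g n) = \<alpha> n" for n
    using eig(2)[OF g_L2, of n n] by (simp add: g_inner)
  then have sum: "summable \<alpha>"
    by (intro trace_class_summable[OF Ainv]) (use \<alpha>(1) in \<open>auto intro: less_imp_le\<close>)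
  obtain H where H: "H \<ge> 0" "\<And>x y. norm (grad \<phi> x - grad \<phi> y) \<le> H * norm (x - y)"
    "\<And>k l x. \<bar>partial_deriv k (partial_deriv l \<phi>) x\<bar> \<le> H"
    using C2_fun_grad_Lipschitz[OF \<phi>] by blast
  have C1: "C1_fun \<phi>" using \<phi>(1) by (simp add: C2_fun_def)
  interpret wasserstein_gaussian_rho lam g \<alpha> ?S G \<phi> H evl \<rho>
    by unfold_locales (use \<alpha>(1) sum eig G lam(1) C1_fun_has_derivative[OF C1] H \<phi>(1) evl \<rho> in auto)
  note gen = generator_u[OF L]
  have "AE \<mu> in Lambda_measure lam G. integrable \<mu> (diffusion_operator (\<rho> \<mu>) \<phi>) \<and>
       L (\<lambda>\<mu>. \<integral>x. \<phi> x \<partial>\<mu>) \<mu> = (\<integral>x. diffusion_operator (\<rho> \<mu>) \<phi> x \<partial>\<mu>)"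
    using gen(2) gen_u_diffusion by eventually_elim simp
  with gen(1) show ?thesis by blast
qed

end
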